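(* A sequence $(\varphi_n)$ of distinct irreducible representations on a compact group is Sidon if and only if it is randomly Sidon.
   Context: Let $G$ be a compact group with Haar probability measure $m_G$. The $\varphi_n:G\to U(d_n)$ are continuous irreducible unitary representations, of finite dimension $d_n$, pairwise inequivalent, viewed as functions in $L_\infty(G,m_G;M_{d_n})$, where $M_d$ is the space of complex $d\times d$ matrices; $|a|=(a^*a)^{1/2}$. $(g_n)$ is an independent sequence of random $d_n\times d_n$ matrices on a probability space $(\Omega,\mathbb{P})$ (expectation $\mathbb{E}$) such that $\{d_n^{1/2}g_n(i,j)\mid n\ge1,1\le i,j\le d_n\}$ are i.i.d. standard complex Gaussian random variables (mean $0$, $\mathbb{E}|\cdot|^2=1$). $(\varphi_n)$ is Sidon if there is a constant $C$ such that for every finitely supported family $(x_n)$ with $x_n\in M_{d_n}$, $\sum d_n\,\mathrm{tr}|x_n|\le C\|\sum d_n\,\mathrm{tr}(x_n\varphi_n)\|_\infty$. It is randomly Sidon if there is a constant $C$ such that for every such family, $\sum d_n\,\mathrm{tr}|x_n|\le C\,\mathbb{E}\|\sum d_n\,\mathrm{tr}(x_ng_n\varphi_n)\|_\infty$. *)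

theory Defs
  imports
    "HOL-Probability.Probability"
    "HOL-Algebra.Group"
    "Jordan_Normal_Form.Schur_Decomposition"
    "Jordan_Normal_Form.VS_Connect"
begin

text \<open>
  The representations have varying dimensions \<open>d n\<close>, so matrices are those of
  \<open>Jordan_Normal_Form\<close>, whose dimensions are values rather than types. Sequences are indexed
  from \<open>0\<close> instead of \<open>1\<close>.
\<close>

subsection \<open>Compact groups and Haar measure\<close>

definition compact_group :: "'a monoid \<Rightarrow> 'a topology \<Rightarrow> bool" where
  "compact_group G T \<longleftrightarrow>
     group G \<and> topspace T = carrier G \<and> compact_space T \<and> Hausdorff_space T \<and>
     continuous_map (prod_topology T T) T (\<lambda>(x, y). x \<otimes>\<^bsub>G\<^esub> y) \<and>
     continuous_map T T (\<lambda>x. inv\<^bsub>G\<^esub> x)"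

text \<open>
  The left invariant regular Borel probability measure. Right invariance is a theorem for
  compact groups and therefore not part of the definition.
\<close>

definition haar_prob_measure :: "'a monoid \<Rightarrow> 'a topology \<Rightarrow> 'a measure \<Rightarrow> bool" where
  "haar_prob_measure G T m \<longleftrightarrow>
     prob_space m \<and> space m = carrier G \<and>
     sets m = sigma_sets (carrier G) {U. openin T U} \<and>
     (\<forall>x\<in>carrier G. \<forall>B\<in>sets m. emeasure m ((\<lambda>y. x \<otimes>\<^bsub>G\<^esub> y) ` B) = emeasure m B) \<and>
     (\<forall>B\<in>sets m. emeasure m B = (INF U\<in>{U. openin T U \<and> B \<subseteq> U}. emeasure m U)) \<and>
     (\<forall>B\<in>sets m. emeasure m B = (SUP K\<in>{K. compactin T K \<and> K \<subseteq> B}. emeasure m K))"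

text \<open>
  The norm of \<open>L\<^sub>\<infinity>(m)\<close>. It is meaningful for measurable, essentially bounded \<open>f\<close>, and only
  applied to continuous functions on a compact group.
\<close>

definition Linfty_norm :: "'a measure \<Rightarrow> ('a \<Rightarrow> complex) \<Rightarrow> real" where
  "Linfty_norm m f = real_of_ereal (esssup m (\<lambda>t. ereal (cmod (f t))))"

subsection \<open>Matrices\<close>

definition mat_trace :: "complex mat \<Rightarrow> complex" where
  "mat_trace A = (\<Sum>i<dim_row A. A $$ (i, i))"

text \<open>
  In the order on \<^typ>\<open>complex\<close>, \<open>0 \<le> z\<close> means that \<open>z\<close> is real and nonnegative; over the
  complex numbers the condition thus forces \<open>A\<close> to be Hermitian.
\<close>

definition psd_mat :: "nat \<Rightarrow> complex mat \<Rightarrow> bool" where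
  "psd_mat k A \<longleftrightarrow> A \<in> carrier_mat k k \<and> (\<forall>v\<in>carrier_vec k. 0 \<le> (A *\<^sub>v v) \<bullet>c v)"

text \<open>\<open>|A| = (A\<^sup>* A)\<^sup>1\<^sup>/\<^sup>2\<close>, the unique positive semidefinite square root of \<open>A\<^sup>* A\<close>.\<close>

definition mat_abs :: "complex mat \<Rightarrow> complex mat" where
  "mat_abs A = (THE p. psd_mat (dim_col A) p \<and> p * p = mat_adjoint A * A)"

definition trace_norm :: "complex mat \<Rightarrow> real" where
  "trace_norm A = Re (mat_trace (mat_abs A))"

subsection \<open>Unitary representations\<close>

definition unitary_mats :: "nat \<Rightarrow> complex mat set" where
  "unitary_mats k = {u \<in> carrier_mat k k. mat_adjoint u * u = 1\<^sub>m k \<and> u * mat_adjoint u = 1\<^sub>m k}"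

definition unitary_rep :: "'a monoid \<Rightarrow> 'a topology \<Rightarrow> nat \<Rightarrow> ('a \<Rightarrow> complex mat) \<Rightarrow> bool" where
  "unitary_rep G T k \<pi> \<longleftrightarrow>
     (\<forall>x\<in>carrier G. \<pi> x \<in> unitary_mats k) \<and>
     (\<forall>x\<in>carrier G. \<forall>y\<in>carrier G. \<pi> (x \<otimes>\<^bsub>G\<^esub> y) = \<pi> x * \<pi> y) \<and>
     (\<forall>i<k. \<forall>j<k. continuous_map T euclidean (\<lambda>x. \<pi> x $$ (i, j)))"

definition irreducible_rep :: "'a monoid \<Rightarrow> nat \<Rightarrow> ('a \<Rightarrow> complex mat) \<Rightarrow> bool" where
  "irreducible_rep G k \<pi> \<longleftrightarrow>
     0 < k \<and>
     (\<forall>W. VectorSpace.subspace class_ring W (module_vec TYPE(complex) k) \<and>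
          (\<forall>x\<in>carrier G. \<forall>w\<in>W. \<pi> x *\<^sub>v w \<in> W) \<longrightarrow>
          W = {0\<^sub>v k} \<or> W = carrier_vec k)"

definition equivalent_reps ::
  "'a monoid \<Rightarrow> nat \<Rightarrow> ('a \<Rightarrow> complex mat) \<Rightarrow> nat \<Rightarrow> ('a \<Rightarrow> complex mat) \<Rightarrow> bool" where
  "equivalent_reps G k \<pi> l \<rho> \<longleftrightarrow>
     k = l \<and>
     (\<exists>S\<in>carrier_mat k k. invertible_mat S \<and> (\<forall>x\<in>carrier G. S * \<pi> x = \<rho> x * S))"

definition distinct_irreps ::
  "'a monoid \<Rightarrow> 'a topology \<Rightarrow> (nat \<Rightarrow> nat) \<Rightarrow> (nat \<Rightarrow> 'a \<Rightarrow> complex mat) \<Rightarrow> bool" where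
  "distinct_irreps G T d \<phi> \<longleftrightarrow>
     (\<forall>n. unitary_rep G T (d n) (\<phi> n) \<and> irreducible_rep G (d n) (\<phi> n)) \<and>
     (\<forall>n n'. n \<noteq> n' \<longrightarrow> \<not> equivalent_reps G (d n) (\<phi> n) (d n') (\<phi> n'))"

subsection \<open>Gaussian random matrices\<close>

text \<open>
  The density of the standard complex Gaussian, \<open>exp(-|z|\<^sup>2)/\<pi>\<close>, is that of independent real and
  imaginary parts with law \<open>N(0, 1/2)\<close>, so that the second absolute moment is \<open>1\<close>.
\<close>

definition std_complex_gaussian :: "'w measure \<Rightarrow> ('w \<Rightarrow> complex) \<Rightarrow> bool" where
  "std_complex_gaussian P X \<longleftrightarrow>
     distributed P lborel X (\<lambda>z. ennreal (exp (- (cmod z)\<^sup>2) / pi))"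

text \<open>
  Joint independence of all entries of all the \<open>g n\<close> includes the independence of the sequence
  of matrices \<open>g\<close>.
\<close>

definition gaussian_matrices ::
  "'w measure \<Rightarrow> (nat \<Rightarrow> nat) \<Rightarrow> (nat \<Rightarrow> 'w \<Rightarrow> complex mat) \<Rightarrow> bool" where
  "gaussian_matrices P d g \<longleftrightarrow>
     prob_space P \<and>
     (\<forall>n. \<forall>\<omega>\<in>space P. g n \<omega> \<in> carrier_mat (d n) (d n)) \<and>
     (\<forall>n. \<forall>i<d n. \<forall>j<d n.
        std_complex_gaussian P (\<lambda>\<omega>. complex_of_real (sqrt (real (d n))) * g n \<omega> $$ (i, j))) \<and>
     prob_space.indep_vars P (\<lambda>_. borel)
       (\<lambda>(n, i, j) \<omega>. complex_of_real (sqrt (real (d n))) * g n \<omega> $$ (i, j))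
       {(n, i, j). i < d n \<and> j < d n}"

subsection \<open>Sidon and randomly Sidon sequences\<close>

definition mat_supp :: "(nat \<Rightarrow> nat) \<Rightarrow> (nat \<Rightarrow> complex mat) \<Rightarrow> nat set" where
  "mat_supp d x = {n. x n \<noteq> 0\<^sub>m (d n) (d n)}"

definition fin_supp_family :: "(nat \<Rightarrow> nat) \<Rightarrow> (nat \<Rightarrow> complex mat) \<Rightarrow> bool" where
  "fin_supp_family d x \<longleftrightarrow> (\<forall>n. x n \<in> carrier_mat (d n) (d n)) \<and> finite (mat_supp d x)"

definition sidon ::
  "'a measure \<Rightarrow> (nat \<Rightarrow> nat) \<Rightarrow> (nat \<Rightarrow> 'a \<Rightarrow> complex mat) \<Rightarrow> bool" where
  "sidon m d \<phi> \<longleftrightarrow>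
     (\<exists>C::real. \<forall>x. fin_supp_family d x \<longrightarrow>
        (\<Sum>n\<in>mat_supp d x. real (d n) * trace_norm (x n))
          \<le> C * Linfty_norm m
                 (\<lambda>t. \<Sum>n\<in>mat_supp d x. of_nat (d n) * mat_trace (x n * \<phi> n t)))"

text \<open>
  The random norm below is a continuous function of finitely many Gaussian variables, bounded by
  a linear combination of their absolute values; hence it is integrable and the Bochner integral
  is the genuine expectation.
\<close>

definition randomly_sidon ::
  "'a measure \<Rightarrow> (nat \<Rightarrow> nat) \<Rightarrow> (nat \<Rightarrow> 'a \<Rightarrow> complex mat) \<Rightarrow>
   'w measure \<Rightarrow> (nat \<Rightarrow> 'w \<Rightarrow> complex mat) \<Rightarrow> bool" where
  "randomly_sidon m d \<phi> P g \<longleftrightarrow>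
     (\<exists>C::real. \<forall>x. fin_supp_family d x \<longrightarrow>
        (\<Sum>n\<in>mat_supp d x. real (d n) * trace_norm (x n))
          \<le> C * prob_space.expectation P (\<lambda>\<omega>. Linfty_norm m
                 (\<lambda>t. \<Sum>n\<in>mat_supp d x. of_nat (d n) * mat_trace (x n * g n \<omega> * \<phi> n t))))"

end

theory Submission
  imports Defs "Jordan_Normal_Form.Spectral_Radius"
begin

text \<open>
  If \<open>(\<phi>\<^sub>n)\<close> is Sidon, apply the inequality to \<open>x\<^sub>n g\<^sub>n\<close> for fixed \<open>\<omega>\<close>; the expectation of \<open>tr|x\<^sub>n g\<^sub>n|\<close> is
  at least \<open>tr|x\<^sub>n| / 2\<close> because \<open>\<sigma> \<ge> \<sigma>\<^sup>2 - \<sigma>\<^sup>4 / 4\<close> reduces it to second and fourth Gaussian moments.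

  Conversely, let \<open>z\<^sub>n\<close> be the polar part of \<open>x\<^sub>n\<close>, so that \<open>z\<^sub>n x\<^sub>n = |x\<^sub>n|\<close>. The random Sidon inequality says that
  \<open>\<Sum> d\<^sub>n tr(q\<^sub>n g\<^sub>n \<phi>\<^sub>n) \<mapsto> \<Sum> d\<^sub>n tr(q\<^sub>n z\<^sub>n)\<close> is bounded for the norm of \<open>L\<^sub>1(P; C(G))\<close>, and by Hahn--Banach it extends
  to a functional \<open>L\<close>. Let \<open>(x\<^sub>a)\<close> be the real Gaussian variables behind \<open>(g\<^sub>n)\<close> and \<open>(w\<^sub>a)\<close> those behind
  \<open>(\<i>\<^sup>k g'\<^sub>n \<phi>\<^sub>n(t))\<close> for an independent copy \<open>g'\<close>. The Riesz product \<open>\<Prod>\<^sub>a (1 + sin(\<rho> x\<^sub>a) sin(\<rho> w\<^sub>a))\<close> is nonnegative with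
  mean \<open>1\<close>, so \<open>L\<close> of its product with a translate of \<open>F = \<Sum> d\<^sub>n tr(x\<^sub>n \<phi>\<^sub>n)\<close> is at most \<open>C \<parallel>F\<parallel>\<close>. Averaging over
  \<open>k < 4\<close> removes the constant term in \<open>w\<close>, and averaging over \<open>t\<close> turns the linear term into
  \<open>\<rho>\<^sup>2 \<Sum> d\<^sub>n tr(|x\<^sub>n| g'\<^sub>n \<phi>\<^sub>n)\<close> up to conjugation, by Schur orthogonality. By Bessel's inequality for the orthogonal
  sine products the remaining terms have mean at most \<open>3 C \<rho>\<^sup>3 \<Sum> d\<^sub>n tr|x\<^sub>n|\<close>, and applying the random Sidon
  inequality to \<open>|x\<^sub>n|\<close> absorbs them when \<open>\<rho>\<close> is small.
\<close>

section \<open>Hahn--Banach extension in finite dimension\<close>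

text \<open>The product of factors \<open>1 + x_a w_a\<close> would be the natural density, but
  Gaussian variables are unbounded and it takes negative values. Sines restore the sign, at the
  price that neither side stays linear. The orders in \<open>\<rho>\<close> settle the matter: the
  wanted term, linear against linear, has order two, whereas every leftover pairs a quantity of size
  \<open>\<rho>\<close> or \<open>\<rho>^2\<close> with one of size \<open>\<rho>^2\<close> and has
  order at least three. The number of variables never enters, because leftovers are estimated in L2
  through orthogonality and not term by term. No product of probability spaces is formed for the
  independent copy: the functional integrates the variables \<open>x_a\<close> away, and the
  variables \<open>w_a\<close> are integrated later over the same space. The bound for the leftovers
  does not depend on the translate of \<open>F\<close>. Hence a supremum over the group may be taken
  before the expectation, and it is this supremum that becomes the random norm of
  \<open>|x_n|\<close>. Only finitely many products of a sine product or error with a coefficient of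
  a representation are involved, so the functional is handled through its coordinates on these
  products.\<close>

definition csubspace :: "('k \<Rightarrow> complex) set \<Rightarrow> bool" where
  "csubspace U \<longleftrightarrow> (\<lambda>_. 0) \<in> U \<and> (\<forall>u\<in>U. \<forall>v\<in>U. \<forall>a. (\<lambda>k. u k + a * v k) \<in> U)"

text \<open>The extension argument depends on an order, so it runs over the reals inside a space of
  complex-valued functions; complex linearity is recovered at the end from the real part.\<close>

definition rsubspace :: "('k \<Rightarrow> complex) set \<Rightarrow> bool" where
  "rsubspace U \<longleftrightarrow> (\<lambda>_. 0) \<in> U \<and> (\<forall>u\<in>U. \<forall>v\<in>U. \<forall>r::real. (\<lambda>k. u k + r * v k) \<in> U)"

definition rlinear_on :: "('k \<Rightarrow> complex) set \<Rightarrow> (('k \<Rightarrow> complex) \<Rightarrow> real) \<Rightarrow> bool" where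
  "rlinear_on U f \<longleftrightarrow> (\<forall>u\<in>U. \<forall>v\<in>U. \<forall>r::real. f (\<lambda>k. u k + r * v k) = f u + r * f v)"

definition is_seminorm :: "(('k \<Rightarrow> complex) \<Rightarrow> real) \<Rightarrow> bool" where
  "is_seminorm p \<longleftrightarrow> (\<forall>u v. p (\<lambda>k. u k + v k) \<le> p u + p v) \<and> (\<forall>a u. p (\<lambda>k. a * u k) = cmod a * p u)"

lemma rlinear_on_zero:
  assumes "rsubspace U" "rlinear_on U f" shows "f (\<lambda>_. 0) = 0"
proof -
  have "(\<lambda>_. 0) \<in> U" using assms(1) by (auto simp: rsubspace_def)
  from assms(2)[unfolded rlinear_on_def, rule_format, OF this this, of 1] show ?thesis by simp
qed

lemma rlinear_on_scale:
  assumes "rsubspace U" "rlinear_on U f" "u \<in> U"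
  shows "f (\<lambda>k. complex_of_real r * u k) = r * f u" "(\<lambda>k. complex_of_real r * u k) \<in> U"
proof -
  have z: "(\<lambda>_. 0) \<in> U" using assms(1) by (auto simp: rsubspace_def)
  from assms(2)[unfolded rlinear_on_def, rule_format, OF z assms(3), of r]
  show "f (\<lambda>k. complex_of_real r * u k) = r * f u" using rlinear_on_zero[OF assms(1,2)] by simp
  from assms(1)[unfolded rsubspace_def, THEN conjunct2, rule_format, OF z assms(3), of r]
  show "(\<lambda>k. complex_of_real r * u k) \<in> U" by simp
qed

lemma rsubspaceD: "rsubspace U \<Longrightarrow> u \<in> U \<Longrightarrow> v \<in> U \<Longrightarrow> (\<lambda>k. u k + complex_of_real r * v k) \<in> U"
  by (simp add: rsubspace_def)

lemma rlinear_onD: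
  "rlinear_on U f \<Longrightarrow> u \<in> U \<Longrightarrow> v \<in> U \<Longrightarrow> f (\<lambda>k. u k + complex_of_real r * v k) = f u + r * f v"
  by (simp add: rlinear_on_def)

text \<open>The triangle inequality puts every \<open>f u - p (u - e)\<close> below every
  \<open>p (v + e) - f v\<close>; any number separating the two families is an admissible value at
  \<open>e\<close>, and the supremum of the lower family is taken.\<close>

lemma hahn_banach_step:
  assumes U: "rsubspace U" and f: "rlinear_on U f" and p: "is_seminorm p"
    and fp: "\<And>u. u \<in> U \<Longrightarrow> f u \<le> p u"
  shows "\<exists>U' f'. rsubspace U' \<and> rlinear_on U' f' \<and> (\<forall>u\<in>U'. f' u \<le> p u) \<and> U \<subseteq> U' \<and> e \<in> U' \<and>
    (\<forall>u\<in>U. f' u = f u)"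
proof (cases "e \<in> U")
  case True
  show ?thesis by (intro exI[of _ U] exI[of _ f] conjI ballI U f fp True subset_refl refl)
next
  case False
  have zU: "(\<lambda>_. 0) \<in> U" and cU: "\<And>u v r. u \<in> U \<Longrightarrow> v \<in> U \<Longrightarrow> (\<lambda>k. u k + complex_of_real r * v k) \<in> U"
    using U by (auto simp: rsubspace_def)
  have lf: "\<And>u v r. u \<in> U \<Longrightarrow> v \<in> U \<Longrightarrow> f (\<lambda>k. u k + complex_of_real r * v k) = f u + r * f v"
    using f by (auto simp: rlinear_on_def)
  have padd: "\<And>u v. p (\<lambda>k. u k + v k) \<le> p u + p v"
    and psc: "\<And>a u. p (\<lambda>k. a * u k) = cmod a * p u" using p by (auto simp: is_seminorm_def)
  have key: "f u - p (\<lambda>k. u k - e k) \<le> p (\<lambda>k. v k + e k) - f v" if "u \<in> U" "v \<in> U" for u v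
  proof -
    have "f u + f v = f (\<lambda>k. u k + complex_of_real 1 * v k)" using lf[OF that, of 1] by simp
    also have "\<dots> \<le> p (\<lambda>k. u k + complex_of_real 1 * v k)" by (intro fp cU that)
    also have "(\<lambda>k. u k + complex_of_real 1 * v k) = (\<lambda>k. (u k - e k) + (v k + e k))" by auto
    also have "p \<dots> \<le> p (\<lambda>k. u k - e k) + p (\<lambda>k. v k + e k)" by (rule padd)
    finally show ?thesis by linarith
  qed
  define L where "L = (\<lambda>u. f u - p (\<lambda>k. u k - e k)) ` U"
  define \<alpha> where "\<alpha> = Sup L"
  have bdd: "bdd_above L" unfolding L_def bdd_above_def using key[OF _ zU] by blast
  have lo: "f u - p (\<lambda>k. u k - e k) \<le> \<alpha>" if "u \<in> U" for u
    unfolding \<alpha>_def by (rule cSup_upper[OF _ bdd]) (use that in \<open>auto simp: L_def\<close>)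
  have hi: "\<alpha> \<le> p (\<lambda>k. v k + e k) - f v" if "v \<in> U" for v
    unfolding \<alpha>_def by (rule cSup_least) (use that zU key in \<open>auto simp: L_def\<close>)
  have uniq: "r = r'" "u = u'" if "u \<in> U" "u' \<in> U"
    and eq: "(\<lambda>k. u k + complex_of_real r * e k) = (\<lambda>k. u' k + complex_of_real r' * e k)" for u u' r r'
  proof -
    show rr: "r = r'"
    proof (rule ccontr)
      assume ne: "r \<noteq> r'"
      have "(\<lambda>k. 0 + complex_of_real (1/(r-r')) * (u' k + complex_of_real (-1) * u k)) \<in> U"
        by (intro cU[where u="\<lambda>_. 0"] zU cU that)
      moreover have "(\<lambda>k. 0 + complex_of_real (1/(r-r')) * (u' k + complex_of_real (-1) * u k)) = e"
      proof
        fix k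
        have "u k + complex_of_real r * e k = u' k + complex_of_real r' * e k" using eq by metis
        hence "u' k - u k = (complex_of_real r - complex_of_real r') * e k" by (simp add: algebra_simps)
        thus "0 + complex_of_real (1/(r-r')) * (u' k + complex_of_real (-1) * u k) = e k"
          using ne by (simp add: field_simps)
      qed
      ultimately show False using False by simp
    qed
    show "u = u'" using eq rr by (auto simp: fun_eq_iff)
  qed
  define U' where "U' = {(\<lambda>k. u k + complex_of_real r * e k) | u r. u \<in> U}"
  have U'I: "(\<lambda>k. u k + complex_of_real r * e k) \<in> U'" if "u \<in> U" for u r
    unfolding U'_def using that by (intro CollectI exI conjI) (rule refl)
  have U'E: "\<exists>u r. u \<in> U \<and> w = (\<lambda>k. u k + complex_of_real r * e k)" if "w \<in> U'" for w
    using that unfolding U'_def mem_Collect_eq by metis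
  \<comment> \<open>Because \<open>e\<close> lies outside \<open>U\<close>, the decomposition is
    unique, and \<open>SOME\<close> has only one choice.\<close>
  define rep where "rep w = (SOME ur. fst ur \<in> U \<and> w = (\<lambda>k. fst ur k + complex_of_real (snd ur) * e k))" for w
  define f' where "f' w = f (fst (rep w)) + snd (rep w) * \<alpha>" for w
  have f': "f' (\<lambda>k. u k + complex_of_real r * e k) = f u + r * \<alpha>" if "u \<in> U" for u r
  proof -
    let ?w = "\<lambda>k. u k + complex_of_real r * e k"
    have "\<exists>ur. fst ur \<in> U \<and> ?w = (\<lambda>k. fst ur k + complex_of_real (snd ur) * e k)"
      by (rule exI[of _ "(u, r)"]) (use that in auto)
    from someI_ex[OF this, folded rep_def]
    have "fst (rep ?w) \<in> U" "?w = (\<lambda>k. fst (rep ?w) k + complex_of_real (snd (rep ?w)) * e k)" by blast+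
    note uniq[OF that this, symmetric]
    thus ?thesis unfolding f'_def by simp
  qed
  have lin: "(\<lambda>k. (u k + complex_of_real r * e k) + complex_of_real c * (v k + complex_of_real s * e k))
      = (\<lambda>k. (u k + complex_of_real c * v k) + complex_of_real (r + c * s) * e k)" for u v r s c
    by (auto simp: algebra_simps)
  have R1: "rsubspace U'" unfolding rsubspace_def
  proof (intro conjI ballI allI)
    show "(\<lambda>_. 0) \<in> U'" unfolding U'_def using zU by (intro CollectI exI[of _ "\<lambda>_. 0"] exI[of _ 0]) auto
    fix u v c assume "u \<in> U'" "v \<in> U'"
    then obtain u0 r v0 s where *: "u0 \<in> U" "v0 \<in> U" "u = (\<lambda>k. u0 k + complex_of_real r * e k)" "v = (\<lambda>k. v0 k + complex_of_real s * e k)"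
      using U'E by metis
    show "(\<lambda>k. u k + complex_of_real c * v k) \<in> U'" unfolding *(3,4) lin by (intro U'I cU *)
  qed
  have R2: "rlinear_on U' f'" unfolding rlinear_on_def
  proof (intro ballI allI)
    fix u v c assume "u \<in> U'" "v \<in> U'"
    then obtain u0 r v0 s where *: "u0 \<in> U" "v0 \<in> U" "u = (\<lambda>k. u0 k + complex_of_real r * e k)" "v = (\<lambda>k. v0 k + complex_of_real s * e k)"
      using U'E by metis
    have "f' (\<lambda>k. u k + complex_of_real c * v k) = f (\<lambda>k. u0 k + complex_of_real c * v0 k) + (r + c * s) * \<alpha>"
      unfolding *(3,4) lin by (intro f' cU *)
    also have "\<dots> = f' u + c * f' v" unfolding *(3,4) f'[OF *(1)] f'[OF *(2)] lf[OF *(1,2)]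
      by (simp add: algebra_simps)
    finally show "f' (\<lambda>k. u k + complex_of_real c * v k) = f' u + c * f' v" .
  qed
  have R3: "f' w \<le> p w" if "w \<in> U'" for w
  proof -
    obtain u r where u: "u \<in> U" and w: "w = (\<lambda>k. u k + complex_of_real r * e k)" using U'E[OF \<open>w \<in> U'\<close>] by metis
    \<comment> \<open>Homogeneity reduces the bound at \<open>u + r e\<close> to the two
      inequalities for \<open>\<alpha>\<close>: the upper one when \<open>r\<close> is positive, the
      lower one when it is negative.\<close>
    let ?v = "\<lambda>k. complex_of_real (1/\<bar>r\<bar>) * u k"
    have v: "?v \<in> U" "f ?v = (1/\<bar>r\<bar>) * f u"
      using rlinear_on_scale[OF U f u, of "1/\<bar>r\<bar>"] by auto
    consider "r = 0" | "r > 0" | "r < 0" by linarith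
    thus ?thesis
    proof cases
      case 1 thus ?thesis using f'[OF u, of r] fp[OF u] unfolding w by simp
    next
      case 2
      have weq: "w = (\<lambda>k. complex_of_real r * (?v k + e k))" using 2 unfolding w by (auto simp: field_simps)
      have "p w = r * p (\<lambda>k. ?v k + e k)" by (subst weq, subst psc) (use 2 in simp)
      moreover have "r * \<alpha> \<le> r * (p (\<lambda>k. ?v k + e k) - f ?v)" using 2 hi[OF v(1)] by (intro mult_left_mono) auto
      moreover have "r * f ?v = f u" using 2 v(2) by simp
      ultimately show ?thesis using f'[OF u, of r] unfolding w by (simp add: algebra_simps)
    next
      case 3
      have weq: "w = (\<lambda>k. complex_of_real (-r) * (?v k - e k))" using 3 unfolding w by (auto simp: field_simps)
      have "p w = (-r) * p (\<lambda>k. ?v k - e k)" by (subst weq, subst psc) (use 3 in simp)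
      moreover have "(-r) * (f ?v - p (\<lambda>k. ?v k - e k)) \<le> (-r) * \<alpha>" using 3 lo[OF v(1)] by (intro mult_left_mono) auto
      moreover have "(-r) * f ?v = f u" using 3 v(2) by simp
      ultimately show ?thesis using f'[OF u, of r] unfolding w by (simp add: algebra_simps)
    qed
  qed
  have R4: "U \<subseteq> U'"
  proof
    fix u assume "u \<in> U"
    thus "u \<in> U'" unfolding U'_def by (intro CollectI exI[of _ u] exI[of _ 0]) auto
  qed
  have R5: "e \<in> U'" unfolding U'_def using zU
    by (intro CollectI exI[of _ "\<lambda>_. 0"] exI[of _ 1]) auto
  have R6: "f' u = f u" if "u \<in> U" for u using f'[OF that, of 0] by simp
  show ?thesis by (intro exI[of _ U'] exI[of _ f'] conjI ballI R1 R2 R3 R4 R5 R6)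
qed

lemma hahn_banach_finite:
  assumes "finite E" "rsubspace U" "rlinear_on U f" "is_seminorm p" "\<And>u. u \<in> U \<Longrightarrow> f u \<le> p u"
  shows "\<exists>U' f'. rsubspace U' \<and> rlinear_on U' f' \<and> (\<forall>u\<in>U'. f' u \<le> p u) \<and> U \<subseteq> U' \<and> E \<subseteq> U' \<and>
    (\<forall>u\<in>U. f' u = f u)"
  using assms(1)
proof (induction E rule: finite_induct)
  case empty
  show ?case by (intro exI[of _ U] exI[of _ f] conjI ballI assms subset_refl refl empty_subsetI)
next
  case (insert e E)
  then obtain U1 f1 where 1: "rsubspace U1" "rlinear_on U1 f1" "\<forall>u\<in>U1. f1 u \<le> p u" "U \<subseteq> U1" "E \<subseteq> U1"
    "\<forall>u\<in>U. f1 u = f u" by blast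
  from hahn_banach_step[OF 1(1,2) assms(4), of e] 1(3)
  obtain U2 f2 where "rsubspace U2" "rlinear_on U2 f2" "\<forall>u\<in>U2. f2 u \<le> p u" "U1 \<subseteq> U2" "e \<in> U2"
    "\<forall>u\<in>U1. f2 u = f1 u" by blast
  thus ?case using 1 by (intro exI[of _ U2] exI[of _ f2]) (auto simp: subset_iff)
qed

lemma rlinear_on_sum:
  assumes "rsubspace U" "rlinear_on U f" "finite I" "\<And>i. i \<in> I \<Longrightarrow> e i \<in> U"
  shows "f (\<lambda>k. \<Sum>i\<in>I. complex_of_real (r i) * e i k) = (\<Sum>i\<in>I. r i * f (e i))
    \<and> (\<lambda>k. \<Sum>i\<in>I. complex_of_real (r i) * e i k) \<in> U"
  using assms(3,4)
proof (induction I rule: finite_induct)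
  case empty thus ?case using rlinear_on_zero[OF assms(1,2)] assms(1) by (simp add: rsubspace_def)
next
  case (insert i I)
  let ?s = "\<lambda>k. \<Sum>i\<in>I. complex_of_real (r i) * e i k"
  have eq: "(\<lambda>k. \<Sum>i\<in>insert i I. complex_of_real (r i) * e i k) = (\<lambda>k. ?s k + complex_of_real (r i) * e i k)"
    using insert.hyps by (auto simp: add.commute)
  have "?s \<in> U" "e i \<in> U" using insert by auto
  from rlinear_onD[OF assms(2) this, of "r i"] rsubspaceD[OF assms(1) this, of "r i"]
  show ?case unfolding eq using insert by simp
qed

lemma complex_phase: "\<exists>a. cmod a = 1 \<and> a * z = complex_of_real (cmod z)"
proof (cases "z = 0")
  case False
  have "cnj z * z = complex_of_real (cmod z) * complex_of_real (cmod z)"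
    using complex_norm_square[of z] unfolding power2_eq_square by (simp only: mult.commute of_real_mult)
  thus ?thesis using False by (intro exI[of _ "cnj z / complex_of_real (cmod z)"]) (simp add: norm_divide)
qed (simp add: exI[of _ 1])

text \<open>The seminorm sees only the coordinates in the finite set \<open>K\<close>. It is
  therefore enough to extend the real part of the functional to the vectors with a single entry
  \<open>1\<close> or \<open>\<i>\<close> at a point of \<open>K\<close>.\<close>

theorem hahn_banach_coords:
  fixes p :: "('k \<Rightarrow> complex) \<Rightarrow> real" and l0 :: "'k \<Rightarrow> complex"
  assumes K: "finite K" and U: "csubspace U" and p: "is_seminorm p"
    and pK: "\<And>c c'. (\<And>k. k \<in> K \<Longrightarrow> c k = c' k) \<Longrightarrow> p c = p c'"
    and l0: "\<And>u. u \<in> U \<Longrightarrow> cmod (\<Sum>k\<in>K. l0 k * u k) \<le> p u"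
  shows "\<exists>l. (\<forall>c. cmod (\<Sum>k\<in>K. l k * c k) \<le> p c) \<and>
    (\<forall>u\<in>U. (\<Sum>k\<in>K. l k * u k) = (\<Sum>k\<in>K. l0 k * u k))"
proof -
  define f where "f u = Re (\<Sum>k\<in>K. l0 k * u k)" for u
  define e where "e b j = (\<lambda>k::'k. if k = j then (if b then 1 else \<i>) else 0)" for b and j :: 'k
  have rU: "rsubspace U" using U unfolding csubspace_def rsubspace_def by blast
  have fU: "rlinear_on U f" unfolding rlinear_on_def f_def
    by (auto simp: sum.distrib sum_distrib_left algebra_simps)
  have fp: "f u \<le> p u" if "u \<in> U" for u
    using l0[OF that] complex_Re_le_cmod order_trans unfolding f_def by blast
  have fin: "finite ((\<lambda>(b, j). e b j) ` (UNIV \<times> K))" using K by auto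
  obtain U' f' where *: "rsubspace U'" "rlinear_on U' f'" "\<forall>u\<in>U'. f' u \<le> p u" "U \<subseteq> U'"
    "(\<lambda>(b, j). e b j) ` (UNIV \<times> K) \<subseteq> U'" "\<forall>u\<in>U. f' u = f u"
    using hahn_banach_finite[OF fin rU fU p fp] by blast
  have eU: "e b j \<in> U'" if "j \<in> K" for b j using *(5) that by auto
  \<comment> \<open>A complex linear functional is its real part at \<open>c\<close> minus
    \<open>\<i>\<close> times its real part at \<open>\<i> c\<close>; these are its
    coordinates.\<close>
  define l where "l k = Complex (f' (e True k)) (- f' (e False k))" for k
  define s where "s c k = (\<Sum>i\<in>UNIV \<times> K. complex_of_real ((\<lambda>(b, j). if b then Re (c j) else Im (c j)) i)
      * (\<lambda>(b, j). e b j) i k)" for c :: "'k \<Rightarrow> complex" and k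
  have sU: "s c \<in> U'" and f's: "f' (s c) = Re (\<Sum>k\<in>K. l k * c k)" for c
  proof -
    have 1: "f' (s c) = (\<Sum>i\<in>UNIV \<times> K. (\<lambda>(b, j). if b then Re (c j) else Im (c j)) i * f' ((\<lambda>(b, j). e b j) i))
        \<and> s c \<in> U'"
      unfolding s_def by (rule rlinear_on_sum[OF *(1,2)]) (use K eU in auto)
    thus "s c \<in> U'" by blast
    show "f' (s c) = Re (\<Sum>k\<in>K. l k * c k)" unfolding 1[THEN conjunct1]
      by (subst sum.cartesian_product')
        (simp add: l_def UNIV_bool sum.distrib mult.commute add.commute)
  qed
  have sk: "s c k = c k" if "k \<in> K" for k c
  proof -
    have "s c k = (\<Sum>j\<in>K. complex_of_real (Im (c j)) * e False j k) + (\<Sum>j\<in>K. complex_of_real (Re (c j)) * e True j k)"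
      unfolding s_def by (subst sum.cartesian_product') (simp add: UNIV_bool)
    also have "\<dots> = (\<Sum>j\<in>K. if k = j then complex_of_real (Im (c j)) * \<i> + complex_of_real (Re (c j)) else 0)"
      unfolding sum.distrib[symmetric] by (rule sum.cong) (auto simp: e_def)
    also have "\<dots> = complex_of_real (Im (c k)) * \<i> + complex_of_real (Re (c k))"
      by (subst sum.delta'[OF K]) (simp add: that)
    also have "\<dots> = c k" by (simp add: complex_eq_iff)
    finally show ?thesis .
  qed
  have F: "Re (\<Sum>k\<in>K. l k * c k) \<le> p c" for c
  proof -
    have "p (s c) = p c" by (rule pK) (rule sk)
    with bspec[OF *(3) sU[of c]] f's[of c] show ?thesis by linarith
  qed
  \<comment> \<open>A vector \<open>u\<close> of \<open>U\<close> and its truncation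
    \<open>s u\<close> to \<open>K\<close> differ by a vector of seminorm zero. The dominated
    functional vanishes on it, since all real multiples of its value are at most zero.\<close>
  have G: "Re (\<Sum>k\<in>K. l k * u k) = Re (\<Sum>k\<in>K. l0 k * u k)" if "u \<in> U" for u
  proof -
    have uU': "u \<in> U'" using that *(4) by auto
    have 0: "c * (f' (s u) - f' u) \<le> 0" for c
    proof -
      let ?w = "\<lambda>k. s u k + complex_of_real (-1) * u k"
      have w: "?w \<in> U'" by (rule rsubspaceD[OF *(1) sU uU'])
      have fw: "f' ?w = f' (s u) - f' u" using rlinear_onD[OF *(2) sU uU', of u "-1"] by simp
      have 1: "f' (\<lambda>k. complex_of_real c * ?w k) = c * (f' (s u) - f' u)" "(\<lambda>k. complex_of_real c * ?w k) \<in> U'"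
        using rlinear_on_scale[OF *(1,2) w, of c] unfolding fw by blast+
      have "c * (f' (s u) - f' u) \<le> p (\<lambda>k. complex_of_real c * ?w k)" using bspec[OF *(3) 1(2)] 1(1) by linarith
      also have "\<dots> = p (\<lambda>k. 0 * u k)" by (rule pK) (simp add: sk)
      also have "\<dots> = cmod 0 * p u" by (rule p[unfolded is_seminorm_def, THEN conjunct2, rule_format])
      also have "\<dots> = 0" by simp
      finally show ?thesis .
    qed
    have "f' (s u) = f' u" 
    proof (rule antisym)
      show "f' (s u) \<le> f' u" using 0[of 1] by simp
      show "f' u \<le> f' (s u)" using 0[of "-1"] by simp
    qed
    hence "f' (s u) = f u" using bspec[OF *(6) that] by (rule trans)
    thus ?thesis unfolding f_def f's .
  qed
  have A: "cmod (\<Sum>k\<in>K. l k * c k) \<le> p c" for c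
  proof -
    let ?z = "\<Sum>k\<in>K. l k * c k"
    obtain a where a: "cmod a = 1" "a * ?z = complex_of_real (cmod ?z)" using complex_phase by blast
    have "cmod ?z = Re (a * ?z)" by (simp add: a)
    also have "a * ?z = (\<Sum>k\<in>K. l k * (a * c k))" by (simp add: sum_distrib_left algebra_simps)
    also have "Re \<dots> \<le> p (\<lambda>k. a * c k)" by (rule F)
    also have "\<dots> = p c" using p a unfolding is_seminorm_def by simp
    finally show ?thesis .
  qed
  \<comment> \<open>Applying the equality of real parts to \<open>\<i> u\<close>, which also lies in
    \<open>U\<close>, gives the imaginary parts.\<close>
  have B: "(\<Sum>k\<in>K. l k * u k) = (\<Sum>k\<in>K. l0 k * u k)" if "u \<in> U" for u
  proof (rule complex_eqI)
    show "Re (\<Sum>k\<in>K. l k * u k) = Re (\<Sum>k\<in>K. l0 k * u k)" by (rule G[OF that])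
    from U[unfolded csubspace_def, THEN conjunct2, rule_format, OF _ that, of "\<lambda>_. 0" \<i>] U[unfolded csubspace_def]
    have "(\<lambda>k. \<i> * u k) \<in> U" by simp
    from G[OF this] have "Re (\<i> * (\<Sum>k\<in>K. l k * u k)) = Re (\<i> * (\<Sum>k\<in>K. l0 k * u k))"
      by (simp add: sum_distrib_left algebra_simps)
    thus "Im (\<Sum>k\<in>K. l k * u k) = Im (\<Sum>k\<in>K. l0 k * u k)" by simp
  qed
  from A B show ?thesis by blast
qed

section \<open>Unitary diagonalisation\<close>

text \<open>Vectors are functions of which only the values below \<open>n\<close> count. Identities
  then become rearrangements of finite sums, free of carrier conditions.\<close>

definition ip :: "nat \<Rightarrow> (nat \<Rightarrow> complex) \<Rightarrow> (nat \<Rightarrow> complex) \<Rightarrow> complex" where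
  "ip n f h = (\<Sum>i<n. f i * cnj (h i))"

definition nrm2 :: "nat \<Rightarrow> (nat \<Rightarrow> complex) \<Rightarrow> real" where
  "nrm2 n f = (\<Sum>i<n. (cmod (f i))\<^sup>2)"

definition mapply :: "nat \<Rightarrow> complex mat \<Rightarrow> (nat \<Rightarrow> complex) \<Rightarrow> nat \<Rightarrow> complex" where
  "mapply n A f i = (\<Sum>j<n. A $$ (i, j) * f j)"

definition contraction :: "nat \<Rightarrow> complex mat \<Rightarrow> bool" where
  "contraction n A \<longleftrightarrow> A \<in> carrier_mat n n \<and> (\<forall>f. nrm2 n (mapply n A f) \<le> nrm2 n f)"

lemma ip_self: "ip n f f = complex_of_real (nrm2 n f)"
  by (simp add: ip_def nrm2_def complex_norm_square del: of_real_power)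

lemma nrm2_nonneg [simp]: "0 \<le> nrm2 n f" by (simp add: nrm2_def sum_nonneg)

lemma nrm2_eq_0: "nrm2 n f = 0 \<longleftrightarrow> (\<forall>i<n. f i = 0)"
  by (auto simp: nrm2_def sum_nonneg_eq_0_iff)

lemma ip_cauchy_schwarz: "cmod (ip n f h) \<le> sqrt (nrm2 n f) * sqrt (nrm2 n h)"
proof -
  have "cmod (ip n f h) \<le> (\<Sum>i<n. cmod (f i) * cmod (h i))"
    unfolding ip_def by (rule order_trans[OF norm_sum]) (simp add: norm_mult)
  also have "\<dots> \<le> L2_set (\<lambda>i. cmod (f i)) {..<n} * L2_set (\<lambda>i. cmod (h i)) {..<n}"
    using L2_set_mult_ineq[of "\<lambda>i. cmod (f i)" "\<lambda>i. cmod (h i)" "{..<n}"] by simp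
  finally show ?thesis by (simp add: L2_set_def nrm2_def)
qed

lemma mat_adjoint_carrier [simp]: "A \<in> carrier_mat n m \<Longrightarrow> mat_adjoint A \<in> carrier_mat m n"
  unfolding mat_adjoint_def by auto

lemma mat_adjoint_index:
  "A \<in> carrier_mat n m \<Longrightarrow> i < m \<Longrightarrow> j < n \<Longrightarrow> mat_adjoint A $$ (i, j) = cnj (A $$ (j, i))"
  unfolding mat_adjoint_def by (simp add: mat_of_rows_index)

lemma times_mat_sum:
  "A \<in> carrier_mat n m \<Longrightarrow> B \<in> carrier_mat m p \<Longrightarrow> i < n \<Longrightarrow> j < p \<Longrightarrow>
    (A * B) $$ (i, j) = (\<Sum>k<m. A $$ (i, k) * B $$ (k, j))"
  by (simp add: scalar_prod_def atLeast0LessThan)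

text \<open>An inner product of two linear combinations becomes a double sum over Gram entries, the
  form into which orthonormality relations are substituted below.\<close>

lemma sum_sum_swap3:
  fixes a :: "'x \<Rightarrow> complex"
  shows "(\<Sum>m\<in>M. (\<Sum>k\<in>K. a k * b k m) * (\<Sum>l\<in>L. c l * e l m))
    = (\<Sum>k\<in>K. \<Sum>l\<in>L. a k * c l * (\<Sum>m\<in>M. b k m * e l m))"
proof -
  have "(\<Sum>m\<in>M. (\<Sum>k\<in>K. a k * b k m) * (\<Sum>l\<in>L. c l * e l m))
    = (\<Sum>m\<in>M. \<Sum>k\<in>K. \<Sum>l\<in>L. a k * c l * (b k m * e l m))"
    unfolding sum_product by (intro sum.cong refl) (simp only: mult_ac)
  also have "\<dots> = (\<Sum>k\<in>K. \<Sum>m\<in>M. \<Sum>l\<in>L. a k * c l * (b k m * e l m))" by (rule sum.swap)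
  also have "\<dots> = (\<Sum>k\<in>K. \<Sum>l\<in>L. \<Sum>m\<in>M. a k * c l * (b k m * e l m))"
    by (intro sum.cong refl sum.swap)
  finally show ?thesis by (simp add: sum_distrib_left)
qed

lemma sum_delta_lt:
  fixes a :: "nat \<Rightarrow> complex"
  shows "i < n \<Longrightarrow> (\<Sum>k<n. a k * (if k = i then 1 else 0)) = a i"
    "i < n \<Longrightarrow> (\<Sum>k<n. a k * (if i = k then 1 else 0)) = a i"
    "i < n \<Longrightarrow> (\<Sum>k<n. (if k = i then 1 else 0) * a k) = a i"
    "i < n \<Longrightarrow> (\<Sum>k<n. (if i = k then 1 else 0) * a k) = a i"
  by (simp_all add: if_distrib[where f="\<lambda>x. a _ * x"] if_distrib[where f="\<lambda>x. x * a _"] cong: if_cong)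

text \<open>Gram-Schmidt keeps the first vector of the completed basis, so normalisation only
  rescales \<open>v\<close>.\<close>

lemma unitary_col_completion:
  assumes v: "v \<in> carrier_vec n" "v \<noteq> 0\<^sub>v n"
  shows "\<exists>U\<in>unitary_mats n. \<exists>c. \<forall>i<n. U $$ (i, 0) = c * v $ i"
proof -
  interpret cof_vec_space n "TYPE(complex)" .
  have n: "n \<noteq> 0"
  proof
    assume "n = 0"
    thus False using v by (metis carrier_vecD eq_vecI index_zero_vec(2) less_nat_zero_code)
  qed
  note b = basis_completion[OF v]
  define b where "b = basis_completion v"
  obtain vs where bv: "b = v # vs" using b n unfolding b_def by (cases "basis_completion v") auto
  define ws where "ws = gram_schmidt n b"
  have ws: "set ws \<subseteq> carrier_vec n" "corthogonal ws" "length ws = n"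
    using gram_schmidt_result[of b ws] b unfolding b_def ws_def by auto
  have hd: "ws ! 0 = v" using gram_schmidt_hd[OF v(1), of vs] bv ws(3) n unfolding ws_def
    by (metis hd_conv_nth list.size(3))
  define r where "r k = (\<Sum>i<n. (cmod (ws ! k $ i))\<^sup>2)" for k
  have ipw: "ws ! i \<bullet>c ws ! j = (\<Sum>m<n. ws ! i $ m * cnj (ws ! j $ m))" if "i < n" "j < n" for i j
    using that ws by (auto simp: scalar_prod_def atLeast0LessThan subset_iff intro!: sum.cong)
  have rr: "ws ! k \<bullet>c ws ! k = complex_of_real (r k)" if "k < n" for k
    unfolding ipw[OF that that] r_def by (simp add: complex_norm_square del: of_real_power)
  have rpos: "r k > 0" if "k < n" for k
  proof -
    have "r k \<ge> 0" unfolding r_def by (simp add: sum_nonneg)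
    moreover have "r k \<noteq> 0" using corthogonalD[OF ws(2), of k k] rr[OF that] that ws(3) by auto
    ultimately show ?thesis by linarith
  qed
  define U where "U = mat n n (\<lambda>(i, k). ws ! k $ i / complex_of_real (sqrt (r k)))"
  have U: "U \<in> carrier_mat n n" unfolding U_def by simp
  have Uix: "U $$ (i, k) = ws ! k $ i / complex_of_real (sqrt (r k))" if "i < n" "k < n" for i k
    using that by (simp add: U_def)
  have UU: "mat_adjoint U * U = 1\<^sub>m n"
  proof (rule eq_matI)
    fix i j assume ij: "i < dim_row (1\<^sub>m n)" "j < dim_col (1\<^sub>m n)"
    hence "(mat_adjoint U * U) $$ (i, j) = (\<Sum>k<n. cnj (ws ! i $ k / complex_of_real (sqrt (r i))) * (ws ! j $ k / complex_of_real (sqrt (r j))))"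
      using U by (subst times_mat_sum[OF mat_adjoint_carrier[OF U] U])
        (auto simp: mat_adjoint_index[OF U] Uix intro!: sum.cong)
    also have "\<dots> = (\<Sum>k<n. ws ! j $ k * cnj (ws ! i $ k)) / complex_of_real (sqrt (r i) * sqrt (r j))"
      unfolding sum_divide_distrib by (intro sum.cong) (auto simp: field_simps)
    also have "\<dots> = (ws ! j \<bullet>c ws ! i) / complex_of_real (sqrt (r i) * sqrt (r j))" using ij ipw by simp
    also have "\<dots> = 1\<^sub>m n $$ (i, j)"
      using corthogonalD[OF ws(2), of j i] ij ws(3) rr[of i] rpos[of i] by (cases "i = j") auto
    finally show "(mat_adjoint U * U) $$ (i, j) = 1\<^sub>m n $$ (i, j)" .
  qed (use carrier_matD[OF U] carrier_matD[OF mat_adjoint_carrier[OF U]] in auto)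
  hence "U * mat_adjoint U = 1\<^sub>m n"
    using mat_mult_left_right_inverse[OF mat_adjoint_carrier[OF U] U] by simp
  with UU U have "U \<in> unitary_mats n" by (simp add: unitary_mats_def)
  moreover have "U $$ (i, 0) = (1 / complex_of_real (sqrt (r 0))) * v $ i" if "i < n" for i
    using that n hd by (simp add: U_def)
  ultimately show ?thesis by blast
qed

lemma unitaryD:
  assumes "U \<in> unitary_mats n" "i < n" "j < n"
  shows "(\<Sum>k<n. cnj (U $$ (k, i)) * U $$ (k, j)) = (if i = j then 1 else 0)"
    "(\<Sum>k<n. U $$ (i, k) * cnj (U $$ (j, k))) = (if i = j then 1 else 0)"
proof -
  have U: "U \<in> carrier_mat n n" and UU: "mat_adjoint U * U = 1\<^sub>m n" "U * mat_adjoint U = 1\<^sub>m n"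
    using assms by (auto simp: unitary_mats_def)
  show "(\<Sum>k<n. cnj (U $$ (k, i)) * U $$ (k, j)) = (if i = j then 1 else 0)"
    using arg_cong[OF UU(1), of "\<lambda>A. A $$ (i, j)"] assms(2,3)
    by (simp only: times_mat_sum[OF mat_adjoint_carrier[OF U] U]) (simp add: mat_adjoint_index[OF U])
  show "(\<Sum>k<n. U $$ (i, k) * cnj (U $$ (j, k))) = (if i = j then 1 else 0)"
    using arg_cong[OF UU(2), of "\<lambda>A. A $$ (i, j)"] assms(2,3)
    by (simp only: times_mat_sum[OF U mat_adjoint_carrier[OF U]]) (simp add: mat_adjoint_index[OF U])
qed

text \<open>\<open>v k\<close> is the \<open>k\<close>-th vector. Orthonormality and completeness
  are both recorded; they are the two halves of unitarity.\<close>

definition onb :: "nat \<Rightarrow> (nat \<Rightarrow> nat \<Rightarrow> complex) \<Rightarrow> bool" where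
  "onb n v \<longleftrightarrow> (\<forall>k<n. \<forall>l<n. (\<Sum>i<n. cnj (v k i) * v l i) = (if k = l then 1 else 0)) \<and>
    (\<forall>i<n. \<forall>j<n. (\<Sum>k<n. v k i * cnj (v k j)) = (if i = j then 1 else 0))"

definition diagonalises :: "nat \<Rightarrow> (nat \<Rightarrow> nat \<Rightarrow> complex) \<Rightarrow> (nat \<Rightarrow> nat \<Rightarrow> complex) \<Rightarrow> bool" where
  "diagonalises n v H \<longleftrightarrow>
    (\<forall>k<n. \<forall>l<n. k \<noteq> l \<longrightarrow> (\<Sum>i<n. \<Sum>j<n. cnj (v k i) * H i j * v l j) = 0)"

text \<open>Induction on the dimension: in a unitary basis that starts with an eigenvector, the
  first column vanishes off the diagonal, hermitian symmetry clears the first row, and the induction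
  hypothesis handles the remaining block.\<close>

lemma hermitian_unitary_diag:
  fixes H :: "nat \<Rightarrow> nat \<Rightarrow> complex"
  assumes "\<And>i j. i < n \<Longrightarrow> j < n \<Longrightarrow> H j i = cnj (H i j)"
  shows "\<exists>v. onb n v \<and> diagonalises n v H"
  using assms
proof (induction n arbitrary: H)
  case 0 thus ?case by (simp add: onb_def diagonalises_def)
next
  case (Suc n)
  let ?N = "Suc n"
  define A where "A = mat ?N ?N (\<lambda>(i, j). H i j)"
  have A: "A \<in> carrier_mat ?N ?N" unfolding A_def by simp
  obtain e where "eigenvalue A e" using spectrum_non_empty[OF A] by (auto simp: spectrum_def)
  then obtain v where v: "v \<in> carrier_vec ?N" "v \<noteq> 0\<^sub>v ?N" and ev: "A *\<^sub>v v = e \<cdot>\<^sub>v v"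
    using A by (auto simp: eigenvalue_def eigenvector_def)
  obtain U c where U: "U \<in> unitary_mats ?N" and Uc: "\<And>i. i < ?N \<Longrightarrow> U $$ (i, 0) = c * v $ i"
    using unitary_col_completion[OF v] by blast
  define u where "u k i = U $$ (i, k)" for k i
  have u1: "(\<Sum>i<?N. cnj (u k i) * u l i) = (if k = l then 1 else 0)" if "k < ?N" "l < ?N" for k l
    using unitaryD(1)[OF U that] by (simp add: u_def)
  have u2: "(\<Sum>k<?N. u k i * cnj (u k j)) = (if i = j then 1 else 0)" if "i < ?N" "j < ?N" for i j
    using unitaryD(2)[OF U that] by (simp add: u_def)
  have evf: "(\<Sum>j<?N. H i j * u 0 j) = e * u 0 i" if "i < ?N" for i
  proof -
    have "(A *\<^sub>v v) $ i = (\<Sum>j<?N. H i j * v $ j)"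
      using that v by (simp add: A_def scalar_prod_def atLeast0LessThan)
    hence "(\<Sum>j<?N. H i j * v $ j) = e * v $ i" using ev that v by simp
    hence "c * (\<Sum>j<?N. H i j * v $ j) = c * (e * v $ i)" by simp
    moreover have "(\<Sum>j<?N. H i j * u 0 j) = c * (\<Sum>j<?N. H i j * v $ j)"
      unfolding sum_distrib_left by (intro sum.cong) (auto simp: u_def Uc)
    ultimately show ?thesis using that Uc[OF that] by (simp add: u_def mult_ac)
  qed
  define F where "F k l = (\<Sum>i<?N. \<Sum>j<?N. cnj (u k i) * H i j * u l j)" for k l
  have F0: "F k 0 = 0" if "0 < k" "k < ?N" for k
  proof -
    have "F k 0 = (\<Sum>i<?N. cnj (u k i) * (\<Sum>j<?N. H i j * u 0 j))"
      unfolding F_def by (simp only: sum_distrib_left mult.assoc)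
    also have "\<dots> = (\<Sum>i<?N. cnj (u k i) * (e * u 0 i))" by (intro sum.cong refl) (simp only: evf lessThan_iff)
    also have "\<dots> = e * (\<Sum>i<?N. cnj (u k i) * u 0 i)" by (simp only: sum_distrib_left mult_ac)
    also have "\<dots> = 0" using u1[of k 0] that by simp
    finally show ?thesis .
  qed
  have Hc: "cnj (H i j) = H j i" if "i < ?N" "j < ?N" for i j using Suc.prems[OF that] by (rule sym)
  have Fh: "F l k = cnj (F k l)" for k l
  proof -
    have "cnj (F k l) = (\<Sum>i<?N. \<Sum>j<?N. u k i * cnj (H i j) * cnj (u l j))" unfolding F_def by simp
    also have "\<dots> = (\<Sum>i<?N. \<Sum>j<?N. u k i * H j i * cnj (u l j))"
      by (intro sum.cong refl) (simp only: Hc lessThan_iff)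
    also have "\<dots> = F l k" unfolding F_def by (subst sum.swap) (simp only: mult_ac)
    finally show ?thesis by simp
  qed
  have "\<exists>v. onb n v \<and> diagonalises n v (\<lambda>i j. F (Suc i) (Suc j))"
    by (rule Suc.IH) (rule Fh)
  then obtain w where w: "onb n w" "diagonalises n w (\<lambda>i j. F (Suc i) (Suc j))" by blast
  have w1: "\<And>k l. k < n \<Longrightarrow> l < n \<Longrightarrow> (\<Sum>i<n. cnj (w k i) * w l i) = (if k = l then 1 else 0)"
    and w2: "\<And>i j. i < n \<Longrightarrow> j < n \<Longrightarrow> (\<Sum>k<n. w k i * cnj (w k j)) = (if i = j then 1 else 0)"
    using w(1) unfolding onb_def by simp_all
  have w3: "\<And>k l. k < n \<Longrightarrow> l < n \<Longrightarrow> k \<noteq> l \<Longrightarrow> (\<Sum>i<n. \<Sum>j<n. cnj (w k i) * F (Suc i) (Suc j) * w l j) = 0"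
    using w(2) unfolding diagonalises_def by simp
  \<comment> \<open>The block sum of the number \<open>1\<close> and the basis from the induction
    hypothesis, whose indices are shifted by one.\<close>
  define W where "W k i = (if k = 0 then (if i = 0 then 1 else 0) else if i = 0 then 0 else w (k - 1) (i - 1))" for k i
  have W[simp]: "W 0 0 = 1" "W 0 (Suc i) = 0" "W (Suc k) 0 = 0" "W (Suc k) (Suc i) = w k i" for k i
    by (simp_all add: W_def)
  have W1: "(\<Sum>i<?N. cnj (W k i) * W l i) = (if k = l then 1 else 0)" if "k < ?N" "l < ?N" for k l
    using that by (cases k; cases l) (auto simp: sum.lessThan_Suc_shift w1 simp del: sum.lessThan_Suc)
  have W2: "(\<Sum>k<?N. W k i * cnj (W k j)) = (if i = j then 1 else 0)" if "i < ?N" "j < ?N" for i j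
    using that by (cases i; cases j) (auto simp: sum.lessThan_Suc_shift w2 simp del: sum.lessThan_Suc)
  have W3: "(\<Sum>i<?N. \<Sum>j<?N. cnj (W k i) * F i j * W l j) = 0" if "k < ?N" "l < ?N" "k \<noteq> l" for k l
  proof -
    have F0': "F 0 (Suc i) = 0" if "i < n" for i using Fh[of 0 "Suc i"] F0[of "Suc i"] that by simp
    show ?thesis using that F0 F0'
      by (cases k; cases l) (auto simp: sum.lessThan_Suc_shift w3 simp del: sum.lessThan_Suc)
  qed
  define x where "x k i = (\<Sum>a<?N. W k a * u a i)" for k i
  have xc: "cnj (x k i) = (\<Sum>a<?N. cnj (W k a) * cnj (u a i))" for k i unfolding x_def by simp
  have "(\<Sum>i<?N. cnj (x k i) * x l i) = (if k = l then 1 else 0)" if kl: "k < ?N" "l < ?N" for k l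
  proof -
    have "(\<Sum>i<?N. cnj (x k i) * x l i) = (\<Sum>a<?N. \<Sum>b<?N. cnj (W k a) * W l b * (\<Sum>i<?N. cnj (u a i) * u b i))"
      unfolding x_def cnj_sum complex_cnj_mult by (rule sum_sum_swap3)
    also have "\<dots> = (\<Sum>a<?N. \<Sum>b<?N. cnj (W k a) * W l b * (if a = b then 1 else 0))"
      by (intro sum.cong refl) (simp only: u1 lessThan_iff)
    also have "\<dots> = (\<Sum>a<?N. cnj (W k a) * W l a)" by (intro sum.cong refl sum_delta_lt) simp
    finally show ?thesis using W1[OF kl] by simp
  qed
  moreover have "(\<Sum>k<?N. x k i * cnj (x k j)) = (if i = j then 1 else 0)" if ij: "i < ?N" "j < ?N" for i j
  proof -
    have "(\<Sum>k<?N. x k i * cnj (x k j)) = (\<Sum>k<?N. (\<Sum>a<?N. u a i * W k a) * (\<Sum>b<?N. cnj (u b j) * cnj (W k b)))"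
      unfolding x_def cnj_sum complex_cnj_mult by (simp only: mult.commute)
    also have "\<dots> = (\<Sum>a<?N. \<Sum>b<?N. u a i * cnj (u b j) * (\<Sum>k<?N. W k a * cnj (W k b)))" by (rule sum_sum_swap3)
    also have "\<dots> = (\<Sum>a<?N. \<Sum>b<?N. u a i * cnj (u b j) * (if a = b then 1 else 0))"
      by (intro sum.cong refl) (simp only: W2 lessThan_iff)
    also have "\<dots> = (\<Sum>a<?N. u a i * cnj (u a j))" by (intro sum.cong refl sum_delta_lt) simp
    finally show ?thesis using u2[OF ij] by simp
  qed
  moreover have "(\<Sum>i<?N. \<Sum>j<?N. cnj (x k i) * H i j * x l j) = 0" if kl: "k < ?N" "l < ?N" "k \<noteq> l" for k l
  proof -
    have "(\<Sum>i<?N. \<Sum>j<?N. cnj (x k i) * H i j * x l j)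
      = (\<Sum>i<?N. \<Sum>j<?N. \<Sum>a<?N. \<Sum>b<?N. cnj (W k a) * (cnj (u a i) * H i j * u b j) * W l b)"
      by (simp only: xc) (simp only: x_def sum_distrib_left sum_distrib_right mult_ac)
    also have "\<dots> = (\<Sum>i<?N. \<Sum>a<?N. \<Sum>j<?N. \<Sum>b<?N. cnj (W k a) * (cnj (u a i) * H i j * u b j) * W l b)"
      by (intro sum.cong refl sum.swap)
    also have "\<dots> = (\<Sum>a<?N. \<Sum>i<?N. \<Sum>j<?N. \<Sum>b<?N. cnj (W k a) * (cnj (u a i) * H i j * u b j) * W l b)"
      by (rule sum.swap)
    also have "\<dots> = (\<Sum>a<?N. \<Sum>i<?N. \<Sum>b<?N. \<Sum>j<?N. cnj (W k a) * (cnj (u a i) * H i j * u b j) * W l b)"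
      by (intro sum.cong refl sum.swap)
    also have "\<dots> = (\<Sum>a<?N. \<Sum>b<?N. \<Sum>i<?N. \<Sum>j<?N. cnj (W k a) * (cnj (u a i) * H i j * u b j) * W l b)"
      by (intro sum.cong refl sum.swap)
    also have "\<dots> = (\<Sum>a<?N. \<Sum>b<?N. cnj (W k a) * F a b * W l b)"
      unfolding F_def by (simp only: sum_distrib_left sum_distrib_right)
    finally show ?thesis using W3[OF kl] by simp
  qed
  ultimately show ?case unfolding onb_def diagonalises_def by (intro exI[of _ x] conjI allI impI) auto
qed

section \<open>Singular values and the trace norm\<close>

text \<open>Left vectors with \<open>s k = 0\<close> are zero instead of being completed to an
  orthonormal basis; the condition \<open>k = l \<and> s k \<noteq> 0\<close> expresses both
  cases.\<close>

definition svd :: "nat \<Rightarrow> complex mat \<Rightarrow> (nat \<Rightarrow> real) \<Rightarrow> (nat \<Rightarrow> nat \<Rightarrow> complex) \<Rightarrow> (nat \<Rightarrow> nat \<Rightarrow> complex) \<Rightarrow> bool" where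
  "svd n A s u v \<longleftrightarrow> A \<in> carrier_mat n n \<and> (\<forall>k<n. 0 \<le> s k) \<and> onb n v \<and>
    (\<forall>k<n. \<forall>l<n. (\<Sum>i<n. cnj (u k i) * u l i) = (if k = l \<and> s k \<noteq> 0 then 1 else 0)) \<and>
    (\<forall>i<n. \<forall>j<n. A $$ (i, j) = (\<Sum>k<n. complex_of_real (s k) * u k i * cnj (v k j)))"

lemma svdD:
  assumes "svd n A s u v"
  shows "A \<in> carrier_mat n n" "\<And>k. k < n \<Longrightarrow> 0 \<le> s k" "onb n v"
    "\<And>k l. k < n \<Longrightarrow> l < n \<Longrightarrow> (\<Sum>i<n. cnj (v k i) * v l i) = (if k = l then 1 else 0)"
    "\<And>i j. i < n \<Longrightarrow> j < n \<Longrightarrow> (\<Sum>k<n. v k i * cnj (v k j)) = (if i = j then 1 else 0)"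
    "\<And>k l. k < n \<Longrightarrow> l < n \<Longrightarrow> (\<Sum>i<n. cnj (u k i) * u l i) = (if k = l \<and> s k \<noteq> 0 then 1 else 0)"
    "\<And>i j. i < n \<Longrightarrow> j < n \<Longrightarrow> A $$ (i, j) = (\<Sum>k<n. complex_of_real (s k) * u k i * cnj (v k j))"
  using assms unfolding svd_def onb_def by simp_all

text \<open>A basis \<open>v\<close> that diagonalises the product of the adjoint of
  \<open>A\<close> with \<open>A\<close> has pairwise orthogonal images under \<open>A\<close>; the
  lengths of these images are the singular values.\<close>

lemma svd_exists:
  assumes A: "A \<in> carrier_mat n n"
  shows "\<exists>s u v. svd n A s u v"
proof -
  define H where "H i j = (\<Sum>m<n. cnj (A $$ (m, i)) * A $$ (m, j))" for i j
  have "H j i = cnj (H i j)" for i j unfolding H_def by (simp add: mult.commute)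
  then obtain v where v: "onb n v" "diagonalises n v H" using hermitian_unitary_diag[of n H] by blast
  have v1: "\<And>k l. k < n \<Longrightarrow> l < n \<Longrightarrow> (\<Sum>i<n. cnj (v k i) * v l i) = (if k = l then 1 else 0)"
    and v2: "\<And>i j. i < n \<Longrightarrow> j < n \<Longrightarrow> (\<Sum>k<n. v k i * cnj (v k j)) = (if i = j then 1 else 0)"
    using v(1) unfolding onb_def by simp_all
  define w where "w k = mapply n A (v k)" for k
  have ww: "(\<Sum>m<n. cnj (w k m) * w l m) = (\<Sum>i<n. \<Sum>j<n. cnj (v k i) * H i j * v l j)" for k l
  proof -
    have "(\<Sum>m<n. cnj (w k m) * w l m) = (\<Sum>m<n. (\<Sum>i<n. cnj (v k i) * cnj (A $$ (m, i))) * (\<Sum>j<n. v l j * A $$ (m, j)))"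
      unfolding w_def mapply_def cnj_sum complex_cnj_mult by (simp only: mult.commute)
    also have "\<dots> = (\<Sum>i<n. \<Sum>j<n. cnj (v k i) * v l j * H i j)" unfolding H_def by (rule sum_sum_swap3)
    finally show ?thesis by (simp only: mult_ac)
  qed
  have w0: "(\<Sum>m<n. cnj (w k m) * w l m) = 0" if "k < n" "l < n" "k \<noteq> l" for k l
    unfolding ww using v(2) that unfolding diagonalises_def by simp
  define s where "s k = sqrt (nrm2 n (w k))" for k
  have s2: "(\<Sum>m<n. cnj (w k m) * w k m) = complex_of_real (s k) * complex_of_real (s k)" for k
  proof -
    have "complex_of_real (s k) * complex_of_real (s k) = complex_of_real (nrm2 n (w k))"
      unfolding s_def of_real_mult[symmetric] by simp
    thus ?thesis unfolding ip_self[symmetric] ip_def by (simp only: mult.commute)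
  qed
  \<comment> \<open>Division by zero gives zero, which is exactly the convention for
    \<open>u k\<close> when \<open>s k = 0\<close>.\<close>
  define u where "u k i = w k i / complex_of_real (s k)" for k i
  have su: "complex_of_real (s k) * u k i = w k i" if "i < n" for k i
  proof (cases "s k = 0")
    case True
    hence "nrm2 n (w k) = 0" unfolding s_def by simp
    thus ?thesis using True that by (simp add: nrm2_eq_0)
  qed (simp add: u_def)
  have "(\<Sum>i<n. cnj (u k i) * u l i) = (if k = l \<and> s k \<noteq> 0 then 1 else 0)" if "k < n" "l < n" for k l
  proof -
    have "(\<Sum>i<n. cnj (u k i) * u l i) = (\<Sum>i<n. cnj (w k i) * w l i) / (complex_of_real (s k) * complex_of_real (s l))"
      unfolding sum_divide_distrib by (intro sum.cong refl) (simp add: u_def)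
    thus ?thesis using w0[OF that] s2[of k] by (cases "k = l") auto
  qed
  moreover have "A $$ (i, j) = (\<Sum>k<n. complex_of_real (s k) * u k i * cnj (v k j))" if ij: "i < n" "j < n" for i j
  proof -
    have "(\<Sum>k<n. complex_of_real (s k) * u k i * cnj (v k j)) = (\<Sum>k<n. w k i * cnj (v k j))"
      by (simp only: su[OF ij(1)])
    also have "\<dots> = (\<Sum>k<n. \<Sum>m<n. A $$ (i, m) * (v k m * cnj (v k j)))"
      unfolding w_def mapply_def sum_distrib_right by (simp only: mult.assoc)
    also have "\<dots> = (\<Sum>m<n. A $$ (i, m) * (\<Sum>k<n. v k m * cnj (v k j)))"
      by (subst sum.swap) (simp only: sum_distrib_left)
    also have "\<dots> = (\<Sum>m<n. A $$ (i, m) * (if m = j then 1 else 0))"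
      by (intro sum.cong refl) (simp only: v2 ij lessThan_iff)
    finally show ?thesis using sum_delta_lt(1)[OF ij(2)] by simp
  qed
  ultimately have "svd n A s u v" unfolding svd_def using A v(1) by (simp add: s_def)
  thus ?thesis by blast
qed

section \<open>Positive square roots and the modulus of a matrix\<close>

lemma psd_mat_iff:
  assumes "q \<in> carrier_mat n n"
  shows "psd_mat n q \<longleftrightarrow> (\<forall>f. 0 \<le> ip n (mapply n q f) f)"
proof -
  have e: "(q *\<^sub>v v) \<bullet>c v = ip n (mapply n q (($) v)) (($) v)" if "v \<in> carrier_vec n" for v
    using that assms by (auto simp: ip_def mapply_def scalar_prod_def atLeast0LessThan intro!: sum.cong)
  have i: "ip n (mapply n q f) f = ip n (mapply n q (($) (vec n f))) (($) (vec n f))" for f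
    by (auto simp: ip_def mapply_def intro!: sum.cong)
  show ?thesis unfolding psd_mat_def using assms e i by (metis vec_carrier)
qed

lemma mapply_mult:
  assumes "A \<in> carrier_mat n n" "B \<in> carrier_mat n n" "i < n"
  shows "mapply n (A * B) f i = mapply n A (mapply n B f) i"
proof -
  have "mapply n (A * B) f i = (\<Sum>j<n. \<Sum>k<n. A $$ (i, k) * (B $$ (k, j) * f j))"
    unfolding mapply_def by (intro sum.cong refl)
      (simp only: times_mat_sum[OF assms(1,2,3)] lessThan_iff sum_distrib_right mult.assoc)
  also have "\<dots> = mapply n A (mapply n B f) i"
    unfolding mapply_def by (subst sum.swap) (simp only: sum_distrib_left)
  finally show ?thesis .
qed

text \<open>With \<open>y = q x\<close> and \<open>q y = 0\<close>, positivity at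
  \<open>x + \<i> t y\<close> says that \<open>ip n y x - \<i> * t * ip n y y\<close> is real for
  every real \<open>t\<close>. Comparing \<open>t = 0\<close> with \<open>t = 1\<close> leaves
  \<open>y = 0\<close>.\<close>

lemma psd_kernel:
  assumes q: "\<And>f. 0 \<le> ip n (mapply n q f) f" and 0: "\<And>i. i < n \<Longrightarrow> mapply n q (mapply n q x) i = 0"
    and i: "i < n"
  shows "mapply n q x i = 0"
proof -
  define y where "y = mapply n q x"
  have "0 \<le> ip n (mapply n q (\<lambda>j. x j + \<i> * (of_real t * y j))) (\<lambda>j. x j + \<i> * (of_real t * y j))" for t :: real by (rule q)
  moreover have "ip n (mapply n q (\<lambda>j. x j + \<i> * (of_real t * y j))) (\<lambda>j. x j + \<i> * (of_real t * y j))
      = ip n y x - \<i> * of_real t * ip n y y" for t :: real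
  proof -
    have "mapply n q (\<lambda>j. x j + \<i> * (of_real t * y j)) k = y k" if "k < n" for k
    proof -
      have "mapply n q (\<lambda>j. x j + \<i> * (of_real t * y j)) k = mapply n q x k + \<i> * of_real t * mapply n q y k"
        unfolding mapply_def sum_distrib_left sum.distrib[symmetric] by (intro sum.cong refl) (simp add: algebra_simps)
      thus ?thesis using 0[OF that] by (simp add: y_def)
    qed
    hence "ip n (mapply n q (\<lambda>j. x j + \<i> * (of_real t * y j))) (\<lambda>j. x j + \<i> * (of_real t * y j))
      = (\<Sum>k<n. y k * cnj (x k + \<i> * (of_real t * y k)))" unfolding ip_def by (intro sum.cong refl) simp
    also have "\<dots> = ip n y x - \<i> * of_real t * ip n y y"
      unfolding ip_def sum_distrib_left sum_subtractf[symmetric] by (intro sum.cong refl) (simp add: algebra_simps)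
    finally show ?thesis .
  qed
  ultimately have "Im (ip n y x - \<i> * of_real t * ip n y y) = 0" for t :: real
    by (metis less_eq_complex_def zero_complex.simps(2))
  from this[of 0] this[of 1] have "nrm2 n y = 0" by (simp add: ip_self)
  thus ?thesis using i by (simp add: nrm2_eq_0 y_def)
qed

text \<open>The spectral form with eigenvectors \<open>v k\<close> and eigenvalues
  \<open>s k\<close>; for a singular value decomposition of \<open>A\<close> it is
  \<open>|A|\<close>.\<close>

definition abs_of :: "nat \<Rightarrow> (nat \<Rightarrow> real) \<Rightarrow> (nat \<Rightarrow> nat \<Rightarrow> complex) \<Rightarrow> complex mat" where
  "abs_of n s v = mat n n (\<lambda>(i, j). \<Sum>k<n. complex_of_real (s k) * v k i * cnj (v k j))"

lemma abs_of_carrier [simp]: "abs_of n s v \<in> carrier_mat n n" by (simp add: abs_of_def)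

lemma abs_of_index:
  "i < n \<Longrightarrow> j < n \<Longrightarrow> abs_of n s v $$ (i, j) = (\<Sum>k<n. complex_of_real (s k) * v k i * cnj (v k j))"
  by (simp add: abs_of_def)

lemma mapply_abs_of:
  assumes "i < n"
  shows "mapply n (abs_of n s v) f i = (\<Sum>k<n. complex_of_real (s k) * v k i * ip n f (v k))"
proof -
  have "mapply n (abs_of n s v) f i = (\<Sum>j<n. \<Sum>k<n. complex_of_real (s k) * v k i * (f j * cnj (v k j)))"
    unfolding mapply_def abs_of_def using assms by (simp add: sum_distrib_right sum_distrib_left mult_ac)
  also have "\<dots> = (\<Sum>k<n. complex_of_real (s k) * v k i * ip n f (v k))"
    unfolding ip_def by (subst sum.swap) (simp only: sum_distrib_left)
  finally show ?thesis .
qed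

lemma ip_abs_of: "ip n (mapply n (abs_of n s v) f) f = complex_of_real (\<Sum>k<n. s k * (cmod (ip n f (v k)))\<^sup>2)"
proof -
  have "ip n (mapply n (abs_of n s v) f) f = (\<Sum>i<n. \<Sum>k<n. complex_of_real (s k) * ip n f (v k) * (v k i * cnj (f i)))"
    unfolding ip_def[of n "mapply _ _ _"] by (intro sum.cong refl) (simp add: mapply_abs_of sum_distrib_right sum_distrib_left mult_ac)
  also have "\<dots> = (\<Sum>k<n. complex_of_real (s k) * ip n f (v k) * ip n (v k) f)"
    unfolding ip_def[of n "v _" f] by (subst sum.swap) (simp only: sum_distrib_left)
  also have "\<dots> = (\<Sum>k<n. complex_of_real (s k * (cmod (ip n f (v k)))\<^sup>2))"
  proof (intro sum.cong refl)
    fix k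
    have "ip n (v k) f = cnj (ip n f (v k))" by (simp add: ip_def mult.commute)
    thus "complex_of_real (s k) * ip n f (v k) * ip n (v k) f = complex_of_real (s k * (cmod (ip n f (v k)))\<^sup>2)"
      by (simp add: complex_norm_square del: of_real_power)
  qed
  finally show ?thesis by simp
qed

lemma ip_onb: "onb n v \<Longrightarrow> k < n \<Longrightarrow> l < n \<Longrightarrow> ip n (v k) (v l) = (if k = l then 1 else 0)"
  unfolding onb_def ip_def by (auto simp: mult.commute)

lemma mapply_abs_of_onb:
  assumes "onb n v" "i < n" "l < n"
  shows "mapply n (abs_of n s v) (v l) i = complex_of_real (s l) * v l i"
proof -
  have "mapply n (abs_of n s v) (v l) i = (\<Sum>k<n. complex_of_real (s k) * v k i * (if l = k then 1 else 0))"
    unfolding mapply_abs_of[OF assms(2)] by (intro sum.cong refl) (simp only: ip_onb[OF assms(1) assms(3)] lessThan_iff)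
  thus ?thesis using sum_delta_lt(2)[OF assms(3)] by simp
qed

lemma mat_eq_onb:
  assumes "onb n v" "A \<in> carrier_mat n n" "B \<in> carrier_mat n n"
    and eq: "\<And>k i. k < n \<Longrightarrow> i < n \<Longrightarrow> mapply n A (v k) i = mapply n B (v k) i"
  shows "A = B"
proof (rule eq_matI)
  have ent: "C $$ (i, j) = (\<Sum>k<n. mapply n C (v k) i * cnj (v k j))" if "i < n" "j < n" for C i j
  proof -
    have "(\<Sum>k<n. mapply n C (v k) i * cnj (v k j)) = (\<Sum>k<n. \<Sum>m<n. C $$ (i, m) * (v k m * cnj (v k j)))"
      unfolding mapply_def sum_distrib_right by (simp only: mult.assoc)
    also have "\<dots> = (\<Sum>m<n. C $$ (i, m) * (\<Sum>k<n. v k m * cnj (v k j)))"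
      by (subst sum.swap) (simp only: sum_distrib_left)
    also have "\<dots> = (\<Sum>m<n. C $$ (i, m) * (if m = j then 1 else 0))"
      using assms(1) that unfolding onb_def by (intro sum.cong refl) simp
    finally show ?thesis using sum_delta_lt(1)[OF that(2)] by simp
  qed
  fix i j assume "i < dim_row B" "j < dim_col B"
  hence ij: "i < n" "j < n" using assms by auto
  show "A $$ (i, j) = B $$ (i, j)" unfolding ent[OF ij, of A] ent[OF ij, of B]
    by (intro sum.cong refl) (simp only: eq ij lessThan_iff)
qed (use assms in auto)

lemma abs_of_square:
  assumes "svd n A s u v"
  shows "abs_of n s v * abs_of n s v = mat_adjoint A * A"
proof (rule mat_eq_onb[OF svdD(3)[OF assms]])
  note D = svdD[OF assms]
  fix k i assume ki: "k < n" "i < n"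
  have lin: "mapply n B (\<lambda>j. c * f j) i = c * mapply n B f i" for B c f
    unfolding mapply_def by (simp add: sum_distrib_left mult_ac)
  have cong: "mapply n B f i = mapply n B h i" if "\<And>j. j < n \<Longrightarrow> f j = h j" for B f h
    unfolding mapply_def using that by simp
  have "mapply n (abs_of n s v * abs_of n s v) (v k) i = mapply n (abs_of n s v) (mapply n (abs_of n s v) (v k)) i"
    using ki by (simp add: mapply_mult)
  also have "\<dots> = mapply n (abs_of n s v) (\<lambda>j. complex_of_real (s k) * v k j) i"
    by (rule cong) (simp add: mapply_abs_of_onb[OF D(3)] ki)
  also have "\<dots> = complex_of_real (s k) * (complex_of_real (s k) * v k i)"
    unfolding lin by (simp only: mapply_abs_of_onb[OF D(3) ki(2,1)])
  also have "\<dots> = mapply n (mat_adjoint A * A) (v k) i"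
  proof -
    have Av: "mapply n A (v k) m = complex_of_real (s k) * u k m" if m: "m < n" for m
    proof -
      have "mapply n A (v k) m = (\<Sum>j<n. \<Sum>l<n. complex_of_real (s l) * u l m * (cnj (v l j) * v k j))"
        unfolding mapply_def by (intro sum.cong refl) (simp add: D(7) m sum_distrib_right sum_distrib_left mult_ac)
      also have "\<dots> = (\<Sum>l<n. complex_of_real (s l) * u l m * (\<Sum>j<n. cnj (v l j) * v k j))"
        by (subst sum.swap) (simp only: sum_distrib_left)
      also have "\<dots> = (\<Sum>l<n. complex_of_real (s l) * u l m * (if l = k then 1 else 0))"
        by (intro sum.cong refl) (simp only: D(4) ki lessThan_iff)
      finally show ?thesis using sum_delta_lt(1)[OF ki(1)] by simp
    qed
    have "mapply n (mat_adjoint A * A) (v k) i = mapply n (mat_adjoint A) (mapply n A (v k)) i"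
      by (rule mapply_mult[OF mat_adjoint_carrier[OF D(1)] D(1) ki(2)])
    also have "\<dots> = mapply n (mat_adjoint A) (\<lambda>m. complex_of_real (s k) * u k m) i" by (rule cong) (rule Av)
    also have "\<dots> = complex_of_real (s k) * mapply n (mat_adjoint A) (u k) i" by (rule lin)
    also have "mapply n (mat_adjoint A) (u k) i = (\<Sum>m<n. \<Sum>l<n. complex_of_real (s l) * v l i * (cnj (u l m) * u k m))"
      unfolding mapply_def by (intro sum.cong refl) (simp add: mat_adjoint_index[OF D(1)] D(7) ki sum_distrib_right sum_distrib_left mult_ac)
    also have "\<dots> = (\<Sum>l<n. complex_of_real (s l) * v l i * (\<Sum>m<n. cnj (u l m) * u k m))"
      by (subst sum.swap) (simp only: sum_distrib_left)
    also have "\<dots> = (\<Sum>l<n. complex_of_real (s l) * v l i * (if l = k then 1 else 0))"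
      by (intro sum.cong refl) (use D(6) ki in auto)
    also have "\<dots> = complex_of_real (s k) * v k i" using sum_delta_lt(1)[OF ki(1)] by simp
    finally show ?thesis by simp
  qed
  finally show "mapply n (abs_of n s v * abs_of n s v) (v k) i = mapply n (mat_adjoint A * A) (v k) i" .
qed (intro mult_carrier_mat[of _ n n] abs_of_carrier mat_adjoint_carrier svdD(1)[OF assms])+

lemma psd_abs_of:
  assumes "\<And>k. k < n \<Longrightarrow> 0 \<le> s k" shows "psd_mat n (abs_of n s v)"
proof -
  have "0 \<le> (\<Sum>k<n. s k * (cmod (ip n f (v k)))\<^sup>2)" for f using assms by (intro sum_nonneg mult_nonneg_nonneg) auto
  thus ?thesis unfolding psd_mat_iff[OF abs_of_carrier] ip_abs_of by (simp add: less_eq_complex_def)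
qed

text \<open>At a vector \<open>v k\<close> the equality of squares factors as
  \<open>(q + s)(q - s) v = 0\<close> with \<open>s = s k\<close>. For \<open>s > 0\<close> the
  vector \<open>y = (q - s) v\<close> satisfies \<open>q y = - s y\<close>, which positivity
  excludes unless \<open>y = 0\<close>; for \<open>s = 0\<close> the kernel lemma applies.\<close>

lemma psd_sqrt_unique:
  assumes v: "onb n v" and s: "\<And>k. k < n \<Longrightarrow> 0 \<le> s k" and q: "psd_mat n q"
    and sq: "q * q = abs_of n s v * abs_of n s v"
  shows "q = abs_of n s v"
proof -
  have qc: "q \<in> carrier_mat n n" using q by (simp add: psd_mat_def)
  have pos: "\<And>f. 0 \<le> ip n (mapply n q f) f" using q psd_mat_iff[OF qc] by blast
  show ?thesis
  proof (rule mat_eq_onb[OF v qc abs_of_carrier])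
    fix k i assume ki: "k < n" "i < n"
    have lin: "mapply n B (\<lambda>j. f j + c * h j) l = mapply n B f l + c * mapply n B h l" for B c f h l
      unfolding mapply_def by (simp add: sum_distrib_left sum.distrib algebra_simps)
    have cong: "mapply n B f l = mapply n B h l" if "\<And>j. j < n \<Longrightarrow> f j = h j" for B f h l
      unfolding mapply_def using that by simp
    have qq: "mapply n q (mapply n q (v k)) l = complex_of_real (s k) * (complex_of_real (s k) * v k l)" if l: "l < n" for l
    proof -
      have "mapply n q (mapply n q (v k)) l = mapply n (abs_of n s v * abs_of n s v) (v k) l"
        unfolding mapply_mult[OF qc qc l, symmetric] sq ..
      also have "\<dots> = mapply n (abs_of n s v) (mapply n (abs_of n s v) (v k)) l"
        by (rule mapply_mult[OF abs_of_carrier abs_of_carrier l])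
      also have "\<dots> = mapply n (abs_of n s v) (\<lambda>j. 0 + complex_of_real (s k) * v k j) l"
        by (rule cong) (simp add: mapply_abs_of_onb[OF v] ki)
      also have "\<dots> = complex_of_real (s k) * (complex_of_real (s k) * v k l)"
        unfolding lin mapply_abs_of_onb[OF v l ki(1)] by (simp add: mapply_def)
      finally show ?thesis .
    qed
    have "mapply n q (v k) i = complex_of_real (s k) * v k i"
    proof (cases "s k = 0")
      case True
      have "mapply n q (v k) i = 0" by (rule psd_kernel[OF pos _ ki(2)]) (simp add: qq True)
      thus ?thesis using True by simp
    next
      case False
      hence sp: "s k > 0" using s[OF ki(1)] by simp
      define y where "y j = mapply n q (v k) j + (- complex_of_real (s k)) * v k j" for j
      have qy: "mapply n q y l = (- complex_of_real (s k)) * y l" if "l < n" for l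
      proof -
        have "mapply n q y l = mapply n q (mapply n q (v k)) l + (- complex_of_real (s k)) * mapply n q (v k) l"
          unfolding y_def lin ..
        thus ?thesis unfolding y_def qq[OF that] by (simp add: algebra_simps)
      qed
      have "ip n (mapply n q y) y = (- complex_of_real (s k)) * ip n y y"
        unfolding ip_def sum_distrib_left by (intro sum.cong refl) (simp only: qy lessThan_iff mult.assoc)
      hence "0 \<le> - (s k * nrm2 n y)" using pos[of y] by (simp add: ip_self less_eq_complex_def)
      hence "nrm2 n y \<le> 0" using sp by (simp add: mult_le_0_iff)
      hence "nrm2 n y = 0" by (intro antisym nrm2_nonneg)
      thus ?thesis using ki by (simp add: nrm2_eq_0 y_def)
    qed
    thus "mapply n q (v k) i = mapply n (abs_of n s v) (v k) i"
      by (simp only: mapply_abs_of_onb[OF v ki(2,1)])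
  qed
qed

lemma mat_abs_svd:
  assumes "svd n A s u v" shows "mat_abs A = abs_of n s v"
  unfolding mat_abs_def
proof (rule the_equality)
  note D = svdD[OF assms]
  have [simp]: "dim_col A = n" using D(1) by simp
  show "psd_mat (dim_col A) (abs_of n s v) \<and> abs_of n s v * abs_of n s v = mat_adjoint A * A"
    using psd_abs_of[OF D(2)] abs_of_square[OF assms] by simp
  show "p = abs_of n s v" if "psd_mat (dim_col A) p \<and> p * p = mat_adjoint A * A" for p
    by (rule psd_sqrt_unique[OF D(3)]) (use D(2) that abs_of_square[OF assms] in simp_all)
qed

section \<open>The trace norm as the sum of the singular values\<close>

lemma mat_trace_sum: "A \<in> carrier_mat n n \<Longrightarrow> mat_trace A = (\<Sum>i<n. A $$ (i, i))"
  by (simp add: mat_trace_def)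

lemma mat_trace_mult:
  "A \<in> carrier_mat n n \<Longrightarrow> B \<in> carrier_mat n n \<Longrightarrow> mat_trace (A * B) = (\<Sum>i<n. \<Sum>j<n. A $$ (i, j) * B $$ (j, i))"
  unfolding mat_trace_sum[OF mult_carrier_mat[of A n n B n]]
  by (intro sum.cong refl) (simp only: times_mat_sum[of A n n B n] lessThan_iff)

lemma trace_norm_svd:
  assumes "svd n A s u v" shows "trace_norm A = (\<Sum>k<n. s k)"
proof -
  note D = svdD[OF assms]
  have "mat_trace (abs_of n s v) = (\<Sum>i<n. \<Sum>k<n. complex_of_real (s k) * (cnj (v k i) * v k i))"
    unfolding mat_trace_sum[OF abs_of_carrier] by (intro sum.cong refl) (simp add: abs_of_def mult_ac)
  also have "\<dots> = (\<Sum>k<n. complex_of_real (s k) * (\<Sum>i<n. cnj (v k i) * v k i))"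
    by (subst sum.swap) (simp only: sum_distrib_left)
  also have "\<dots> = (\<Sum>k<n. complex_of_real (s k))" by (intro sum.cong refl) (use D(4) in simp)
  finally show ?thesis unfolding trace_norm_def mat_abs_svd[OF assms] by simp
qed

lemma mat_abs_carrier [simp]: "A \<in> carrier_mat n n \<Longrightarrow> mat_abs A \<in> carrier_mat n n"
  using svd_exists[of A n] mat_abs_svd abs_of_carrier by metis

lemma trace_norm_nonneg: "A \<in> carrier_mat n n \<Longrightarrow> 0 \<le> trace_norm A"
  using svd_exists[of A n] trace_norm_svd svdD(2) by (metis lessThan_iff sum_nonneg)

text \<open>\<open>|A|\<close> is hermitian and positive, hence the positive root of its own square,
  so taking the modulus again changes nothing.\<close>

lemma trace_norm_mat_abs:
  assumes A: "A \<in> carrier_mat n n" shows "trace_norm (mat_abs A) = trace_norm A"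
proof -
  obtain s u v where sv: "svd n A s u v" using svd_exists[OF A] by blast
  note D = svdD[OF sv]
  let ?p = "abs_of n s v"
  have adj: "mat_adjoint ?p = ?p"
    using carrier_matD[OF mat_adjoint_carrier[OF abs_of_carrier[of n s v]]] carrier_matD[OF abs_of_carrier[of n s v]]
    by (intro eq_matI) (auto simp: mat_adjoint_index[OF abs_of_carrier] abs_of_index mult_ac)
  obtain s' u' v' where sv': "svd n ?p s' u' v'" using svd_exists[OF abs_of_carrier] by blast
  have "?p * ?p = abs_of n s' v' * abs_of n s' v'" using abs_of_square[OF sv'] adj by simp
  hence "?p = abs_of n s' v'"
    by (intro psd_sqrt_unique[OF svdD(3)[OF sv']] svdD(2)[OF sv'] psd_abs_of D(2))
  hence "mat_abs ?p = mat_abs A" using mat_abs_svd[OF sv] mat_abs_svd[OF sv'] by simp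
  thus ?thesis unfolding trace_norm_def mat_abs_svd[OF sv] by simp
qed

section \<open>Bessel's inequality, polar parts and trace duality\<close>

lemma bessel:
  assumes u: "\<And>k l. k < n \<Longrightarrow> l < n \<Longrightarrow> (\<Sum>i<n. cnj (u k i) * u l i) = (if k = l \<and> e k then 1 else 0)"
  shows "(\<Sum>k<n. (cmod (ip n f (u k)))\<^sup>2) \<le> nrm2 n f"
proof -
  define c where "c k = ip n f (u k)" for k
  \<comment> \<open>Indices with \<open>e k\<close> false carry zero vectors; the left singular
    vectors form such a family. The inequality then follows from the squared distance between
    \<open>f\<close> and its projection \<open>?p\<close>.\<close>
  have c0: "c k = 0" if "k < n" "\<not> e k" for k
  proof -
    have "ip n (u k) (u k) = 0" using u[of k k] that by (simp add: ip_def mult.commute)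
    hence "nrm2 n (u k) = 0" by (simp add: ip_self)
    thus ?thesis by (simp add: c_def ip_def nrm2_eq_0)
  qed
  let ?p = "\<lambda>i. \<Sum>k<n. c k * u k i"
  have pp: "(\<Sum>i<n. ?p i * cnj (?p i)) = (\<Sum>k<n. c k * cnj (c k))"
  proof -
    have "(\<Sum>i<n. ?p i * cnj (?p i)) = (\<Sum>i<n. (\<Sum>l<n. cnj (c l) * cnj (u l i)) * ?p i)"
      by (simp add: mult.commute)
    also have "\<dots> = (\<Sum>l<n. \<Sum>k<n. cnj (c l) * c k * (\<Sum>i<n. cnj (u l i) * u k i))" by (rule sum_sum_swap3)
    also have "\<dots> = (\<Sum>l<n. \<Sum>k<n. cnj (c l) * c k * (if l = k then 1 else 0))"
      by (intro sum.cong refl) (use c0 u in auto)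
    also have "\<dots> = (\<Sum>k<n. cnj (c k) * c k)" by (intro sum.cong refl sum_delta_lt) simp
    finally show ?thesis by (simp add: mult.commute)
  qed
  have fp: "(\<Sum>i<n. f i * cnj (?p i)) = (\<Sum>k<n. c k * cnj (c k))"
  proof -
    have "(\<Sum>i<n. f i * cnj (?p i)) = (\<Sum>i<n. \<Sum>k<n. cnj (c k) * (f i * cnj (u k i)))"
      by (simp add: sum_distrib_left mult_ac)
    also have "\<dots> = (\<Sum>k<n. cnj (c k) * c k)" unfolding c_def[of _, unfolded ip_def]
      by (subst sum.swap) (simp add: sum_distrib_left)
    finally show ?thesis by (simp add: mult.commute)
  qed
  have pf: "(\<Sum>i<n. ?p i * cnj (f i)) = (\<Sum>k<n. c k * cnj (c k))"
    using arg_cong[OF fp, of cnj] by (simp add: mult.commute)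
  have "complex_of_real (nrm2 n (\<lambda>i. f i - ?p i)) = (\<Sum>i<n. f i * cnj (f i) - f i * cnj (?p i) - ?p i * cnj (f i) + ?p i * cnj (?p i))"
    unfolding ip_self[symmetric] ip_def by (intro sum.cong refl) (simp add: algebra_simps)
  also have "\<dots> = complex_of_real (nrm2 n f) - (\<Sum>k<n. c k * cnj (c k))"
    unfolding sum.distrib sum_subtractf pp fp pf ip_self[symmetric] ip_def by simp
  also have "(\<Sum>k<n. c k * cnj (c k)) = complex_of_real (\<Sum>k<n. (cmod (c k))\<^sup>2)"
    by (simp add: complex_norm_square del: of_real_power)
  finally have "nrm2 n (\<lambda>i. f i - ?p i) = nrm2 n f - (\<Sum>k<n. (cmod (c k))\<^sup>2)"
    unfolding of_real_diff[symmetric] of_real_eq_iff .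
  thus ?thesis using nrm2_nonneg[of n "\<lambda>i. f i - ?p i"] by (simp add: c_def)
qed

lemma parseval:
  assumes "onb n v" shows "nrm2 n (\<lambda>i. \<Sum>k<n. c k * v k i) = (\<Sum>k<n. (cmod (c k))\<^sup>2)"
proof -
  have "ip n (\<lambda>i. \<Sum>k<n. c k * v k i) (\<lambda>i. \<Sum>k<n. c k * v k i)
    = (\<Sum>i<n. (\<Sum>l<n. cnj (c l) * cnj (v l i)) * (\<Sum>k<n. c k * v k i))"
    by (simp add: ip_def mult.commute)
  also have "\<dots> = (\<Sum>l<n. \<Sum>k<n. cnj (c l) * c k * (\<Sum>i<n. cnj (v l i) * v k i))" by (rule sum_sum_swap3)
  also have "\<dots> = (\<Sum>l<n. \<Sum>k<n. cnj (c l) * c k * (if l = k then 1 else 0))"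
    using assms unfolding onb_def by (intro sum.cong refl) simp
  also have "\<dots> = (\<Sum>k<n. cnj (c k) * c k)" by (intro sum.cong refl sum_delta_lt) simp
  also have "\<dots> = complex_of_real (\<Sum>k<n. (cmod (c k))\<^sup>2)"
    by (simp add: complex_norm_square mult.commute del: of_real_power)
  finally show ?thesis unfolding ip_self of_real_eq_iff .
qed

text \<open>The adjoint of the usual partial isometry \<open>W\<close> in \<open>A = W |A|\<close>:
  it sends \<open>u k\<close> to \<open>v k\<close> and therefore turns \<open>A\<close> into
  \<open>|A|\<close> by multiplication from the left.\<close>

definition polar :: "nat \<Rightarrow> (nat \<Rightarrow> nat \<Rightarrow> complex) \<Rightarrow> (nat \<Rightarrow> nat \<Rightarrow> complex) \<Rightarrow> complex mat" where
  "polar n u v = mat n n (\<lambda>(i, j). \<Sum>k<n. v k i * cnj (u k j))"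

lemma polar_carrier [simp]: "polar n u v \<in> carrier_mat n n" by (simp add: polar_def)

lemma mapply_polar:
  assumes "i < n" shows "mapply n (polar n u v) f i = (\<Sum>k<n. ip n f (u k) * v k i)"
proof -
  have "mapply n (polar n u v) f i = (\<Sum>j<n. \<Sum>k<n. v k i * (f j * cnj (u k j)))"
    unfolding mapply_def polar_def using assms by (simp add: sum_distrib_right sum_distrib_left mult_ac)
  also have "\<dots> = (\<Sum>k<n. v k i * ip n f (u k))"
    unfolding ip_def by (subst sum.swap) (simp only: sum_distrib_left)
  finally show ?thesis by (simp add: mult.commute)
qed

lemma nrm2_cong: "(\<And>i. i < n \<Longrightarrow> f i = h i) \<Longrightarrow> nrm2 n f = nrm2 n h"
  by (simp add: nrm2_def)

lemma ip_cong: "(\<And>i. i < n \<Longrightarrow> f i = f' i) \<Longrightarrow> (\<And>i. i < n \<Longrightarrow> h i = h' i) \<Longrightarrow> ip n f h = ip n f' h'"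
  by (simp add: ip_def)

lemma mapply_cong: "(\<And>i. i < n \<Longrightarrow> f i = h i) \<Longrightarrow> mapply n A f i = mapply n A h i"
  by (simp add: mapply_def)

lemma contraction_polar:
  assumes "svd n A s u v" shows "contraction n (polar n u v)"
  unfolding contraction_def
proof (intro conjI allI)
  note D = svdD[OF assms]
  fix f
  have "nrm2 n (mapply n (polar n u v) f) = (\<Sum>k<n. (cmod (ip n f (u k)))\<^sup>2)"
    unfolding parseval[OF D(3), symmetric] by (rule nrm2_cong) (rule mapply_polar)
  also have "\<dots> \<le> nrm2 n f" by (rule bessel[where e="\<lambda>k. s k \<noteq> 0"]) (rule D(6))
  finally show "nrm2 n (mapply n (polar n u v) f) \<le> nrm2 n f" .
qed simp

lemma mapply_svd:
  assumes "svd n A s u v" "i < n"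
  shows "mapply n A f i = (\<Sum>k<n. complex_of_real (s k) * ip n f (v k) * u k i)"
proof -
  have "mapply n A f i = (\<Sum>j<n. \<Sum>k<n. complex_of_real (s k) * u k i * (f j * cnj (v k j)))"
    unfolding mapply_def by (intro sum.cong refl) (simp add: svdD(7)[OF assms(1)] assms(2) sum_distrib_right sum_distrib_left mult_ac)
  also have "\<dots> = (\<Sum>k<n. complex_of_real (s k) * u k i * ip n f (v k))"
    unfolding ip_def by (subst sum.swap) (simp only: sum_distrib_left)
  finally show ?thesis by (simp add: mult_ac)
qed

lemma mapply_adj_svd:
  assumes "svd n A s u v" "i < n"
  shows "mapply n (mat_adjoint A) f i = (\<Sum>k<n. complex_of_real (s k) * ip n f (u k) * v k i)"
proof -
  have "mapply n (mat_adjoint A) f i = (\<Sum>j<n. \<Sum>k<n. complex_of_real (s k) * v k i * (f j * cnj (u k j)))"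
    unfolding mapply_def by (intro sum.cong refl)
      (simp add: mat_adjoint_index[OF svdD(1)[OF assms(1)]] svdD(7)[OF assms(1)] assms(2) sum_distrib_right sum_distrib_left mult_ac)
  also have "\<dots> = (\<Sum>k<n. complex_of_real (s k) * v k i * ip n f (u k))"
    unfolding ip_def by (subst sum.swap) (simp only: sum_distrib_left)
  finally show ?thesis by (simp add: mult_ac)
qed

lemma ip_comb_left: "ip n (\<lambda>i. \<Sum>k<N. c k * u k i) h = (\<Sum>k<N. c k * ip n (u k) h)"
proof -
  have "ip n (\<lambda>i. \<Sum>k<N. c k * u k i) h = (\<Sum>i<n. \<Sum>k<N. c k * (u k i * cnj (h i)))"
    unfolding ip_def by (simp add: sum_distrib_right sum_distrib_left mult_ac)
  also have "\<dots> = (\<Sum>k<N. c k * ip n (u k) h)"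
    unfolding ip_def by (subst sum.swap) (simp only: sum_distrib_left)
  finally show ?thesis .
qed

lemma polar_mult:
  assumes "svd n A s u v" shows "polar n u v * A = mat_abs A"
  unfolding mat_abs_svd[OF assms]
proof (rule mat_eq_onb[OF svdD(3)[OF assms]])
  note D = svdD[OF assms]
  fix k i assume ki: "k < n" "i < n"
  have Av: "mapply n A (v k) j = complex_of_real (s k) * u k j" if "j < n" for j
  proof -
    have "mapply n A (v k) j = (\<Sum>l<n. (complex_of_real (s l) * u l j) * (if k = l then 1 else 0))"
      unfolding mapply_svd[OF assms that] by (intro sum.cong refl) (simp add: ip_onb[OF D(3)] ki)
    thus ?thesis using sum_delta_lt(2)[OF ki(1)] by simp
  qed
  have ipu: "ip n (u k) (u l) = (if k = l \<and> s k \<noteq> 0 then 1 else 0)" if "l < n" for l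
    using D(6)[OF that ki(1)] unfolding ip_def by (auto simp: mult.commute)
  have "mapply n (polar n u v * A) (v k) i = mapply n (polar n u v) (mapply n A (v k)) i"
    by (rule mapply_mult[OF polar_carrier D(1) ki(2)])
  also have "\<dots> = mapply n (polar n u v) (\<lambda>j. complex_of_real (s k) * u k j) i" by (rule mapply_cong) (rule Av)
  also have "\<dots> = (\<Sum>l<n. complex_of_real (s k) * v l i * ip n (u k) (u l))"
    unfolding mapply_polar[OF ki(2)] ip_def by (simp add: sum_distrib_left sum_distrib_right mult_ac)
  also have "\<dots> = (\<Sum>l<n. complex_of_real (s k) * v l i * (if k = l then 1 else 0))"
    by (intro sum.cong refl) (auto simp: ipu)
  also have "\<dots> = mapply n (abs_of n s v) (v k) i" using sum_delta_lt(2)[OF ki(1)]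
    by (simp add: mapply_abs_of_onb[OF D(3) ki(2,1)])
  finally show "mapply n (polar n u v * A) (v k) i = mapply n (abs_of n s v) (v k) i" .
qed (intro mult_carrier_mat[of _ n n] polar_carrier abs_of_carrier svdD(1)[OF assms])+

lemma onb_nrm2: "onb n v \<Longrightarrow> k < n \<Longrightarrow> nrm2 n (v k) = 1"
  using ip_onb[of n v k k] unfolding ip_self by simp

lemma svd_nrm2_u:
  assumes "svd n A s u v" "k < n" shows "nrm2 n (u k) \<le> 1"
proof -
  have "ip n (u k) (u k) = (if s k \<noteq> 0 then 1 else 0)" using svdD(6)[OF assms(1,2,2)] by (simp add: ip_def mult.commute)
  thus ?thesis unfolding ip_self by (cases "s k = 0") auto
qed

lemma trace_mult_svd:
  assumes "svd n A s u v"
  shows "(\<Sum>i<n. \<Sum>j<n. A $$ (i, j) * B j i) = (\<Sum>k<n. complex_of_real (s k) * ip n (\<lambda>j. \<Sum>i<n. B j i * u k i) (v k))"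
proof -
  have "(\<Sum>i<n. \<Sum>j<n. A $$ (i, j) * B j i) = (\<Sum>i<n. \<Sum>j<n. \<Sum>k<n. complex_of_real (s k) * (B j i * u k i * cnj (v k j)))"
    by (intro sum.cong refl) (simp add: svdD(7)[OF assms] sum_distrib_right sum_distrib_left mult_ac)
  also have "\<dots> = (\<Sum>i<n. \<Sum>k<n. \<Sum>j<n. complex_of_real (s k) * (B j i * u k i * cnj (v k j)))"
    by (intro sum.cong refl sum.swap)
  also have "\<dots> = (\<Sum>k<n. \<Sum>i<n. \<Sum>j<n. complex_of_real (s k) * (B j i * u k i * cnj (v k j)))" by (rule sum.swap)
  also have "\<dots> = (\<Sum>k<n. \<Sum>j<n. \<Sum>i<n. complex_of_real (s k) * (B j i * u k i * cnj (v k j)))"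
    by (intro sum.cong refl sum.swap)
  also have "\<dots> = (\<Sum>k<n. complex_of_real (s k) * ip n (\<lambda>j. \<Sum>i<n. B j i * u k i) (v k))"
    unfolding ip_def by (simp only: sum_distrib_left sum_distrib_right)
  finally show ?thesis .
qed

text \<open>The vectors \<open>B u k\<close> are kept apart instead of being bounded by an operator
  norm of \<open>B\<close>. In the converse implication \<open>B\<close> is random, and expectations
  of lengths are controlled only for one fixed vector at a time.\<close>

lemma trace_mult_svd_le:
  assumes "svd n A s u v"
  shows "cmod (\<Sum>i<n. \<Sum>j<n. A $$ (i, j) * B j i) \<le> (\<Sum>k<n. s k * sqrt (nrm2 n (\<lambda>j. \<Sum>i<n. B j i * u k i)))"
  unfolding trace_mult_svd[OF assms]
proof (rule order_trans[OF norm_sum], rule sum_mono)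
  fix k assume k: "k \<in> {..<n}"
  have "cmod (ip n (\<lambda>j. \<Sum>i<n. B j i * u k i) (v k)) \<le> sqrt (nrm2 n (\<lambda>j. \<Sum>i<n. B j i * u k i))"
    using ip_cauchy_schwarz[of n "\<lambda>j. \<Sum>i<n. B j i * u k i" "v k"] onb_nrm2[OF svdD(3)[OF assms]] k by simp
  thus "cmod (complex_of_real (s k) * ip n (\<lambda>j. \<Sum>i<n. B j i * u k i) (v k)) \<le> s k * sqrt (nrm2 n (\<lambda>j. \<Sum>i<n. B j i * u k i))"
    using svdD(2)[OF assms] k by (simp add: norm_mult mult_left_mono)
qed

text \<open>In singular vectors of \<open>A\<close> the trace is a sum of \<open>s k\<close> times
  inner products of \<open>B u k\<close> with \<open>v k\<close>, each of modulus at most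
  \<open>1\<close> for a contraction.\<close>

lemma trace_norm_dual:
  assumes A: "A \<in> carrier_mat n n" and B: "contraction n B"
  shows "cmod (mat_trace (A * B)) \<le> trace_norm A"
proof -
  obtain s u v where sv: "svd n A s u v" using svd_exists[OF A] by blast
  have "cmod (mat_trace (A * B)) \<le> (\<Sum>k<n. s k * sqrt (nrm2 n (mapply n B (u k))))"
    using B mat_trace_mult[OF A, of B] trace_mult_svd_le[OF sv, of "\<lambda>i j. B $$ (i, j)"]
    by (simp add: contraction_def mapply_def[abs_def])
  also have "\<dots> \<le> (\<Sum>k<n. s k * 1)"
  proof (rule sum_mono)
    fix k assume k: "k \<in> {..<n}"
    have "nrm2 n (mapply n B (u k)) \<le> 1" using B svd_nrm2_u[OF sv] k unfolding contraction_def by (meson lessThan_iff order_trans)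
    thus "s k * sqrt (nrm2 n (mapply n B (u k))) \<le> s k * 1" using svdD(2)[OF sv] k by (intro mult_left_mono) auto
  qed
  finally show ?thesis by (simp add: trace_norm_svd[OF sv])
qed

lemma trace_norm_zero: "trace_norm (0\<^sub>m n n) = 0"
proof -
  obtain s u v where sv: "svd n (0\<^sub>m n n) s u v" using svd_exists[of "0\<^sub>m n n" n] by auto
  have "mat_abs (0\<^sub>m n n) = 0\<^sub>m n n" using polar_mult[OF sv] polar_carrier[of n u v] by (metis right_mult_zero_mat)
  thus ?thesis by (simp add: trace_norm_def mat_trace_def)
qed

lemma contraction_mult:
  assumes "contraction n A" "contraction n B" shows "contraction n (A * B)"
proof -
  have c: "A \<in> carrier_mat n n" "B \<in> carrier_mat n n" using assms by (auto simp: contraction_def)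
  have "nrm2 n (mapply n (A * B) f) \<le> nrm2 n f" for f
  proof -
    have "nrm2 n (mapply n (A * B) f) = nrm2 n (mapply n A (mapply n B f))"
      by (rule nrm2_cong) (rule mapply_mult[OF c])
    also have "\<dots> \<le> nrm2 n f" using assms unfolding contraction_def by (meson order_trans)
    finally show ?thesis .
  qed
  thus ?thesis using c by (simp add: contraction_def)
qed

text \<open>The polar part of \<open>g\<close> turns \<open>g\<close> into \<open>|g\<^sup>*|\<close>, which is bounded below through
  \<open>\<sigma> \<ge> \<sigma>\<^sup>2 - \<sigma>\<^sup>4 / 4\<close> for \<open>\<sigma> \<ge> 0\<close>.\<close>

lemma polar_lower:
  assumes g: "g \<in> carrier_mat n n"
  shows "\<exists>Z. contraction n Z \<and> (\<forall>f. nrm2 n (mapply n (mat_adjoint g) f)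
    - nrm2 n (mapply n g (mapply n (mat_adjoint g) f)) / 4 \<le> Re (ip n (mapply n g (mapply n Z f)) f))"
proof -
  obtain s u v where sv: "svd n g s u v" using svd_exists[OF g] by blast
  note D = svdD[OF sv]
  have *: "nrm2 n (mapply n (mat_adjoint g) f) - nrm2 n (mapply n g (mapply n (mat_adjoint g) f)) / 4
      \<le> Re (ip n (mapply n g (mapply n (polar n u v) f)) f)" for f
  proof -
    define c where "c k = ip n f (u k)" for k
    have c0: "c k = 0" if "k < n" "s k = 0" for k
    proof -
      have "ip n (u k) (u k) = 0" using D(6)[of k k] that by (simp add: ip_def mult.commute)
      hence "nrm2 n (u k) = 0" by (simp add: ip_self)
      thus ?thesis by (simp add: c_def ip_def nrm2_eq_0)
    qed
    have ipv: "ip n (\<lambda>i. \<Sum>k<n. b k * v k i) (v l) = b l" if "l < n" for b l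
    proof -
      have "ip n (\<lambda>i. \<Sum>k<n. b k * v k i) (v l) = (\<Sum>k<n. b k * (if k = l then 1 else 0))"
        unfolding ip_comb_left using D(3) that by (intro sum.cong refl) (simp add: ip_onb)
      thus ?thesis using sum_delta_lt(1)[OF that] by simp
    qed
    have 1: "nrm2 n (mapply n (mat_adjoint g) f) = (\<Sum>k<n. (s k)\<^sup>2 * (cmod (c k))\<^sup>2)"
    proof -
      have "nrm2 n (mapply n (mat_adjoint g) f) = nrm2 n (\<lambda>i. \<Sum>k<n. (complex_of_real (s k) * c k) * v k i)"
        by (rule nrm2_cong) (simp add: mapply_adj_svd[OF sv] c_def)
      also have "\<dots> = (\<Sum>k<n. (s k)\<^sup>2 * (cmod (c k))\<^sup>2)" unfolding parseval[OF D(3)]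
        by (simp add: norm_mult power_mult_distrib)
      finally show ?thesis .
    qed
    have gg: "mapply n g (mapply n (mat_adjoint g) f) i = (\<Sum>k<n. (complex_of_real ((s k)\<^sup>2) * c k) * u k i)" if "i < n" for i
    proof -
      have "mapply n g (mapply n (mat_adjoint g) f) i = mapply n g (\<lambda>i. \<Sum>k<n. (complex_of_real (s k) * c k) * v k i) i"
        by (rule mapply_cong) (simp add: mapply_adj_svd[OF sv] c_def)
      also have "\<dots> = (\<Sum>k<n. (complex_of_real ((s k)\<^sup>2) * c k) * u k i)"
        unfolding mapply_svd[OF sv that] by (intro sum.cong refl) (simp add: ipv power2_eq_square)
      finally show ?thesis .
    qed
    have 2: "nrm2 n (mapply n g (mapply n (mat_adjoint g) f)) = (\<Sum>k<n. (s k)^4 * (cmod (c k))\<^sup>2)"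
    proof -
      let ?b = "\<lambda>k. complex_of_real ((s k)\<^sup>2) * c k"
      have "complex_of_real (nrm2 n (mapply n g (mapply n (mat_adjoint g) f))) = ip n (\<lambda>i. \<Sum>k<n. ?b k * u k i) (\<lambda>i. \<Sum>k<n. ?b k * u k i)"
        unfolding ip_self[symmetric] by (rule ip_cong) (rule gg, assumption)+
      also have "\<dots> = (\<Sum>i<n. (\<Sum>l<n. cnj (?b l) * cnj (u l i)) * (\<Sum>k<n. ?b k * u k i))"
        by (simp add: ip_def mult.commute)
      also have "\<dots> = (\<Sum>l<n. \<Sum>k<n. cnj (?b l) * ?b k * (\<Sum>i<n. cnj (u l i) * u k i))" by (rule sum_sum_swap3)
      also have "\<dots> = (\<Sum>l<n. \<Sum>k<n. cnj (?b l) * ?b k * (if l = k then 1 else 0))"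
        by (intro sum.cong refl) (auto simp: D(6))
      also have "\<dots> = (\<Sum>k<n. cnj (?b k) * ?b k)" by (intro sum.cong refl sum_delta_lt) simp
      also have "\<dots> = (\<Sum>k<n. complex_of_real ((cmod (?b k))\<^sup>2))"
        by (intro sum.cong refl) (metis complex_norm_square mult.commute)
      also have "\<dots> = complex_of_real (\<Sum>k<n. (s k)^4 * (cmod (c k))\<^sup>2)"
        by (simp add: norm_mult power_mult_distrib power2_eq_square power4_eq_xxxx mult_ac)
      finally show ?thesis unfolding of_real_eq_iff .
    qed
    have 3: "ip n (mapply n g (mapply n (polar n u v) f)) f = complex_of_real (\<Sum>k<n. s k * (cmod (c k))\<^sup>2)"
    proof -
      have "mapply n g (mapply n (polar n u v) f) i = (\<Sum>k<n. (complex_of_real (s k) * c k) * u k i)" if "i < n" for i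
      proof -
        have "mapply n g (mapply n (polar n u v) f) i = mapply n g (\<lambda>i. \<Sum>k<n. c k * v k i) i"
          by (rule mapply_cong) (simp add: mapply_polar c_def)
        thus ?thesis unfolding mapply_svd[OF sv that] by (simp add: ipv)
      qed
      hence "ip n (mapply n g (mapply n (polar n u v) f)) f = ip n (\<lambda>i. \<Sum>k<n. (complex_of_real (s k) * c k) * u k i) f"
        by (intro ip_cong) auto
      also have "\<dots> = (\<Sum>k<n. (complex_of_real (s k) * c k) * ip n (u k) f)" by (rule ip_comb_left)
      also have "\<dots> = (\<Sum>k<n. complex_of_real (s k * (cmod (c k))\<^sup>2))"
      proof (intro sum.cong refl)
        fix k
        have "ip n (u k) f = cnj (c k)" by (simp add: c_def ip_def mult.commute)
        thus "(complex_of_real (s k) * c k) * ip n (u k) f = complex_of_real (s k * (cmod (c k))\<^sup>2)"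
          by (simp add: complex_norm_square mult_ac del: of_real_power)
      qed
      finally show ?thesis by simp
    qed
    have "(\<Sum>k<n. ((s k)\<^sup>2 - (s k)^4 / 4) * (cmod (c k))\<^sup>2) \<le> (\<Sum>k<n. s k * (cmod (c k))\<^sup>2)"
    proof (intro sum_mono mult_right_mono)
      fix k assume "k \<in> {..<n}"
      hence s: "s k \<ge> 0" using D(2) by simp
      \<comment> \<open>The tangent line of the cube:
        \<open>(s - a)^2 (s + 2 a) = s^3 - 3 a^2 s + 2 a^3\<close>. The value \<open>a = 6/5\<close>
        satisfies \<open>3 a^2 \<ge> 4\<close> and \<open>2 a^3 \<le> 4\<close>, so for
        \<open>s \<ge> 0\<close> it implies \<open>s^3 - 4 s + 4 \<ge> 0\<close>.\<close>
      have "0 \<le> (s k - 6/5)\<^sup>2 * (s k + 12/5)" using s by simp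
      moreover have "(s k - 6/5)\<^sup>2 * (s k + 12/5) = (s k)^3 - 108/25 * s k + 432/125"
        by (simp add: power2_eq_square power3_eq_cube field_simps)
      ultimately have "0 \<le> (s k)^3 - 4 * s k + 4" using s by linarith
      hence "0 \<le> s k * ((s k)^3 - 4 * s k + 4)" using s by simp
      hence "4 * (s k)\<^sup>2 - (s k)^4 \<le> 4 * s k" by (simp add: power3_eq_cube power4_eq_xxxx power2_eq_square algebra_simps)
      thus "(s k)\<^sup>2 - (s k)^4 / 4 \<le> s k" by simp
    qed simp
    thus ?thesis unfolding 1 2 3 by (simp add: sum_subtractf sum_divide_distrib left_diff_distrib)
  qed
  show ?thesis by (intro exI[of _ "polar n u v"] conjI contraction_polar[OF sv] allI *)
qed

text \<open>\<open>A g\<close> is tested against the contraction formed from \<open>Z\<close> and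
  the polar part of \<open>A\<close>. Cyclicity of the trace turns the result into the trace of
  \<open>g Z |A|\<close>, a sum over the eigenvectors \<open>v k\<close> of \<open>|A|\<close>, and
  the previous lemma bounds each term by polynomials in the entries of \<open>g\<close>, whose
  expectations can be computed.\<close>

lemma trace_norm_mult_lower:
  assumes A: "svd n A s u v" and g: "g \<in> carrier_mat n n"
  shows "(\<Sum>k<n. s k * (nrm2 n (mapply n (mat_adjoint g) (v k))
      - nrm2 n (mapply n g (mapply n (mat_adjoint g) (v k))) / 4)) \<le> trace_norm (A * g)"
proof -
  note D = svdD[OF A]
  obtain Z where Z: "contraction n Z" and low: "\<And>f. nrm2 n (mapply n (mat_adjoint g) f)
    - nrm2 n (mapply n g (mapply n (mat_adjoint g) f)) / 4 \<le> Re (ip n (mapply n g (mapply n Z f)) f)"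
    using polar_lower[OF g] by blast
  have Zc: "Z \<in> carrier_mat n n" using Z by (simp add: contraction_def)
  have sumsv: "(\<Sum>i<n. \<Sum>j<n. C $$ (i, j) * abs_of n s v $$ (j, i)) = (\<Sum>k<n. complex_of_real (s k) * ip n (mapply n C (v k)) (v k))" for C
  proof -
    have "(\<Sum>i<n. \<Sum>j<n. C $$ (i, j) * abs_of n s v $$ (j, i)) = (\<Sum>i<n. \<Sum>j<n. \<Sum>k<n. complex_of_real (s k) * (C $$ (i, j) * v k j * cnj (v k i)))"
      by (intro sum.cong refl) (simp add: abs_of_index sum_distrib_left mult_ac)
    also have "\<dots> = (\<Sum>i<n. \<Sum>k<n. \<Sum>j<n. complex_of_real (s k) * (C $$ (i, j) * v k j * cnj (v k i)))"
      by (intro sum.cong refl sum.swap)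
    also have "\<dots> = (\<Sum>k<n. \<Sum>i<n. \<Sum>j<n. complex_of_real (s k) * (C $$ (i, j) * v k j * cnj (v k i)))" by (rule sum.swap)
    also have "\<dots> = (\<Sum>k<n. complex_of_real (s k) * ip n (mapply n C (v k)) (v k))"
      unfolding ip_def mapply_def by (simp only: sum_distrib_left sum_distrib_right)
    finally show ?thesis .
  qed
  have gZ: "g * Z \<in> carrier_mat n n" using g Zc by simp
  have P: "polar n u v \<in> carrier_mat n n" by simp
  have "mat_trace ((A * g) * (Z * polar n u v)) = mat_trace ((g * Z) * (polar n u v * A))"
  proof -
    have "mat_trace ((A * g) * (Z * polar n u v)) = mat_trace (A * ((g * Z) * polar n u v))"
      using D(1) g Zc P by (simp add: assoc_mult_mat[of _ n n _ n _ n])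
    also have "\<dots> = mat_trace (((g * Z) * polar n u v) * A)"
      unfolding mat_trace_mult[OF D(1) mult_carrier_mat[OF gZ P]] mat_trace_mult[OF mult_carrier_mat[OF gZ P] D(1)]
      by (subst sum.swap) (simp only: mult.commute)
    also have "\<dots> = mat_trace ((g * Z) * (polar n u v * A))" using D(1) gZ P by (simp add: assoc_mult_mat[of _ n n _ n _ n])
    finally show ?thesis .
  qed
  also have "\<dots> = (\<Sum>k<n. complex_of_real (s k) * ip n (mapply n (g * Z) (v k)) (v k))"
    unfolding polar_mult[OF A] mat_abs_svd[OF A] mat_trace_mult[OF gZ abs_of_carrier] by (rule sumsv)
  also have "\<dots> = (\<Sum>k<n. complex_of_real (s k) * ip n (mapply n g (mapply n Z (v k))) (v k))"
    by (intro sum.cong refl arg_cong2[where f="(*)"] ip_cong) (simp_all add: mapply_mult[OF g Zc])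
  finally have eq: "mat_trace ((A * g) * (Z * polar n u v)) = (\<Sum>k<n. complex_of_real (s k) * ip n (mapply n g (mapply n Z (v k))) (v k))" .
  have "(\<Sum>k<n. s k * (nrm2 n (mapply n (mat_adjoint g) (v k)) - nrm2 n (mapply n g (mapply n (mat_adjoint g) (v k))) / 4))
      \<le> (\<Sum>k<n. s k * Re (ip n (mapply n g (mapply n Z (v k))) (v k)))"
    by (intro sum_mono mult_left_mono low D(2)) simp
  also have "\<dots> = Re (mat_trace ((A * g) * (Z * polar n u v)))" unfolding eq by simp
  also have "\<dots> \<le> cmod (mat_trace ((A * g) * (Z * polar n u v)))" by (rule complex_Re_le_cmod)
  also have "\<dots> \<le> trace_norm (A * g)"
    by (rule trace_norm_dual[OF mult_carrier_mat[OF D(1) g] contraction_mult[OF Z contraction_polar[OF A]]])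
  finally show ?thesis .
qed

section \<open>Haar measure on a compact group\<close>

locale compact_haar =
  fixes G :: "'a monoid" (structure) and T :: "'a topology" and m :: "'a measure"
  assumes cg: "compact_group G T" and haar: "haar_prob_measure G T m"
begin

lemma grp: "group G" using cg by (simp add: compact_group_def)
lemma topsp: "topspace T = carrier G" using cg by (simp add: compact_group_def)
lemma spacem: "space m = carrier G" using haar by (simp add: haar_prob_measure_def)
lemma prob: "prob_space m" using haar by (simp add: haar_prob_measure_def)
lemma setsm: "sets m = sigma_sets (carrier G) {U. openin T U}" using haar by (simp add: haar_prob_measure_def)

sublocale group G by (rule grp)
sublocale prob_space m by (rule prob)

lemma open_sets: "openin T U \<Longrightarrow> U \<in> sets m" unfolding setsm by (auto intro: sigma_sets.Basic)

lemma continuous_measurable: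
  fixes f :: "'a \<Rightarrow> 'b::topological_space"
  assumes "continuous_map T euclidean f" shows "f \<in> borel_measurable m"
proof (rule borel_measurableI)
  fix S :: "'b set" assume "open S"
  hence "openin T {x \<in> topspace T. f x \<in> S}" using assms openin_continuous_map_preimage open_openin by blast
  moreover have "{x \<in> topspace T. f x \<in> S} = f -` S \<inter> space m" using topsp spacem by auto
  ultimately show "f -` S \<inter> space m \<in> sets m" using open_sets by metis
qed

lemma continuous_left_mult: "a \<in> carrier G \<Longrightarrow> continuous_map T T (\<lambda>x. a \<otimes> x)"
proof -
  assume a: "a \<in> carrier G"
  have "continuous_map T (prod_topology T T) (\<lambda>x. (a, x))"
    using a topsp by (intro continuous_map_pairedI) auto
  moreover have "continuous_map (prod_topology T T) T (\<lambda>(x, y). x \<otimes> y)" using cg by (simp add: compact_group_def)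
  ultimately show ?thesis using continuous_map_compose[of T "prod_topology T T" "\<lambda>x. (a, x)" T "\<lambda>(x, y). x \<otimes> y"]
    by (simp add: o_def)
qed

lemma emeasure_translate:
  assumes "a \<in> carrier G" "B \<in> sets m" shows "emeasure m ((\<lambda>y. a \<otimes> y) ` B) = emeasure m B"
  using haar assms unfolding haar_prob_measure_def by blast

lemma translate_eq_vimage:
  assumes a: "a \<in> carrier G" and B: "B \<subseteq> carrier G"
  shows "(\<lambda>y. a \<otimes> y) ` B = {x \<in> carrier G. inv a \<otimes> x \<in> B}"
proof
  show "(\<lambda>y. a \<otimes> y) ` B \<subseteq> {x \<in> carrier G. inv a \<otimes> x \<in> B}"
    using a B by (auto simp: m_assoc[symmetric] subset_iff)
  show "{x \<in> carrier G. inv a \<otimes> x \<in> B} \<subseteq> (\<lambda>y. a \<otimes> y) ` B"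
  proof
    fix x assume x: "x \<in> {x \<in> carrier G. inv a \<otimes> x \<in> B}"
    hence "x = a \<otimes> (inv a \<otimes> x)" using a by (simp add: m_assoc[symmetric])
    thus "x \<in> (\<lambda>y. a \<otimes> y) ` B" using x by blast
  qed
qed

lemma open_translate:
  assumes a: "a \<in> carrier G" and U: "openin T U" shows "openin T ((\<lambda>y. a \<otimes> y) ` U)"
proof -
  have "U \<subseteq> carrier G" using openin_subset[OF U] topsp by simp
  from translate_eq_vimage[OF a this] show ?thesis
    using openin_continuous_map_preimage[OF continuous_left_mult[of "inv a"] U] a topsp by simp
qed

text \<open>Finitely many translates of a nonempty open set cover the compact group, so it is not null.\<close>

lemma open_pos:
  assumes U: "openin T U" "U \<noteq> {}" shows "emeasure m U > 0"
proof (rule ccontr)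
  assume "\<not> emeasure m U > 0"
  hence 0: "emeasure m U = 0" by simp
  have Uc: "U \<subseteq> carrier G" using openin_subset[OF U(1)] topsp by simp
  define \<C> where "\<C> = (\<lambda>a. (\<lambda>y. a \<otimes> y) ` U) ` carrier G"
  obtain u where u: "u \<in> U" using U(2) by blast
  have cov: "carrier G \<subseteq> \<Union>\<C>"
  proof
    fix x assume x: "x \<in> carrier G"
    have uc: "u \<in> carrier G" using u Uc by blast
    have "x = (x \<otimes> inv u) \<otimes> u" using x uc by (simp add: m_assoc)
    thus "x \<in> \<Union>\<C>" unfolding \<C>_def using u x uc by blast
  qed
  have "compact_space T" using cg by (simp add: compact_group_def)
  moreover have "\<And>V. V \<in> \<C> \<Longrightarrow> openin T V" unfolding \<C>_def using open_translate[OF _ U(1)] by blast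
  ultimately obtain \<F> where F: "finite \<F>" "\<F> \<subseteq> \<C>" "topspace T \<subseteq> \<Union>\<F>"
    using cov topsp unfolding compact_space_alt by (metis (no_types, lifting))
  have n: "V \<in> null_sets m" if "V \<in> \<F>" for V
  proof -
    have "V \<in> \<C>" using that F(2) by blast
    then obtain a where a: "a \<in> carrier G" "V = (\<lambda>y. a \<otimes> y) ` U" unfolding \<C>_def by blast
    have "openin T V" unfolding a(2) by (rule open_translate[OF a(1) U(1)])
    moreover have "emeasure m V = 0" unfolding a(2) emeasure_translate[OF a(1) open_sets[OF U(1)]] by (rule 0)
    ultimately show ?thesis using open_sets by blast
  qed
  have "\<Union>\<F> \<in> null_sets m" using F(1) n by (metis null_sets.finite_Union subsetI)
  moreover have "space m \<subseteq> \<Union>\<F>" using F(3) topsp spacem by simp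
  moreover have "\<Union>\<F> \<subseteq> space m" using calculation(1) sets.sets_into_space by blast
  ultimately have "emeasure m (space m) = 0" by (metis null_setsD1 subset_antisym)
  thus False using emeasure_space_1 by simp
qed

definition supnorm :: "('a \<Rightarrow> complex) \<Rightarrow> real" where
  "supnorm f = (SUP t\<in>carrier G. cmod (f t))"

lemma carrier_nonempty: "carrier G \<noteq> {}" by blast

lemma bdd_continuous:
  assumes "continuous_map T euclidean (f :: 'a \<Rightarrow> complex)" shows "bdd_above ((\<lambda>t. cmod (f t)) ` carrier G)"
proof -
  have "compactin T (topspace T)" using cg by (simp add: compact_group_def compact_space_def topsp)
  hence "compactin euclidean (f ` topspace T)" using image_compactin assms by blast
  hence "bounded (f ` carrier G)" using compact_imp_bounded topsp by (simp add: compactin_euclidean_iff)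
  then obtain B where "\<forall>x\<in>f ` carrier G. norm x \<le> B" unfolding bounded_iff by blast
  thus ?thesis by (auto simp: bdd_above_def)
qed

lemma supnorm_upper: "bdd_above ((\<lambda>t. cmod (f t)) ` carrier G) \<Longrightarrow> t \<in> carrier G \<Longrightarrow> cmod (f t) \<le> supnorm f"
  unfolding supnorm_def by (rule cSUP_upper)

lemma supnorm_least: "(\<And>t. t \<in> carrier G \<Longrightarrow> cmod (f t) \<le> c) \<Longrightarrow> supnorm f \<le> c"
  unfolding supnorm_def by (rule cSUP_least) auto

text \<open>The set where the modulus of a continuous function exceeds \<open>c\<close> is open, so
  it is not null unless empty. The essential supremum is thus an upper bound at every single
  point.\<close>

lemma Linfty_eq_supnorm:
  assumes f: "continuous_map T euclidean f" shows "Linfty_norm m f = supnorm f"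
proof -
  note fm = continuous_measurable[OF f]
  note bd = bdd_continuous[OF f]
  let ?e = "esssup m (\<lambda>t. ereal (cmod (f t)))"
  have m1: "(\<lambda>t. ereal (cmod (f t))) \<in> borel_measurable m" using fm by measurable
  have le: "?e \<le> ereal (supnorm f)"
    by (rule esssup_I[OF m1]) (rule AE_I2, use supnorm_upper[OF bd] spacem in simp)
  have ge: "ereal (cmod (f t)) \<le> ?e" if t: "t \<in> carrier G" for t
  proof (rule ccontr)
    assume "\<not> ereal (cmod (f t)) \<le> ?e"
    hence lt: "?e < ereal (cmod (f t))" by simp
    then obtain c where c: "?e < ereal c" "c < cmod (f t)"
      by (metis ereal_dense2 less_ereal.simps(1))
    have ne: "continuous_map T euclidean (\<lambda>t. cmod (f t))" using f by (rule continuous_map_norm)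
    have "openin T {x \<in> topspace T. cmod (f x) \<in> {c<..}}" using openin_continuous_map_preimage[OF ne, of "{c<..}"] open_openin by auto
    moreover have "t \<in> {x \<in> topspace T. cmod (f x) \<in> {c<..}}" using t c topsp by simp
    ultimately have "emeasure m {x \<in> topspace T. cmod (f x) \<in> {c<..}} > 0" using open_pos by blast
    moreover have "AE x in m. \<not> cmod (f x) > c"
      using esssup_AE[of "\<lambda>t. ereal (cmod (f t))" m]
    proof eventually_elim
      case (elim x)
      show ?case
      proof
        assume "c < cmod (f x)"
        hence "ereal c < ereal (cmod (f x))" by simp
        hence "ereal c < ?e" using elim by (rule less_le_trans)
        thus False using c(1) by simp
      qed
    qed
    hence "emeasure m {x \<in> space m. cmod (f x) > c} = 0"
      using fm by (subst (asm) AE_iff_measurable[OF _ refl]) auto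
    moreover have "{x \<in> space m. cmod (f x) > c} = {x \<in> topspace T. cmod (f x) \<in> {c<..}}" using topsp spacem by auto
    ultimately show False by simp
  qed
  have fin: "\<bar>?e\<bar> \<noteq> \<infinity>" using le ge[OF one_closed] by (cases ?e) auto
  then obtain r where r: "?e = ereal r" by (cases ?e) auto
  have "r \<le> supnorm f" using le r by simp
  moreover have "supnorm f \<le> r" by (rule supnorm_least) (use ge r in simp)
  ultimately show ?thesis unfolding Linfty_norm_def r by simp
qed

text \<open>Invariance is given for images of sets. The preimage under translation by
  \<open>a\<close> is the image under translation by its inverse, so the translation pushes
  \<open>m\<close> forward to itself.\<close>

lemma integral_left_translate:
  fixes f :: "'a \<Rightarrow> complex"
  assumes a: "a \<in> carrier G" and f: "f \<in> borel_measurable m"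
  shows "(\<integral>t. f (a \<otimes> t) \<partial>m) = (\<integral>t. f t \<partial>m)"
proof -
  have meas: "(\<lambda>t. a \<otimes> t) \<in> measurable m m"
  proof -
    have "(\<lambda>t. a \<otimes> t) \<in> measurable m (measure_of (carrier G) {U. openin T U} (emeasure m))"
    proof (rule measurable_measure_of)
      show "{U. openin T U} \<subseteq> Pow (carrier G)" using openin_subset topsp by fastforce
      show "(\<lambda>t. a \<otimes> t) \<in> space m \<rightarrow> carrier G" using a spacem by auto
      fix U assume "U \<in> {U. openin T U}"
      hence "openin T {x \<in> topspace T. a \<otimes> x \<in> U}"
        using openin_continuous_map_preimage[OF continuous_left_mult[OF a]] by simp
      moreover have "{x \<in> topspace T. a \<otimes> x \<in> U} = (\<lambda>t. a \<otimes> t) -` U \<inter> space m" using topsp spacem by auto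
      ultimately show "(\<lambda>t. a \<otimes> t) -` U \<inter> space m \<in> sets m" using open_sets by metis
    qed
    moreover have "sets (measure_of (carrier G) {U. openin T U} (emeasure m)) = sets m"
      using setsm openin_subset topsp by (subst sets_measure_of) fastforce+
    ultimately show ?thesis using measurable_cong_sets by blast
  qed
  have "distr m m (\<lambda>t. a \<otimes> t) = m"
  proof (rule measure_eqI)
    fix B assume "B \<in> sets (distr m m (\<lambda>t. a \<otimes> t))"
    hence B: "B \<in> sets m" by simp
    have Bc: "B \<subseteq> carrier G" using sets.sets_into_space[OF B] spacem by simp
    have "emeasure (distr m m (\<lambda>t. a \<otimes> t)) B = emeasure m ((\<lambda>t. a \<otimes> t) -` B \<inter> space m)" by (rule emeasure_distr[OF meas B])
    also have "(\<lambda>t. a \<otimes> t) -` B \<inter> space m = (\<lambda>y. inv a \<otimes> y) ` B"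
      using translate_eq_vimage[of "inv a", OF _ Bc] a spacem by auto
    also have "emeasure m \<dots> = emeasure m B" using emeasure_translate[OF _ B] a by simp
    finally show "emeasure (distr m m (\<lambda>t. a \<otimes> t)) B = emeasure m B" .
  qed simp
  hence "(\<integral>t. f t \<partial>m) = (\<integral>t. f t \<partial>distr m m (\<lambda>t. a \<otimes> t))" by simp
  also have "\<dots> = (\<integral>t. f (a \<otimes> t) \<partial>m)" by (rule integral_distr[OF meas f])
  finally show ?thesis by simp
qed

end

section \<open>Schur orthogonality\<close>

lemma cnj_measurable [measurable (raw)]:
  "f \<in> borel_measurable M \<Longrightarrow> (\<lambda>x. cnj (f x)) \<in> borel_measurable M"
  by (rule measurable_compose[OF _ borel_measurable_continuous_onI[OF continuous_on_cnj[OF continuous_on_id]]])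

lemma mat_mult_zero_vec: "(B :: complex mat) \<in> carrier_mat l k \<Longrightarrow> B *\<^sub>v 0\<^sub>v k = 0\<^sub>v l"
  by (intro eq_vecI) auto

lemma smult_zero_vec: "(c :: complex) \<cdot>\<^sub>v 0\<^sub>v l = 0\<^sub>v l"
  by (intro eq_vecI) auto

lemma nonsingular_invertible:
  assumes A: "(A :: complex mat) \<in> carrier_mat n n" and d: "Determinant.det A \<noteq> 0"
  shows "invertible_mat A"
proof -
  have "A \<in> Units (ring_mat TYPE(complex) n ())" by (rule det_non_zero_imp_unit[OF A d])
  then obtain B where "B \<in> carrier_mat n n" "B * A = 1\<^sub>m n" "A * B = 1\<^sub>m n"
    unfolding Units_def by (auto simp: ring_mat_def)
  thus ?thesis using A unfolding invertible_mat_def inverts_mat_def by auto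
qed

lemma ker_subspace:
  assumes B: "(B :: complex mat) \<in> carrier_mat l k"
  shows "VectorSpace.subspace class_ring {w \<in> carrier_vec k. B *\<^sub>v w = 0\<^sub>v l} (module_vec TYPE(complex) k)"
  unfolding VectorSpace.subspace_def submodule_def
proof (intro conjI allI impI vec_vs vec_module)
  show "{w \<in> carrier_vec k. B *\<^sub>v w = 0\<^sub>v l} \<subseteq> carrier (module_vec TYPE(complex) k)"
    by (auto simp: module_vec_simps)
  show "v \<oplus>\<^bsub>module_vec TYPE(complex) k\<^esub> w \<in> {w \<in> carrier_vec k. B *\<^sub>v w = 0\<^sub>v l}"
    if "v \<in> {w \<in> carrier_vec k. B *\<^sub>v w = 0\<^sub>v l}" "w \<in> {w \<in> carrier_vec k. B *\<^sub>v w = 0\<^sub>v l}" for v w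
    using that B by (simp add: module_vec_simps mult_add_distrib_mat_vec)
  show "\<zero>\<^bsub>module_vec TYPE(complex) k\<^esub> \<in> {w \<in> carrier_vec k. B *\<^sub>v w = 0\<^sub>v l}"
    using mat_mult_zero_vec[OF B] by (simp add: module_vec_simps)
  show "c \<odot>\<^bsub>module_vec TYPE(complex) k\<^esub> v \<in> {w \<in> carrier_vec k. B *\<^sub>v w = 0\<^sub>v l}"
    if "c \<in> carrier class_ring" "v \<in> {w \<in> carrier_vec k. B *\<^sub>v w = 0\<^sub>v l}" for c v
    using that B by (simp add: module_vec_def mult_mat_vec smult_zero_vec)
qed

text \<open>The kernel of an intertwiner is invariant under \<open>\<pi>\<close>; irreducibility
  makes it everything as soon as it contains a nonzero vector.\<close>

lemma schur_kernel:
  assumes irr: "irreducible_rep G k \<pi>" and pc: "\<And>x. x \<in> carrier G \<Longrightarrow> \<pi> x \<in> carrier_mat k k"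
    and rc: "\<And>x. x \<in> carrier G \<Longrightarrow> \<rho> x \<in> carrier_mat l l"
    and B: "B \<in> carrier_mat l k" and inter: "\<And>x. x \<in> carrier G \<Longrightarrow> B * \<pi> x = \<rho> x * B"
    and w: "w \<in> carrier_vec k" "w \<noteq> 0\<^sub>v k" "B *\<^sub>v w = 0\<^sub>v l"
  shows "B = 0\<^sub>m l k"
proof -
  let ?W = "{w \<in> carrier_vec k. B *\<^sub>v w = 0\<^sub>v l}"
  have inv: "\<pi> x *\<^sub>v v \<in> ?W" if x: "x \<in> carrier G" and v: "v \<in> ?W" for x v
  proof -
    have "B *\<^sub>v (\<pi> x *\<^sub>v v) = (B * \<pi> x) *\<^sub>v v" using B pc[OF x] v by simp
    also have "\<dots> = \<rho> x *\<^sub>v (B *\<^sub>v v)" unfolding inter[OF x] using B rc[OF x] v by simp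
    also have "\<dots> = 0\<^sub>v l" using v mat_mult_zero_vec[OF rc[OF x]] by simp
    finally show ?thesis using pc[OF x] v by simp
  qed
  have "VectorSpace.subspace class_ring ?W (module_vec TYPE(complex) k) \<and> (\<forall>x\<in>carrier G. \<forall>w\<in>?W. \<pi> x *\<^sub>v w \<in> ?W)"
    using ker_subspace[OF B] inv by blast
  hence "?W = {0\<^sub>v k} \<or> ?W = carrier_vec k" using irr unfolding irreducible_rep_def by blast
  hence W: "?W = carrier_vec k" using w by blast
  show ?thesis
  proof (rule eq_matI)
    fix i j assume "i < dim_row (0\<^sub>m l k :: complex mat)" "j < dim_col (0\<^sub>m l k :: complex mat)"
    hence ij: "i < l" "j < k" by auto
    have "unit_vec k j \<in> ?W" unfolding W by simp
    hence "B *\<^sub>v unit_vec k j = 0\<^sub>v l" by simp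
    hence "(B *\<^sub>v unit_vec k j) $ i = 0" using ij by simp
    thus "B $$ (i, j) = 0\<^sub>m l k $$ (i, j)" using B ij by (simp add: scalar_prod_right_unit)
  qed (use B in auto)
qed

text \<open>Padding with zero rows gives a square matrix, and every product in its determinant picks
  an entry from the zero row \<open>l\<close>.\<close>

lemma wide_kernel:
  assumes A: "(A :: complex mat) \<in> carrier_mat l k" and lk: "l < k"
  shows "\<exists>w\<in>carrier_vec k. w \<noteq> 0\<^sub>v k \<and> A *\<^sub>v w = 0\<^sub>v l"
proof -
  define A' where "A' = mat k k (\<lambda>(i, j). if i < l then A $$ (i, j) else 0)"
  have A': "A' \<in> carrier_mat k k" by (simp add: A'_def)
  have "Determinant.det A' = 0" unfolding det_def'[OF A']
  proof (intro sum.neutral ballI)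
    fix p assume "p \<in> {p. p permutes {0..<k}}"
    hence "p l < k" using lk permutes_in_image[of p "{0..<k}" l] by simp
    hence "A' $$ (l, p l) = 0" using lk by (simp add: A'_def)
    hence "(\<Prod>i = 0..<k. A' $$ (i, p i)) = 0" using lk by (intro prod_zero) auto
    thus "signof p * (\<Prod>i = 0..<k. A' $$ (i, p i)) = 0" by simp
  qed
  then obtain w where w: "w \<in> carrier_vec k" "w \<noteq> 0\<^sub>v k" "A' *\<^sub>v w = 0\<^sub>v k"
    using det_0_iff_vec_prod_zero_field[OF A'] by blast
  have "A *\<^sub>v w = 0\<^sub>v l"
  proof (rule eq_vecI)
    fix i assume "i < dim_vec (0\<^sub>v l :: complex vec)"
    hence i: "i < l" by simp
    have "(A *\<^sub>v w) $ i = (A' *\<^sub>v w) $ i" using i lk A w(1) by (simp add: A'_def scalar_prod_def)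
    thus "(A *\<^sub>v w) $ i = 0\<^sub>v l $ i" using w(3) i lk by simp
  qed (use A in simp)
  thus ?thesis using w by blast
qed

section \<open>Unitary representations and averages over the group\<close>

context compact_haar
begin

lemma rep_carrier: "unitary_rep G T k \<pi> \<Longrightarrow> x \<in> carrier G \<Longrightarrow> \<pi> x \<in> carrier_mat k k"
  by (simp add: unitary_rep_def unitary_mats_def)

lemma rep_mult: "unitary_rep G T k \<pi> \<Longrightarrow> x \<in> carrier G \<Longrightarrow> y \<in> carrier G \<Longrightarrow> \<pi> (x \<otimes> y) = \<pi> x * \<pi> y"
  by (simp add: unitary_rep_def)

lemma rep_unitary: "unitary_rep G T k \<pi> \<Longrightarrow> x \<in> carrier G \<Longrightarrow> \<pi> x \<in> unitary_mats k"
  by (simp add: unitary_rep_def)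

lemma rep_continuous: "unitary_rep G T k \<pi> \<Longrightarrow> i < k \<Longrightarrow> j < k \<Longrightarrow> continuous_map T euclidean (\<lambda>x. \<pi> x $$ (i, j))"
  by (simp add: unitary_rep_def)

lemma rep_measurable: "unitary_rep G T k \<pi> \<Longrightarrow> i < k \<Longrightarrow> j < k \<Longrightarrow> (\<lambda>x. \<pi> x $$ (i, j)) \<in> borel_measurable m"
  by (rule continuous_measurable[OF rep_continuous])

lemma rep_mult_index:
  assumes "unitary_rep G T k \<pi>" "x \<in> carrier G" "y \<in> carrier G" "i < k" "j < k"
  shows "\<pi> (x \<otimes> y) $$ (i, j) = (\<Sum>a<k. \<pi> x $$ (i, a) * \<pi> y $$ (a, j))"
  unfolding rep_mult[OF assms(1-3)]
  by (rule times_mat_sum[OF rep_carrier[OF assms(1,2)] rep_carrier[OF assms(1,3)] assms(4,5)])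

text \<open>The value at the unit is idempotent and unitary, hence the identity matrix; the value at
  the inverse is then a right inverse of a unitary matrix.\<close>

lemma rep_inv:
  assumes r: "unitary_rep G T k \<pi>" and x: "x \<in> carrier G"
  shows "\<pi> (inv x) = mat_adjoint (\<pi> x)"
proof -
  have c: "\<pi> x \<in> carrier_mat k k" "\<pi> (inv x) \<in> carrier_mat k k" "\<pi> \<one> \<in> carrier_mat k k"
    using rep_carrier[OF r] x by auto
  have u: "mat_adjoint (\<pi> y) * \<pi> y = 1\<^sub>m k" if "y \<in> carrier G" for y
    using rep_unitary[OF r that] by (simp add: unitary_mats_def)
  have ac: "mat_adjoint (\<pi> \<one>) \<in> carrier_mat k k" "mat_adjoint (\<pi> x) \<in> carrier_mat k k" using c by auto
  have "\<pi> \<one> * \<pi> \<one> = \<pi> \<one>" using rep_mult[OF r, of \<one> \<one>] by simp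
  hence "mat_adjoint (\<pi> \<one>) * (\<pi> \<one> * \<pi> \<one>) = mat_adjoint (\<pi> \<one>) * \<pi> \<one>" by simp
  moreover have "mat_adjoint (\<pi> \<one>) * (\<pi> \<one> * \<pi> \<one>) = (mat_adjoint (\<pi> \<one>) * \<pi> \<one>) * \<pi> \<one>"
    by (rule assoc_mult_mat[symmetric, OF ac(1) c(3,3)])
  ultimately have one: "\<pi> \<one> = 1\<^sub>m k" using c(3) u[of \<one>] by simp
  have "\<pi> x * \<pi> (inv x) = 1\<^sub>m k" using rep_mult[OF r x, of "inv x"] x one by simp
  hence "mat_adjoint (\<pi> x) * (\<pi> x * \<pi> (inv x)) = mat_adjoint (\<pi> x)" using ac by simp
  moreover have "mat_adjoint (\<pi> x) * (\<pi> x * \<pi> (inv x)) = (mat_adjoint (\<pi> x) * \<pi> x) * \<pi> (inv x)"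
    by (rule assoc_mult_mat[symmetric, OF ac(2) c(1,2)])
  ultimately show ?thesis using u[OF x] c by simp
qed

lemma rep_inv_index:
  assumes "unitary_rep G T k \<pi>" "x \<in> carrier G" "i < k" "j < k"
  shows "\<pi> (inv x) $$ (i, j) = cnj (\<pi> x $$ (j, i))"
  unfolding rep_inv[OF assms(1,2)] by (rule mat_adjoint_index[OF rep_carrier[OF assms(1,2)] assms(3,4)])

lemma rep_nrm2:
  assumes "unitary_rep G T k \<pi>" "x \<in> carrier G"
  shows "nrm2 k (\<lambda>i. \<Sum>j<k. \<pi> x $$ (i, j) * f j) = nrm2 k f"
proof -
  have "complex_of_real (nrm2 k (\<lambda>i. \<Sum>j<k. \<pi> x $$ (i, j) * f j))
    = (\<Sum>i<k. (\<Sum>l<k. cnj (f l) * cnj (\<pi> x $$ (i, l))) * (\<Sum>j<k. f j * \<pi> x $$ (i, j)))"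
    unfolding ip_self[symmetric] ip_def by (simp add: mult.commute)
  also have "\<dots> = (\<Sum>l<k. \<Sum>j<k. cnj (f l) * f j * (\<Sum>i<k. cnj (\<pi> x $$ (i, l)) * \<pi> x $$ (i, j)))"
    by (rule sum_sum_swap3)
  also have "\<dots> = (\<Sum>l<k. \<Sum>j<k. cnj (f l) * f j * (if l = j then 1 else 0))"
    using unitaryD(1)[OF rep_unitary[OF assms]] by (intro sum.cong refl) simp
  also have "\<dots> = (\<Sum>l<k. cnj (f l) * f l)" by (intro sum.cong refl sum_delta_lt) simp
  also have "\<dots> = complex_of_real (nrm2 k f)" unfolding ip_self[symmetric] ip_def by (simp add: mult.commute)
  finally show ?thesis unfolding of_real_eq_iff .
qed

lemma rep_norm_le_1:
  assumes "unitary_rep G T k \<pi>" "x \<in> carrier G" "i < k" "j < k"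
  shows "cmod (\<pi> x $$ (i, j)) \<le> 1"
proof -
  have "complex_of_real (\<Sum>l<k. (cmod (\<pi> x $$ (l, j)))\<^sup>2) = (\<Sum>l<k. cnj (\<pi> x $$ (l, j)) * \<pi> x $$ (l, j))"
    unfolding of_real_sum by (intro sum.cong refl) (simp only: complex_norm_square mult.commute)
  also have "\<dots> = 1" using unitaryD(1)[OF rep_unitary[OF assms(1,2)] assms(4,4)] by simp
  finally have "(\<Sum>l<k. (cmod (\<pi> x $$ (l, j)))\<^sup>2) = 1" by (simp only: of_real_eq_1_iff)
  moreover have "(cmod (\<pi> x $$ (i, j)))\<^sup>2 \<le> (\<Sum>l<k. (cmod (\<pi> x $$ (l, j)))\<^sup>2)"
    using assms(3) by (intro member_le_sum) auto
  ultimately show ?thesis by (simp add: power_le_one_iff abs_square_le_1)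
qed

lemma rep_coeff_integrable:
  assumes "unitary_rep G T k \<pi>" "unitary_rep G T l \<rho>" "i < k" "j < k" "a < l" "b < l"
  shows "integrable m (\<lambda>t. \<pi> t $$ (i, j) * cnj (\<rho> t $$ (a, b)))"
proof (rule integrable_const_bound[where B=1])
  show "AE t in m. norm (\<pi> t $$ (i, j) * cnj (\<rho> t $$ (a, b))) \<le> 1"
    by (rule AE_I2) (use rep_norm_le_1 assms spacem in \<open>auto simp: norm_mult intro!: mult_le_one\<close>)
  show "(\<lambda>t. \<pi> t $$ (i, j) * cnj (\<rho> t $$ (a, b))) \<in> borel_measurable m"
    using rep_measurable[OF assms(1,3,4)] rep_measurable[OF assms(2,5,6)] by measurable
qed

text \<open>The average \<open>\<integral> \<pi>(t) E \<rho>(t)\<^sup>* dt\<close> of a matrix unit \<open>E\<close> intertwines \<open>\<rho>\<close> and \<open>\<pi>\<close>.\<close>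

lemma averaged_intertwiner:
  assumes p: "unitary_rep G T k \<pi>" and r: "unitary_rep G T l \<rho>" and ab: "a < k" "b < l"
  defines "A \<equiv> mat k l (\<lambda>(i, j). \<integral>t. \<pi> t $$ (i, a) * cnj (\<rho> t $$ (j, b)) \<partial>m)"
  assumes x: "x \<in> carrier G"
  shows "A * \<rho> x = \<pi> x * A"
proof -
  have A: "A \<in> carrier_mat k l" by (simp add: A_def)
  have inv: "A $$ (i, j) = (\<Sum>c<k. \<Sum>e<l. \<pi> x $$ (i, c) * cnj (\<rho> x $$ (j, e)) * A $$ (c, e))" if ij: "i < k" "j < l" for i j
  proof -
    have "A $$ (i, j) = (\<integral>t. \<pi> t $$ (i, a) * cnj (\<rho> t $$ (j, b)) \<partial>m)" using ij by (simp add: A_def)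
    also have "\<dots> = (\<integral>t. \<pi> (x \<otimes> t) $$ (i, a) * cnj (\<rho> (x \<otimes> t) $$ (j, b)) \<partial>m)"
    proof (rule integral_left_translate[symmetric, OF x])
      show "(\<lambda>t. \<pi> t $$ (i, a) * cnj (\<rho> t $$ (j, b))) \<in> borel_measurable m"
        using rep_measurable[OF p ij(1) ab(1)] rep_measurable[OF r ij(2) ab(2)] by measurable
    qed
    also have "\<dots> = (\<integral>t. (\<Sum>c<k. \<Sum>e<l. \<pi> x $$ (i, c) * cnj (\<rho> x $$ (j, e)) * (\<pi> t $$ (c, a) * cnj (\<rho> t $$ (e, b)))) \<partial>m)"
    proof (rule Bochner_Integration.integral_cong[OF refl])
      fix t assume "t \<in> space m"
      hence t: "t \<in> carrier G" using spacem by simp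
      show "\<pi> (x \<otimes> t) $$ (i, a) * cnj (\<rho> (x \<otimes> t) $$ (j, b))
        = (\<Sum>c<k. \<Sum>e<l. \<pi> x $$ (i, c) * cnj (\<rho> x $$ (j, e)) * (\<pi> t $$ (c, a) * cnj (\<rho> t $$ (e, b))))"
        unfolding rep_mult_index[OF p x t ij(1) ab(1)] rep_mult_index[OF r x t ij(2) ab(2)] cnj_sum complex_cnj_mult sum_product
        by (intro sum.cong refl) (simp only: mult_ac)
    qed
    also have "\<dots> = (\<Sum>c<k. \<Sum>e<l. \<pi> x $$ (i, c) * cnj (\<rho> x $$ (j, e)) * (\<integral>t. \<pi> t $$ (c, a) * cnj (\<rho> t $$ (e, b)) \<partial>m))"
    proof -
      note int = integrable_mult_right[OF rep_coeff_integrable[OF p r _ ab(1) _ ab(2)]]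
      have "(\<integral>t. (\<Sum>c<k. \<Sum>e<l. \<pi> x $$ (i, c) * cnj (\<rho> x $$ (j, e)) * (\<pi> t $$ (c, a) * cnj (\<rho> t $$ (e, b)))) \<partial>m)
        = (\<Sum>c<k. \<integral>t. (\<Sum>e<l. \<pi> x $$ (i, c) * cnj (\<rho> x $$ (j, e)) * (\<pi> t $$ (c, a) * cnj (\<rho> t $$ (e, b)))) \<partial>m)"
        by (intro Bochner_Integration.integral_sum Bochner_Integration.integrable_sum int) auto
      also have "\<dots> = (\<Sum>c<k. \<Sum>e<l. \<integral>t. \<pi> x $$ (i, c) * cnj (\<rho> x $$ (j, e)) * (\<pi> t $$ (c, a) * cnj (\<rho> t $$ (e, b))) \<partial>m)"
        by (intro sum.cong refl Bochner_Integration.integral_sum int) auto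
      finally show ?thesis by simp
    qed
    also have "\<dots> = (\<Sum>c<k. \<Sum>e<l. \<pi> x $$ (i, c) * cnj (\<rho> x $$ (j, e)) * A $$ (c, e))"
      by (intro sum.cong refl) (simp add: A_def)
    finally show ?thesis .
  qed
  show ?thesis
  proof (rule eq_matI)
    fix i j assume "i < dim_row (\<pi> x * A)" "j < dim_col (\<pi> x * A)"
    hence ij: "i < k" "j < l" using A rep_carrier[OF p x] by auto
    have "(A * \<rho> x) $$ (i, j) = (\<Sum>e<l. A $$ (i, e) * \<rho> x $$ (e, j))"
      by (rule times_mat_sum[OF A rep_carrier[OF r x] ij])
    also have "\<dots> = (\<Sum>e<l. (\<Sum>c<k. \<Sum>f<l. \<pi> x $$ (i, c) * cnj (\<rho> x $$ (e, f)) * A $$ (c, f)) * \<rho> x $$ (e, j))"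
      by (intro sum.cong arg_cong2[where f="(*)"] inv ij refl) simp_all
    also have "\<dots> = (\<Sum>e<l. \<Sum>c<k. \<Sum>f<l. \<pi> x $$ (i, c) * A $$ (c, f) * (cnj (\<rho> x $$ (e, f)) * \<rho> x $$ (e, j)))"
      unfolding sum_distrib_right by (simp only: mult_ac)
    also have "\<dots> = (\<Sum>c<k. \<Sum>e<l. \<Sum>f<l. \<pi> x $$ (i, c) * A $$ (c, f) * (cnj (\<rho> x $$ (e, f)) * \<rho> x $$ (e, j)))"
      by (rule sum.swap)
    also have "\<dots> = (\<Sum>c<k. \<Sum>f<l. \<Sum>e<l. \<pi> x $$ (i, c) * A $$ (c, f) * (cnj (\<rho> x $$ (e, f)) * \<rho> x $$ (e, j)))"
      by (intro sum.cong refl sum.swap)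
    also have "\<dots> = (\<Sum>c<k. \<Sum>f<l. \<pi> x $$ (i, c) * A $$ (c, f) * (if f = j then 1 else 0))"
      unfolding sum_distrib_left[symmetric] using unitaryD(1)[OF rep_unitary[OF r x]] ij by (intro sum.cong refl) simp
    also have "\<dots> = (\<Sum>c<k. \<pi> x $$ (i, c) * A $$ (c, j))" by (intro sum.cong refl sum_delta_lt ij)
    also have "\<dots> = (\<pi> x * A) $$ (i, j)" by (rule times_mat_sum[OF rep_carrier[OF p x] A ij, symmetric])
    finally show "(A * \<rho> x) $$ (i, j) = (\<pi> x * A) $$ (i, j)" .
  qed (use A rep_carrier[OF p x] rep_carrier[OF r x] in auto)
qed

text \<open>The averages intertwine, so a nonzero kernel vector makes them vanish. Such a vector
  exists by dimension when the sizes differ, after passing to the adjoint average \<open>A'\<close>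
  if \<open>k > l\<close>. For equal sizes an invertible average would be an equivalence, so the
  determinant is zero.\<close>

theorem schur_orthogonality_neq:
  assumes p: "unitary_rep G T k \<pi>" "irreducible_rep G k \<pi>" and r: "unitary_rep G T l \<rho>" "irreducible_rep G l \<rho>"
    and ne: "\<not> equivalent_reps G l \<rho> k \<pi>" and ij: "i < k" "j < l" "a < k" "b < l"
  shows "(\<integral>t. \<pi> t $$ (i, a) * cnj (\<rho> t $$ (j, b)) \<partial>m) = 0"
proof -
  define A where "A = mat k l (\<lambda>(i, j). \<integral>t. \<pi> t $$ (i, a) * cnj (\<rho> t $$ (j, b)) \<partial>m)"
  define A' where "A' = mat l k (\<lambda>(i, j). \<integral>t. \<rho> t $$ (i, b) * cnj (\<pi> t $$ (j, a)) \<partial>m)"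
  have A: "A \<in> carrier_mat k l" "A' \<in> carrier_mat l k" by (simp_all add: A_def A'_def)
  have iA: "\<And>x. x \<in> carrier G \<Longrightarrow> A * \<rho> x = \<pi> x * A" unfolding A_def by (rule averaged_intertwiner[OF p(1) r(1) ij(3,4)])
  have iA': "\<And>x. x \<in> carrier G \<Longrightarrow> A' * \<pi> x = \<rho> x * A'" unfolding A'_def by (rule averaged_intertwiner[OF r(1) p(1) ij(4,3)])
  have "A $$ (i, j) = 0"
  proof (cases k l rule: linorder_cases)
    case less
    from wide_kernel[OF A(1) less] obtain w where w: "w \<in> carrier_vec l" "w \<noteq> 0\<^sub>v l" "A *\<^sub>v w = 0\<^sub>v k" by blast
    have "A = 0\<^sub>m k l"
      by (rule schur_kernel[OF r(2) _ _ A(1) _ w]) (use rep_carrier[OF r(1)] rep_carrier[OF p(1)] iA in auto)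
    thus ?thesis using ij by simp
  next
    case greater
    from wide_kernel[OF A(2) greater] obtain w where w: "w \<in> carrier_vec k" "w \<noteq> 0\<^sub>v k" "A' *\<^sub>v w = 0\<^sub>v l" by blast
    have "A' = 0\<^sub>m l k"
      by (rule schur_kernel[OF p(2) _ _ A(2) _ w]) (use rep_carrier[OF r(1)] rep_carrier[OF p(1)] iA' in auto)
    hence "A' $$ (j, i) = 0" using ij by simp
    moreover have "A $$ (i, j) = cnj (A' $$ (j, i))"
      using ij by (simp add: A_def A'_def) (subst Bochner_Integration.integral_cnj[symmetric], simp add: mult.commute)
    ultimately show ?thesis by simp
  next
    case equal
    have "\<not> invertible_mat A" using ne iA A(1) equal unfolding equivalent_reps_def by blast
    hence "Determinant.det A = 0" using nonsingular_invertible[of A k] A(1) equal by blast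
    then obtain w where w: "w \<in> carrier_vec l" "w \<noteq> 0\<^sub>v l" "A *\<^sub>v w = 0\<^sub>v k"
      using det_0_iff_vec_prod_zero_field[of A k] A(1) equal by auto
    have "A = 0\<^sub>m k l"
      by (rule schur_kernel[OF r(2) _ _ A(1) _ w]) (use rep_carrier[OF r(1)] rep_carrier[OF p(1)] iA in auto)
    thus ?thesis using ij by simp
  qed
  thus ?thesis using ij by (simp add: A_def)
qed

text \<open>Subtracting an eigenvalue \<open>c\<close> from the average leaves an intertwiner with a
  kernel vector, so the average is \<open>c\<close> times the identity. Its trace is the integral of
  an inner product of two columns of a unitary matrix, which determines \<open>c\<close>.\<close>

theorem schur_orthogonality_eq:
  assumes p: "unitary_rep G T k \<pi>" "irreducible_rep G k \<pi>" and ij: "i < k" "j < k" "a < k" "b < k"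
  shows "(\<integral>t. \<pi> t $$ (i, a) * cnj (\<pi> t $$ (j, b)) \<partial>m) = (if i = j \<and> a = b then 1 / of_nat k else 0)"
proof -
  define A where "A = mat k k (\<lambda>(i, j). \<integral>t. \<pi> t $$ (i, a) * cnj (\<pi> t $$ (j, b)) \<partial>m)"
  have A: "A \<in> carrier_mat k k" by (simp add: A_def)
  have k: "k > 0" using ij by simp
  have iA: "\<And>x. x \<in> carrier G \<Longrightarrow> A * \<pi> x = \<pi> x * A" unfolding A_def by (rule averaged_intertwiner[OF p(1) p(1) ij(3,4)])
  obtain c where "eigenvalue A c" using spectrum_non_empty[OF A] k by (auto simp: spectrum_def)
  then obtain w where w: "w \<in> carrier_vec k" "w \<noteq> 0\<^sub>v k" "A *\<^sub>v w = c \<cdot>\<^sub>v w"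
    using A by (auto simp: eigenvalue_def eigenvector_def)
  define B where "B = A - c \<cdot>\<^sub>m 1\<^sub>m k"
  have B: "B \<in> carrier_mat k k" unfolding B_def by (intro minus_carrier_mat smult_carrier_mat one_carrier_mat)
  have iB: "B * \<pi> x = \<pi> x * B" if x: "x \<in> carrier G" for x
    unfolding B_def using A rep_carrier[OF p(1) x] iA[OF x]
    by (simp add: minus_mult_distrib_mat[of _ k k _ _ k] mult_minus_distrib_mat[of _ k k _ k] mult_smult_distrib[of _ k k _ k] mult_smult_assoc_mat[of _ k k _ k])
  have Bw: "B *\<^sub>v w = 0\<^sub>v k"
  proof (rule eq_vecI)
    fix i assume "i < dim_vec (0\<^sub>v k :: complex vec)"
    hence i: "i < k" by simp
    have "(B *\<^sub>v w) $ i = (A *\<^sub>v w) $ i - c * w $ i"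
      using i A w(1) by (simp add: B_def minus_mult_distrib_mat_vec[of _ k k])
    thus "(B *\<^sub>v w) $ i = 0\<^sub>v k $ i" using i w by simp
  qed (use B in simp)
  have "B = 0\<^sub>m k k" by (rule schur_kernel[OF p(2) rep_carrier[OF p(1)] rep_carrier[OF p(1)] B iB w(1,2) Bw])
  hence Ac: "A $$ (i, j) = (if i = j then c else 0)" if "i < k" "j < k" for i j
  proof -
    have "B $$ (i, j) = 0" using \<open>B = 0\<^sub>m k k\<close> that by simp
    thus ?thesis using that A by (auto simp: B_def split: if_splits)
  qed
  have "(\<Sum>i<k. A $$ (i, i)) = (\<Sum>i<k. \<integral>t. \<pi> t $$ (i, a) * cnj (\<pi> t $$ (i, b)) \<partial>m)"
    by (intro sum.cong refl) (simp add: A_def)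
  also have "\<dots> = (\<integral>t. (\<Sum>i<k. \<pi> t $$ (i, a) * cnj (\<pi> t $$ (i, b))) \<partial>m)"
    by (rule Bochner_Integration.integral_sum[symmetric]) (use rep_coeff_integrable[OF p(1) p(1)] ij in auto)
  also have "\<dots> = (\<integral>t. (if b = a then 1 else 0) \<partial>m)"
  proof (rule Bochner_Integration.integral_cong[OF refl])
    fix t assume "t \<in> space m"
    hence t: "t \<in> carrier G" using spacem by simp
    have "(\<Sum>i<k. \<pi> t $$ (i, a) * cnj (\<pi> t $$ (i, b))) = (\<Sum>i<k. cnj (\<pi> t $$ (i, b)) * \<pi> t $$ (i, a))"
      by (simp only: mult.commute)
    thus "(\<Sum>i<k. \<pi> t $$ (i, a) * cnj (\<pi> t $$ (i, b))) = (if b = a then 1 else 0)"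
      using unitaryD(1)[OF rep_unitary[OF p(1) t] ij(4,3)] by simp
  qed
  also have "\<dots> = (if b = a then 1 else 0)" using prob_space by simp
  finally have "of_nat k * c = (if b = a then 1 else 0)" by (simp add: Ac)
  hence "c = (if b = a then 1 / of_nat k else 0)" using k by (auto simp: field_simps)
  thus ?thesis using Ac[OF ij(1,2)] ij by (auto simp: A_def)
qed

end

section \<open>Complex Gaussian variables\<close>

text \<open>Lebesgue measure is determined by its values on boxes, and a complex box is a product of
  two intervals. This is what splits a complex Gaussian into two real ones.\<close>

lemma lborel_complex: "lborel = distr (lborel \<Otimes>\<^sub>M lborel) borel (\<lambda>(x, y). Complex x y)"
proof (rule lborel_eqI)
  have m: "(\<lambda>(x, y). Complex x y) \<in> borel_measurable (lborel \<Otimes>\<^sub>M lborel)"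
  proof -
    have "(\<lambda>p. complex_of_real (fst p) + \<i> * complex_of_real (snd p)) \<in> borel_measurable (lborel \<Otimes>\<^sub>M lborel)" by measurable
    thus ?thesis by (simp add: Complex_eq case_prod_beta)
  qed
  fix l u :: complex assume lu: "\<And>b. b \<in> Basis \<Longrightarrow> l \<bullet> b \<le> u \<bullet> b"
  have "(\<lambda>(x, y). Complex x y) -` box l u \<inter> space (lborel \<Otimes>\<^sub>M lborel) = {Re l<..<Re u} \<times> {Im l<..<Im u}"
    by (auto simp: box_def Basis_complex_def inner_complex_def space_pair_measure)
  hence "emeasure (distr (lborel \<Otimes>\<^sub>M lborel) borel (\<lambda>(x, y). Complex x y)) (box l u)
    = emeasure (lborel \<Otimes>\<^sub>M lborel) ({Re l<..<Re u} \<times> {Im l<..<Im u})"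
    by (simp add: emeasure_distr[OF m])
  also have "\<dots> = emeasure lborel {Re l<..<Re u} * emeasure lborel {Im l<..<Im u}"
    by (rule lborel.emeasure_pair_measure_Times) auto
  also have "\<dots> = ennreal ((Re u - Re l) * (Im u - Im l))"
    using lu[of 1] lu[of \<i>] by (simp add: Basis_complex_def inner_complex_def ennreal_mult)
  also have "(Re u - Re l) * (Im u - Im l) = (\<Prod>b\<in>Basis. (u - l) \<bullet> b)"
    by (simp add: Basis_complex_def inner_complex_def)
  finally show "emeasure (distr (lborel \<Otimes>\<^sub>M lborel) borel (\<lambda>(x, y). Complex x y)) (box l u) = ennreal (\<Prod>b\<in>Basis. (u - l) \<bullet> b)" .
qed simp

abbreviation "halfN \<equiv> density lborel (\<lambda>x. ennreal (normal_density 0 (1 / sqrt 2) x))"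

lemma normal_density_half: "normal_density 0 (1 / sqrt 2) x = exp (- x\<^sup>2) / sqrt pi"
  by (simp add: normal_density_def power_divide)

lemma Complex_measurable: "(\<lambda>(x, y). Complex x y) \<in> borel_measurable (borel \<Otimes>\<^sub>M borel)"
proof -
  have "(\<lambda>p. complex_of_real (fst p) + \<i> * complex_of_real (snd p)) \<in> borel_measurable (borel \<Otimes>\<^sub>M borel)" by measurable
  thus ?thesis by (simp add: Complex_eq case_prod_beta)
qed

lemma prob_halfN: "prob_space halfN"
  by (rule prob_space_normal_density) simp

text \<open>The density is a function of the squared modulus in the exponent, so it factors into two
  normal densities of variance \<open>1/2\<close>.\<close>

lemma complex_gaussian_law:
  assumes X: "std_complex_gaussian P X"
  shows "distr P borel X = distr (halfN \<Otimes>\<^sub>M halfN) borel (\<lambda>(x, y). Complex x y)"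
proof -
  let ?g = "\<lambda>z::complex. ennreal (exp (- (cmod z)\<^sup>2) / pi)"
  let ?C = "\<lambda>(x, y). Complex x y"
  have m: "?C \<in> borel_measurable (lborel \<Otimes>\<^sub>M lborel)" using Complex_measurable by simp
  have gm: "?g \<in> borel_measurable borel" by measurable
  have "distr P borel X = distr P lborel X" by (rule distr_cong) auto
  also have "\<dots> = density lborel ?g" using X unfolding std_complex_gaussian_def by (rule distributed_distr_eq_density)
  also have "\<dots> = density (distr (lborel \<Otimes>\<^sub>M lborel) borel ?C) ?g" by (subst lborel_complex) (rule refl)
  also have "\<dots> = distr (density (lborel \<Otimes>\<^sub>M lborel) (\<lambda>p. ?g (?C p))) borel ?C"
    by (rule density_distr[OF gm m])
  also have "density (lborel \<Otimes>\<^sub>M lborel) (\<lambda>p. ?g (?C p))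
      = density (lborel \<Otimes>\<^sub>M lborel) (\<lambda>(x, y). ennreal (normal_density 0 (1 / sqrt 2) x) * ennreal (normal_density 0 (1 / sqrt 2) y))"
  proof (rule density_cong)
    show "(\<lambda>p. ?g (?C p)) \<in> borel_measurable (lborel \<Otimes>\<^sub>M lborel)" by (rule measurable_compose[OF m gm])
    show "AE p in lborel \<Otimes>\<^sub>M lborel. ?g (?C p) = (case p of (x, y) \<Rightarrow> ennreal (normal_density 0 (1 / sqrt 2) x) * ennreal (normal_density 0 (1 / sqrt 2) y))"
    proof (rule AE_I2, clarify)
      fix x y :: real
      have e: "exp (- (cmod (Complex x y))\<^sup>2) = exp (- x\<^sup>2) * exp (- y\<^sup>2)"
        by (simp add: cmod_power2 flip: exp_add)
      have "ennreal (exp (- x\<^sup>2) / sqrt pi) * ennreal (exp (- y\<^sup>2) / sqrt pi) = ennreal ((exp (- x\<^sup>2) / sqrt pi) * (exp (- y\<^sup>2) / sqrt pi))"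
        by (rule ennreal_mult[symmetric]) auto
      also have "(exp (- x\<^sup>2) / sqrt pi) * (exp (- y\<^sup>2) / sqrt pi) = exp (- (cmod (Complex x y))\<^sup>2) / pi"
        unfolding e by simp
      finally show "?g (Complex x y) = ennreal (normal_density 0 (1 / sqrt 2) x) * ennreal (normal_density 0 (1 / sqrt 2) y)"
        unfolding normal_density_half by simp
    qed
  qed measurable
  also have "\<dots> = halfN \<Otimes>\<^sub>M halfN"
  proof (rule pair_measure_density[symmetric])
    interpret prob_space halfN by (rule prob_halfN)
    show "sigma_finite_measure halfN" by unfold_locales
    show "sigma_finite_measure (lborel :: real measure)" by unfold_locales
  qed measurable
  finally show ?thesis .
qed

text \<open>Rescaling by \<open>sqrt 2\<close> moves all computations to the standard normal
  distribution, with its known moments and characteristic function.\<close>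

lemma halfN_integral:
  fixes f :: "real \<Rightarrow> complex"
  assumes f: "f \<in> borel_measurable borel"
  shows "(\<integral>x. f (sqrt 2 * x) \<partial>halfN) = (\<integral>x. f x \<partial>std_normal_distribution)"
    "integrable std_normal_distribution f \<Longrightarrow> integrable halfN (\<lambda>x. f (sqrt 2 * x))"
proof -
  interpret N: prob_space halfN by (rule prob_halfN)
  have "distributed halfN lborel (\<lambda>x. x) (normal_density 0 (1 / sqrt 2))"
    unfolding distributed_def by (auto simp: distr_id2)
  hence "distributed halfN lborel (\<lambda>x. (x - 0) / (1 / sqrt 2)) std_normal_density"
    using N.normal_standard_normal_convert[of "1 / sqrt 2" "\<lambda>x. x" 0] by simp
  hence d: "distr halfN lborel (\<lambda>x. sqrt 2 * x) = std_normal_distribution"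
    using distributed_distr_eq_density by (fastforce simp: mult.commute)
  have m: "(\<lambda>x. sqrt 2 * x) \<in> measurable halfN lborel" by measurable
  have f': "f \<in> borel_measurable lborel" using f by simp
  show "(\<integral>x. f (sqrt 2 * x) \<partial>halfN) = (\<integral>x. f x \<partial>std_normal_distribution)"
    unfolding d[symmetric] by (rule integral_distr[OF m f', symmetric])
  show "integrable halfN (\<lambda>x. f (sqrt 2 * x))" if "integrable std_normal_distribution f"
    using that unfolding d[symmetric] by (subst (asm) integrable_distr_eq[OF m f'])
qed

lemma pair_integral_prod:
  fixes f k :: "real \<Rightarrow> complex"
  assumes "prob_space M" "prob_space N" and f: "integrable M f" and k: "integrable N k"
  shows "integrable (M \<Otimes>\<^sub>M N) (\<lambda>(x, y). f x * k y)"
    "(\<integral>p. (case p of (x, y) \<Rightarrow> f x * k y) \<partial>(M \<Otimes>\<^sub>M N)) = (\<integral>x. f x \<partial>M) * (\<integral>y. k y \<partial>N)"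
proof -
  interpret M: prob_space M by fact
  interpret N: prob_space N by fact
  interpret pair_sigma_finite M N by unfold_locales
  have [measurable]: "f \<in> borel_measurable M" "k \<in> borel_measurable N" using f k by auto
  show int: "integrable (M \<Otimes>\<^sub>M N) (\<lambda>(x, y). f x * k y)"
  proof (rule Fubini_integrable)
    show "(\<lambda>(x, y). f x * k y) \<in> borel_measurable (M \<Otimes>\<^sub>M N)" by measurable
    show "integrable M (\<lambda>x. \<integral>y. norm (case (x, y) of (x, y) \<Rightarrow> f x * k y) \<partial>N)"
      using f by (simp add: norm_mult)
    show "AE x in M. integrable N (\<lambda>y. case (x, y) of (x, y) \<Rightarrow> f x * k y)" using k by simp
  qed
  have "(\<integral>p. (case p of (x, y) \<Rightarrow> f x * k y) \<partial>(M \<Otimes>\<^sub>M N)) = (\<integral>x. (\<integral>y. f x * k y \<partial>N) \<partial>M)"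
    using integral_fst'[OF int] by simp
  also have "\<dots> = (\<integral>x. f x \<partial>M) * (\<integral>y. k y \<partial>N)" by simp
  finally show "(\<integral>p. (case p of (x, y) \<Rightarrow> f x * k y) \<partial>(M \<Otimes>\<^sub>M N)) = (\<integral>x. f x \<partial>M) * (\<integral>y. k y \<partial>N)" .
qed

lemma complex_gaussian_measurable: "std_complex_gaussian P X \<Longrightarrow> X \<in> borel_measurable P"
  unfolding std_complex_gaussian_def distributed_def by simp

lemma complex_gaussian_prod:
  fixes f k :: "real \<Rightarrow> complex"
  assumes X: "std_complex_gaussian P X"
    and f: "f \<in> borel_measurable borel" "integrable std_normal_distribution f"
    and k: "k \<in> borel_measurable borel" "integrable std_normal_distribution k"
  shows "integrable P (\<lambda>\<omega>. f (sqrt 2 * Re (X \<omega>)) * k (sqrt 2 * Im (X \<omega>)))"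
    "(\<integral>\<omega>. f (sqrt 2 * Re (X \<omega>)) * k (sqrt 2 * Im (X \<omega>)) \<partial>P)
      = (\<integral>x. f x \<partial>std_normal_distribution) * (\<integral>x. k x \<partial>std_normal_distribution)"
proof -
  note Xm = complex_gaussian_measurable[OF X]
  let ?F = "\<lambda>z. f (sqrt 2 * Re z) * k (sqrt 2 * Im z)"
  let ?C = "\<lambda>(x, y). Complex x y"
  have Fm: "?F \<in> borel_measurable borel" using f k by measurable
  have Cm: "?C \<in> borel_measurable (halfN \<Otimes>\<^sub>M halfN)" using Complex_measurable by simp
  have e: "?F (?C p) = (case p of (x, y) \<Rightarrow> f (sqrt 2 * x) * k (sqrt 2 * y))" for p by (cases p) simp
  note pr = pair_integral_prod[OF prob_halfN prob_halfN halfN_integral(2)[OF f] halfN_integral(2)[OF k]]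
  have "integrable (distr P borel X) ?F"
    unfolding complex_gaussian_law[OF X] integrable_distr_eq[OF Cm Fm] e by (rule pr(1))
  thus "integrable P (\<lambda>\<omega>. ?F (X \<omega>))" unfolding integrable_distr_eq[OF Xm Fm] .
  have "(\<integral>\<omega>. ?F (X \<omega>) \<partial>P) = (\<integral>z. ?F z \<partial>distr P borel X)" by (rule integral_distr[OF Xm Fm, symmetric])
  also have "\<dots> = (\<integral>p. ?F (?C p) \<partial>(halfN \<Otimes>\<^sub>M halfN))" unfolding complex_gaussian_law[OF X] by (rule integral_distr[OF Cm Fm])
  also have "\<dots> = (\<integral>x. f (sqrt 2 * x) \<partial>halfN) * (\<integral>x. k (sqrt 2 * x) \<partial>halfN)" unfolding e by (rule pr(2))
  finally show "(\<integral>\<omega>. ?F (X \<omega>) \<partial>P) = (\<integral>x. f x \<partial>std_normal_distribution) * (\<integral>x. k x \<partial>std_normal_distribution)"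
    unfolding halfN_integral(1)[OF f(1)] halfN_integral(1)[OF k(1)] .
qed

section \<open>Characteristic function and mixed moments of a complex Gaussian\<close>

lemma prob_std: "prob_space std_normal_distribution"
  by (rule prob_space_normal_density) simp

lemma std_normal_char:
  "(\<integral>x. exp (\<i> * complex_of_real (t * x)) \<partial>std_normal_distribution) = complex_of_real (exp (- (t\<^sup>2) / 2))"
  using fun_cong[OF char_std_normal_distribution, of t] unfolding char_def by simp

text \<open>The real part of \<open>c X\<close> is centred normal of variance
  \<open>cmod c ^ 2 / 2\<close>; the second half in the exponent comes from the characteristic
  function itself.\<close>

lemma complex_gaussian_char:
  assumes X: "std_complex_gaussian P X"
  shows "(\<integral>\<omega>. exp (\<i> * complex_of_real (Re (c * X \<omega>))) \<partial>P) = complex_of_real (exp (- ((cmod c)\<^sup>2) / 4))"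
proof -
  interpret S: prob_space std_normal_distribution by (rule prob_std)
  let ?f = "\<lambda>t x::real. exp (\<i> * complex_of_real (t * x))"
  have fm: "?f t \<in> borel_measurable borel" for t by measurable
  have fi: "integrable std_normal_distribution (?f t)" for t
    by (rule S.integrable_const_bound[where B=1]) (auto simp: norm_exp_i_times)
  have e: "exp (\<i> * complex_of_real (Re (c * X \<omega>))) = ?f (Re c / sqrt 2) (sqrt 2 * Re (X \<omega>)) * ?f (- Im c / sqrt 2) (sqrt 2 * Im (X \<omega>))" for \<omega>
    unfolding exp_add[symmetric] by (simp add: algebra_simps flip: of_real_mult)
  have "(\<integral>\<omega>. exp (\<i> * complex_of_real (Re (c * X \<omega>))) \<partial>P)
    = complex_of_real (exp (- ((Re c / sqrt 2)\<^sup>2) / 2)) * complex_of_real (exp (- ((- Im c / sqrt 2)\<^sup>2) / 2))"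
    unfolding e complex_gaussian_prod(2)[OF X fm fi fm fi] std_normal_char ..
  also have "\<dots> = complex_of_real (exp (- ((cmod c)\<^sup>2) / 4))"
    unfolding of_real_mult[symmetric] exp_add[symmetric] by (simp add: cmod_power2 power_divide add_divide_distrib)
  finally show ?thesis .
qed

lemma std_moments:
  "integrable std_normal_distribution (\<lambda>x. complex_of_real (x ^ k))"
  "(\<integral>x. complex_of_real (x ^ 0) \<partial>std_normal_distribution) = 1"
  "(\<integral>x. complex_of_real (x ^ 1) \<partial>std_normal_distribution) = 0"
  "(\<integral>x. complex_of_real (x ^ 2) \<partial>std_normal_distribution) = 1"
  "(\<integral>x. complex_of_real (x ^ 3) \<partial>std_normal_distribution) = 0"
  "(\<integral>x. complex_of_real (x ^ 4) \<partial>std_normal_distribution) = 3"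
proof -
  interpret S: prob_space std_normal_distribution by (rule prob_std)
  have r: "(LINT x|std_normal_distribution. x ^ k) = (LINT x|lborel. std_normal_density x * x ^ k)" for k
    by (subst integral_density) (auto simp: normal_density_nonneg)
  have i: "integrable std_normal_distribution (\<lambda>x. x ^ k)" for k
    by (subst integrable_density) (auto simp: normal_density_nonneg integrable_std_normal_moment)
  show "integrable std_normal_distribution (\<lambda>x. complex_of_real (x ^ k))" by (intro integrable_of_real i)
  show "(\<integral>x. complex_of_real (x ^ 0) \<partial>std_normal_distribution) = 1" using S.prob_space by simp
  show "(\<integral>x. complex_of_real (x ^ 1) \<partial>std_normal_distribution) = 0"
    unfolding integral_complex_of_real r using integral_std_normal_moment_odd[of 0] by simp
  show "(\<integral>x. complex_of_real (x ^ 3) \<partial>std_normal_distribution) = 0"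
    unfolding integral_complex_of_real r using integral_std_normal_moment_odd[of 1] by (simp add: numeral_3_eq_3)
  show "(\<integral>x. complex_of_real (x ^ 2) \<partial>std_normal_distribution) = 1"
    unfolding integral_complex_of_real r using integral_std_normal_moment_even[of 1] by simp
  show "(\<integral>x. complex_of_real (x ^ 4) \<partial>std_normal_distribution) = 3"
    unfolding integral_complex_of_real r using integral_std_normal_moment_even[of 2] by (simp add: fact_numeral)
qed

lemma complex_gaussian_real_moments:
  assumes X: "std_complex_gaussian P X"
  shows "integrable P (\<lambda>\<omega>. complex_of_real ((sqrt 2 * Re (X \<omega>)) ^ p) * complex_of_real ((sqrt 2 * Im (X \<omega>)) ^ q))"
    "(\<integral>\<omega>. complex_of_real ((sqrt 2 * Re (X \<omega>)) ^ p) * complex_of_real ((sqrt 2 * Im (X \<omega>)) ^ q) \<partial>P)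
      = (\<integral>x. complex_of_real (x ^ p) \<partial>std_normal_distribution) * (\<integral>x. complex_of_real (x ^ q) \<partial>std_normal_distribution)"
  by (rule complex_gaussian_prod[OF X], measurable, rule std_moments, measurable, rule std_moments)+

text \<open>The mixed moments \<open>E[X\<^sup>p (cnj X)\<^sup>q]\<close> of a standard complex Gaussian.\<close>

definition cg_moment :: "nat \<Rightarrow> nat \<Rightarrow> complex" where
  "cg_moment p q = (if p = q then of_nat (fact p) else 0)"

text \<open>\<open>U\<close> and \<open>V\<close> are the two real parts scaled to variance
  \<open>1\<close>. Assumption \<open>eq\<close> is the expansion of the product into their
  monomials, and \<open>r\<close> is its value once the normal moments \<open>M\<close> are
  inserted.\<close>

lemma complex_gaussian_polynomial:
  fixes c :: "nat \<Rightarrow> complex" and a b :: "nat \<Rightarrow> nat"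
  defines "M \<equiv> \<lambda>k. (\<integral>x. complex_of_real (x ^ k) \<partial>std_normal_distribution)"
  assumes X: "std_complex_gaussian P X"
    and eq: "\<And>u v. ((u + \<i> * v) / complex_of_real (sqrt 2)) ^ p * ((u - \<i> * v) / complex_of_real (sqrt 2)) ^ q
        = (\<Sum>i\<in>A. c i * (u ^ a i * v ^ b i))"
    and r: "(\<Sum>i\<in>A. c i * (M (a i) * M (b i))) = r"
  shows "integrable P (\<lambda>\<omega>. X \<omega> ^ p * cnj (X \<omega>) ^ q) \<and> (\<integral>\<omega>. X \<omega> ^ p * cnj (X \<omega>) ^ q \<partial>P) = r"
proof -
  define U where "U \<omega> = complex_of_real (sqrt 2 * Re (X \<omega>))" for \<omega>
  define V where "V \<omega> = complex_of_real (sqrt 2 * Im (X \<omega>))" for \<omega>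
  have XU: "X \<omega> = (U \<omega> + \<i> * V \<omega>) / complex_of_real (sqrt 2)" "cnj (X \<omega>) = (U \<omega> - \<i> * V \<omega>) / complex_of_real (sqrt 2)" for \<omega>
    by (simp_all add: U_def V_def complex_eq_iff)
  have UV: "integrable P (\<lambda>\<omega>. U \<omega> ^ e * V \<omega> ^ f)" "(\<integral>\<omega>. U \<omega> ^ e * V \<omega> ^ f \<partial>P) = M e * M f" for e f
    using complex_gaussian_real_moments[OF X, of e f] unfolding U_def V_def M_def of_real_power by simp_all
  have "X \<omega> ^ p * cnj (X \<omega>) ^ q = (\<Sum>i\<in>A. c i * (U \<omega> ^ a i * V \<omega> ^ b i))" for \<omega>
    unfolding eq[symmetric] unfolding XU(2) unfolding XU(1) ..
  thus ?thesis using UV r by (simp add: Bochner_Integration.integral_sum)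
qed

text \<open>The highest order computed below has two plain and two conjugated factors, so exponents
  up to \<open>2\<close> cover all coincidences of indices. The lists in each case hold the
  coefficients and the exponents of \<open>U\<close> and \<open>V\<close> in the expanded
  product.\<close>

lemma complex_gaussian_moments:
  assumes X: "std_complex_gaussian P X" and P: "prob_space P" and pq: "p \<le> 2" "q \<le> 2"
  shows "integrable P (\<lambda>\<omega>. X \<omega> ^ p * cnj (X \<omega>) ^ q)"
    "(\<integral>\<omega>. X \<omega> ^ p * cnj (X \<omega>) ^ q \<partial>P) = cg_moment p q"
proof -
  interpret prob_space P by fact
  define M where "M k = (\<integral>x. complex_of_real (x ^ k) \<partial>std_normal_distribution)" for k
  have Mv: "M 0 = 1" "M (Suc 0) = 0" "M 2 = 1" "M 3 = 0" "M 4 = 3"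
    using std_moments unfolding M_def by (simp_all add: prob_space.prob_space[OF prob_std])
  have Mv': "M (Suc (Suc 0)) = 1" "M (Suc (Suc (Suc 0))) = 0" using Mv by (simp_all add: eval_nat_numeral)
  note main = complex_gaussian_polynomial[OF X, folded M_def]
  have r2: "complex_of_real (sqrt 2) * complex_of_real (sqrt 2) = 2" by (simp flip: of_real_mult)
  let ?s = "complex_of_real (sqrt 2)"
  have "integrable P (\<lambda>\<omega>. X \<omega> ^ p * cnj (X \<omega>) ^ q) \<and> (\<integral>\<omega>. X \<omega> ^ p * cnj (X \<omega>) ^ q \<partial>P) = cg_moment p q"
  proof -
    have c3: "p = 0 \<or> p = 1 \<or> p = 2" "q = 0 \<or> q = 1 \<or> q = 2" using pq by auto
    have s4: "?s * (?s * (?s * ?s)) = 4" using r2 by (metis mult.assoc mult_2 mult_numeral_1 numeral_Bit0)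
    note cong = power2_eq_square power3_eq_cube power4_eq_xxxx cg_moment_def Mv Mv'
    consider "p = 0" "q = 0" | "p = 1" "q = 0" | "p = 0" "q = 1" | "p = 2" "q = 0" | "p = 0" "q = 2" | "p = 1" "q = 1"
      | "p = 2" "q = 1" | "p = 1" "q = 2" | "p = 2" "q = 2" using c3 by blast
    thus ?thesis
    proof cases
      case 1
      show ?thesis by (rule main[where A="{0}" and c="\<lambda>_. 1" and a="\<lambda>_. 0" and b="\<lambda>_. 0"]) (simp_all add: 1 cong)
    next
      case 2
      show ?thesis by (rule main[where A="{0,1}" and c="(!) [1/?s, \<i>/?s]" and a="(!) [1,0]" and b="(!) [0,1]"])
          (simp_all add: 2 cong add_divide_distrib)
    next
      case 3
      show ?thesis by (rule main[where A="{0,1}" and c="(!) [1/?s, -\<i>/?s]" and a="(!) [1,0]" and b="(!) [0,1]"])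
          (simp_all add: 3 cong diff_divide_distrib)
    next
      case 4
      show ?thesis by (rule main[where A="{0,1,2}" and c="(!) [1/2, \<i>, -1/2]" and a="(!) [2,1,0]" and b="(!) [0,1,2]"])
          (simp_all add: 4 cong r2 field_simps numeral_2_eq_2)
    next
      case 5
      show ?thesis by (rule main[where A="{0,1,2}" and c="(!) [1/2, -\<i>, -1/2]" and a="(!) [2,1,0]" and b="(!) [0,1,2]"])
          (simp_all add: 5 cong r2 field_simps numeral_2_eq_2)
    next
      case 6
      show ?thesis by (rule main[where A="{0,1}" and c="(!) [1/2, 1/2]" and a="(!) [2,0]" and b="(!) [0,2]"])
          (simp_all add: 6 cong r2 field_simps)
    next
      case 7
      show ?thesis by (rule main[where A="{0,1,2,3}" and c="(!) [1/(2*?s), \<i>/(2*?s), 1/(2*?s), \<i>/(2*?s)]" and a="(!) [3,2,1,0]" and b="(!) [0,1,2,3]"])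
          (simp_all add: 7 cong r2 field_simps numeral_2_eq_2 numeral_3_eq_3)
    next
      case 8
      show ?thesis by (rule main[where A="{0,1,2,3}" and c="(!) [1/(2*?s), -\<i>/(2*?s), 1/(2*?s), -\<i>/(2*?s)]" and a="(!) [3,2,1,0]" and b="(!) [0,1,2,3]"])
          (simp_all add: 8 cong r2 field_simps numeral_2_eq_2 numeral_3_eq_3)
    next
      case 9
      show ?thesis by (rule main[where A="{0,1,2}" and c="(!) [1/4, 1/2, 1/4]" and a="(!) [4,2,0]" and b="(!) [0,2,4]"])
          (simp_all add: 9 cong r2 s4 field_simps numeral_2_eq_2)
    qed
  qed
  thus "integrable P (\<lambda>\<omega>. X \<omega> ^ p * cnj (X \<omega>) ^ q)" "(\<integral>\<omega>. X \<omega> ^ p * cnj (X \<omega>) ^ q \<partial>P) = cg_moment p q" by auto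
qed

section \<open>Independent families of complex Gaussian variables\<close>

locale cgauss_family = prob_space P for P :: "'w measure" +
  fixes \<gamma> :: "'i \<Rightarrow> 'w \<Rightarrow> complex" and I :: "'i set"
  assumes gauss: "\<And>a. a \<in> I \<Longrightarrow> std_complex_gaussian P (\<gamma> a)"
    and indep: "indep_vars (\<lambda>_. borel) \<gamma> I"
begin

lemma gamma_measurable: "a \<in> I \<Longrightarrow> \<gamma> a \<in> borel_measurable P"
  by (rule complex_gaussian_measurable[OF gauss])

lemma indep_prod:
  assumes "finite F" "F \<subseteq> I" "\<And>a. a \<in> F \<Longrightarrow> h a \<in> borel_measurable borel"
    "\<And>a. a \<in> F \<Longrightarrow> integrable P (\<lambda>\<omega>. h a (\<gamma> a \<omega>) :: complex)"
  shows "(\<integral>\<omega>. (\<Prod>a\<in>F. h a (\<gamma> a \<omega>)) \<partial>P) = (\<Prod>a\<in>F. \<integral>\<omega>. h a (\<gamma> a \<omega>) \<partial>P)"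
    "integrable P (\<lambda>\<omega>. \<Prod>a\<in>F. h a (\<gamma> a \<omega>))"
proof -
  have "indep_vars (\<lambda>_. borel) (\<lambda>a \<omega>. h a (\<gamma> a \<omega>)) F"
    by (rule indep_vars_compose2[OF indep_vars_subset[OF indep assms(2)]]) (use assms in auto)
  from indep_vars_lebesgue_integral[OF assms(1) this assms(4)] indep_vars_integrable[OF assms(1) this assms(4)]
  show "(\<integral>\<omega>. (\<Prod>a\<in>F. h a (\<gamma> a \<omega>)) \<partial>P) = (\<Prod>a\<in>F. \<integral>\<omega>. h a (\<gamma> a \<omega>) \<partial>P)"
    "integrable P (\<lambda>\<omega>. \<Prod>a\<in>F. h a (\<gamma> a \<omega>))" by auto
qed

lemma gamma_powers:
  assumes "finite F" "F \<subseteq> I" "\<And>a. a \<in> F \<Longrightarrow> p a \<le> 2 \<and> q a \<le> 2"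
  shows "integrable P (\<lambda>\<omega>. \<Prod>a\<in>F. \<gamma> a \<omega> ^ p a * cnj (\<gamma> a \<omega>) ^ q a)"
    "(\<integral>\<omega>. (\<Prod>a\<in>F. \<gamma> a \<omega> ^ p a * cnj (\<gamma> a \<omega>) ^ q a) \<partial>P) = (\<Prod>a\<in>F. cg_moment (p a) (q a))"
proof -
  have m: "\<And>a. a \<in> F \<Longrightarrow> (\<lambda>z. z ^ p a * cnj z ^ q a) \<in> borel_measurable borel"
    by (intro borel_measurable_continuous_onI continuous_intros)
  have c: "\<And>a. a \<in> F \<Longrightarrow> integrable P (\<lambda>\<omega>. \<gamma> a \<omega> ^ p a * cnj (\<gamma> a \<omega>) ^ q a)"
    "\<And>a. a \<in> F \<Longrightarrow> (\<integral>\<omega>. \<gamma> a \<omega> ^ p a * cnj (\<gamma> a \<omega>) ^ q a \<partial>P) = cg_moment (p a) (q a)"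
    using complex_gaussian_moments[OF gauss prob_space_axioms] assms by blast+
  show "integrable P (\<lambda>\<omega>. \<Prod>a\<in>F. \<gamma> a \<omega> ^ p a * cnj (\<gamma> a \<omega>) ^ q a)"
    by (rule indep_prod(2)[OF assms(1,2) m c(1)])
  show "(\<integral>\<omega>. (\<Prod>a\<in>F. \<gamma> a \<omega> ^ p a * cnj (\<gamma> a \<omega>) ^ q a) \<partial>P) = (\<Prod>a\<in>F. cg_moment (p a) (q a))"
    by (subst indep_prod(1)[OF assms(1,2) m c(1)]) (simp_all add: c(2))
qed

lemma gamma_second:
  assumes "a \<in> I" "b \<in> I"
  shows "integrable P (\<lambda>\<omega>. \<gamma> a \<omega> * cnj (\<gamma> b \<omega>))"
    "(\<integral>\<omega>. \<gamma> a \<omega> * cnj (\<gamma> b \<omega>) \<partial>P) = (if a = b then 1 else 0)"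
proof -
  define p q where "p = (\<lambda>c. if c = a then 1 else 0::nat)" and "q = (\<lambda>c. if c = b then 1 else 0::nat)"
  have F: "finite {a, b}" "{a, b} \<subseteq> I" "\<And>c. c \<in> {a, b} \<Longrightarrow> p c \<le> 2 \<and> q c \<le> 2" using assms by (auto simp: p_def q_def)
  have e: "(\<Prod>c\<in>{a, b}. \<gamma> c \<omega> ^ p c * cnj (\<gamma> c \<omega>) ^ q c) = \<gamma> a \<omega> * cnj (\<gamma> b \<omega>)" for \<omega>
    by (cases "a = b") (auto simp: p_def q_def)
  show "integrable P (\<lambda>\<omega>. \<gamma> a \<omega> * cnj (\<gamma> b \<omega>))" unfolding e[symmetric] by (rule gamma_powers(1)[OF F(1,2)]) (rule F(3))
  show "(\<integral>\<omega>. \<gamma> a \<omega> * cnj (\<gamma> b \<omega>) \<partial>P) = (if a = b then 1 else 0)"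
    unfolding e[symmetric] by (subst gamma_powers(2)[OF F(1,2)], rule F(3), assumption)
      (cases "a = b"; auto simp: p_def q_def cg_moment_def)
qed

text \<open>Wick's formula. The product is written as powers over the set of indices that occur,
  with \<open>p\<close> and \<open>q\<close> counting multiplicities. When all four coincide, the
  moment \<open>2\<close> of a single variable accounts for both pairings.\<close>

lemma gamma_fourth:
  assumes "a \<in> I" "b \<in> I" "c \<in> I" "e \<in> I"
  shows "integrable P (\<lambda>\<omega>. \<gamma> a \<omega> * \<gamma> b \<omega> * cnj (\<gamma> c \<omega>) * cnj (\<gamma> e \<omega>))"
    "(\<integral>\<omega>. \<gamma> a \<omega> * \<gamma> b \<omega> * cnj (\<gamma> c \<omega>) * cnj (\<gamma> e \<omega>) \<partial>P)
      = (if a = c \<and> b = e then 1 else 0) + (if a = e \<and> b = c then 1 else 0)"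
proof -
  define p q where "p = (\<lambda>x. (if x = a then 1 else 0) + (if x = b then 1 else 0::nat))"
    and "q = (\<lambda>x. (if x = c then 1 else 0) + (if x = e then 1 else 0::nat))"
  have F: "finite {a, b, c, e}" "{a, b, c, e} \<subseteq> I" "\<And>x. x \<in> {a, b, c, e} \<Longrightarrow> p x \<le> 2 \<and> q x \<le> 2"
    using assms by (auto simp: p_def q_def)
  have e: "(\<Prod>x\<in>{a, b, c, e}. \<gamma> x \<omega> ^ p x * cnj (\<gamma> x \<omega>) ^ q x) = \<gamma> a \<omega> * \<gamma> b \<omega> * cnj (\<gamma> c \<omega>) * cnj (\<gamma> e \<omega>)" for \<omega>
    by (cases "a = b"; cases "a = c"; cases "a = e"; cases "b = c"; cases "b = e"; cases "c = e")
      (simp_all add: p_def q_def power2_eq_square insert_commute mult_ac)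
  show "integrable P (\<lambda>\<omega>. \<gamma> a \<omega> * \<gamma> b \<omega> * cnj (\<gamma> c \<omega>) * cnj (\<gamma> e \<omega>))" unfolding e[symmetric] by (rule gamma_powers(1)[OF F(1,2)]) (rule F(3))
  show "(\<integral>\<omega>. \<gamma> a \<omega> * \<gamma> b \<omega> * cnj (\<gamma> c \<omega>) * cnj (\<gamma> e \<omega>) \<partial>P)
      = (if a = c \<and> b = e then 1 else 0) + (if a = e \<and> b = c then 1 else 0)"
    unfolding e[symmetric]
    apply (subst gamma_powers(2)[OF F(1,2)], rule F(3), assumption)
    by (cases "a = b"; cases "a = c"; cases "a = e"; cases "b = c"; cases "b = e"; cases "c = e")
      (simp_all add: p_def q_def cg_moment_def insert_commute)
qed

end

section \<open>Sine products of Gaussian variables\<close>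

definition sinprod :: "real \<Rightarrow> ('j \<Rightarrow> 'b \<Rightarrow> real) \<Rightarrow> 'j set \<Rightarrow> 'b \<Rightarrow> real" where
  "sinprod \<rho> w A \<omega> = (\<Prod>a\<in>A. sin (\<rho> * w a \<omega>))"

text \<open>The expectation of the square of \<open>sin (\<rho> x)\<close> for a standard normal
  \<open>x\<close>.\<close>

definition sinvar :: "real \<Rightarrow> real" where
  "sinvar \<rho> = (1 - exp (- 2 * \<rho>\<^sup>2)) / 2"

lemma sinvar_bounds: "0 \<le> sinvar \<rho>" "sinvar \<rho> \<le> \<rho>\<^sup>2"
  using exp_ge_add_one_self[of "- 2 * \<rho>\<^sup>2"] by (simp_all add: sinvar_def)

definition sinrem :: "real \<Rightarrow> ('j \<Rightarrow> 'b \<Rightarrow> real) \<Rightarrow> 'j \<Rightarrow> 'b \<Rightarrow> real" where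
  "sinrem \<rho> w a \<omega> = sin (\<rho> * w a \<omega>) - \<rho> * w a \<omega>"

context prob_space
begin

text \<open>The characteristic function of independent standard normal variables. It is all that is
  used about the joint law of such variables.\<close>

definition jgauss :: "'j set \<Rightarrow> ('j \<Rightarrow> 'a \<Rightarrow> real) \<Rightarrow> bool" where
  "jgauss J w \<longleftrightarrow> finite J \<and> (\<forall>a\<in>J. w a \<in> borel_measurable M) \<and>
    (\<forall>c. (\<integral>\<omega>. exp (\<i> * complex_of_real (\<Sum>a\<in>J. c a * w a \<omega>)) \<partial>M) = complex_of_real (exp (- (\<Sum>a\<in>J. (c a)\<^sup>2) / 2)))"

lemma exp_i_integrable: "f \<in> borel_measurable M \<Longrightarrow> integrable M (\<lambda>\<omega>. exp (\<i> * complex_of_real (f \<omega>)))"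
  by (rule integrable_const_bound[where B=1]) (auto simp: norm_exp_i_times)

lemma jgaussD:
  assumes "jgauss J w"
  shows "finite J" "\<And>a. a \<in> J \<Longrightarrow> w a \<in> borel_measurable M"
    "\<And>c. (\<integral>\<omega>. exp (\<i> * complex_of_real (\<Sum>a\<in>J. c a * w a \<omega>)) \<partial>M) = complex_of_real (exp (- (\<Sum>a\<in>J. (c a)\<^sup>2) / 2))"
    "\<And>c. (\<lambda>\<omega>. \<Sum>a\<in>J. c a * w a \<omega>) \<in> borel_measurable M"
  using assms unfolding jgauss_def by (auto intro!: borel_measurable_sum)

text \<open>Expansion gives exponentials of linear combinations. Their expectations factor over
  \<open>J\<close> because the exponent of the characteristic function is a sum over
  \<open>J\<close>, and the expansion is then undone.\<close>

lemma jgauss_trig: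
  fixes B :: "real set" and J :: "'j set" and \<alpha> :: "'j \<Rightarrow> real \<Rightarrow> complex"
  assumes w: "jgauss J w" and B: "finite B"
  shows "(\<integral>\<omega>. (\<Prod>a\<in>J. \<Sum>b\<in>B. \<alpha> a b * exp (\<i> * complex_of_real (b * w a \<omega>))) \<partial>M)
    = (\<Prod>a\<in>J. \<Sum>b\<in>B. \<alpha> a b * complex_of_real (exp (- b\<^sup>2 / 2)))"
proof -
  have J: "finite J" and wm: "\<And>a. a \<in> J \<Longrightarrow> w a \<in> borel_measurable M"
    and ch: "\<And>c. (\<integral>\<omega>. exp (\<i> * complex_of_real (\<Sum>a\<in>J. c a * w a \<omega>)) \<partial>M) = complex_of_real (exp (- (\<Sum>a\<in>J. (c a)\<^sup>2) / 2))"
    by (rule jgaussD[OF w], assumption?)+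
  have e: "(\<Prod>a\<in>J. \<Sum>b\<in>B. \<alpha> a b * exp (\<i> * complex_of_real (b * w a \<omega>)))
    = (\<Sum>f\<in>PiE J (\<lambda>_. B). (\<Prod>a\<in>J. \<alpha> a (f a)) * exp (\<i> * complex_of_real (\<Sum>a\<in>J. f a * w a \<omega>)))" for \<omega>
    unfolding prod_sum_PiE[OF J B] prod.distrib of_real_sum sum_distrib_left exp_sum[OF J] ..
  have "(\<integral>\<omega>. (\<Prod>a\<in>J. \<Sum>b\<in>B. \<alpha> a b * exp (\<i> * complex_of_real (b * w a \<omega>))) \<partial>M)
    = (\<Sum>f\<in>PiE J (\<lambda>_. B). (\<Prod>a\<in>J. \<alpha> a (f a)) * (\<integral>\<omega>. exp (\<i> * complex_of_real (\<Sum>a\<in>J. f a * w a \<omega>)) \<partial>M))"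
    unfolding e
  proof (subst Bochner_Integration.integral_sum)
    fix f
    have "(\<lambda>\<omega>. \<Sum>a\<in>J. f a * w a \<omega>) \<in> borel_measurable M" using wm by measurable
    thus "integrable M (\<lambda>\<omega>. (\<Prod>a\<in>J. \<alpha> a (f a)) * exp (\<i> * complex_of_real (\<Sum>a\<in>J. f a * w a \<omega>)))"
      by (intro integrable_mult_right exp_i_integrable)
  qed simp
  also have "\<dots> = (\<Sum>f\<in>PiE J (\<lambda>_. B). \<Prod>a\<in>J. \<alpha> a (f a) * complex_of_real (exp (- (f a)\<^sup>2 / 2)))"
    unfolding ch
  proof (intro sum.cong refl)
    fix f :: "'j \<Rightarrow> real"
    have "exp (- (\<Sum>a\<in>J. (f a)\<^sup>2) / 2) = (\<Prod>a\<in>J. exp (- (f a)\<^sup>2 / 2))"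
      unfolding exp_sum[OF J, symmetric] by (simp add: sum_negf sum_divide_distrib)
    thus "(\<Prod>a\<in>J. \<alpha> a (f a)) * complex_of_real (exp (- (\<Sum>a\<in>J. (f a)\<^sup>2) / 2)) = (\<Prod>a\<in>J. \<alpha> a (f a) * complex_of_real (exp (- (f a)\<^sup>2 / 2)))"
      by (simp add: prod.distrib)
  qed
  also have "\<dots> = (\<Prod>a\<in>J. \<Sum>b\<in>B. \<alpha> a b * complex_of_real (exp (- b\<^sup>2 / 2)))"
    by (rule prod_sum_PiE[OF J B, symmetric])
  finally show ?thesis .
qed

text \<open>At each coordinate the factor is \<open>1\<close>, a sine or a squared sine. All are
  trigonometric polynomials with frequencies \<open>0\<close>, \<open>\<rho>\<close>,
  \<open>2 * \<rho>\<close> and their negatives, with coefficients \<open>\<alpha>\<close>. A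
  coordinate lying in exactly one of the sets carries an odd factor, whose mean is zero.\<close>

lemma sinprod_orthogonal:
  fixes J :: "'j set"
  assumes w: "jgauss J w" and \<rho>: "\<rho> > 0" and AB: "A \<subseteq> J" "A' \<subseteq> J"
  shows "(\<integral>\<omega>. sinprod \<rho> w A \<omega> * sinprod \<rho> w A' \<omega> \<partial>M) = (if A = A' then sinvar \<rho> ^ card A else 0)"
proof -
  have J: "finite J" using w by (simp add: jgauss_def)
  define B where "B = {- 2 * \<rho>, - \<rho>, 0, \<rho>, 2 * \<rho>}"
  define \<alpha> :: "'j \<Rightarrow> real \<Rightarrow> complex" where "\<alpha> a b =
    (if a \<in> A \<and> a \<in> A' then (if b = 0 then 1/2 else if b = 2 * \<rho> \<or> b = - 2 * \<rho> then -1/4 else 0)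
     else if a \<in> A \<or> a \<in> A' then (if b = \<rho> then 1 / (2 * \<i>) else if b = - \<rho> then - 1 / (2 * \<i>) else 0)
     else (if b = 0 then 1 else 0))" for a b
  \<comment> \<open>Positivity of \<open>\<rho>\<close> separates the five frequencies, so that
    summation over \<open>B\<close> does not merge coefficients.\<close>
  have dist: "- 2 * \<rho> \<noteq> - \<rho>" "- 2 * \<rho> \<noteq> 0" "- 2 * \<rho> \<noteq> \<rho>" "- 2 * \<rho> \<noteq> 2 * \<rho>" "- \<rho> \<noteq> 0" "- \<rho> \<noteq> \<rho>" "- \<rho> \<noteq> 2 * \<rho>"
    "0 \<noteq> \<rho>" "0 \<noteq> 2 * \<rho>" "\<rho> \<noteq> 2 * \<rho>" using \<rho> by auto
  have sumB: "(\<Sum>b\<in>B. h b) = h (- 2 * \<rho>) + h (- \<rho>) + h 0 + h \<rho> + h (2 * \<rho>)" for h :: "real \<Rightarrow> complex"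
    unfolding B_def using dist by (simp add: add.assoc)
  have sn: "complex_of_real (sin y) = 1 / (2 * \<i>) * exp (\<i> * complex_of_real y) - 1 / (2 * \<i>) * exp (\<i> * complex_of_real (- y))" for y
    unfolding sin_of_real[symmetric] sin_exp_eq by (simp add: field_simps)
  have sn2: "complex_of_real (sin y) * complex_of_real (sin y) = 1/2 - 1/4 * exp (\<i> * complex_of_real (2 * y)) - 1/4 * exp (\<i> * complex_of_real (- 2 * y))" for y
  proof -
    have s: "sin y * sin y = 1/2 - cos (2 * y) / 2" by (simp add: cos_double_sin power2_eq_square diff_divide_distrib)
    have c: "complex_of_real (cos z) = (exp (\<i> * complex_of_real z) + exp (\<i> * complex_of_real (- z))) / 2" for z
      unfolding cos_of_real[symmetric] cos_exp_eq by simp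
    show ?thesis unfolding of_real_mult[symmetric] s of_real_diff of_real_divide c by (simp add: field_simps)
  qed
  have fac: "complex_of_real (sinprod \<rho> w A \<omega> * sinprod \<rho> w A' \<omega>)
    = (\<Prod>a\<in>J. \<Sum>b\<in>B. \<alpha> a b * exp (\<i> * complex_of_real (b * w a \<omega>)))" for \<omega>
  proof -
    have "sinprod \<rho> w C \<omega> = (\<Prod>a\<in>J. if a \<in> C then sin (\<rho> * w a \<omega>) else 1)" if "C \<subseteq> J" for C
      unfolding sinprod_def using J that by (simp add: prod.inter_restrict[symmetric] Int_absorb1)
    hence "complex_of_real (sinprod \<rho> w A \<omega> * sinprod \<rho> w A' \<omega>)
      = (\<Prod>a\<in>J. (if a \<in> A then complex_of_real (sin (\<rho> * w a \<omega>)) else 1) * (if a \<in> A' then complex_of_real (sin (\<rho> * w a \<omega>)) else 1))"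
      using AB by (simp add: prod.distrib if_distrib[where f=complex_of_real] cong: if_cong)
    also have "\<dots> = (\<Prod>a\<in>J. \<Sum>b\<in>B. \<alpha> a b * exp (\<i> * complex_of_real (b * w a \<omega>)))"
    proof (intro prod.cong refl)
      fix a
      show "(if a \<in> A then complex_of_real (sin (\<rho> * w a \<omega>)) else 1) * (if a \<in> A' then complex_of_real (sin (\<rho> * w a \<omega>)) else 1)
        = (\<Sum>b\<in>B. \<alpha> a b * exp (\<i> * complex_of_real (b * w a \<omega>)))"
      proof (cases "a \<in> A \<and> a \<in> A'")
        case True
        thus ?thesis unfolding sumB \<alpha>_def using dist by (simp add: sn2 mult.assoc)
      next
        case False
        thus ?thesis unfolding sumB \<alpha>_def using dist
          by (cases "a \<in> A"; cases "a \<in> A'") (simp_all add: sn mult.assoc)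
      qed
    qed
    finally show ?thesis .
  qed
  have val: "(\<Sum>b\<in>B. \<alpha> a b * complex_of_real (exp (- b\<^sup>2 / 2)))
    = (if a \<in> A \<and> a \<in> A' then complex_of_real (sinvar \<rho>) else if a \<in> A \<or> a \<in> A' then 0 else 1)" for a
    unfolding sumB \<alpha>_def using dist
    by (cases "a \<in> A"; cases "a \<in> A'") (simp_all add: sinvar_def power_mult_distrib field_simps)
  have "complex_of_real (\<integral>\<omega>. sinprod \<rho> w A \<omega> * sinprod \<rho> w A' \<omega> \<partial>M)
    = (\<Prod>a\<in>J. if a \<in> A \<and> a \<in> A' then complex_of_real (sinvar \<rho>) else if a \<in> A \<or> a \<in> A' then 0 else 1)"
    unfolding integral_complex_of_real[symmetric] fac using jgauss_trig[OF w, of B \<alpha>] val by (simp add: B_def)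
  also have "\<dots> = complex_of_real (if A = A' then sinvar \<rho> ^ card A else 0)"
  proof (cases "A = A'")
    case True
    have "(\<Prod>a\<in>J. if a \<in> A then complex_of_real (sinvar \<rho>) else 1) = (\<Prod>a\<in>A. complex_of_real (sinvar \<rho>))"
      using J AB by (simp add: prod.inter_restrict[symmetric] Int_absorb1)
    thus ?thesis using True by (simp cong: if_cong)
  next
    case False
    then obtain a where "a \<in> A \<union> A'" "\<not> (a \<in> A \<and> a \<in> A')" by blast
    thus ?thesis using False J AB by (auto intro!: prod_zero)
  qed
  finally show ?thesis unfolding of_real_eq_iff .
qed

lemma sinprod_bounded: "\<bar>sinprod \<rho> w A \<omega>\<bar> \<le> 1"
  unfolding sinprod_def abs_prod by (intro prod_le_1) auto

lemma sinprod_measurable: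
  "jgauss J w \<Longrightarrow> A \<subseteq> J \<Longrightarrow> sinprod \<rho> w A \<in> borel_measurable M"
  unfolding sinprod_def[abs_def] jgauss_def by (intro borel_measurable_prod measurable_compose[OF _ borel_measurable_continuous_onI[of sin]] continuous_intros borel_measurable_times) auto

section \<open>Orthogonal families in L2\<close>

definition square_integrable :: "('a \<Rightarrow> real) \<Rightarrow> bool" where
  "square_integrable f \<longleftrightarrow> f \<in> borel_measurable M \<and> integrable M (\<lambda>\<omega>. (f \<omega>)\<^sup>2)"

lemma square_integrable_mult:
  assumes "square_integrable f" "square_integrable h" shows "integrable M (\<lambda>\<omega>. f \<omega> * h \<omega>)"
proof (rule Bochner_Integration.integrable_bound)
  show "integrable M (\<lambda>\<omega>. (f \<omega>)\<^sup>2 + (h \<omega>)\<^sup>2)" using assms by (auto simp: square_integrable_def)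
  show "(\<lambda>\<omega>. f \<omega> * h \<omega>) \<in> borel_measurable M" using assms by (auto simp: square_integrable_def)
  show "AE \<omega> in M. norm (f \<omega> * h \<omega>) \<le> norm ((f \<omega>)\<^sup>2 + (h \<omega>)\<^sup>2)"
  proof (rule AE_I2)
    fix \<omega>
    have "2 * (\<bar>f \<omega>\<bar> * \<bar>h \<omega>\<bar>) \<le> (f \<omega>)\<^sup>2 + (h \<omega>)\<^sup>2"
      using sum_squares_bound[of "\<bar>f \<omega>\<bar>" "\<bar>h \<omega>\<bar>"] by (simp add: mult.assoc)
    moreover have "0 \<le> \<bar>f \<omega>\<bar> * \<bar>h \<omega>\<bar>" by simp
    ultimately have "\<bar>f \<omega>\<bar> * \<bar>h \<omega>\<bar> \<le> (f \<omega>)\<^sup>2 + (h \<omega>)\<^sup>2" by linarith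
    thus "norm (f \<omega> * h \<omega>) \<le> norm ((f \<omega>)\<^sup>2 + (h \<omega>)\<^sup>2)" by (simp add: abs_mult)
  qed
qed

lemma square_integrable_add:
  assumes "square_integrable f" "square_integrable h" shows "square_integrable (\<lambda>\<omega>. f \<omega> + c * h \<omega>)"
proof -
  have "(\<lambda>\<omega>. (f \<omega> + c * h \<omega>)\<^sup>2) = (\<lambda>\<omega>. (f \<omega>)\<^sup>2 + 2 * c * (f \<omega> * h \<omega>) + c\<^sup>2 * (h \<omega>)\<^sup>2)"
    by (auto simp: power2_eq_square algebra_simps)
  thus ?thesis using assms square_integrable_mult[OF assms] by (auto simp: square_integrable_def)
qed

lemma square_integrable_bounded:
  assumes "f \<in> borel_measurable M" "\<And>\<omega>. \<bar>f \<omega>\<bar> \<le> 1" shows "square_integrable f"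
  unfolding square_integrable_def
proof
  show "integrable M (\<lambda>\<omega>. (f \<omega>)\<^sup>2)"
    by (rule integrable_const_bound[where B=1]) (use assms in \<open>auto simp: abs_square_le_1\<close>)
qed (rule assms)

text \<open>Only a common upper bound \<open>\<beta>\<close> for the norms is kept. One notion
  thereby serves the sine products, the linear variables and the errors, which differ just in the
  power of \<open>\<rho>\<close> that they provide.\<close>

definition orthogonal_family :: "'b set \<Rightarrow> ('b \<Rightarrow> 'a \<Rightarrow> real) \<Rightarrow> real \<Rightarrow> bool" where
  "orthogonal_family B \<psi> \<beta> \<longleftrightarrow> finite B \<and> 0 \<le> \<beta> \<and> (\<forall>b\<in>B. square_integrable (\<psi> b) \<and> (\<integral>\<omega>. (\<psi> b \<omega>)\<^sup>2 \<partial>M) \<le> \<beta>\<^sup>2) \<and>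
    (\<forall>b\<in>B. \<forall>b'\<in>B. b \<noteq> b' \<longrightarrow> (\<integral>\<omega>. \<psi> b \<omega> * \<psi> b' \<omega> \<partial>M) = 0)"

lemma orthogonal_bound:
  assumes "orthogonal_family B \<psi> \<beta>"
  shows "integrable M (\<lambda>\<omega>. (cmod (\<Sum>b\<in>B. c b * complex_of_real (\<psi> b \<omega>)))\<^sup>2)"
    "(\<integral>\<omega>. (cmod (\<Sum>b\<in>B. c b * complex_of_real (\<psi> b \<omega>)))\<^sup>2 \<partial>M) \<le> \<beta>\<^sup>2 * (\<Sum>b\<in>B. (cmod (c b))\<^sup>2)"
proof -
  have B: "finite B" and sq: "\<And>b. b \<in> B \<Longrightarrow> square_integrable (\<psi> b)" and le: "\<And>b. b \<in> B \<Longrightarrow> (\<integral>\<omega>. (\<psi> b \<omega>)\<^sup>2 \<partial>M) \<le> \<beta>\<^sup>2"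
    and ort: "\<And>b b'. b \<in> B \<Longrightarrow> b' \<in> B \<Longrightarrow> b \<noteq> b' \<Longrightarrow> (\<integral>\<omega>. \<psi> b \<omega> * \<psi> b' \<omega> \<partial>M) = 0"
    using assms by (auto simp: orthogonal_family_def)
  have e: "(cmod (\<Sum>b\<in>B. c b * complex_of_real (\<psi> b \<omega>)))\<^sup>2 = (\<Sum>b\<in>B. \<Sum>b'\<in>B. Re (c b * cnj (c b')) * (\<psi> b \<omega> * \<psi> b' \<omega>))" for \<omega>
  proof -
    have "complex_of_real ((cmod (\<Sum>b\<in>B. c b * complex_of_real (\<psi> b \<omega>)))\<^sup>2)
      = (\<Sum>b\<in>B. \<Sum>b'\<in>B. (c b * cnj (c b')) * complex_of_real (\<psi> b \<omega> * \<psi> b' \<omega>))"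
      unfolding complex_norm_square cnj_sum sum_product by (intro sum.cong refl) (simp add: mult_ac)
    from arg_cong[OF this, of Re] show ?thesis by (simp add: Re_sum)
  qed
  have int: "integrable M (\<lambda>\<omega>. Re (c b * cnj (c b')) * (\<psi> b \<omega> * \<psi> b' \<omega>))" if "b \<in> B" "b' \<in> B" for b b'
    by (intro integrable_mult_right square_integrable_mult sq that)
  show "integrable M (\<lambda>\<omega>. (cmod (\<Sum>b\<in>B. c b * complex_of_real (\<psi> b \<omega>)))\<^sup>2)"
    unfolding e by (intro Bochner_Integration.integrable_sum int)
  have "(\<integral>\<omega>. (cmod (\<Sum>b\<in>B. c b * complex_of_real (\<psi> b \<omega>)))\<^sup>2 \<partial>M)
    = (\<Sum>b\<in>B. \<Sum>b'\<in>B. \<integral>\<omega>. Re (c b * cnj (c b')) * (\<psi> b \<omega> * \<psi> b' \<omega>) \<partial>M)"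
    unfolding e by (subst Bochner_Integration.integral_sum, intro Bochner_Integration.integrable_sum int, assumption, assumption)
      (intro sum.cong refl Bochner_Integration.integral_sum int)
  also have "\<dots> = (\<Sum>b\<in>B. \<Sum>b'\<in>B. if b = b' then (cmod (c b))\<^sup>2 * (\<integral>\<omega>. (\<psi> b \<omega>)\<^sup>2 \<partial>M) else 0)"
  proof (intro sum.cong refl)
    fix b b' assume b: "b \<in> B" "b' \<in> B"
    have "Re (c b * cnj (c b)) = (cmod (c b))\<^sup>2" by (metis Re_complex_of_real complex_norm_square)
    hence "(\<integral>\<omega>. Re (c b * cnj (c b)) * (\<psi> b \<omega> * \<psi> b \<omega>) \<partial>M) = (cmod (c b))\<^sup>2 * (\<integral>\<omega>. (\<psi> b \<omega>)\<^sup>2 \<partial>M)"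
      by (simp only: power2_eq_square[of "\<psi> b _"] integral_mult_right_zero)
    thus "(\<integral>\<omega>. Re (c b * cnj (c b')) * (\<psi> b \<omega> * \<psi> b' \<omega>) \<partial>M) = (if b = b' then (cmod (c b))\<^sup>2 * (\<integral>\<omega>. (\<psi> b \<omega>)\<^sup>2 \<partial>M) else 0)"
      using ort[OF b] by (cases "b = b'") (simp_all only: if_True if_False integral_mult_right_zero mult_zero_right simp_thms)
  qed
  also have "\<dots> = (\<Sum>b\<in>B. (cmod (c b))\<^sup>2 * (\<integral>\<omega>. (\<psi> b \<omega>)\<^sup>2 \<partial>M))" using B by simp
  also have "\<dots> \<le> (\<Sum>b\<in>B. (cmod (c b))\<^sup>2 * \<beta>\<^sup>2)" by (intro sum_mono mult_left_mono le) auto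
  also have "\<dots> = \<beta>\<^sup>2 * (\<Sum>b\<in>B. (cmod (c b))\<^sup>2)" by (simp add: sum_distrib_left mult.commute)
  finally show "(\<integral>\<omega>. (cmod (\<Sum>b\<in>B. c b * complex_of_real (\<psi> b \<omega>)))\<^sup>2 \<partial>M) \<le> \<beta>\<^sup>2 * (\<Sum>b\<in>B. (cmod (c b))\<^sup>2)" .
qed

text \<open>Every factor contributes a variance of at most \<open>\<rho>^2\<close>, and
  \<open>\<rho> \<le> 1\<close> allows all larger sets to be measured by the smallest cardinality
  \<open>k\<close>.\<close>

lemma sinprod_family:
  assumes w: "jgauss J w" and \<rho>: "\<rho> > 0" "\<rho> \<le> 1" and C: "C \<subseteq> {A. A \<subseteq> J \<and> k \<le> card A}"
  shows "orthogonal_family C (sinprod \<rho> w) (\<rho> ^ k)"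
  unfolding orthogonal_family_def
proof (intro conjI ballI impI)
  have J: "finite J" using w by (simp add: jgauss_def)
  show "finite C" by (rule finite_subset[of _ "Pow J"]) (use C J in auto)
  show "0 \<le> \<rho> ^ k" using \<rho> by simp
  fix A assume A: "A \<in> C"
  hence AJ: "A \<subseteq> J" "k \<le> card A" using C by auto
  show "square_integrable (sinprod \<rho> w A)"
    by (rule square_integrable_bounded[OF sinprod_measurable[OF w AJ(1)] sinprod_bounded])
  have "(\<integral>\<omega>. (sinprod \<rho> w A \<omega>)\<^sup>2 \<partial>M) = sinvar \<rho> ^ card A"
    using sinprod_orthogonal[OF w \<rho>(1) AJ(1,1)] by (simp add: power2_eq_square)
  also have "\<dots> \<le> (\<rho>\<^sup>2) ^ card A" by (intro power_mono sinvar_bounds)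
  also have "\<dots> \<le> (\<rho>\<^sup>2) ^ k" using \<rho> AJ by (intro power_decreasing) (auto simp: power_le_one)
  finally show "(\<integral>\<omega>. (sinprod \<rho> w A \<omega>)\<^sup>2 \<partial>M) \<le> (\<rho> ^ k)\<^sup>2" by (simp add: power_mult[symmetric] mult.commute)
  fix A' assume A': "A' \<in> C" "A \<noteq> A'"
  hence "A' \<subseteq> J" using C by auto
  from sinprod_orthogonal[OF w \<rho>(1) AJ(1) this] A'(2)
  show "(\<integral>\<omega>. sinprod \<rho> w A \<omega> * sinprod \<rho> w A' \<omega> \<partial>M) = 0" by simp
qed

text \<open>The joint characteristic function along the ray through \<open>c\<close> is that of a
  standard normal variable, and characteristic functions determine laws. Moments of single variables
  and covariances are read off from suitable unit vectors \<open>c\<close>.\<close>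

lemma jgauss_normal:
  assumes w: "jgauss J w" and c: "(\<Sum>a\<in>J. (c a)\<^sup>2) = 1"
  shows "distr M borel (\<lambda>\<omega>. \<Sum>a\<in>J. c a * w a \<omega>) = std_normal_distribution"
proof (rule Levy_uniqueness)
  have m: "(\<lambda>\<omega>. \<Sum>a\<in>J. c a * w a \<omega>) \<in> borel_measurable M" by (rule jgaussD(4)[OF w])
  show "real_distribution (distr M borel (\<lambda>\<omega>. \<Sum>a\<in>J. c a * w a \<omega>))" by (rule real_distribution_distr[OF m])
  show "real_distribution std_normal_distribution" by (rule real_dist_normal_dist)
  show "char (distr M borel (\<lambda>\<omega>. \<Sum>a\<in>J. c a * w a \<omega>)) = char std_normal_distribution"
  proof
    fix t
    have "char (distr M borel (\<lambda>\<omega>. \<Sum>a\<in>J. c a * w a \<omega>)) t = (\<integral>\<omega>. exp (\<i> * complex_of_real (\<Sum>a\<in>J. (t * c a) * w a \<omega>)) \<partial>M)"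
      unfolding char_def by (subst integral_distr[OF m]) (auto simp: sum_distrib_left mult.assoc)
    also have "\<dots> = complex_of_real (exp (- (\<Sum>a\<in>J. (t * c a)\<^sup>2) / 2))" by (rule jgaussD(3)[OF w])
    also have "(\<Sum>a\<in>J. (t * c a)\<^sup>2) = t\<^sup>2 * (\<Sum>a\<in>J. (c a)\<^sup>2)" by (simp add: power_mult_distrib sum_distrib_left)
    finally show "char (distr M borel (\<lambda>\<omega>. \<Sum>a\<in>J. c a * w a \<omega>)) t = char std_normal_distribution t"
      by (simp add: c char_std_normal_distribution)
  qed
qed

lemma jgauss_moments:
  assumes w: "jgauss J w" and c: "(\<Sum>a\<in>J. (c a)\<^sup>2) = 1"
  shows "integrable M (\<lambda>\<omega>. (\<Sum>a\<in>J. c a * w a \<omega>) ^ k)"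
    "(\<integral>\<omega>. (\<Sum>a\<in>J. c a * w a \<omega>) ^ 2 \<partial>M) = 1" "(\<integral>\<omega>. (\<Sum>a\<in>J. c a * w a \<omega>) ^ 4 \<partial>M) = 3"
proof -
  have m: "(\<lambda>\<omega>. \<Sum>a\<in>J. c a * w a \<omega>) \<in> borel_measurable M" by (rule jgaussD(4)[OF w])
  have pm: "(\<lambda>x::real. x ^ k) \<in> borel_measurable borel" for k by measurable
  have ir: "integrable std_normal_distribution (\<lambda>x. x ^ k)" for k
    using std_moments(1)[of k] by (simp only: of_real_power[symmetric] complex_of_real_integrable_eq)
  show "integrable M (\<lambda>\<omega>. (\<Sum>a\<in>J. c a * w a \<omega>) ^ k)"
    using ir[of k] unfolding jgauss_normal[OF w c, symmetric] integrable_distr_eq[OF m pm] .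
  have v: "complex_of_real (\<integral>\<omega>. (\<Sum>a\<in>J. c a * w a \<omega>) ^ k \<partial>M) = (\<integral>x. complex_of_real (x ^ k) \<partial>std_normal_distribution)" for k
    unfolding integral_complex_of_real jgauss_normal[OF w c, symmetric] integral_distr[OF m pm] ..
  show "(\<integral>\<omega>. (\<Sum>a\<in>J. c a * w a \<omega>) ^ 2 \<partial>M) = 1" using v[of 2] unfolding std_moments by simp
  have "complex_of_real (\<integral>\<omega>. (\<Sum>a\<in>J. c a * w a \<omega>) ^ 4 \<partial>M) = complex_of_real 3" using v[of 4] unfolding std_moments by simp
  thus "(\<integral>\<omega>. (\<Sum>a\<in>J. c a * w a \<omega>) ^ 4 \<partial>M) = 3" unfolding of_real_eq_iff .
qed

lemma jgauss_single:
  assumes w: "jgauss J w" and a: "a \<in> J"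
  shows "integrable M (\<lambda>\<omega>. (w a \<omega>) ^ k)" "(\<integral>\<omega>. (w a \<omega>) ^ 2 \<partial>M) = 1" "(\<integral>\<omega>. (w a \<omega>) ^ 4 \<partial>M) = 3"
    "square_integrable (w a)"
proof -
  have J: "finite J" using w by (simp add: jgauss_def)
  let ?c = "\<lambda>b. if b = a then 1 else 0 :: real"
  have c: "(\<Sum>b\<in>J. (?c b)\<^sup>2) = 1" using J a by (simp add: if_distrib[where f="\<lambda>x. x\<^sup>2"] cong: if_cong)
  have e: "(\<Sum>b\<in>J. ?c b * w b \<omega>) = w a \<omega>" for \<omega> using J a by (simp add: if_distrib[where f="\<lambda>x. x * _"] cong: if_cong)
  show *: "integrable M (\<lambda>\<omega>. (w a \<omega>) ^ k)" for k using jgauss_moments(1)[OF w c, of k] unfolding e .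
  show "(\<integral>\<omega>. (w a \<omega>) ^ 2 \<partial>M) = 1" using jgauss_moments(2)[OF w c] unfolding e .
  show "(\<integral>\<omega>. (w a \<omega>) ^ 4 \<partial>M) = 3" using jgauss_moments(3)[OF w c] unfolding e .
  show "square_integrable (w a)" unfolding square_integrable_def using *[of 2] w a by (auto simp: jgauss_def)
qed

text \<open>Polarisation: \<open>(w a + w b) / sqrt 2\<close> has variance \<open>1\<close>, as do
  both summands, which leaves nothing for the covariance.\<close>

lemma jgauss_pair:
  assumes w: "jgauss J w" and ab: "a \<in> J" "b \<in> J" "a \<noteq> b"
  shows "(\<integral>\<omega>. w a \<omega> * w b \<omega> \<partial>M) = 0"
proof -
  have J: "finite J" using w by (simp add: jgauss_def)
  let ?c = "\<lambda>x. (if x = a then 1 / sqrt 2 else 0) + (if x = b then 1 / sqrt 2 else 0 :: real)"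
  have "(\<Sum>x\<in>J. (?c x)\<^sup>2) = (\<Sum>x\<in>J. (if x = a then 1/2 else 0) + (if x = b then 1/2 else 0))"
    using ab by (intro sum.cong refl) (auto simp: power_divide)
  also have "\<dots> = 1" using J ab by (simp add: sum.distrib)
  finally have c: "(\<Sum>x\<in>J. (?c x)\<^sup>2) = 1" .
  have e: "(\<Sum>x\<in>J. ?c x * w x \<omega>) = (w a \<omega> + w b \<omega>) / sqrt 2" for \<omega>
    using J ab by (simp add: distrib_right sum.distrib if_distrib[where f="\<lambda>x. x * _"] add_divide_distrib cong: if_cong)
  have "(\<integral>\<omega>. ((w a \<omega> + w b \<omega>) / sqrt 2)\<^sup>2 \<partial>M) = 1" using jgauss_moments(2)[OF w c] unfolding e .
  moreover have "((w a \<omega> + w b \<omega>) / sqrt 2)\<^sup>2 = (w a \<omega>)\<^sup>2 / 2 + (w b \<omega>)\<^sup>2 / 2 + w a \<omega> * w b \<omega>" for \<omega>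
    by (simp add: power_divide power2_sum field_simps)
  moreover have "(\<integral>\<omega>. (w a \<omega>)\<^sup>2 / 2 + (w b \<omega>)\<^sup>2 / 2 + w a \<omega> * w b \<omega> \<partial>M) = 1/2 + 1/2 + (\<integral>\<omega>. w a \<omega> * w b \<omega> \<partial>M)"
    using jgauss_single[OF w ab(1)] jgauss_single[OF w ab(2)] square_integrable_mult by simp
  ultimately show ?thesis by simp
qed

lemma jgauss_family:
  assumes w: "jgauss J w" and "\<rho> \<ge> 0" shows "orthogonal_family J (\<lambda>a \<omega>. \<rho> * w a \<omega>) \<rho>"
  unfolding orthogonal_family_def
proof (intro conjI ballI impI)
  fix a assume a: "a \<in> J"
  show "square_integrable (\<lambda>\<omega>. \<rho> * w a \<omega>)"
    using square_integrable_add[OF square_integrable_bounded[of "\<lambda>_. 0"] jgauss_single(4)[OF w a], of \<rho>] by simp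
  show "(\<integral>\<omega>. (\<rho> * w a \<omega>)\<^sup>2 \<partial>M) \<le> \<rho>\<^sup>2" using jgauss_single(2)[OF w a] by (simp add: power_mult_distrib)
  fix b assume "b \<in> J" "a \<noteq> b"
  from jgauss_pair[OF w a this] show "(\<integral>\<omega>. \<rho> * w a \<omega> * (\<rho> * w b \<omega>) \<partial>M) = 0" by (simp add: mult_ac)
qed (use w assms(2) in \<open>auto simp: jgauss_def\<close>)

text \<open>The second frequency \<open>\<eta>\<close> is free so that it can tend to zero in the
  next lemma.\<close>

lemma jgauss_sin_pair:
  assumes w: "jgauss J w" and ab: "a \<in> J" "b \<in> J" "a \<noteq> b" and \<rho>: "\<rho> > 0"
  shows "(\<integral>\<omega>. sin (\<rho> * w a \<omega>) * sin (\<eta> * w b \<omega>) \<partial>M) = 0"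
proof -
  have J: "finite J" using w by (simp add: jgauss_def)
  have sn: "complex_of_real (sin y) = 1 / (2 * \<i>) * exp (\<i> * complex_of_real y) - 1 / (2 * \<i>) * exp (\<i> * complex_of_real (- y))" for y
    unfolding sin_of_real[symmetric] sin_exp_eq by (simp add: field_simps)
  have ch: "(\<integral>\<omega>. exp (\<i> * complex_of_real (s * w a \<omega> + t * w b \<omega>)) \<partial>M) = complex_of_real (exp (- (s\<^sup>2 + t\<^sup>2) / 2))" for s t
  proof -
    let ?c = "\<lambda>x. (if x = a then s else 0) + (if x = b then t else 0)"
    have "(\<Sum>x\<in>J. (?c x)\<^sup>2) = (\<Sum>x\<in>J. (if x = a then s\<^sup>2 else 0) + (if x = b then t\<^sup>2 else 0))"
      using ab by (intro sum.cong refl) auto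
    also have "\<dots> = s\<^sup>2 + t\<^sup>2" using J ab by (simp add: sum.distrib)
    finally have c: "(\<Sum>x\<in>J. (?c x)\<^sup>2) = s\<^sup>2 + t\<^sup>2" .
    have "(\<Sum>x\<in>J. ?c x * w x \<omega>) = s * w a \<omega> + t * w b \<omega>" for \<omega>
      using J ab by (simp add: distrib_right sum.distrib if_distrib[where f="\<lambda>x. x * _"] cong: if_cong)
    thus ?thesis using jgaussD(3)[OF w, of ?c] unfolding c by simp
  qed
  have wm: "w a \<in> borel_measurable M" "w b \<in> borel_measurable M" using w ab by (auto simp: jgauss_def)
  define E where "E s t \<omega> = exp (\<i> * complex_of_real (s * w a \<omega> + t * w b \<omega>))" for s t \<omega>
  have int: "integrable M (E s t)" for s t
    unfolding E_def[abs_def] by (rule exp_i_integrable) (use wm in measurable)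
  have ch': "(\<integral>\<omega>. E s t \<omega> \<partial>M) = complex_of_real (exp (- (s\<^sup>2 + t\<^sup>2) / 2))" for s t
    unfolding E_def by (rule ch)
  have e: "complex_of_real (sin (\<rho> * w a \<omega>) * sin (\<eta> * w b \<omega>))
    = 1/4 * E \<rho> (- \<eta>) \<omega> + 1/4 * E (- \<rho>) \<eta> \<omega> - 1/4 * E \<rho> \<eta> \<omega> - 1/4 * E (- \<rho>) (- \<eta>) \<omega>" for \<omega>
    unfolding of_real_mult[of "sin _"] sn E_def of_real_add distrib_left exp_add by (simp add: field_simps)
  have "complex_of_real (\<integral>\<omega>. sin (\<rho> * w a \<omega>) * sin (\<eta> * w b \<omega>) \<partial>M) = 0"
    unfolding integral_complex_of_real[symmetric] e using int by (simp add: ch')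
  thus ?thesis unfolding of_real_eq_0_iff .
qed

text \<open>\<open>w b\<close> is the limit of the quotients \<open>sin (h * w b) / h\<close> as
  \<open>h\<close> tends to zero, and these are dominated by the absolute value of
  \<open>w b\<close>.\<close>

lemma jgauss_sin_linear:
  assumes w: "jgauss J w" and ab: "a \<in> J" "b \<in> J" "a \<noteq> b" and \<rho>: "\<rho> > 0"
  shows "(\<integral>\<omega>. sin (\<rho> * w a \<omega>) * w b \<omega> \<partial>M) = 0"
proof (rule LIMSEQ_unique)
  have [measurable]: "w a \<in> borel_measurable M" "w b \<in> borel_measurable M" using w ab by (auto simp: jgauss_def)
  let ?f = "\<lambda>n \<omega>. sin (\<rho> * w a \<omega>) * (sin (1 / real (Suc n) * w b \<omega>) * real (Suc n))"
  show "(\<lambda>n. \<integral>\<omega>. ?f n \<omega> \<partial>M) \<longlonglongrightarrow> (\<integral>\<omega>. sin (\<rho> * w a \<omega>) * w b \<omega> \<partial>M)"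
  proof (rule integral_dominated_convergence[where w="\<lambda>\<omega>. \<bar>w b \<omega>\<bar>"])
    show "integrable M (\<lambda>\<omega>. \<bar>w b \<omega>\<bar>)" using jgauss_single(1)[OF w ab(2), of 1] by simp
    show "AE \<omega> in M. (\<lambda>n. ?f n \<omega>) \<longlonglongrightarrow> sin (\<rho> * w a \<omega>) * w b \<omega>"
    proof (rule AE_I2, rule tendsto_mult[OF tendsto_const])
      fix \<omega>
      have "((\<lambda>h. (sin (h * w b \<omega>) - sin (0 * w b \<omega>)) / h) \<longlongrightarrow> w b \<omega>) (at 0)"
      proof -
        have "((\<lambda>h. sin (h * w b \<omega>)) has_field_derivative w b \<omega>) (at 0)"
          by (auto intro!: derivative_eq_intros)
        thus ?thesis unfolding has_field_derivative_def[symmetric] DERIV_def by simp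
      qed
      moreover have "filterlim (\<lambda>n. 1 / real (Suc n)) (at 0) sequentially"
        unfolding filterlim_at using lim_inverse_n' LIMSEQ_Suc[OF lim_1_over_n] by auto
      ultimately have "(\<lambda>n. (sin (1 / real (Suc n) * w b \<omega>) - sin (0 * w b \<omega>)) / (1 / real (Suc n))) \<longlonglongrightarrow> w b \<omega>"
        by (rule filterlim_compose)
      thus "(\<lambda>n. sin (1 / real (Suc n) * w b \<omega>) * real (Suc n)) \<longlonglongrightarrow> w b \<omega>" by simp
    qed
    fix n
    show "AE \<omega> in M. norm (?f n \<omega>) \<le> \<bar>w b \<omega>\<bar>"
    proof (rule AE_I2)
      fix \<omega>
      have "\<bar>sin (1 / real (Suc n) * w b \<omega>)\<bar> \<le> \<bar>1 / real (Suc n) * w b \<omega>\<bar>" by (rule abs_sin_x_le_abs_x)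
      hence "\<bar>sin (1 / real (Suc n) * w b \<omega>)\<bar> * real (Suc n) \<le> \<bar>w b \<omega>\<bar>" by (simp add: abs_mult field_simps)
      hence "\<bar>sin (\<rho> * w a \<omega>)\<bar> * (\<bar>sin (1 / real (Suc n) * w b \<omega>)\<bar> * real (Suc n)) \<le> 1 * \<bar>w b \<omega>\<bar>"
        by (intro mult_mono) auto
      thus "norm (?f n \<omega>) \<le> \<bar>w b \<omega>\<bar>" by (simp add: abs_mult)
    qed
  qed measurable
  have "(\<integral>\<omega>. ?f n \<omega> \<partial>M) = 0" for n
    using jgauss_sin_pair[OF w ab \<rho>, of "1 / real (Suc n)"] by (simp add: mult.assoc[symmetric])
  thus "(\<lambda>n. \<integral>\<omega>. ?f n \<omega> \<partial>M) \<longlonglongrightarrow> 0" by simp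
qed

text \<open>The error is at most \<open>y^2 / 2\<close> at \<open>y = \<rho> x\<close>, and the
  fourth moment \<open>3\<close> yields the squared norm \<open>3/4 * \<rho>^4\<close> as a bound.
  Compared with the sine this gains one power of \<open>\<rho>\<close>, the gain that makes
  leftovers smaller than the main term.\<close>

lemma sinrem_family:
  assumes w: "jgauss J w" and \<rho>: "\<rho> > 0"
  shows "orthogonal_family J (sinrem \<rho> w) (\<rho>\<^sup>2)"
  unfolding orthogonal_family_def
proof (intro conjI ballI impI)
  have sq: "square_integrable (\<lambda>\<omega>. sin (\<rho> * w a \<omega>))" if "a \<in> J" for a
    by (rule square_integrable_bounded) (use w that in \<open>auto simp: jgauss_def\<close>)
  have mi: "integrable M (\<lambda>\<omega>. sin (\<rho> * w a \<omega>) * sin (\<rho> * w b \<omega>))" "integrable M (\<lambda>\<omega>. sin (\<rho> * w a \<omega>) * w b \<omega>)"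
    "integrable M (\<lambda>\<omega>. w a \<omega> * sin (\<rho> * w b \<omega>))" "integrable M (\<lambda>\<omega>. w a \<omega> * w b \<omega>)" if "a \<in> J" "b \<in> J" for a b
    using square_integrable_mult sq jgauss_single(4)[OF w] that by blast+
  fix a assume a: "a \<in> J"
  show si: "square_integrable (sinrem \<rho> w a)"
    using square_integrable_add[OF sq[OF a] jgauss_single(4)[OF w a], of "- \<rho>"] unfolding sinrem_def[abs_def] by simp
  have "(\<integral>\<omega>. (sinrem \<rho> w a \<omega>)\<^sup>2 \<partial>M) \<le> (\<integral>\<omega>. \<rho>^4 / 4 * (w a \<omega>)^4 \<partial>M)"
  proof (rule integral_mono)
    show "integrable M (\<lambda>\<omega>. (sinrem \<rho> w a \<omega>)\<^sup>2)" using si by (simp add: square_integrable_def)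
    show "integrable M (\<lambda>\<omega>. \<rho>^4 / 4 * (w a \<omega>)^4)" using jgauss_single(1)[OF w a, of 4] by simp
    fix \<omega>
    have "\<bar>sin (\<rho> * w a \<omega>) - \<rho> * w a \<omega>\<bar> \<le> (\<rho> * w a \<omega>)\<^sup>2 / 2"
      using Maclaurin_sin_bound[of "\<rho> * w a \<omega>" 2] by (simp add: sin_coeff_def numeral_2_eq_2)
    hence "(sinrem \<rho> w a \<omega>)\<^sup>2 \<le> ((\<rho> * w a \<omega>)\<^sup>2 / 2)\<^sup>2" unfolding sinrem_def
      by (metis abs_ge_zero power2_abs power_mono)
    thus "(sinrem \<rho> w a \<omega>)\<^sup>2 \<le> \<rho>^4 / 4 * (w a \<omega>)^4" by (simp add: power_divide power_mult_distrib)
  qed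
  also have "\<dots> = \<rho>^4 * (3/4)" using jgauss_single(3)[OF w a] by simp
  also have "\<dots> \<le> \<rho>^4" using \<rho> by simp
  finally show "(\<integral>\<omega>. (sinrem \<rho> w a \<omega>)\<^sup>2 \<partial>M) \<le> (\<rho>\<^sup>2)\<^sup>2" by simp
  fix b assume b: "b \<in> J" "a \<noteq> b"
  have "(\<integral>\<omega>. sinrem \<rho> w a \<omega> * sinrem \<rho> w b \<omega> \<partial>M) = (\<integral>\<omega>. sin (\<rho> * w a \<omega>) * sin (\<rho> * w b \<omega>)
      - \<rho> * (sin (\<rho> * w a \<omega>) * w b \<omega>) - \<rho> * (w a \<omega> * sin (\<rho> * w b \<omega>)) + \<rho>\<^sup>2 * (w a \<omega> * w b \<omega>) \<partial>M)"
    by (intro Bochner_Integration.integral_cong refl) (simp add: sinrem_def algebra_simps power2_eq_square)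
  also have "\<dots> = (\<integral>\<omega>. sin (\<rho> * w a \<omega>) * sin (\<rho> * w b \<omega>) \<partial>M) - \<rho> * (\<integral>\<omega>. sin (\<rho> * w a \<omega>) * w b \<omega> \<partial>M)
      - \<rho> * (\<integral>\<omega>. w a \<omega> * sin (\<rho> * w b \<omega>) \<partial>M) + \<rho>\<^sup>2 * (\<integral>\<omega>. w a \<omega> * w b \<omega> \<partial>M)"
    using mi[OF a b(1)] by simp
  also have "(\<integral>\<omega>. w a \<omega> * sin (\<rho> * w b \<omega>) \<partial>M) = 0"
    using jgauss_sin_linear[OF w b(1) a _ \<rho>] b(2) by (simp add: mult.commute)
  finally show "(\<integral>\<omega>. sinrem \<rho> w a \<omega> * sinrem \<rho> w b \<omega> \<partial>M) = 0"
    using jgauss_sin_pair[OF w a b \<rho>, of \<rho>] jgauss_sin_linear[OF w a b \<rho>] jgauss_pair[OF w a b] by simp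
qed (use w in \<open>auto simp: jgauss_def\<close>)

end

context cgauss_family
begin

text \<open>Orthonormal rows preserve the squared length of coefficient vectors. A real combination
  of the normalised parts is the real part of a complex combination of the
  \<open>\<gamma> a\<close>, and the normalisation \<open>sqrt 2\<close> doubles its squared length,
  so that the factor \<open>1/4\<close> of the complex characteristic function becomes
  \<open>1/2\<close>.\<close>

lemma unitary_image_jgauss:
  fixes U :: "'k \<Rightarrow> 'i \<Rightarrow> complex"
  assumes F: "finite F" "F \<subseteq> I" and K: "finite K"
    and U: "\<And>b b'. b \<in> K \<Longrightarrow> b' \<in> K \<Longrightarrow> (\<Sum>a\<in>F. U b a * cnj (U b' a)) = (if b = b' then 1 else 0)"
  defines "W \<equiv> \<lambda>b \<omega>. \<Sum>a\<in>F. U b a * \<gamma> a \<omega>"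
  shows "jgauss (K \<times> UNIV) (\<lambda>(b, r) \<omega>. sqrt 2 * (if r then Re (W b \<omega>) else Im (W b \<omega>)))"
  unfolding jgauss_def
proof (intro conjI ballI allI)
  have gm: "\<And>a. a \<in> F \<Longrightarrow> \<gamma> a \<in> borel_measurable P" using gamma_measurable F by blast
  have Wm: "W b \<in> borel_measurable P" for b unfolding W_def using gm by measurable
  show "finite (K \<times> (UNIV :: bool set))" using K by simp
  show "(case a of (b, r) \<Rightarrow> \<lambda>\<omega>. sqrt 2 * (if r then Re (W b \<omega>) else Im (W b \<omega>))) \<in> borel_measurable P" for a
    using Wm by (cases a) (auto split: if_splits)
  fix c :: "'k \<times> bool \<Rightarrow> real"
  \<comment> \<open>The real part of \<open>E b * W\<close> is
    \<open>c (b, True) * Re W + c (b, False) * Im W\<close>.\<close>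
  define E where "E b = Complex (c (b, True)) (- c (b, False))" for b
  define e where "e a = complex_of_real (sqrt 2) * (\<Sum>b\<in>K. E b * U b a)" for a
  have s: "(\<Sum>x\<in>K \<times> UNIV. c x * (case x of (b, r) \<Rightarrow> \<lambda>\<omega>. sqrt 2 * (if r then Re (W b \<omega>) else Im (W b \<omega>))) \<omega>) = (\<Sum>a\<in>F. Re (e a * \<gamma> a \<omega>))" for \<omega>
  proof -
    have "(\<Sum>x\<in>K \<times> UNIV. c x * (case x of (b, r) \<Rightarrow> \<lambda>\<omega>. sqrt 2 * (if r then Re (W b \<omega>) else Im (W b \<omega>))) \<omega>)
      = (\<Sum>b\<in>K. Re (complex_of_real (sqrt 2) * (E b * W b \<omega>)))"
      by (subst sum.cartesian_product') (simp add: UNIV_bool E_def algebra_simps)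
    also have "\<dots> = Re (\<Sum>b\<in>K. \<Sum>a\<in>F. complex_of_real (sqrt 2) * (E b * U b a * \<gamma> a \<omega>))"
      unfolding W_def Re_sum[symmetric] by (simp add: sum_distrib_left mult.assoc)
    also have "(\<Sum>b\<in>K. \<Sum>a\<in>F. complex_of_real (sqrt 2) * (E b * U b a * \<gamma> a \<omega>)) = (\<Sum>a\<in>F. e a * \<gamma> a \<omega>)"
      unfolding e_def by (subst sum.swap) (simp add: sum_distrib_left sum_distrib_right mult.assoc)
    finally show ?thesis by simp
  qed
  have e2: "(\<Sum>a\<in>F. (cmod (e a))\<^sup>2) = 2 * (\<Sum>x\<in>K \<times> UNIV. (c x)\<^sup>2)"
  proof -
    have "complex_of_real (\<Sum>a\<in>F. (cmod (e a))\<^sup>2) = (\<Sum>a\<in>F. 2 * ((\<Sum>b\<in>K. E b * U b a) * (\<Sum>b'\<in>K. cnj (E b') * cnj (U b' a))))"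
    proof -
      have "complex_of_real ((cmod (e a))\<^sup>2) = 2 * ((\<Sum>b\<in>K. E b * U b a) * (\<Sum>b'\<in>K. cnj (E b') * cnj (U b' a)))" for a
      proof -
        have r2: "complex_of_real (sqrt 2) * complex_of_real (sqrt 2) = 2" by (simp flip: of_real_mult)
        have "complex_of_real ((cmod (e a))\<^sup>2) = (complex_of_real (sqrt 2) * complex_of_real (sqrt 2)) * ((\<Sum>b\<in>K. E b * U b a) * cnj (\<Sum>b\<in>K. E b * U b a))"
          unfolding complex_norm_square e_def complex_cnj_mult complex_cnj_complex_of_real by (simp only: mult_ac)
        thus ?thesis unfolding r2 by simp
      qed
      thus ?thesis by simp
    qed
    also have "\<dots> = 2 * (\<Sum>b\<in>K. \<Sum>b'\<in>K. E b * cnj (E b') * (\<Sum>a\<in>F. U b a * cnj (U b' a)))"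
    proof -
      have "(\<Sum>a\<in>F. (\<Sum>b\<in>K. E b * U b a) * (\<Sum>b'\<in>K. cnj (E b') * cnj (U b' a))) = (\<Sum>a\<in>F. \<Sum>b\<in>K. \<Sum>b'\<in>K. E b * cnj (E b') * (U b a * cnj (U b' a)))"
        unfolding sum_product by (intro sum.cong refl) (simp only: mult_ac)
      also have "\<dots> = (\<Sum>b\<in>K. \<Sum>a\<in>F. \<Sum>b'\<in>K. E b * cnj (E b') * (U b a * cnj (U b' a)))" by (rule sum.swap)
      also have "\<dots> = (\<Sum>b\<in>K. \<Sum>b'\<in>K. \<Sum>a\<in>F. E b * cnj (E b') * (U b a * cnj (U b' a)))" by (intro sum.cong refl sum.swap)
      finally show ?thesis by (simp only: sum_distrib_left[symmetric])
    qed
    also have "\<dots> = 2 * (\<Sum>b\<in>K. \<Sum>b'\<in>K. if b' = b then E b * cnj (E b) else 0)"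
      by (intro arg_cong[where f="\<lambda>x. 2 * x"] sum.cong refl) (auto simp: U)
    also have "\<dots> = 2 * (\<Sum>b\<in>K. E b * cnj (E b))" using K by simp
    also have "\<dots> = complex_of_real (2 * (\<Sum>b\<in>K. (c (b, True))\<^sup>2 + (c (b, False))\<^sup>2))"
      by (simp add: E_def complex_eq_iff power2_eq_square)
    also have "(\<Sum>b\<in>K. (c (b, True))\<^sup>2 + (c (b, False))\<^sup>2) = (\<Sum>x\<in>K \<times> UNIV. (c x)\<^sup>2)"
      by (subst sum.cartesian_product') (simp add: UNIV_bool add.commute)
    finally show ?thesis unfolding of_real_eq_iff .
  qed
  have hm: "(\<lambda>z. exp (\<i> * complex_of_real (Re (e a * z)))) \<in> borel_measurable borel" for a
    by (intro borel_measurable_continuous_onI continuous_intros)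
  have "(\<integral>\<omega>. exp (\<i> * complex_of_real (\<Sum>a\<in>F. Re (e a * \<gamma> a \<omega>))) \<partial>P) = (\<integral>\<omega>. (\<Prod>a\<in>F. exp (\<i> * complex_of_real (Re (e a * \<gamma> a \<omega>)))) \<partial>P)"
    unfolding of_real_sum sum_distrib_left exp_sum[OF F(1)] ..
  also have "\<dots> = (\<Prod>a\<in>F. \<integral>\<omega>. exp (\<i> * complex_of_real (Re (e a * \<gamma> a \<omega>))) \<partial>P)"
    by (rule indep_prod(1)[OF F hm]) (rule exp_i_integrable, use gm in measurable)
  also have "\<dots> = (\<Prod>a\<in>F. complex_of_real (exp (- ((cmod (e a))\<^sup>2) / 4)))"
    by (intro prod.cong refl complex_gaussian_char gauss) (use F in blast)
  also have "\<dots> = complex_of_real (exp (\<Sum>a\<in>F. - ((cmod (e a))\<^sup>2) / 4))" by (simp add: exp_sum[OF F(1)])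
  also have "(\<Sum>a\<in>F. - ((cmod (e a))\<^sup>2) / 4) = - (\<Sum>x\<in>K \<times> UNIV. (c x)\<^sup>2) / 2"
    using e2 by (simp add: sum_negf sum_divide_distrib[symmetric])
  finally show "(\<integral>\<omega>. exp (\<i> * complex_of_real (\<Sum>x\<in>K \<times> UNIV. c x * (case x of (b, r) \<Rightarrow> \<lambda>\<omega>. sqrt 2 * (if r then Re (W b \<omega>) else Im (W b \<omega>))) \<omega>)) \<partial>P)
    = complex_of_real (exp (- (\<Sum>x\<in>K \<times> UNIV. (c x)\<^sup>2) / 2))" unfolding s .
qed

end

section \<open>Random trace norms\<close>

lemma continuous_map_mult_complex:
  fixes f h :: "'a \<Rightarrow> complex"
  shows "continuous_map X euclidean f \<Longrightarrow> continuous_map X euclidean h \<Longrightarrow> continuous_map X euclidean (\<lambda>x. f x * h x)"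
  by (simp add: continuous_map_atin tendsto_mult)

context compact_haar
begin

lemma continuous_bound:
  assumes "continuous_map T euclidean (f :: 'a \<Rightarrow> complex)"
  shows "\<exists>B. \<forall>t\<in>carrier G. cmod (f t) \<le> B"
  using bdd_continuous[OF assms] by (auto simp: bdd_above_def)

lemma continuous_comb:
  assumes "finite K" "\<And>k. k \<in> K \<Longrightarrow> continuous_map T euclidean (f k)"
  shows "continuous_map T euclidean (\<lambda>t. \<Sum>k\<in>K. (c k :: complex) * f k t)"
  using assms by (intro continuous_map_sum continuous_map_mult_complex continuous_map_const[THEN iffD2]) auto

lemma supnorm_nonneg: "bdd_above ((\<lambda>t. cmod (f t)) ` carrier G) \<Longrightarrow> 0 \<le> supnorm f"
  using supnorm_upper[OF _ one_closed] norm_ge_zero order_trans by blast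

lemma supnorm_add:
  assumes "bdd_above ((\<lambda>t. cmod (f t)) ` carrier G)" "bdd_above ((\<lambda>t. cmod (h t)) ` carrier G)"
  shows "supnorm (\<lambda>t. f t + h t) \<le> supnorm f + supnorm h"
  by (rule supnorm_least) (rule order_trans[OF norm_triangle_ineq], intro add_mono supnorm_upper assms)

lemma supnorm_scale:
  assumes "bdd_above ((\<lambda>t. cmod (f t)) ` carrier G)"
  shows "supnorm (\<lambda>t. c * f t) = cmod c * supnorm f"
proof (cases "c = 0")
  case True thus ?thesis using cSUP_const[OF carrier_nonempty, of "0::real"] by (simp add: supnorm_def)
next
  case False
  have b: "bdd_above ((\<lambda>t. cmod (c * f t)) ` carrier G)"
  proof -
    obtain B where "\<And>t. t \<in> carrier G \<Longrightarrow> cmod (f t) \<le> B" using assms by (auto simp: bdd_above_def)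
    thus ?thesis by (intro bdd_aboveI2[where M="cmod c * B"]) (simp add: norm_mult mult_left_mono)
  qed
  have "supnorm (\<lambda>t. c * f t) \<le> cmod c * supnorm f"
    by (rule supnorm_least) (simp add: norm_mult mult_left_mono supnorm_upper[OF assms])
  moreover have "supnorm f \<le> supnorm (\<lambda>t. c * f t) / cmod c"
  proof (rule supnorm_least)
    fix t assume "t \<in> carrier G"
    from supnorm_upper[OF b this] show "cmod (f t) \<le> supnorm (\<lambda>t. c * f t) / cmod c"
      using False by (simp add: norm_mult field_simps)
  qed
  ultimately show ?thesis using False by (simp add: field_simps)
qed

text \<open>The supremum may be taken over a countable subset, since the points \<open>(f\<^sub>k(t))\<^sub>k\<close> form a
  separable set.\<close>

lemma supnorm_measurable:
  assumes K: "finite K" and a: "\<And>k. k \<in> K \<Longrightarrow> a k \<in> borel_measurable N"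
    and f: "\<And>k. k \<in> K \<Longrightarrow> continuous_map T euclidean (f k)"
  shows "(\<lambda>\<omega>. supnorm (\<lambda>t. \<Sum>k\<in>K. a k \<omega> * f k t)) \<in> borel_measurable N"
proof -
  \<comment> \<open>Enumerating \<open>K\<close> turns the value vectors into functions on
    \<open>nat\<close>, a second countable space, where every subset has a countable dense
    part.\<close>
  obtain h where h: "bij_betw h {..<card K} K" using ex_bij_betw_nat_finite[OF K] by (auto simp: atLeast0LessThan)
  define v where "v t i = (if i < card K then f (h i) t else 0)" for t and i :: nat
  obtain V where V: "countable V" "V \<subseteq> v ` carrier G" "v ` carrier G \<subseteq> closure V"
    using separable[of "v ` carrier G"] by metis
  obtain D where D: "countable D" "D \<subseteq> carrier G" "V = v ` D"
    using V(1,2) by (metis countable_subset_image)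
  have bd: "bdd_above ((\<lambda>t. cmod (\<Sum>k\<in>K. a k \<omega> * f k t)) ` carrier G)" for \<omega>
    by (rule bdd_continuous[OF continuous_comb[OF K f]])
  have Dne: "D \<noteq> {}" using V(3) D(3) carrier_nonempty by auto
  have L: "(\<Sum>k\<in>K. a k \<omega> * f k t) = (\<Sum>i<card K. a (h i) \<omega> * v t i)" for \<omega> t
    using sum.reindex_bij_betw[OF h, of "\<lambda>k. a k \<omega> * f k t"] by (simp add: v_def)
  have eq: "supnorm (\<lambda>t. \<Sum>k\<in>K. a k \<omega> * f k t) = (SUP t\<in>D. cmod (\<Sum>k\<in>K. a k \<omega> * f k t))" for \<omega>
  proof (rule antisym)
    have bdD: "bdd_above ((\<lambda>t. cmod (\<Sum>k\<in>K. a k \<omega> * f k t)) ` D)" by (rule bdd_above_mono[OF bd]) (use D(2) in blast)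
    show "supnorm (\<lambda>t. \<Sum>k\<in>K. a k \<omega> * f k t) \<le> (SUP t\<in>D. cmod (\<Sum>k\<in>K. a k \<omega> * f k t))" (is "_ \<le> ?s")
    proof (rule supnorm_least)
      fix t assume t: "t \<in> carrier G"
      have "continuous_on UNIV (\<lambda>x :: nat \<Rightarrow> complex. cmod (\<Sum>i<card K. a (h i) \<omega> * x i))"
        by (intro continuous_intros continuous_on_product_coordinates)
      hence "closed {x :: nat \<Rightarrow> complex. cmod (\<Sum>i<card K. a (h i) \<omega> * x i) \<le> ?s}"
        by (intro closed_Collect_le) auto
      moreover have "V \<subseteq> {x. cmod (\<Sum>i<card K. a (h i) \<omega> * x i) \<le> ?s}"
      proof
        fix x assume "x \<in> V"
        then obtain s where s: "s \<in> D" "x = v s" using D(3) by blast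
        have "cmod (\<Sum>k\<in>K. a k \<omega> * f k s) \<le> ?s" by (rule cSUP_upper[OF s(1) bdD])
        thus "x \<in> {x. cmod (\<Sum>i<card K. a (h i) \<omega> * x i) \<le> ?s}" unfolding L s(2) by simp
      qed
      ultimately have "closure V \<subseteq> {x. cmod (\<Sum>i<card K. a (h i) \<omega> * x i) \<le> ?s}" by (rule closure_minimal[rotated])
      hence "v t \<in> {x. cmod (\<Sum>i<card K. a (h i) \<omega> * x i) \<le> ?s}" using V(3) t by blast
      thus "cmod (\<Sum>k\<in>K. a k \<omega> * f k t) \<le> ?s" unfolding L by simp
    qed
    show "?s \<le> supnorm (\<lambda>t. \<Sum>k\<in>K. a k \<omega> * f k t)"
      unfolding supnorm_def by (rule cSUP_subset_mono[OF Dne bd D(2)]) simp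
  qed
  show ?thesis unfolding eq
  proof (rule borel_measurable_cSUP[OF D(1)])
    show "(\<lambda>\<omega>. cmod (\<Sum>k\<in>K. a k \<omega> * f k t)) \<in> borel_measurable N" for t
      using a by (intro measurable_compose[OF _ borel_measurable_norm] borel_measurable_sum borel_measurable_times) auto
    show "bdd_above ((\<lambda>t. cmod (\<Sum>k\<in>K. a k \<omega> * f k t)) ` D)" for \<omega>
      by (rule bdd_above_mono[OF bd]) (use D(2) in blast)
  qed
qed

lemma supnorm_integrable:
  assumes K: "finite K" and a: "\<And>k. k \<in> K \<Longrightarrow> integrable N (a k)"
    and f: "\<And>k. k \<in> K \<Longrightarrow> continuous_map T euclidean (f k)"
  shows "integrable N (\<lambda>\<omega>. supnorm (\<lambda>t. \<Sum>k\<in>K. a k \<omega> * f k t))"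
proof -
  have "\<exists>B. \<forall>k\<in>K. \<forall>t\<in>carrier G. cmod (f k t) \<le> B k"
    using continuous_bound[OF f] by (intro bchoice) blast
  then obtain B where B: "\<And>k t. k \<in> K \<Longrightarrow> t \<in> carrier G \<Longrightarrow> cmod (f k t) \<le> B k" by blast
  show ?thesis
  proof (rule Bochner_Integration.integrable_bound)
    show "integrable N (\<lambda>\<omega>. \<Sum>k\<in>K. cmod (a k \<omega>) * B k)"
      using a by (intro Bochner_Integration.integrable_sum integrable_mult_left integrable_norm)
    show "(\<lambda>\<omega>. supnorm (\<lambda>t. \<Sum>k\<in>K. a k \<omega> * f k t)) \<in> borel_measurable N"
      by (rule supnorm_measurable[OF K _ f]) (use a in auto)
    show "AE \<omega> in N. norm (supnorm (\<lambda>t. \<Sum>k\<in>K. a k \<omega> * f k t)) \<le> norm (\<Sum>k\<in>K. cmod (a k \<omega>) * B k)"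
    proof (rule AE_I2)
      fix \<omega>
      have "0 \<le> supnorm (\<lambda>t. \<Sum>k\<in>K. a k \<omega> * f k t)"
        by (rule supnorm_nonneg[OF bdd_continuous[OF continuous_comb[OF K f]]])
      moreover have "supnorm (\<lambda>t. \<Sum>k\<in>K. a k \<omega> * f k t) \<le> (\<Sum>k\<in>K. cmod (a k \<omega>) * B k)"
      proof (rule supnorm_least)
        fix t assume t: "t \<in> carrier G"
        have "cmod (\<Sum>k\<in>K. a k \<omega> * f k t) \<le> (\<Sum>k\<in>K. cmod (a k \<omega> * f k t))" by (rule norm_sum)
        also have "\<dots> \<le> (\<Sum>k\<in>K. cmod (a k \<omega>) * B k)"
          by (intro sum_mono) (simp add: norm_mult mult_left_mono B t)
        finally show "cmod (\<Sum>k\<in>K. a k \<omega> * f k t) \<le> (\<Sum>k\<in>K. cmod (a k \<omega>) * B k)" .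
      qed
      ultimately show "norm (supnorm (\<lambda>t. \<Sum>k\<in>K. a k \<omega> * f k t)) \<le> norm (\<Sum>k\<in>K. cmod (a k \<omega>) * B k)" by simp
    qed
  qed
qed

text \<open>The L1 norm of a random continuous function, read as a function of its coefficients
  \<open>c\<close>. It is merely a seminorm, as the functions combined may be linearly
  dependent.\<close>

lemma supnorm_seminorm:
  assumes K: "finite K" and a: "\<And>k. k \<in> K \<Longrightarrow> integrable N (a k)"
    and f: "\<And>k. k \<in> K \<Longrightarrow> continuous_map T euclidean (f k)"
  shows "is_seminorm (\<lambda>c. \<integral>\<omega>. supnorm (\<lambda>t. \<Sum>k\<in>K. (c k * a k \<omega>) * f k t) \<partial>N)"
  unfolding is_seminorm_def
proof (intro conjI allI)
  have i: "integrable N (\<lambda>\<omega>. supnorm (\<lambda>t. \<Sum>k\<in>K. (c k * a k \<omega>) * f k t))" for c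
    by (rule supnorm_integrable[OF K _ f]) (use a in auto)
  have b: "bdd_above ((\<lambda>t. cmod (\<Sum>k\<in>K. (c k * a k \<omega>) * f k t)) ` carrier G)" for c \<omega>
    by (rule bdd_continuous[OF continuous_comb[OF K f]])
  fix u v :: "'b \<Rightarrow> complex"
  have "(\<integral>\<omega>. supnorm (\<lambda>t. \<Sum>k\<in>K. ((u k + v k) * a k \<omega>) * f k t) \<partial>N)
    \<le> (\<integral>\<omega>. supnorm (\<lambda>t. \<Sum>k\<in>K. (u k * a k \<omega>) * f k t) + supnorm (\<lambda>t. \<Sum>k\<in>K. (v k * a k \<omega>) * f k t) \<partial>N)"
  proof (rule integral_mono[OF i Bochner_Integration.integrable_add[OF i i]])
    fix \<omega>
    show "supnorm (\<lambda>t. \<Sum>k\<in>K. ((u k + v k) * a k \<omega>) * f k t)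
      \<le> supnorm (\<lambda>t. \<Sum>k\<in>K. (u k * a k \<omega>) * f k t) + supnorm (\<lambda>t. \<Sum>k\<in>K. (v k * a k \<omega>) * f k t)"
      using supnorm_add[OF b b] by (simp add: distrib_right sum.distrib)
  qed
  thus "(\<integral>\<omega>. supnorm (\<lambda>t. \<Sum>k\<in>K. ((u k + v k) * a k \<omega>) * f k t) \<partial>N)
    \<le> (\<integral>\<omega>. supnorm (\<lambda>t. \<Sum>k\<in>K. (u k * a k \<omega>) * f k t) \<partial>N) + (\<integral>\<omega>. supnorm (\<lambda>t. \<Sum>k\<in>K. (v k * a k \<omega>) * f k t) \<partial>N)"
    using i by simp
  fix c :: complex
  have "supnorm (\<lambda>t. \<Sum>k\<in>K. (c * u k * a k \<omega>) * f k t) = cmod c * supnorm (\<lambda>t. \<Sum>k\<in>K. (u k * a k \<omega>) * f k t)" for \<omega>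
    using supnorm_scale[OF b, of c u \<omega>] by (simp add: sum_distrib_left mult.assoc)
  thus "(\<integral>\<omega>. supnorm (\<lambda>t. \<Sum>k\<in>K. (c * u k * a k \<omega>) * f k t) \<partial>N) = cmod c * (\<integral>\<omega>. supnorm (\<lambda>t. \<Sum>k\<in>K. (u k * a k \<omega>) * f k t) \<partial>N)"
    by simp
qed

end

section \<open>The random norm and the passage from Sidon to randomly Sidon\<close>

lemma mat_trace_mult3:
  assumes "A \<in> carrier_mat n n" "B \<in> carrier_mat n n" "C \<in> carrier_mat n n"
  shows "mat_trace (A * B * C) = (\<Sum>i<n. \<Sum>l<n. \<Sum>j<n. A $$ (i, l) * B $$ (l, j) * C $$ (j, i))"
proof -
  have "mat_trace (A * B * C) = (\<Sum>i<n. \<Sum>j<n. \<Sum>l<n. A $$ (i, l) * B $$ (l, j) * C $$ (j, i))"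
    unfolding mat_trace_mult[OF mult_carrier_mat[OF assms(1,2)] assms(3)]
    by (intro sum.cong refl) (simp only: times_mat_sum[OF assms(1,2)] lessThan_iff sum_distrib_right)
  also have "\<dots> = (\<Sum>i<n. \<Sum>l<n. \<Sum>j<n. A $$ (i, l) * B $$ (l, j) * C $$ (j, i))"
    by (intro sum.cong refl sum.swap)
  finally show ?thesis .
qed

locale sidon_setting = compact_haar G T m
  for G :: "'a monoid" (structure) and T :: "'a topology" and m :: "'a measure" +
  fixes d :: "nat \<Rightarrow> nat" and \<phi> :: "nat \<Rightarrow> 'a \<Rightarrow> complex mat"
    and P :: "'w measure" and g :: "nat \<Rightarrow> 'w \<Rightarrow> complex mat"
  assumes irreps: "distinct_irreps G T d \<phi>" and gm: "gaussian_matrices P d g"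
begin

definition gam :: "nat \<times> nat \<times> nat \<Rightarrow> 'w \<Rightarrow> complex" where
  "gam = (\<lambda>(n, i, j) \<omega>. complex_of_real (sqrt (real (d n))) * g n \<omega> $$ (i, j))"

definition entries :: "(nat \<times> nat \<times> nat) set" where
  "entries = {(n, i, j). i < d n \<and> j < d n}"

sublocale Q: cgauss_family P gam entries
proof -
  have "prob_space P" "\<And>a. a \<in> entries \<Longrightarrow> std_complex_gaussian P (gam a)" "prob_space.indep_vars P (\<lambda>_. borel) gam entries"
    using gm unfolding gaussian_matrices_def gam_def entries_def by auto
  thus "cgauss_family P gam entries" by (intro cgauss_family.intro cgauss_family_axioms.intro)
qed

lemma rep: "unitary_rep G T (d n) (\<phi> n)" and irr: "irreducible_rep G (d n) (\<phi> n)"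
  using irreps by (auto simp: distinct_irreps_def)

lemma d_pos: "0 < d n" using irr[of n] by (simp add: irreducible_rep_def)

lemma g_carrier: "\<omega> \<in> space P \<Longrightarrow> g n \<omega> \<in> carrier_mat (d n) (d n)"
  using gm by (simp add: gaussian_matrices_def)

lemma g_gam: "g n \<omega> $$ (i, j) = gam (n, i, j) \<omega> / complex_of_real (sqrt (real (d n)))"
  using d_pos[of n] by (simp add: gam_def)

lemma gam_integrable: "a \<in> entries \<Longrightarrow> integrable P (gam a)"
  using complex_gaussian_moments(1)[OF Q.gauss Q.prob_space_axioms, of a 1 0] by simp

lemma g_integrable: "i < d n \<Longrightarrow> j < d n \<Longrightarrow> integrable P (\<lambda>\<omega>. g n \<omega> $$ (i, j))"
  unfolding g_gam using gam_integrable by (simp add: entries_def)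

definition randnorm :: "nat set \<Rightarrow> (nat \<Rightarrow> complex mat) \<Rightarrow> 'w \<Rightarrow> real" where
  "randnorm S x \<omega> = supnorm (\<lambda>t. \<Sum>n\<in>S. of_nat (d n) * mat_trace (x n * g n \<omega> * \<phi> n t))"

lemma trace_continuous:
  assumes "finite S" "\<And>n. n \<in> S \<Longrightarrow> x n \<in> carrier_mat (d n) (d n)"
  shows "continuous_map T euclidean (\<lambda>t. \<Sum>n\<in>S. of_nat (d n) * mat_trace (x n * \<phi> n t))"
proof -
  let ?f = "\<lambda>t. \<Sum>n\<in>S. of_nat (d n) * (\<Sum>i<d n. \<Sum>j<d n. x n $$ (i, j) * \<phi> n t $$ (j, i))"
  have "continuous_map T euclidean ?f"
    using assms(1) rep_continuous[OF rep]
    by (intro continuous_map_sum continuous_map_mult_complex continuous_map_const[THEN iffD2]) auto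
  moreover have "?f t = (\<Sum>n\<in>S. of_nat (d n) * mat_trace (x n * \<phi> n t))" if "t \<in> topspace T" for t
    using assms(2) rep_carrier[OF rep] that topsp
    by (intro sum.cong refl arg_cong2[where f="(*)"] mat_trace_mult[symmetric]) auto
  ultimately show ?thesis by (rule continuous_map_eq)
qed

lemma randnorm_expand:
  assumes "finite S" "\<And>n. n \<in> S \<Longrightarrow> x n \<in> carrier_mat (d n) (d n)" "\<omega> \<in> space P"
  shows "randnorm S x \<omega> = supnorm (\<lambda>t. \<Sum>(n, i, l, j)\<in>(SIGMA n:S. {..<d n} \<times> {..<d n} \<times> {..<d n}).
    (of_nat (d n) * x n $$ (i, l) * g n \<omega> $$ (l, j)) * \<phi> n t $$ (j, i))"
  unfolding randnorm_def supnorm_def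
proof (intro SUP_cong refl arg_cong[where f=cmod])
  fix t assume t: "t \<in> carrier G"
  have "(\<Sum>n\<in>S. of_nat (d n) * mat_trace (x n * g n \<omega> * \<phi> n t))
    = (\<Sum>n\<in>S. \<Sum>i<d n. \<Sum>l<d n. \<Sum>j<d n. (of_nat (d n) * x n $$ (i, l) * g n \<omega> $$ (l, j)) * \<phi> n t $$ (j, i))"
    by (intro sum.cong refl) (simp add: mat_trace_mult3[OF assms(2) g_carrier[OF assms(3)] rep_carrier[OF rep t]] sum_distrib_left mult.assoc)
  also have "\<dots> = (\<Sum>(n, i, l, j)\<in>(SIGMA n:S. {..<d n} \<times> {..<d n} \<times> {..<d n}).
    (of_nat (d n) * x n $$ (i, l) * g n \<omega> $$ (l, j)) * \<phi> n t $$ (j, i))"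
    using assms(1) by (simp add: sum.Sigma sum.cartesian_product case_prod_beta')
  finally show "(\<Sum>n\<in>S. of_nat (d n) * mat_trace (x n * g n \<omega> * \<phi> n t)) = (\<Sum>(n, i, l, j)\<in>(SIGMA n:S. {..<d n} \<times> {..<d n} \<times> {..<d n}).
    (of_nat (d n) * x n $$ (i, l) * g n \<omega> $$ (l, j)) * \<phi> n t $$ (j, i))" .
qed

lemma randnorm_integrable:
  assumes "finite S" "\<And>n. n \<in> S \<Longrightarrow> x n \<in> carrier_mat (d n) (d n)"
  shows "integrable P (randnorm S x)"
proof -
  let ?K = "SIGMA n:S. {..<d n} \<times> {..<d n} \<times> {..<d n}"
  have "integrable P (\<lambda>\<omega>. supnorm (\<lambda>t. \<Sum>k\<in>?K. (case k of (n, i, l, j) \<Rightarrow> \<lambda>\<omega>. of_nat (d n) * x n $$ (i, l) * g n \<omega> $$ (l, j)) \<omega> * (case k of (n, i, l, j) \<Rightarrow> \<lambda>t. \<phi> n t $$ (j, i)) t))"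
    by (rule supnorm_integrable) (use assms(1) g_integrable rep_continuous[OF rep] in auto)
  thus ?thesis
    by (subst Bochner_Integration.integrable_cong[OF refl randnorm_expand[OF assms]]) (simp_all add: case_prod_beta')
qed

lemma Linfty_randnorm:
  assumes "finite S" "\<And>n. n \<in> S \<Longrightarrow> x n \<in> carrier_mat (d n) (d n)" "\<omega> \<in> space P"
  shows "Linfty_norm m (\<lambda>t. \<Sum>n\<in>S. of_nat (d n) * mat_trace (x n * g n \<omega> * \<phi> n t)) = randnorm S x \<omega>"
  unfolding randnorm_def
  by (rule Linfty_eq_supnorm, rule trace_continuous[OF assms(1), of "\<lambda>n. x n * g n \<omega>"])
    (intro mult_carrier_mat[OF assms(2) g_carrier[OF assms(3)]])

text \<open>Each of the \<open>d n\<close> coordinates is a combination of independent entries of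
  variance \<open>1 / d n\<close> with the unit coefficient vector \<open>v\<close>, up to
  conjugation.\<close>

lemma expectation_nrm2_adjoint:
  assumes v: "nrm2 (d n) v = 1"
  shows "integrable P (\<lambda>\<omega>. nrm2 (d n) (mapply (d n) (mat_adjoint (g n \<omega>)) v))"
    "(\<integral>\<omega>. nrm2 (d n) (mapply (d n) (mat_adjoint (g n \<omega>)) v) \<partial>P) = 1"
proof -
  let ?N = "d n"
  define F where "F \<omega> = (\<Sum>i<?N. \<Sum>j<?N. \<Sum>l<?N. (v j * cnj (v l) / of_nat ?N) * (gam (n, l, i) \<omega> * cnj (gam (n, j, i) \<omega>)))" for \<omega>
  have ent: "i < ?N \<Longrightarrow> j < ?N \<Longrightarrow> (n, i, j) \<in> entries" for i j by (simp add: entries_def)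
  have r2: "complex_of_real (sqrt (real ?N)) * complex_of_real (sqrt (real ?N)) = of_nat ?N" by (simp flip: of_real_mult)
  have eq: "nrm2 ?N (mapply ?N (mat_adjoint (g n \<omega>)) v) = Re (F \<omega>)" if "\<omega> \<in> space P" for \<omega>
  proof -
    have "complex_of_real (nrm2 ?N (mapply ?N (mat_adjoint (g n \<omega>)) v))
      = (\<Sum>i<?N. (\<Sum>j<?N. cnj (g n \<omega> $$ (j, i)) * v j) * cnj (\<Sum>l<?N. cnj (g n \<omega> $$ (l, i)) * v l))"
      unfolding ip_self[symmetric] ip_def mapply_def
      by (intro sum.cong refl arg_cong2[where f="(*)"] arg_cong[where f=cnj]) (auto simp: mat_adjoint_index[OF g_carrier[OF that]] intro!: sum.cong)
    also have "\<dots> = F \<omega>" unfolding F_def cnj_sum sum_product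
    proof (intro sum.cong refl)
      fix i j l
      have "cnj (g n \<omega> $$ (j, i)) * v j * cnj (cnj (g n \<omega> $$ (l, i)) * v l)
        = v j * cnj (v l) * (gam (n, l, i) \<omega> * cnj (gam (n, j, i) \<omega>)) / (complex_of_real (sqrt (real ?N)) * complex_of_real (sqrt (real ?N)))"
        by (simp add: g_gam mult_ac)
      thus "cnj (g n \<omega> $$ (j, i)) * v j * cnj (cnj (g n \<omega> $$ (l, i)) * v l) = v j * cnj (v l) / of_nat ?N * (gam (n, l, i) \<omega> * cnj (gam (n, j, i) \<omega>))"
        unfolding r2 by simp
    qed
    finally show ?thesis by (metis Re_complex_of_real)
  qed
  have Fi: "integrable P F" unfolding F_def
    by (intro Bochner_Integration.integrable_sum integrable_mult_right Q.gamma_second(1) ent) auto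
  have "(\<integral>\<omega>. F \<omega> \<partial>P) = (\<Sum>i<?N. \<integral>\<omega>. (\<Sum>j<?N. \<Sum>l<?N. (v j * cnj (v l) / of_nat ?N) * (gam (n, l, i) \<omega> * cnj (gam (n, j, i) \<omega>))) \<partial>P)"
    unfolding F_def by (rule Bochner_Integration.integral_sum) (intro Bochner_Integration.integrable_sum integrable_mult_right Q.gamma_second(1) ent; simp)
  also have "\<dots> = (\<Sum>i<?N. \<Sum>j<?N. \<integral>\<omega>. (\<Sum>l<?N. (v j * cnj (v l) / of_nat ?N) * (gam (n, l, i) \<omega> * cnj (gam (n, j, i) \<omega>))) \<partial>P)"
    by (intro sum.cong refl Bochner_Integration.integral_sum) (intro Bochner_Integration.integrable_sum integrable_mult_right Q.gamma_second(1) ent; simp)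
  also have "\<dots> = (\<Sum>i<?N. \<Sum>j<?N. \<Sum>l<?N. \<integral>\<omega>. (v j * cnj (v l) / of_nat ?N) * (gam (n, l, i) \<omega> * cnj (gam (n, j, i) \<omega>)) \<partial>P)"
    by (intro sum.cong refl Bochner_Integration.integral_sum) (intro Bochner_Integration.integrable_sum integrable_mult_right Q.gamma_second(1) ent; simp)
  also have "\<dots> = (\<Sum>i<?N. \<Sum>j<?N. \<Sum>l<?N. (v j * cnj (v l) / of_nat ?N) * (if l = j then 1 else 0))"
    by (intro sum.cong refl) (simp add: Q.gamma_second(2)[OF ent ent])
  also have "\<dots> = (\<Sum>i<?N. \<Sum>j<?N. v j * cnj (v j) / of_nat ?N)"
    by (intro sum.cong refl sum_delta_lt) simp
  also have "\<dots> = ip ?N v v" using d_pos[of n] by (simp add: ip_def sum_divide_distrib[symmetric])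
  finally have "(\<integral>\<omega>. F \<omega> \<partial>P) = 1" by (simp add: ip_self v)
  hence "(\<integral>\<omega>. Re (F \<omega>) \<partial>P) = 1" using Fi by simp
  thus "(\<integral>\<omega>. nrm2 ?N (mapply ?N (mat_adjoint (g n \<omega>)) v) \<partial>P) = 1"
    using Bochner_Integration.integral_cong[OF refl eq, of P] by simp
  show "integrable P (\<lambda>\<omega>. nrm2 ?N (mapply ?N (mat_adjoint (g n \<omega>)) v))"
    using Bochner_Integration.integrable_cong[OF refl eq, of P] Fi by simp
qed

text \<open>One Wick pairing forces \<open>i = l = p\<close> and leaves \<open>k\<close> and
  \<open>q\<close> free, the other forces \<open>k = q\<close> and \<open>l = p\<close> and leaves
  \<open>i\<close> and \<open>k\<close> free. Either way two free indices cancel the factor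
  \<open>1 / d n ^ 2\<close>, so each pairing contributes the squared length of
  \<open>v\<close>.\<close>

lemma expectation_nrm2_square:
  assumes v: "nrm2 (d n) v = 1"
  shows "integrable P (\<lambda>\<omega>. nrm2 (d n) (mapply (d n) (g n \<omega>) (mapply (d n) (mat_adjoint (g n \<omega>)) v)))"
    "(\<integral>\<omega>. nrm2 (d n) (mapply (d n) (g n \<omega>) (mapply (d n) (mat_adjoint (g n \<omega>)) v)) \<partial>P) = 2"
proof -
  let ?N = "d n"
  let ?K = "{..<?N} \<times> {..<?N} \<times> {..<?N} \<times> {..<?N} \<times> {..<?N}"
  define h where "h = (\<lambda>(i, k, l, q, p) \<omega>. gam (n, i, k) \<omega> * gam (n, p, q) \<omega> * cnj (gam (n, l, k) \<omega>) * cnj (gam (n, i, q) \<omega>))"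
  define c where "c = (\<lambda>(i::nat, k::nat, l, q::nat, p). v l * cnj (v p) / (of_nat ?N * of_nat ?N))"
  define F where "F \<omega> = (\<Sum>x\<in>?K. c x * h x \<omega>)" for \<omega>
  have ent: "i < ?N \<Longrightarrow> j < ?N \<Longrightarrow> (n, i, j) \<in> entries" for i j by (simp add: entries_def)
  have r2: "complex_of_real (sqrt (real ?N)) * complex_of_real (sqrt (real ?N)) = of_nat ?N" by (simp flip: of_real_mult)
  have eq: "nrm2 ?N (mapply ?N (g n \<omega>) (mapply ?N (mat_adjoint (g n \<omega>)) v)) = Re (F \<omega>)" if "\<omega> \<in> space P" for \<omega>
  proof -
    have ap: "mapply ?N (g n \<omega>) (mapply ?N (mat_adjoint (g n \<omega>)) v) i = (\<Sum>k<?N. \<Sum>l<?N. g n \<omega> $$ (i, k) * (cnj (g n \<omega> $$ (l, k)) * v l))" for i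
      unfolding mapply_def sum_distrib_left by (intro sum.cong refl) (simp add: mat_adjoint_index[OF g_carrier[OF that]])
    have "complex_of_real (nrm2 ?N (mapply ?N (g n \<omega>) (mapply ?N (mat_adjoint (g n \<omega>)) v)))
      = (\<Sum>i<?N. (\<Sum>k<?N. \<Sum>l<?N. g n \<omega> $$ (i, k) * (cnj (g n \<omega> $$ (l, k)) * v l)) * (\<Sum>q<?N. \<Sum>p<?N. cnj (g n \<omega> $$ (i, q) * (cnj (g n \<omega> $$ (p, q)) * v p))))"
      unfolding ip_self[symmetric] ip_def ap cnj_sum ..
    also have "\<dots> = (\<Sum>i<?N. \<Sum>k<?N. \<Sum>q<?N. \<Sum>l<?N. \<Sum>p<?N. (g n \<omega> $$ (i, k) * (cnj (g n \<omega> $$ (l, k)) * v l)) * cnj (g n \<omega> $$ (i, q) * (cnj (g n \<omega> $$ (p, q)) * v p)))"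
      unfolding sum_product ..
    also have "\<dots> = (\<Sum>i<?N. \<Sum>k<?N. \<Sum>l<?N. \<Sum>q<?N. \<Sum>p<?N. (g n \<omega> $$ (i, k) * (cnj (g n \<omega> $$ (l, k)) * v l)) * cnj (g n \<omega> $$ (i, q) * (cnj (g n \<omega> $$ (p, q)) * v p)))"
      by (intro sum.cong refl sum.swap)
    also have "\<dots> = (\<Sum>i<?N. \<Sum>k<?N. \<Sum>l<?N. \<Sum>q<?N. \<Sum>p<?N. c (i, k, l, q, p) * h (i, k, l, q, p) \<omega>)"
    proof (intro sum.cong refl)
      fix i k l q p
      let ?s = "complex_of_real (sqrt (real ?N))"
      have "(g n \<omega> $$ (i, k) * (cnj (g n \<omega> $$ (l, k)) * v l)) * cnj (g n \<omega> $$ (i, q) * (cnj (g n \<omega> $$ (p, q)) * v p))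
        = v l * cnj (v p) * h (i, k, l, q, p) \<omega> / ((?s * ?s) * (?s * ?s))"
        by (simp add: g_gam h_def mult_ac)
      thus "(g n \<omega> $$ (i, k) * (cnj (g n \<omega> $$ (l, k)) * v l)) * cnj (g n \<omega> $$ (i, q) * (cnj (g n \<omega> $$ (p, q)) * v p)) = c (i, k, l, q, p) * h (i, k, l, q, p) \<omega>"
        unfolding r2 c_def by simp
    qed
    also have "\<dots> = F \<omega>" unfolding F_def by (simp add: sum.cartesian_product case_prod_beta')
    finally show ?thesis by (metis Re_complex_of_real)
  qed
  have hi: "integrable P (\<lambda>\<omega>. c x * h x \<omega>)" "(\<integral>\<omega>. c x * h x \<omega> \<partial>P) = c x * (case x of (i, k, l, q, p) \<Rightarrow>
      (if i = l \<and> p = i then 1 else 0) + (if k = q \<and> p = l then 1 else 0))" if "x \<in> ?K" for x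
  proof -
    obtain i k l q p where x: "x = (i, k, l, q, p)" by (metis prod_cases5)
    have "i < ?N" "k < ?N" "l < ?N" "q < ?N" "p < ?N" using that by (auto simp: x)
    note q = Q.gamma_fourth[OF ent[OF this(1,2)] ent[OF this(5,4)] ent[OF this(3,2)] ent[OF this(1,4)]]
    show "integrable P (\<lambda>\<omega>. c x * h x \<omega>)" using q(1) by (simp add: h_def x)
    have "(\<integral>\<omega>. h x \<omega> \<partial>P) = (if i = l \<and> p = i then 1 else 0) + (if k = q \<and> p = l then 1 else 0)"
      unfolding h_def x prod.case q(2) by (intro arg_cong2[where f="(+)"] if_cong refl) auto
    thus "(\<integral>\<omega>. c x * h x \<omega> \<partial>P) = c x * (case x of (i, k, l, q, p) \<Rightarrow>
      (if i = l \<and> p = i then 1 else 0) + (if k = q \<and> p = l then 1 else 0))" by (simp add: x)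
  qed
  have Fi: "integrable P F" unfolding F_def by (intro Bochner_Integration.integrable_sum hi)
  have "(\<integral>\<omega>. F \<omega> \<partial>P) = (\<Sum>x\<in>?K. c x * (case x of (i, k, l, q, p) \<Rightarrow> (if i = l \<and> p = i then 1 else 0) + (if k = q \<and> p = l then 1 else 0)))"
    unfolding F_def by (subst Bochner_Integration.integral_sum[OF hi(1)], assumption) (intro sum.cong refl hi(2))
  also have "\<dots> = (\<Sum>i<?N. \<Sum>k<?N. \<Sum>l<?N. \<Sum>q<?N. \<Sum>p<?N. v l * cnj (v p) / (of_nat ?N * of_nat ?N) *
      ((if i = l \<and> p = i then 1 else 0) + (if k = q \<and> p = l then 1 else 0)))"
    by (simp only: c_def sum.cartesian_product split_def fst_conv snd_conv)
  also have "\<dots> = (\<Sum>i<?N. \<Sum>k<?N. \<Sum>l<?N. \<Sum>q<?N. v l * cnj (v l) / (of_nat ?N * of_nat ?N) *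
      ((if i = l then 1 else 0) + (if k = q then 1 else 0)))"
  proof (intro sum.cong refl)
    fix i k l q :: nat assume "l \<in> {..<?N}"
    hence l: "l < ?N" by simp
    have "(\<Sum>p<?N. v l * cnj (v p) / (of_nat ?N * of_nat ?N) * ((if i = l \<and> p = i then 1 else 0) + (if k = q \<and> p = l then 1 else 0)))
      = (\<Sum>p<?N. v l * cnj (v p) / (of_nat ?N * of_nat ?N) * ((if i = l then 1 else 0) + (if k = q then 1 else 0)) * (if p = l then 1 else 0))"
    proof (intro sum.cong refl)
      fix p
      have "((if i = l \<and> p = i then 1 else 0) + (if k = q \<and> p = l then 1 else 0) :: complex) = ((if i = l then 1 else 0) + (if k = q then 1 else 0)) * (if p = l then 1 else 0)"
        by auto
      thus "v l * cnj (v p) / (of_nat ?N * of_nat ?N) * ((if i = l \<and> p = i then 1 else 0) + (if k = q \<and> p = l then 1 else 0))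
        = v l * cnj (v p) / (of_nat ?N * of_nat ?N) * ((if i = l then 1 else 0) + (if k = q then 1 else 0)) * (if p = l then 1 else 0)"
        by (simp only: mult.assoc)
    qed
    thus "(\<Sum>p<?N. v l * cnj (v p) / (of_nat ?N * of_nat ?N) * ((if i = l \<and> p = i then 1 else 0) + (if k = q \<and> p = l then 1 else 0)))
      = v l * cnj (v l) / (of_nat ?N * of_nat ?N) * ((if i = l then 1 else 0) + (if k = q then 1 else 0))"
      by (simp only: sum_delta_lt(1)[OF l])
  qed
  also have "\<dots> = (\<Sum>i<?N. \<Sum>k<?N. \<Sum>l<?N. v l * cnj (v l) / (of_nat ?N * of_nat ?N) * (of_nat ?N * (if i = l then 1 else 0) + 1))"
  proof (intro sum.cong refl)
    fix i k l :: nat assume "k \<in> {..<?N}"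
    hence k: "k < ?N" by simp
    have "(\<Sum>q<?N. ((if i = l then 1 else 0) + (if k = q then 1 else 0)) :: complex) = of_nat ?N * (if i = l then 1 else 0) + 1"
      using k by (simp add: sum.distrib)
    thus "(\<Sum>q<?N. v l * cnj (v l) / (of_nat ?N * of_nat ?N) * ((if i = l then 1 else 0) + (if k = q then 1 else 0)))
      = v l * cnj (v l) / (of_nat ?N * of_nat ?N) * (of_nat ?N * (if i = l then 1 else 0) + 1)"
      unfolding sum_distrib_left[symmetric] by simp
  qed
  also have "\<dots> = (\<Sum>i<?N. \<Sum>l<?N. of_nat ?N * (v l * cnj (v l) / (of_nat ?N * of_nat ?N) * (of_nat ?N * (if i = l then 1 else 0) + 1)))"
    by (simp only: sum_constant card_lessThan sum_distrib_left)
  also have "\<dots> = (\<Sum>l<?N. \<Sum>i<?N. of_nat ?N * (v l * cnj (v l) / (of_nat ?N * of_nat ?N) * (of_nat ?N * (if i = l then 1 else 0) + 1)))"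
    by (rule sum.swap)
  also have "\<dots> = (\<Sum>l<?N. 2 * (v l * cnj (v l)))"
  proof (intro sum.cong refl)
    fix l :: nat assume "l \<in> {..<?N}"
    hence l: "l < ?N" by simp
    have "(\<Sum>i<?N. of_nat ?N * (if i = l then 1 else 0) + 1 :: complex) = 2 * of_nat ?N"
      using l by (simp add: sum.distrib sum_distrib_left[symmetric])
    thus "(\<Sum>i<?N. of_nat ?N * (v l * cnj (v l) / (of_nat ?N * of_nat ?N) * (of_nat ?N * (if i = l then 1 else 0) + 1))) = 2 * (v l * cnj (v l))"
      using d_pos[of n] by (simp only: sum_distrib_left[symmetric]) simp
  qed
  also have "\<dots> = 2 * ip ?N v v" by (simp add: ip_def sum_distrib_left)
  finally have "(\<integral>\<omega>. F \<omega> \<partial>P) = 2" by (simp add: ip_self v)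
  hence "(\<integral>\<omega>. Re (F \<omega>) \<partial>P) = 2" using Fi by simp
  thus "(\<integral>\<omega>. nrm2 ?N (mapply ?N (g n \<omega>) (mapply ?N (mat_adjoint (g n \<omega>)) v)) \<partial>P) = 2"
    using Bochner_Integration.integral_cong[OF refl eq, of P] by simp
  show "integrable P (\<lambda>\<omega>. nrm2 ?N (mapply ?N (g n \<omega>) (mapply ?N (mat_adjoint (g n \<omega>)) v)))"
    using Bochner_Integration.integrable_cong[OF refl eq, of P] Fi by simp
qed

text \<open>Terms outside the support vanish. The form with a larger set \<open>S\<close> is for
  families such as \<open>x n * g n \<omega>\<close>, whose support varies with
  \<open>\<omega>\<close> inside that of \<open>x\<close>.\<close>

lemma mat_supp_sum:
  assumes "\<And>n. x n \<in> carrier_mat (d n) (d n)" "finite S" "mat_supp d x \<subseteq> S"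
  shows "(\<Sum>n\<in>mat_supp d x. real (d n) * trace_norm (x n)) = (\<Sum>n\<in>S. real (d n) * trace_norm (x n))"
    "t \<in> carrier G \<Longrightarrow> (\<Sum>n\<in>mat_supp d x. of_nat (d n) * mat_trace (x n * \<phi> n t)) = (\<Sum>n\<in>S. of_nat (d n) * mat_trace (x n * \<phi> n t))"
    "\<omega> \<in> space P \<Longrightarrow> t \<in> carrier G \<Longrightarrow> (\<Sum>n\<in>mat_supp d x. of_nat (d n) * mat_trace (x n * g n \<omega> * \<phi> n t)) = (\<Sum>n\<in>S. of_nat (d n) * mat_trace (x n * g n \<omega> * \<phi> n t))"
proof -
  have z: "x n = 0\<^sub>m (d n) (d n)" if "n \<in> S - mat_supp d x" for n using that by (simp add: mat_supp_def)
  have tz: "mat_trace (0\<^sub>m k k) = 0" for k by (simp add: mat_trace_def)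
  show "(\<Sum>n\<in>mat_supp d x. real (d n) * trace_norm (x n)) = (\<Sum>n\<in>S. real (d n) * trace_norm (x n))"
    by (rule sum.mono_neutral_left[OF assms(2,3)]) (simp add: z trace_norm_zero)
  show "(\<Sum>n\<in>mat_supp d x. of_nat (d n) * mat_trace (x n * \<phi> n t)) = (\<Sum>n\<in>S. of_nat (d n) * mat_trace (x n * \<phi> n t))" if "t \<in> carrier G"
    by (rule sum.mono_neutral_left[OF assms(2,3)]) (simp add: z tz left_mult_zero_mat[OF rep_carrier[OF rep that]])
  show "(\<Sum>n\<in>mat_supp d x. of_nat (d n) * mat_trace (x n * g n \<omega> * \<phi> n t)) = (\<Sum>n\<in>S. of_nat (d n) * mat_trace (x n * g n \<omega> * \<phi> n t))" if "\<omega> \<in> space P" "t \<in> carrier G"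
    by (rule sum.mono_neutral_left[OF assms(2,3)]) (simp add: z tz left_mult_zero_mat[OF g_carrier[OF that(1)]] left_mult_zero_mat[OF rep_carrier[OF rep that(2)]])
qed

text \<open>Identities between matrix coefficients hold on the carrier alone, so the functions
  compared need not agree elsewhere.\<close>

lemma Linfty_cong:
  assumes "\<And>t. t \<in> carrier G \<Longrightarrow> f t = h t" and h: "continuous_map T euclidean h"
  shows "Linfty_norm m f = supnorm h"
proof -
  have "continuous_map T euclidean f"
    by (rule continuous_map_eq[OF h]) (simp add: assms(1) topsp)
  hence "Linfty_norm m f = supnorm f" by (rule Linfty_eq_supnorm)
  also have "\<dots> = supnorm h" unfolding supnorm_def
    by (rule SUP_cong[OF refl]) (simp only: assms(1))
  finally show ?thesis .
qed

theorem sidon_imp_randomly_sidon: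
  assumes "sidon m d \<phi>" shows "randomly_sidon m d \<phi> P g"
proof -
  obtain C0 where C0: "\<And>x. fin_supp_family d x \<Longrightarrow> (\<Sum>n\<in>mat_supp d x. real (d n) * trace_norm (x n))
      \<le> C0 * Linfty_norm m (\<lambda>t. \<Sum>n\<in>mat_supp d x. of_nat (d n) * mat_trace (x n * \<phi> n t))"
    using assms unfolding sidon_def by blast
  define C where "C = max C0 0"
  show ?thesis unfolding randomly_sidon_def
  proof (intro exI[of _ "2 * C"] allI impI)
    fix x assume "fin_supp_family d x"
    hence xc: "\<And>n. x n \<in> carrier_mat (d n) (d n)" and S: "finite (mat_supp d x)" by (auto simp: fin_supp_family_def)
    let ?S = "mat_supp d x"
    have "\<exists>s u v. svd (d n) (x n) s u v" for n by (rule svd_exists[OF xc])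
    then obtain s u v where sv: "\<And>n. svd (d n) (x n) (s n) (u n) (v n)" by metis
    \<comment> \<open>A polynomial minorant of the sum of the trace norms of
      \<open>x n * g n \<omega>\<close>. Its expectation is explicit: every singular value is
      multiplied by \<open>1 - 2 / 4\<close>, the second moment minus a quarter of the fourth-order
      one, which accounts for the factor \<open>2\<close> in the constant.\<close>
    define low where "low \<omega> = (\<Sum>n\<in>?S. real (d n) * (\<Sum>k<d n. s n k * (nrm2 (d n) (mapply (d n) (mat_adjoint (g n \<omega>)) (v n k))
      - nrm2 (d n) (mapply (d n) (g n \<omega>) (mapply (d n) (mat_adjoint (g n \<omega>)) (v n k))) / 4)))" for \<omega>
    have n1: "nrm2 (d n) (v n k) = 1" if "k < d n" for n k by (rule onb_nrm2[OF svdD(3)[OF sv] that])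
    have "low \<omega> \<le> C * randnorm ?S x \<omega>" if w: "\<omega> \<in> space P" for \<omega>
    proof -
      define y where "y n = x n * g n \<omega>" for n
      have yc: "\<And>n. y n \<in> carrier_mat (d n) (d n)" unfolding y_def by (intro mult_carrier_mat[OF xc g_carrier[OF w]])
      have yS: "mat_supp d y \<subseteq> ?S" unfolding mat_supp_def y_def using left_mult_zero_mat[OF g_carrier[OF w]] by auto
      have yf: "fin_supp_family d y" unfolding fin_supp_family_def using yc finite_subset[OF yS S] by blast
      have "low \<omega> \<le> (\<Sum>n\<in>?S. real (d n) * trace_norm (y n))"
        unfolding low_def y_def by (intro sum_mono mult_left_mono trace_norm_mult_lower[OF sv g_carrier[OF w]]) simp
      also have "\<dots> = (\<Sum>n\<in>mat_supp d y. real (d n) * trace_norm (y n))" by (rule mat_supp_sum(1)[OF yc S yS, symmetric])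
      also have "\<dots> \<le> C0 * Linfty_norm m (\<lambda>t. \<Sum>n\<in>mat_supp d y. of_nat (d n) * mat_trace (y n * \<phi> n t))" by (rule C0[OF yf])
      also have "Linfty_norm m (\<lambda>t. \<Sum>n\<in>mat_supp d y. of_nat (d n) * mat_trace (y n * \<phi> n t)) = randnorm ?S x \<omega>"
        unfolding randnorm_def y_def[symmetric]
        by (rule Linfty_cong[OF mat_supp_sum(2)[OF yc S yS] trace_continuous[OF S yc]])
      also have "C0 * randnorm ?S x \<omega> \<le> C * randnorm ?S x \<omega>"
      proof (rule mult_right_mono)
        show "0 \<le> randnorm ?S x \<omega>" unfolding randnorm_def y_def[symmetric]
          by (rule supnorm_nonneg[OF bdd_continuous[OF trace_continuous[OF S yc]]])
      qed (simp add: C_def)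
      finally show ?thesis .
    qed
    moreover define e where "e n k \<omega> = nrm2 (d n) (mapply (d n) (mat_adjoint (g n \<omega>)) (v n k))
      - nrm2 (d n) (mapply (d n) (g n \<omega>) (mapply (d n) (mat_adjoint (g n \<omega>)) (v n k))) / 4" for n k \<omega>
    have ei: "integrable P (e n k)" and ee: "(\<integral>\<omega>. e n k \<omega> \<partial>P) = 1 / 2" if k: "k < d n" for n k
    proof -
      note a = expectation_nrm2_adjoint[OF n1[OF k]] and b = expectation_nrm2_square[OF n1[OF k]]
      show "integrable P (e n k)" unfolding e_def[abs_def]
        by (rule Bochner_Integration.integrable_diff[OF a(1) integrable_divide]) (rule b(1))
      show "(\<integral>\<omega>. e n k \<omega> \<partial>P) = 1 / 2" unfolding e_def[abs_def]
        by (subst Bochner_Integration.integral_diff[OF a(1) integrable_divide]) (use a(2) b in simp_all)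
    qed
    have low_e: "low = (\<lambda>\<omega>. \<Sum>n\<in>?S. real (d n) * (\<Sum>k<d n. s n k * e n k \<omega>))"
      by (rule ext) (simp only: low_def e_def)
    have si: "integrable P (\<lambda>\<omega>. \<Sum>k<d n. s n k * e n k \<omega>)" for n
      by (intro Bochner_Integration.integrable_sum integrable_mult_right ei) simp
    have lowi: "integrable P low" unfolding low_e
      by (intro Bochner_Integration.integrable_sum integrable_mult_right si)
    have se: "(\<integral>\<omega>. (\<Sum>k<d n. s n k * e n k \<omega>) \<partial>P) = (\<Sum>k<d n. s n k * (1 / 2))" for n
      by (subst Bochner_Integration.integral_sum) (intro integrable_mult_right ei, simp, intro sum.cong refl, simp only: lessThan_iff integral_mult_right_zero ee)
    ultimately have "(\<integral>\<omega>. low \<omega> \<partial>P) \<le> (\<integral>\<omega>. C * randnorm ?S x \<omega> \<partial>P)"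
      using randnorm_integrable[OF S xc] lowi by (intro integral_mono) auto
    moreover have "(\<integral>\<omega>. low \<omega> \<partial>P) = (\<Sum>n\<in>?S. real (d n) * (\<Sum>k<d n. s n k * (1 / 2)))"
      unfolding low_e by (subst Bochner_Integration.integral_sum) (intro integrable_mult_right si, simp only: integral_mult_right_zero se)
    moreover have "\<dots> = (\<Sum>n\<in>?S. real (d n) * trace_norm (x n)) / 2"
      unfolding sum_divide_distrib by (intro sum.cong refl) (simp add: trace_norm_svd[OF sv] sum_distrib_right[symmetric] sum_divide_distrib[symmetric])
    moreover have "(\<integral>\<omega>. randnorm ?S x \<omega> \<partial>P) = (\<integral>\<omega>. Linfty_norm m (\<lambda>t. \<Sum>n\<in>?S. of_nat (d n) * mat_trace (x n * g n \<omega> * \<phi> n t)) \<partial>P)"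
      by (rule Bochner_Integration.integral_cong[OF refl]) (simp add: Linfty_randnorm[OF S xc])
    ultimately show "(\<Sum>n\<in>?S. real (d n) * trace_norm (x n)) \<le> 2 * C * (\<integral>\<omega>. Linfty_norm m (\<lambda>t. \<Sum>n\<in>?S. of_nat (d n) * mat_trace (x n * g n \<omega> * \<phi> n t)) \<partial>P)"
      by (simp only: integral_mult_right_zero)
  qed
qed

end

section \<open>The dual functional\<close>

lemma (in prob_space) jgauss_cong:
  assumes "jgauss J w" "\<And>a \<omega>. a \<in> J \<Longrightarrow> w' a \<omega> = w a \<omega>" shows "jgauss J w'"
proof -
  have e: "w' a = w a" if "a \<in> J" for a using assms(2)[OF that] by (intro ext)
  have f: "(\<Sum>a\<in>J. c a * w' a \<omega>) = (\<Sum>a\<in>J. c a * w a \<omega>)" for c \<omega> by (intro sum.cong refl) (simp only: e)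
  show ?thesis using assms(1) unfolding jgauss_def f by (simp add: e)
qed

lemma is_seminorm_scale:
  assumes "is_seminorm p" "0 \<le> (C::real)" shows "is_seminorm (\<lambda>c. C * p c)"
  unfolding is_seminorm_def
proof (intro conjI allI)
  fix u v :: "'a \<Rightarrow> complex" and a :: complex
  have "p (\<lambda>k. u k + v k) \<le> p u + p v" "p (\<lambda>k. a * u k) = cmod a * p u"
    using assms(1) unfolding is_seminorm_def by simp_all
  thus "C * p (\<lambda>k. u k + v k) \<le> C * p u + C * p v" "C * p (\<lambda>k. a * u k) = cmod a * (C * p u)"
    using mult_left_mono[OF _ assms(2)] by (simp_all flip: distrib_left)
qed

definition cunit :: "bool \<Rightarrow> complex" where "cunit r = (if r then 1 else \<i>)"

text \<open>A finite support \<open>S\<close> is fixed, which makes every index set below finite,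
  and \<open>random_bound\<close> is the random Sidon inequality on it. At this stage the
  \<open>z n\<close> are arbitrary contractions.\<close>

locale randomly_sidon_step = sidon_setting G T m d \<phi> P g
  for G :: "'a monoid" (structure) and T :: "'a topology" and m :: "'a measure"
    and d :: "nat \<Rightarrow> nat" and \<phi> :: "nat \<Rightarrow> 'a \<Rightarrow> complex mat"
    and P :: "'w measure" and g :: "nat \<Rightarrow> 'w \<Rightarrow> complex mat" +
  fixes S :: "nat set" and C \<rho> :: real and z :: "nat \<Rightarrow> complex mat"
  assumes finS: "finite S" and C_pos: "0 < C" and rho: "0 < \<rho>" "\<rho> \<le> 1"
    and z_contraction: "\<And>n. n \<in> S \<Longrightarrow> contraction (d n) (z n)"
    and random_bound: "\<And>q. (\<And>n. q n \<in> carrier_mat (d n) (d n)) \<Longrightarrow>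
      (\<Sum>n\<in>S. real (d n) * trace_norm (q n)) \<le> C * (\<integral>\<omega>. randnorm S q \<omega> \<partial>P)"
begin

text \<open>A key \<open>((n, i, j), r)\<close> in \<open>J\<close> stands for the real (\<open>r\<close>) or imaginary part \<open>x\<^sub>a\<close> of the entry \<open>(i, j)\<close> of
  \<open>g n\<close>, normalised to variance \<open>1\<close>. The functions \<open>chi\<close> are the products \<open>X\<^sub>A = \<Prod>\<^sub>a sin(\<rho> x\<^sub>a)\<close> and the
  errors \<open>sin(\<rho> x\<^sub>a) - \<rho> x\<^sub>a\<close>; the difference of the two for \<open>A = {a}\<close> is \<open>\<rho> x\<^sub>a\<close>. In terms of the functions
  \<open>chi b \<cdot> fe e\<close> on \<open>\<Omega> \<times> G\<close>, \<open>uq q\<close> lists the coefficients of \<open>\<Sum> d\<^sub>n tr(q\<^sub>n g\<^sub>n \<phi>\<^sub>n)\<close>, \<open>l0\<close> represents the functional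
  \<open>q \<mapsto> \<Sum> d\<^sub>n tr(q\<^sub>n z\<^sub>n)\<close> and \<open>ps\<close> is \<open>C\<close> times the norm of \<open>L\<^sub>1(P; C(G))\<close>.\<close>

definition E :: "(nat \<times> nat \<times> nat) set" where "E = (SIGMA n:S. {..<d n} \<times> {..<d n})"

definition J :: "((nat \<times> nat \<times> nat) \<times> bool) set" where "J = E \<times> UNIV"

definition B :: "(((nat \<times> nat \<times> nat) \<times> bool) set + ((nat \<times> nat \<times> nat) \<times> bool)) set" where
  "B = Pow J <+> J"

definition jx :: "(nat \<times> nat \<times> nat) \<times> bool \<Rightarrow> 'w \<Rightarrow> real" where
  "jx = (\<lambda>(b, r) \<omega>. sqrt 2 * (if r then Re (gam b \<omega>) else Im (gam b \<omega>)))"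

definition chi :: "((nat \<times> nat \<times> nat) \<times> bool) set + ((nat \<times> nat \<times> nat) \<times> bool) \<Rightarrow> 'w \<Rightarrow> real" where
  "chi = case_sum (sinprod \<rho> jx) (sinrem \<rho> jx)"

text \<open>The deterministic half of the test functions: a triple stands for one matrix coefficient
  on the group, matched later by the random half \<open>chi\<close>.\<close>

definition fe :: "nat \<times> nat \<times> nat \<Rightarrow> 'a \<Rightarrow> complex" where "fe = (\<lambda>(n, p, q) t. \<phi> n t $$ (p, q))"

definition cc :: "nat \<Rightarrow> complex" where "cc n = complex_of_real (sqrt (real (d n) / 2) / \<rho>)"

text \<open>The coefficient of \<open>\<rho> x_a\<close> times the group coefficient
  \<open>(n, p, i)\<close> in the trace sum. The entry \<open>(l, j)\<close> of \<open>g\<close>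
  meets row \<open>p\<close> of \<open>\<phi>\<close> only if \<open>j = p\<close>, and
  \<open>cc n\<close> carries the normalisation of \<open>g\<close>, the weight \<open>d n\<close>
  and the division by \<open>\<rho>\<close>.\<close>

definition kap :: "(nat \<Rightarrow> nat \<Rightarrow> nat \<Rightarrow> complex) \<Rightarrow> (nat \<times> nat \<times> nat) \<times> bool \<Rightarrow> nat \<times> nat \<times> nat \<Rightarrow> complex" where
  "kap q = (\<lambda>((n', l, j), r) (n, p, i). if n' = n \<and> j = p then cc n * q n i l * cunit r else 0)"

definition uq where
  "uq q = (\<lambda>(b, e). case b of Inl A \<Rightarrow> if card A = 1 then kap q (the_elem A) e else 0 | Inr a \<Rightarrow> - kap q a e)"

definition l0 where
  "l0 = (\<lambda>(b, (n, p, i)). case b of Inl A \<Rightarrow> 0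
    | Inr ((n', l, j), r) \<Rightarrow> - complex_of_real (\<rho> / sqrt (2 * real (d n))) * z n $$ (l, i) * cnj (cunit r))"

lemma finE: "finite E" using finS by (simp add: E_def)
lemma finJ: "finite J" by (simp add: J_def finE)
lemma finB: "finite B" by (simp add: B_def finJ)

lemma E_iff: "(n, p, q) \<in> E \<longleftrightarrow> n \<in> S \<and> p < d n \<and> q < d n" by (auto simp: E_def)

lemma E_entries: "E \<subseteq> entries" by (auto simp: E_def entries_def)

lemma sumE:
  fixes f :: "nat \<times> nat \<times> nat \<Rightarrow> 'z::comm_monoid_add"
  shows "(\<Sum>e\<in>E. f e) = (\<Sum>n\<in>S. \<Sum>p<d n. \<Sum>q<d n. f (n, p, q))"
proof -
  have "(\<Sum>n\<in>S. \<Sum>p<d n. \<Sum>q<d n. f (n, p, q)) = (\<Sum>n\<in>S. \<Sum>pq\<in>{..<d n} \<times> {..<d n}. f (n, pq))"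
    by (simp only: sum.cartesian_product')
  also have "\<dots> = (\<Sum>(n, pq)\<in>E. f (n, pq))"
    unfolding E_def by (rule sum.Sigma[OF finS]) simp
  finally show ?thesis by simp
qed

lemma sumJ:
  fixes f :: "(nat \<times> nat \<times> nat) \<times> bool \<Rightarrow> 'z::comm_monoid_add"
  shows "(\<Sum>a\<in>J. f a) = (\<Sum>b\<in>E. f (b, True) + f (b, False))"
  unfolding J_def sum.cartesian_product' UNIV_bool by (intro sum.cong refl) (simp add: add.commute)

lemma sumB: "(\<Sum>b\<in>B. f b) = (\<Sum>A\<in>Pow J. f (Inl A)) + (\<Sum>a\<in>J. f (Inr a))"
  unfolding B_def by (subst sum.Plus) (simp_all add: finJ)

lemma sum_card_one:
  fixes h :: "(nat \<times> nat \<times> nat) \<times> bool \<Rightarrow> complex"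
  shows "(\<Sum>A\<in>Pow J. f A * (if card A = 1 then h (the_elem A) else 0)) = (\<Sum>a\<in>J. f {a} * h a)"
proof -
  have "(\<Sum>A\<in>Pow J. f A * (if card A = 1 then h (the_elem A) else 0)) = (\<Sum>A\<in>(\<lambda>a. {a}) ` J. f A * (if card A = 1 then h (the_elem A) else 0))"
    by (rule sum.mono_neutral_right) (auto simp: finJ card_1_singleton_iff)
  also have "\<dots> = (\<Sum>a\<in>J. f {a} * h a)" by (subst sum.reindex) (simp_all add: inj_on_def)
  finally show ?thesis .
qed

lemma sum_uq: "(\<Sum>b\<in>B. h b * uq q (b, e)) = (\<Sum>a\<in>J. kap q a e * (h (Inl {a}) - h (Inr a)))"
proof -
  have "(\<Sum>b\<in>B. h b * uq q (b, e)) = (\<Sum>A\<in>Pow J. h (Inl A) * (if card A = 1 then kap q (the_elem A) e else 0)) + (\<Sum>a\<in>J. - (h (Inr a) * kap q a e))"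
    unfolding sumB uq_def by simp
  also have "\<dots> = (\<Sum>a\<in>J. h (Inl {a}) * kap q a e) + (\<Sum>a\<in>J. - (h (Inr a) * kap q a e))"
    by (simp only: sum_card_one[of "\<lambda>A. h (Inl A)" "\<lambda>a. kap q a e"])
  also have "\<dots> = (\<Sum>a\<in>J. kap q a e * (h (Inl {a}) - h (Inr a)))"
    unfolding sum.distrib[symmetric] by (intro sum.cong refl) (simp add: algebra_simps)
  finally show ?thesis .
qed

lemma sum_kap:
  assumes "n \<in> S" "p < d n"
  shows "(\<Sum>a\<in>J. kap q a (n, p, i) * y a) = (\<Sum>l<d n. cc n * q n i l * (y ((n, l, p), True) + \<i> * y ((n, l, p), False)))"
proof -
  let ?X = "\<lambda>l. cc n * q n i l * (y ((n, l, p), True) + \<i> * y ((n, l, p), False))"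
  have "(\<Sum>a\<in>J. kap q a (n, p, i) * y a) = (\<Sum>n'\<in>S. \<Sum>l<d n'. \<Sum>j<d n'. if n' = n \<and> j = p then ?X l else 0)"
    unfolding sumJ sumE by (intro sum.cong refl) (simp add: kap_def cunit_def algebra_simps)
  also have "\<dots> = (\<Sum>n'\<in>S. if n' = n then \<Sum>l<d n. ?X l else 0)"
  proof (intro sum.cong refl)
    fix n' show "(\<Sum>l<d n'. \<Sum>j<d n'. if n' = n \<and> j = p then ?X l else 0) = (if n' = n then \<Sum>l<d n. ?X l else 0)"
    proof (cases "n' = n")
      case True
      have "(\<Sum>j<d n. if j = p then ?X l else 0) = ?X l" for l using assms(2) by (simp only: sum.delta[OF finite_lessThan] lessThan_iff if_True)
      thus ?thesis by (simp only: True simp_thms if_True)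
    qed simp
  qed
  also have "\<dots> = (\<Sum>l<d n. ?X l)" using assms(1) by (simp only: sum.delta[OF finS] if_True)
  finally show ?thesis .
qed

lemma chi_diff: "chi (Inl {a}) \<omega> - chi (Inr a) \<omega> = \<rho> * jx a \<omega>"
  by (simp add: chi_def sinprod_def sinrem_def)

lemma jx_gam: "complex_of_real (jx (b, True) \<omega>) + \<i> * complex_of_real (jx (b, False) \<omega>) = complex_of_real (sqrt 2) * gam b \<omega>"
  by (simp add: jx_def complex_eq_iff)

lemma cc_gam: "cc n * complex_of_real (\<rho> * sqrt 2) * gam (n, l, p) \<omega> = of_nat (d n) * g n \<omega> $$ (l, p)"
proof -
  have "sqrt (real (d n) / 2) / \<rho> * (\<rho> * sqrt 2) = sqrt (real (d n))" using rho by (simp add: real_sqrt_divide)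
  hence "cc n * complex_of_real (\<rho> * sqrt 2) = complex_of_real (sqrt (real (d n)))"
    unfolding cc_def of_real_mult[symmetric] by (simp only:)
  moreover have "complex_of_real (sqrt (real (d n))) * complex_of_real (sqrt (real (d n))) = of_nat (d n)"
    by (simp flip: of_real_mult)
  ultimately show ?thesis by (simp add: gam_def flip: mult.assoc)
qed

lemma sum_uq_chi:
  assumes "n \<in> S" "p < d n"
  shows "(\<Sum>b\<in>B. complex_of_real (chi b \<omega>) * uq q (b, (n, p, i))) = (\<Sum>l<d n. of_nat (d n) * q n i l * g n \<omega> $$ (l, p))"
proof -
  have "(\<Sum>b\<in>B. complex_of_real (chi b \<omega>) * uq q (b, (n, p, i))) = (\<Sum>a\<in>J. kap q a (n, p, i) * complex_of_real (\<rho> * jx a \<omega>))"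
    unfolding sum_uq of_real_diff[symmetric] chi_diff ..
  also have "\<dots> = (\<Sum>l<d n. of_nat (d n) * q n i l * g n \<omega> $$ (l, p))"
    unfolding sum_kap[OF assms]
  proof (intro sum.cong refl)
    fix l
    have "complex_of_real (\<rho> * jx ((n, l, p), True) \<omega>) + \<i> * complex_of_real (\<rho> * jx ((n, l, p), False) \<omega>)
      = complex_of_real \<rho> * (complex_of_real (sqrt 2) * gam (n, l, p) \<omega>)"
      unfolding jx_gam[symmetric] by (simp add: algebra_simps)
    hence "cc n * q n i l * (complex_of_real (\<rho> * jx ((n, l, p), True) \<omega>) + \<i> * complex_of_real (\<rho> * jx ((n, l, p), False) \<omega>))
      = q n i l * (cc n * complex_of_real (\<rho> * sqrt 2) * gam (n, l, p) \<omega>)" by (simp add: mult_ac)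
    thus "cc n * q n i l * (complex_of_real (\<rho> * jx ((n, l, p), True) \<omega>) + \<i> * complex_of_real (\<rho> * jx ((n, l, p), False) \<omega>))
      = of_nat (d n) * q n i l * g n \<omega> $$ (l, p)" unfolding cc_gam by (simp add: mult_ac)
  qed
  finally show ?thesis .
qed

lemma cc_l0: "cc n * complex_of_real (\<rho> / sqrt (2 * real (d n))) * 2 = 1"
proof -
  have "sqrt (real (d n) / 2) / \<rho> * (\<rho> / sqrt (2 * real (d n))) * 2 = 1"
    using rho d_pos[of n] by (simp add: real_sqrt_divide real_sqrt_mult)
  thus ?thesis unfolding cc_def by (metis of_real_1 of_real_mult of_real_numeral)
qed

text \<open>The real and the imaginary key contribute equally, since
  \<open>cunit r * cnj (cunit r) = 1\<close>; this is the factor \<open>2\<close> in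
  \<open>cc_l0\<close>. The index \<open>p\<close> is idle, and summing over it supplies
  \<open>d n\<close>.\<close>

lemma sum_l0_uq: "(\<Sum>e\<in>E. \<Sum>b\<in>B. l0 (b, e) * uq q (b, e)) = (\<Sum>n\<in>S. of_nat (d n) * (\<Sum>i<d n. \<Sum>l<d n. q n i l * z n $$ (l, i)))"
  unfolding sumE
proof (intro sum.cong refl)
  fix n assume n: "n \<in> S"
  have "(\<Sum>b\<in>B. l0 (b, (n, p, i)) * uq q (b, (n, p, i))) = (\<Sum>l<d n. q n i l * z n $$ (l, i))" if "p < d n" for p i
  proof -
    let ?c = "complex_of_real (\<rho> / sqrt (2 * real (d n)))"
    have "(\<Sum>b\<in>B. l0 (b, (n, p, i)) * uq q (b, (n, p, i))) = (\<Sum>l<d n. cc n * q n i l * (?c * z n $$ (l, i) * 2))"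
      unfolding sum_uq[of "\<lambda>b. l0 (b, (n, p, i))"] sum_kap[OF n that] by (intro sum.cong refl arg_cong2[where f="(*)"]) (simp add: l0_def cunit_def algebra_simps)
    also have "\<dots> = (\<Sum>l<d n. (cc n * ?c * 2) * (q n i l * z n $$ (l, i)))" by (intro sum.cong refl) (simp only: mult_ac)
    finally show ?thesis unfolding cc_l0 by simp
  qed
  thus "(\<Sum>p<d n. \<Sum>i<d n. \<Sum>b\<in>B. l0 (b, (n, p, i)) * uq q (b, (n, p, i))) = of_nat (d n) * (\<Sum>i<d n. \<Sum>l<d n. q n i l * z n $$ (l, i))"
    by simp
qed

definition ps :: "(_ \<Rightarrow> complex) \<Rightarrow> real" where
  "ps c = C * (\<integral>\<omega>. supnorm (\<lambda>t. \<Sum>k\<in>B \<times> E. (c k * complex_of_real (chi (fst k) \<omega>)) * fe (snd k) t) \<partial>P)"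

lemma ps_uq:
  assumes "\<And>n. Q n = mat (d n) (d n) (\<lambda>(i, l). q n i l)"
  shows "ps (uq q) = C * (\<integral>\<omega>. randnorm S Q \<omega> \<partial>P)"
  unfolding ps_def
proof (intro arg_cong2[where f="(*)"] refl Bochner_Integration.integral_cong)
  fix \<omega> assume w: "\<omega> \<in> space P"
  have Qc: "Q n \<in> carrier_mat (d n) (d n)" for n by (simp add: assms)
  show "supnorm (\<lambda>t. \<Sum>k\<in>B \<times> E. (uq q k * complex_of_real (chi (fst k) \<omega>)) * fe (snd k) t) = randnorm S Q \<omega>"
    unfolding randnorm_def supnorm_def
  proof (intro SUP_cong refl arg_cong[where f=cmod])
    fix t assume t: "t \<in> carrier G"
    have "(\<Sum>k\<in>B \<times> E. (uq q k * complex_of_real (chi (fst k) \<omega>)) * fe (snd k) t)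
      = (\<Sum>e\<in>E. (\<Sum>b\<in>B. complex_of_real (chi b \<omega>) * uq q (b, e)) * fe e t)"
      unfolding sum.cartesian_product' fst_conv snd_conv sum_distrib_right
      by (subst sum.swap) (simp only: mult.commute[of "uq q _"])
    also have "\<dots> = (\<Sum>n\<in>S. \<Sum>p<d n. \<Sum>i<d n. (\<Sum>l<d n. of_nat (d n) * q n i l * g n \<omega> $$ (l, p)) * \<phi> n t $$ (p, i))"
      unfolding sumE by (intro sum.cong refl) (simp add: sum_uq_chi fe_def)
    also have "\<dots> = (\<Sum>n\<in>S. of_nat (d n) * mat_trace (Q n * g n \<omega> * \<phi> n t))"
    proof (intro sum.cong refl)
      fix n
      have "(\<Sum>p<d n. \<Sum>i<d n. (\<Sum>l<d n. of_nat (d n) * q n i l * g n \<omega> $$ (l, p)) * \<phi> n t $$ (p, i))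
        = (\<Sum>i<d n. \<Sum>p<d n. \<Sum>l<d n. of_nat (d n) * (Q n $$ (i, l) * g n \<omega> $$ (l, p) * \<phi> n t $$ (p, i)))"
        unfolding sum_distrib_right by (subst sum.swap, intro sum.cong refl) (simp add: assms mult_ac)
      also have "\<dots> = (\<Sum>i<d n. \<Sum>l<d n. \<Sum>p<d n. of_nat (d n) * (Q n $$ (i, l) * g n \<omega> $$ (l, p) * \<phi> n t $$ (p, i)))"
        by (intro sum.cong refl sum.swap)
      finally show "(\<Sum>p<d n. \<Sum>i<d n. (\<Sum>l<d n. of_nat (d n) * q n i l * g n \<omega> $$ (l, p)) * \<phi> n t $$ (p, i)) = of_nat (d n) * mat_trace (Q n * g n \<omega> * \<phi> n t)"
        unfolding mat_trace_mult3[OF Qc g_carrier[OF w] rep_carrier[OF rep t]] sum_distrib_left .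
    qed
    finally show "(\<Sum>k\<in>B \<times> E. (uq q k * complex_of_real (chi (fst k) \<omega>)) * fe (snd k) t) = (\<Sum>n\<in>S. of_nat (d n) * mat_trace (Q n * g n \<omega> * \<phi> n t))" .
  qed
qed

lemma jx_jgauss: "Q.jgauss J jx"
proof -
  let ?U = "\<lambda>b a :: nat \<times> nat \<times> nat. if a = b then 1 else 0 :: complex"
  have "Q.jgauss (E \<times> UNIV) (\<lambda>(b, r) \<omega>. sqrt 2 * (if r then Re (\<Sum>a\<in>E. ?U b a * gam a \<omega>) else Im (\<Sum>a\<in>E. ?U b a * gam a \<omega>)))"
    by (rule Q.unitary_image_jgauss[OF finE E_entries finE]) (simp add: finE if_distrib[of cnj] if_distrib[of "\<lambda>x. _ * x"] cong: if_cong)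
  thus ?thesis unfolding J_def
  proof (rule Q.jgauss_cong)
    fix a :: "(nat \<times> nat \<times> nat) \<times> bool" and \<omega> assume "a \<in> E \<times> UNIV"
    then obtain b r where a: "a = (b, r)" "b \<in> E" by (cases a) auto
    have "(\<Sum>a\<in>E. ?U b a * gam a \<omega>) = (\<Sum>a\<in>E. if a = b then gam a \<omega> else 0)" by (intro sum.cong refl) simp
    also have "\<dots> = gam b \<omega>" by (simp only: sum.delta[OF finE] a(2) if_True)
    finally show "jx a \<omega> = (case a of (b, r) \<Rightarrow> \<lambda>\<omega>. sqrt 2 * (if r then Re (\<Sum>a\<in>E. ?U b a * gam a \<omega>) else Im (\<Sum>a\<in>E. ?U b a * gam a \<omega>))) \<omega>"
      by (simp only: a jx_def prod.case)
  qed
qed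

lemma fe_continuous: "e \<in> E \<Longrightarrow> continuous_map T euclidean (fe e)"
  using rep_continuous[OF rep] by (cases e) (auto simp: fe_def E_iff)

lemma chi_square_integrable: "b \<in> B \<Longrightarrow> Q.square_integrable (chi b)"
  using Q.sinprod_family[OF jx_jgauss rho, of "Pow J" 0] Q.sinrem_family[OF jx_jgauss rho(1)]
  unfolding B_def chi_def Q.orthogonal_family_def by (cases b) auto

lemma chi_integrable:
  assumes "b \<in> B" shows "integrable P (\<lambda>\<omega>. complex_of_real (chi b \<omega>))"
proof -
  have "Q.square_integrable (\<lambda>_. 1)" by (rule Q.square_integrable_bounded) auto
  from Q.square_integrable_mult[OF chi_square_integrable[OF assms] this] show ?thesis by simp
qed

lemma ps_seminorm: "is_seminorm ps"
proof -
  have "is_seminorm (\<lambda>c. \<integral>\<omega>. supnorm (\<lambda>t. \<Sum>k\<in>B \<times> E. (c k * complex_of_real (chi (fst k) \<omega>)) * fe (snd k) t) \<partial>P)"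
    by (rule supnorm_seminorm[where a="\<lambda>k \<omega>. complex_of_real (chi (fst k) \<omega>)" and f="\<lambda>k. fe (snd k)"])
      (auto simp: finB finE chi_integrable fe_continuous)
  from is_seminorm_scale[OF this less_imp_le[OF C_pos]] show ?thesis unfolding ps_def[abs_def] .
qed

lemma uq_subspace: "csubspace (range uq)"
  unfolding csubspace_def
proof (intro conjI ballI allI)
  have "(\<lambda>_. 0) = uq (\<lambda>_ _ _. 0)"
    by (rule ext) (auto simp: uq_def kap_def split: sum.splits prod.splits)
  thus "(\<lambda>_. 0) \<in> range uq" by blast
  fix u v a assume "u \<in> range uq" "v \<in> range uq"
  then obtain q q' where q: "u = uq q" "v = uq q'" by blast
  have k: "kap (\<lambda>n i l. q n i l + a * q' n i l) b e = kap q b e + a * kap q' b e" for b e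
    by (cases b, cases "fst b", cases e) (simp add: kap_def algebra_simps)
  have "(\<lambda>k. u k + a * v k) = uq (\<lambda>n i l. q n i l + a * q' n i l)"
    by (rule ext) (simp add: q uq_def k split: sum.splits prod.splits)
  thus "(\<lambda>k. u k + a * v k) \<in> range uq" by blast
qed

text \<open>Here the hypothesis enters: duality with the contractions \<open>z n\<close> bounds the
  functional by trace norms of \<open>Q\<close>, and the random Sidon inequality bounds those by
  \<open>ps\<close>.\<close>

lemma l0_bound: "cmod (\<Sum>k\<in>B \<times> E. l0 k * uq q k) \<le> ps (uq q)"
proof -
  define Q where "Q n = mat (d n) (d n) (\<lambda>(i, l). q n i l)" for n
  have Qc: "Q n \<in> carrier_mat (d n) (d n)" for n by (simp add: Q_def)
  have zc: "z n \<in> carrier_mat (d n) (d n)" if "n \<in> S" for n using z_contraction[OF that] by (simp add: contraction_def)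
  have "(\<Sum>k\<in>B \<times> E. l0 k * uq q k) = (\<Sum>e\<in>E. \<Sum>b\<in>B. l0 (b, e) * uq q (b, e))"
    unfolding sum.cartesian_product' by (rule sum.swap)
  also have "\<dots> = (\<Sum>n\<in>S. of_nat (d n) * mat_trace (Q n * z n))"
    unfolding sum_l0_uq by (intro sum.cong refl) (simp add: mat_trace_mult[OF Qc zc], simp add: Q_def)
  finally have "cmod (\<Sum>k\<in>B \<times> E. l0 k * uq q k) \<le> (\<Sum>n\<in>S. cmod (of_nat (d n) * mat_trace (Q n * z n)))"
    by (simp only: norm_sum)
  also have "\<dots> \<le> (\<Sum>n\<in>S. real (d n) * trace_norm (Q n))"
    by (intro sum_mono) (simp add: norm_mult mult_left_mono trace_norm_dual[OF Qc z_contraction])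
  also have "\<dots> \<le> C * (\<integral>\<omega>. randnorm S Q \<omega> \<partial>P)" by (rule random_bound[OF Qc])
  also have "\<dots> = ps (uq q)" by (rule ps_uq[symmetric]) (rule Q_def)
  finally show ?thesis .
qed

text \<open>The second clause is agreement with \<open>l0\<close> on the trace sums, compared entry
  by entry in \<open>q\<close>; a difference of an \<open>Inl {a}\<close> and an
  \<open>Inr a\<close> value is the value of the functional at \<open>\<rho> x_a\<close>. Only sums
  over \<open>p\<close> are determined, and the average over the group will produce precisely these
  sums.\<close>

definition dual_functional where
  "dual_functional L \<longleftrightarrow> (\<forall>c. cmod (\<Sum>k\<in>B \<times> E. L k * c k) \<le> ps c) \<and>
    (\<forall>n\<in>S. \<forall>i<d n. \<forall>l<d n. (\<Sum>p<d n. (L (Inl {((n, l, p), True)}, (n, p, i)) - L (Inr ((n, l, p), True), (n, p, i)))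
      + \<i> * (L (Inl {((n, l, p), False)}, (n, p, i)) - L (Inr ((n, l, p), False), (n, p, i))))
      = complex_of_real (\<rho> * sqrt (2 * real (d n))) * z n $$ (l, i))"

lemma dual_functional_exists: "\<exists>L. dual_functional L"
proof -
  have "\<exists>L. (\<forall>c. cmod (\<Sum>k\<in>B \<times> E. L k * c k) \<le> ps c) \<and> (\<forall>u\<in>range uq. (\<Sum>k\<in>B \<times> E. L k * u k) = (\<Sum>k\<in>B \<times> E. l0 k * u k))"
  proof (rule hahn_banach_coords[OF _ uq_subspace ps_seminorm])
    show "finite (B \<times> E)" by (simp add: finB finE)
    show "ps c = ps c'" if "\<And>k. k \<in> B \<times> E \<Longrightarrow> c k = c' k" for c c'
    proof -
      have "(\<Sum>k\<in>B \<times> E. (c k * complex_of_real (chi (fst k) \<omega>)) * fe (snd k) t) = (\<Sum>k\<in>B \<times> E. (c' k * complex_of_real (chi (fst k) \<omega>)) * fe (snd k) t)" for \<omega> t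
        by (intro sum.cong refl) (simp only: that)
      thus ?thesis unfolding ps_def by (simp only:)
    qed
    show "cmod (\<Sum>k\<in>B \<times> E. l0 k * u k) \<le> ps u" if "u \<in> range uq" for u
      using that l0_bound by blast
  qed
  then obtain L where L: "\<And>c. cmod (\<Sum>k\<in>B \<times> E. L k * c k) \<le> ps c"
    and Lu: "\<And>q. (\<Sum>k\<in>B \<times> E. L k * uq q k) = (\<Sum>k\<in>B \<times> E. l0 k * uq q k)" by blast
  define del where "del n i l p = (L (Inl {((n, l, p), True)}, (n, p, i)) - L (Inr ((n, l, p), True), (n, p, i)))
      + \<i> * (L (Inl {((n, l, p), False)}, (n, p, i)) - L (Inr ((n, l, p), False), (n, p, i)))" for n i l p
  \<comment> \<open>The defect of the required identity at the entry \<open>(i, l)\<close>.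
    Agreement of the two functionals makes its pairing with every \<open>q\<close> vanish.\<close>
  define V where "V n i l = cc n * (\<Sum>p<d n. del n i l p) - of_nat (d n) * z n $$ (l, i)" for n i l
  have V0: "(\<Sum>n\<in>S. \<Sum>i<d n. \<Sum>l<d n. q n i l * V n i l) = 0" for q
  proof -
    have "(\<Sum>k\<in>B \<times> E. L k * uq q k) = (\<Sum>e\<in>E. \<Sum>b\<in>B. L (b, e) * uq q (b, e))"
      unfolding sum.cartesian_product' by (rule sum.swap)
    also have "\<dots> = (\<Sum>n\<in>S. \<Sum>p<d n. \<Sum>i<d n. \<Sum>l<d n. cc n * q n i l * del n i l p)"
      unfolding sumE
    proof (intro sum.cong refl)
      fix n p i assume "n \<in> S" "p \<in> {..<d n}"
      hence n: "n \<in> S" "p < d n" by auto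
      show "(\<Sum>b\<in>B. L (b, n, p, i) * uq q (b, n, p, i)) = (\<Sum>l<d n. cc n * q n i l * del n i l p)"
        unfolding sum_uq[of "\<lambda>b. L (b, (n, p, i))"] sum_kap[OF n] del_def ..
    qed
    also have "\<dots> = (\<Sum>n\<in>S. \<Sum>i<d n. \<Sum>p<d n. \<Sum>l<d n. cc n * q n i l * del n i l p)"
      by (intro sum.cong refl sum.swap)
    also have "\<dots> = (\<Sum>n\<in>S. \<Sum>i<d n. \<Sum>l<d n. \<Sum>p<d n. cc n * q n i l * del n i l p)"
      by (intro sum.cong refl sum.swap)
    also have "\<dots> = (\<Sum>n\<in>S. \<Sum>i<d n. \<Sum>l<d n. q n i l * (cc n * (\<Sum>p<d n. del n i l p)))"
      unfolding sum_distrib_left by (intro sum.cong refl) (simp only: mult_ac)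
    finally have 1: "(\<Sum>k\<in>B \<times> E. L k * uq q k) = (\<Sum>n\<in>S. \<Sum>i<d n. \<Sum>l<d n. q n i l * (cc n * (\<Sum>p<d n. del n i l p)))" .
    have "(\<Sum>k\<in>B \<times> E. l0 k * uq q k) = (\<Sum>e\<in>E. \<Sum>b\<in>B. l0 (b, e) * uq q (b, e))"
      unfolding sum.cartesian_product' by (rule sum.swap)
    also have "\<dots> = (\<Sum>n\<in>S. \<Sum>i<d n. \<Sum>l<d n. q n i l * (of_nat (d n) * z n $$ (l, i)))"
      unfolding sum_l0_uq sum_distrib_left by (intro sum.cong refl) (simp only: mult_ac)
    finally have "(\<Sum>n\<in>S. \<Sum>i<d n. \<Sum>l<d n. q n i l * (cc n * (\<Sum>p<d n. del n i l p))) = (\<Sum>n\<in>S. \<Sum>i<d n. \<Sum>l<d n. q n i l * (of_nat (d n) * z n $$ (l, i)))"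
      using 1 Lu by simp
    thus ?thesis unfolding V_def right_diff_distrib sum_subtractf by simp
  qed
  \<comment> \<open>Choosing \<open>q\<close> as the conjugate of \<open>V\<close> makes a sum of
    squares vanish.\<close>
  have "complex_of_real (\<Sum>e\<in>E. (cmod (case e of (n, i, l) \<Rightarrow> V n i l))\<^sup>2) = (\<Sum>n\<in>S. \<Sum>i<d n. \<Sum>l<d n. cnj (V n i l) * V n i l)"
    unfolding sumE of_real_sum by (intro sum.cong refl) (simp only: prod.case complex_norm_square mult.commute)
  also have "\<dots> = 0" by (rule V0)
  finally have "(\<Sum>e\<in>E. (cmod (case e of (n, i, l) \<Rightarrow> V n i l))\<^sup>2) = 0" by (simp only: of_real_eq_0_iff)
  hence Ve: "\<forall>e\<in>E. (cmod (case e of (n, i, l) \<Rightarrow> V n i l))\<^sup>2 = 0" by (subst (asm) sum_nonneg_eq_0_iff[OF finE]) auto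
  have "(\<Sum>p<d n. del n i l p) = complex_of_real (\<rho> * sqrt (2 * real (d n))) * z n $$ (l, i)" if "n \<in> S" "i < d n" "l < d n" for n i l
  proof -
    have "(n, i, l) \<in> E" using that by (simp add: E_iff)
    from bspec[OF Ve this] have v: "cc n * (\<Sum>p<d n. del n i l p) = of_nat (d n) * z n $$ (l, i)" by (simp add: V_def)
    have "sqrt (real (d n) / 2) / \<rho> * (\<rho> * sqrt (2 * real (d n))) = real (d n)"
      using rho d_pos[of n] by (simp add: real_sqrt_divide real_sqrt_mult)
    hence k: "cc n * complex_of_real (\<rho> * sqrt (2 * real (d n))) = of_nat (d n)"
      unfolding cc_def of_real_mult[symmetric] by (simp only: of_real_of_nat_eq)
    have "cc n \<noteq> 0" using rho d_pos[of n] by (simp add: cc_def)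
    moreover have "cc n * (\<Sum>p<d n. del n i l p) = cc n * (complex_of_real (\<rho> * sqrt (2 * real (d n))) * z n $$ (l, i))"
      unfolding v mult.assoc[symmetric] k ..
    ultimately show ?thesis by (simp only: mult_cancel_left) simp
  qed
  thus ?thesis unfolding dual_functional_def del_def using L by blast
qed

end

text \<open>The inequality \<open>2 * sqrt y \<le> y / e + e\<close> is integrated. Taking
  \<open>c + e\<close> with small positive \<open>e\<close> in place of \<open>c\<close> covers the
  case \<open>c = 0\<close>.\<close>

lemma (in prob_space) expectation_sqrt:
  assumes f: "integrable M f" "\<And>x. 0 \<le> f x" and c: "(\<integral>x. f x \<partial>M) \<le> c\<^sup>2" "0 \<le> c"
  shows "integrable M (\<lambda>x. sqrt (f x))" "(\<integral>x. sqrt (f x) \<partial>M) \<le> c"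
proof -
  have amgm: "sqrt (f x) \<le> (f x / e + e) / 2" if "e > 0" for e x
  proof -
    have "0 \<le> (sqrt (f x) - e)\<^sup>2" by simp
    hence "2 * e * sqrt (f x) \<le> f x + e\<^sup>2" using f(2)[of x] by (simp add: power2_diff mult_ac)
    thus ?thesis using that by (simp add: field_simps power2_eq_square)
  qed
  have "integrable M (\<lambda>x. 1 + f x)" using f(1) by simp
  thus i: "integrable M (\<lambda>x. sqrt (f x))"
  proof (rule Bochner_Integration.integrable_bound)
    show "(\<lambda>x. sqrt (f x)) \<in> borel_measurable M" using f(1) by measurable
    show "AE x in M. norm (sqrt (f x)) \<le> norm (1 + f x)"
    proof (rule AE_I2)
      fix x show "norm (sqrt (f x)) \<le> norm (1 + f x)" using amgm[of 1 x] f(2)[of x] by simp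
    qed
  qed
  show "(\<integral>x. sqrt (f x) \<partial>M) \<le> c"
  proof (rule field_le_epsilon)
    fix e :: real assume e: "0 < e"
    hence ce: "c + e > 0" using c(2) by simp
    have "(\<integral>x. sqrt (f x) \<partial>M) \<le> (\<integral>x. (f x / (c + e) + (c + e)) / 2 \<partial>M)"
      using f(1) by (intro integral_mono i amgm[OF ce]) simp_all
    also have "\<dots> = ((\<integral>x. f x \<partial>M) / (c + e) + (c + e)) / 2" using f(1) by (simp add: prob_space)
    also have "(\<integral>x. f x \<partial>M) / (c + e) \<le> (c + e)\<^sup>2 / (c + e)"
      by (rule divide_right_mono[OF order_trans[OF c(1) power_mono]]) (use e c(2) in auto)
    also have "(c + e)\<^sup>2 / (c + e) = c + e" using ce by (simp add: power2_eq_square)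
    finally show "(\<integral>x. sqrt (f x) \<partial>M) \<le> c + e" by simp
  qed
qed

section \<open>Bessel inequalities for the dual functional\<close>

lemma nrm2_add3:
  "nrm2 n (\<lambda>p. f p + h p + k p) \<le> 3 * (nrm2 n f + nrm2 n h + nrm2 n k)"
proof -
  have "(cmod (a + b + c))\<^sup>2 \<le> 3 * ((cmod a)\<^sup>2 + (cmod b)\<^sup>2 + (cmod c)\<^sup>2)" for a b c
  proof -
    have "(cmod (a + b + c))\<^sup>2 \<le> (cmod a + cmod b + cmod c)\<^sup>2"
      by (intro power_mono order_trans[OF norm_triangle_ineq] add_right_mono norm_triangle_ineq norm_ge_zero)
    also have "\<dots> \<le> 3 * ((cmod a)\<^sup>2 + (cmod b)\<^sup>2 + (cmod c)\<^sup>2)"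
      using zero_le_power2[of "cmod a - cmod b"] zero_le_power2[of "cmod b - cmod c"] zero_le_power2[of "cmod a - cmod c"]
      by (simp add: power2_eq_square algebra_simps)
    finally show ?thesis .
  qed
  thus ?thesis unfolding nrm2_def sum.distrib[symmetric] sum_distrib_left by (intro sum_mono) blast
qed

lemma (in prob_space) orthogonal_family_reindex:
  assumes "orthogonal_family (f ` K) \<psi> \<beta>" "inj_on f K" shows "orthogonal_family K (\<lambda>k. \<psi> (f k)) \<beta>"
proof -
  have "finite K" using assms finite_imageD unfolding orthogonal_family_def by blast
  thus ?thesis using assms(1) inj_onD[OF assms(2)] unfolding orthogonal_family_def by (simp, metis)
qed

locale randomly_sidon_dual = randomly_sidon_step G T m d \<phi> P g S C \<rho> z
  for G :: "'a monoid" (structure) and T :: "'a topology" and m :: "'a measure"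
    and d :: "nat \<Rightarrow> nat" and \<phi> :: "nat \<Rightarrow> 'a \<Rightarrow> complex mat"
    and P :: "'w measure" and g :: "nat \<Rightarrow> 'w \<Rightarrow> complex mat"
    and S C \<rho> z +
  fixes L assumes L: "dual_functional L"
begin

lemma L_bound:
  "cmod (\<Sum>b\<in>B. \<Sum>e\<in>E. L (b, e) * c b e)
    \<le> C * (\<integral>\<omega>. supnorm (\<lambda>t. \<Sum>b\<in>B. \<Sum>e\<in>E. c b e * complex_of_real (chi b \<omega>) * fe e t) \<partial>P)"
proof -
  have "cmod (\<Sum>k\<in>B \<times> E. L k * (case k of (b, e) \<Rightarrow> c b e)) \<le> ps (\<lambda>(b, e). c b e)"
    using L unfolding dual_functional_def by (elim conjE allE) assumption
  thus ?thesis unfolding ps_def sum.cartesian_product' by (simp only: prod.case fst_conv snd_conv)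
qed

lemma L_integrable: "integrable P (\<lambda>\<omega>. supnorm (\<lambda>t. \<Sum>b\<in>B. \<Sum>e\<in>E. c b e * complex_of_real (chi b \<omega>) * fe e t))"
proof -
  have "integrable P (\<lambda>\<omega>. supnorm (\<lambda>t. \<Sum>k\<in>B \<times> E. (case k of (b, e) \<Rightarrow> c b e * complex_of_real (chi b \<omega>)) * (case k of (b, e) \<Rightarrow> fe e t)))"
    using supnorm_integrable[of "B \<times> E" P "\<lambda>k \<omega>. case k of (b, e) \<Rightarrow> c b e * complex_of_real (chi b \<omega>)" "\<lambda>k t. case k of (b, e) \<Rightarrow> fe e t"]
    by (auto simp: finB finE chi_integrable fe_continuous)
  thus ?thesis unfolding sum.cartesian_product' by (simp only: prod.case)
qed

text \<open>The functional is tested on the coefficients \<open>cnj (Z b p) * v q\<close>, where it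
  returns the left-hand side \<open>R\<close>. Since \<open>\<phi> n t\<close> is unitary, the sup
  norm of the tested function is at most \<open>sqrt (M \<omega>)\<close> times the length of
  \<open>v\<close>, and orthogonality bounds the mean of \<open>sqrt (M \<omega>)\<close> by
  \<open>\<alpha> * sqrt R\<close>. Hence \<open>R\<close> is at most \<open>sqrt R\<close> times
  the root of the right-hand side.\<close>

lemma bessel_L:
  assumes i: "inj_on \<iota> K" "\<iota> ` K \<subseteq> B" and o: "Q.orthogonal_family K (\<lambda>k. chi (\<iota> k)) \<alpha>" and m: "n \<in> S"
  shows "(\<Sum>k\<in>K. nrm2 (d n) (\<lambda>p. \<Sum>q<d n. L (\<iota> k, (n, p, q)) * v q)) \<le> (C * \<alpha>)\<^sup>2 * nrm2 (d n) v"
proof -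
  define Z where "Z b p = (\<Sum>q<d n. L (b, (n, p, q)) * v q)" for b p
  define c where "c b = (\<lambda>(n', p, q). if b \<in> \<iota> ` K \<and> n' = n then cnj (Z b p) * v q else 0)" for b
  define R where "R = (\<Sum>k\<in>K. nrm2 (d n) (Z (\<iota> k)))"
  define M where "M \<omega> = (\<Sum>p<d n. (cmod (\<Sum>k\<in>K. cnj (Z (\<iota> k) p) * complex_of_real (chi (\<iota> k) \<omega>)))\<^sup>2)" for \<omega>
  have \<alpha>: "0 \<le> \<alpha>" using o by (simp add: Q.orthogonal_family_def)
  have R0: "0 \<le> R" by (simp add: R_def sum_nonneg)
  have cE: "(\<Sum>e\<in>E. c b e * h e) = (if b \<in> \<iota> ` K then \<Sum>p<d n. \<Sum>q<d n. cnj (Z b p) * v q * h (n, p, q) else 0)" for b h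
  proof -
    have "(\<Sum>e\<in>E. c b e * h e) = (\<Sum>n'\<in>S. if n' = n then (\<Sum>p<d n. \<Sum>q<d n. c b (n, p, q) * h (n, p, q)) else 0)"
      unfolding sumE by (intro sum.cong refl) (simp add: c_def)
    also have "\<dots> = (\<Sum>p<d n. \<Sum>q<d n. c b (n, p, q) * h (n, p, q))" by (simp only: sum.delta[OF finS] m if_True)
    finally show ?thesis by (simp add: c_def)
  qed
  have cB: "(\<Sum>b\<in>B. if b \<in> \<iota> ` K then h b else 0) = (\<Sum>k\<in>K. h (\<iota> k))" for h :: "_ \<Rightarrow> complex"
  proof -
    have "(\<Sum>b\<in>B. if b \<in> \<iota> ` K then h b else 0) = (\<Sum>b\<in>B \<inter> \<iota> ` K. h b)" by (rule sum.inter_restrict[OF finB, symmetric])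
    also have "B \<inter> \<iota> ` K = \<iota> ` K" using i(2) by blast
    finally show ?thesis by (simp only: sum.reindex[OF i(1)] comp_def)
  qed
  have "(\<Sum>b\<in>B. \<Sum>e\<in>E. L (b, e) * c b e) = (\<Sum>k\<in>K. \<Sum>p<d n. \<Sum>q<d n. cnj (Z (\<iota> k) p) * v q * L (\<iota> k, (n, p, q)))"
    unfolding mult.commute[of "L _"] cE cB ..
  also have "\<dots> = (\<Sum>k\<in>K. \<Sum>p<d n. Z (\<iota> k) p * cnj (Z (\<iota> k) p))"
  proof (intro sum.cong refl)
    fix k p
    have "(\<Sum>q<d n. cnj (Z (\<iota> k) p) * v q * L (\<iota> k, (n, p, q))) = cnj (Z (\<iota> k) p) * (\<Sum>q<d n. L (\<iota> k, (n, p, q)) * v q)"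
      unfolding sum_distrib_left by (intro sum.cong refl) (simp only: mult_ac)
    also have "(\<Sum>q<d n. L (\<iota> k, (n, p, q)) * v q) = Z (\<iota> k) p" by (simp only: Z_def)
    finally show "(\<Sum>q<d n. cnj (Z (\<iota> k) p) * v q * L (\<iota> k, (n, p, q))) = Z (\<iota> k) p * cnj (Z (\<iota> k) p)"
      by (simp only: mult.commute)
  qed
  also have "\<dots> = complex_of_real R" unfolding R_def nrm2_def of_real_sum complex_norm_square ..
  finally have LR: "(\<Sum>b\<in>B. \<Sum>e\<in>E. L (b, e) * c b e) = complex_of_real R" .
  have sb: "supnorm (\<lambda>t. \<Sum>b\<in>B. \<Sum>e\<in>E. c b e * complex_of_real (chi b \<omega>) * fe e t) \<le> sqrt (M \<omega>) * sqrt (nrm2 (d n) v)" for \<omega>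
  proof (rule supnorm_least)
    fix t assume t: "t \<in> carrier G"
    have "(\<Sum>b\<in>B. \<Sum>e\<in>E. c b e * complex_of_real (chi b \<omega>) * fe e t)
      = (\<Sum>k\<in>K. \<Sum>p<d n. \<Sum>q<d n. cnj (Z (\<iota> k) p) * v q * (complex_of_real (chi (\<iota> k) \<omega>) * fe (n, p, q) t))"
      unfolding mult.assoc[of "c _ _"] cE cB ..
    also have "\<dots> = (\<Sum>p<d n. \<Sum>k\<in>K. \<Sum>q<d n. cnj (Z (\<iota> k) p) * v q * (complex_of_real (chi (\<iota> k) \<omega>) * fe (n, p, q) t))"
      by (rule sum.swap)
    also have "\<dots> = (\<Sum>p<d n. (\<Sum>q<d n. \<phi> n t $$ (p, q) * v q) * (\<Sum>k\<in>K. cnj (Z (\<iota> k) p) * complex_of_real (chi (\<iota> k) \<omega>)))"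
    proof (intro sum.cong refl)
      fix p
      show "(\<Sum>k\<in>K. \<Sum>q<d n. cnj (Z (\<iota> k) p) * v q * (complex_of_real (chi (\<iota> k) \<omega>) * fe (n, p, q) t))
        = (\<Sum>q<d n. \<phi> n t $$ (p, q) * v q) * (\<Sum>k\<in>K. cnj (Z (\<iota> k) p) * complex_of_real (chi (\<iota> k) \<omega>))"
        unfolding sum_product by (subst sum.swap) (simp add: fe_def mult_ac)
    qed
    also have "\<dots> = ip (d n) (\<lambda>p. \<Sum>q<d n. \<phi> n t $$ (p, q) * v q) (\<lambda>p. cnj (\<Sum>k\<in>K. cnj (Z (\<iota> k) p) * complex_of_real (chi (\<iota> k) \<omega>)))"
      unfolding ip_def complex_cnj_cnj ..
    also have "cmod \<dots> \<le> sqrt (nrm2 (d n) (\<lambda>p. \<Sum>q<d n. \<phi> n t $$ (p, q) * v q)) * sqrt (nrm2 (d n) (\<lambda>p. cnj (\<Sum>k\<in>K. cnj (Z (\<iota> k) p) * complex_of_real (chi (\<iota> k) \<omega>))))"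
      by (rule ip_cauchy_schwarz)
    also have "\<dots> = sqrt (M \<omega>) * sqrt (nrm2 (d n) v)"
      unfolding rep_nrm2[OF rep t] unfolding nrm2_def complex_mod_cnj M_def by (rule mult.commute)
    finally show "cmod (\<Sum>b\<in>B. \<Sum>e\<in>E. c b e * complex_of_real (chi b \<omega>) * fe e t) \<le> sqrt (M \<omega>) * sqrt (nrm2 (d n) v)" .
  qed
  have Mi: "integrable P M" unfolding M_def by (intro Bochner_Integration.integrable_sum Q.orthogonal_bound(1)[OF o])
  have "(\<integral>\<omega>. M \<omega> \<partial>P) = (\<Sum>p<d n. \<integral>\<omega>. (cmod (\<Sum>k\<in>K. cnj (Z (\<iota> k) p) * complex_of_real (chi (\<iota> k) \<omega>)))\<^sup>2 \<partial>P)"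
    unfolding M_def by (rule Bochner_Integration.integral_sum) (rule Q.orthogonal_bound(1)[OF o])
  also have "\<dots> \<le> (\<Sum>p<d n. \<alpha>\<^sup>2 * (\<Sum>k\<in>K. (cmod (cnj (Z (\<iota> k) p)))\<^sup>2))"
    by (intro sum_mono Q.orthogonal_bound(2)[OF o])
  also have "\<dots> = (\<alpha> * sqrt R)\<^sup>2"
    unfolding sum_distrib_left[symmetric] power_mult_distrib real_sqrt_pow2[OF R0]
    unfolding R_def nrm2_def complex_mod_cnj by (subst sum.swap) (rule refl)
  finally have M: "(\<integral>\<omega>. M \<omega> \<partial>P) \<le> (\<alpha> * sqrt R)\<^sup>2" .
  have M0: "0 \<le> M \<omega>" for \<omega> by (simp add: M_def sum_nonneg)
  note sq = Q.expectation_sqrt[OF Mi M0 M mult_nonneg_nonneg[OF \<alpha> real_sqrt_ge_zero[OF R0]]]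
  have "R = cmod (\<Sum>b\<in>B. \<Sum>e\<in>E. L (b, e) * c b e)" unfolding LR using R0 by simp
  also have "\<dots> \<le> C * (\<integral>\<omega>. supnorm (\<lambda>t. \<Sum>b\<in>B. \<Sum>e\<in>E. c b e * complex_of_real (chi b \<omega>) * fe e t) \<partial>P)" by (rule L_bound)
  also have "\<dots> \<le> C * (\<integral>\<omega>. sqrt (M \<omega>) * sqrt (nrm2 (d n) v) \<partial>P)"
    using C_pos sq(1) by (intro mult_left_mono integral_mono L_integrable sb) simp_all
  also have "\<dots> \<le> C * (\<alpha> * sqrt R * sqrt (nrm2 (d n) v))"
    using C_pos mult_right_mono[OF sq(2), of "sqrt (nrm2 (d n) v)"] by (simp add: mult.assoc)
  finally have RR: "sqrt R * sqrt R \<le> (C * \<alpha> * sqrt (nrm2 (d n) v)) * sqrt R" using R0 by (simp add: mult_ac)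
  have "sqrt R \<le> C * \<alpha> * sqrt (nrm2 (d n) v)"
  proof (cases "R = 0")
    case True thus ?thesis using C_pos \<alpha> by simp
  next
    case False
    hence "0 < sqrt R" using R0 by simp
    thus ?thesis using RR by (simp only: mult_le_cancel_right_pos)
  qed
  hence "(sqrt R)\<^sup>2 \<le> (C * \<alpha> * sqrt (nrm2 (d n) v))\<^sup>2" by (rule power_mono) (simp add: R0)
  thus ?thesis unfolding real_sqrt_pow2[OF R0] power_mult_distrib real_sqrt_pow2[OF nrm2_nonneg] unfolding R_def Z_def .
qed

text \<open>Two orthogonal families are paired key by key: \<open>bessel_L\<close> controls the
  values of the functional on the first, orthogonality of \<open>\<psi>\<close> the random sum. The
  norm bounds multiply, whatever the number of keys.\<close>

lemma piece_bound:
  assumes i: "inj_on \<iota> K" "\<iota> ` K \<subseteq> B" and o: "Q.orthogonal_family K (\<lambda>k. chi (\<iota> k)) \<alpha>" and m: "n \<in> S"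
    and \<psi>: "Q.orthogonal_family K \<psi> \<beta>" and v: "nrm2 (d n) v \<le> 1"
  defines "N \<equiv> \<lambda>\<omega>. nrm2 (d n) (\<lambda>p. \<Sum>k\<in>K. (\<Sum>q<d n. L (\<iota> k, (n, p, q)) * v q) * complex_of_real (\<psi> k \<omega>))"
  shows "integrable P N" "(\<integral>\<omega>. N \<omega> \<partial>P) \<le> (C * \<alpha> * \<beta>)\<^sup>2"
proof -
  show "integrable P N" unfolding N_def nrm2_def
    by (intro Bochner_Integration.integrable_sum Q.orthogonal_bound(1)[OF \<psi>])
  have "(\<integral>\<omega>. N \<omega> \<partial>P) = (\<Sum>p<d n. \<integral>\<omega>. (cmod (\<Sum>k\<in>K. (\<Sum>q<d n. L (\<iota> k, (n, p, q)) * v q) * complex_of_real (\<psi> k \<omega>)))\<^sup>2 \<partial>P)"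
    unfolding N_def nrm2_def by (rule Bochner_Integration.integral_sum) (rule Q.orthogonal_bound(1)[OF \<psi>])
  also have "\<dots> \<le> (\<Sum>p<d n. \<beta>\<^sup>2 * (\<Sum>k\<in>K. (cmod (\<Sum>q<d n. L (\<iota> k, (n, p, q)) * v q))\<^sup>2))"
    by (intro sum_mono Q.orthogonal_bound(2)[OF \<psi>])
  also have "\<dots> = \<beta>\<^sup>2 * (\<Sum>k\<in>K. nrm2 (d n) (\<lambda>p. \<Sum>q<d n. L (\<iota> k, (n, p, q)) * v q))"
    unfolding sum_distrib_left[symmetric] nrm2_def by (subst sum.swap) (rule refl)
  also have "\<dots> \<le> \<beta>\<^sup>2 * ((C * \<alpha>)\<^sup>2 * nrm2 (d n) v)" by (intro mult_left_mono bessel_L[OF i o m]) simp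
  also have "\<dots> \<le> \<beta>\<^sup>2 * ((C * \<alpha>)\<^sup>2 * 1)" by (intro mult_left_mono v) simp_all
  finally show "(\<integral>\<omega>. N \<omega> \<partial>P) \<le> (C * \<alpha> * \<beta>)\<^sup>2" by (simp add: power_mult_distrib mult_ac)
qed

text \<open>The entries of \<open>g n * \<phi> n t\<close>, a unitary image of those of \<open>g n\<close>; the rotation by \<open>\<i> ^ k\<close> in \<open>jy\<close>
  serves to separate conjugate linear from linear and constant terms.\<close>

definition hh :: "'a \<Rightarrow> nat \<times> nat \<times> nat \<Rightarrow> 'w \<Rightarrow> complex" where
  "hh t = (\<lambda>(n, i, j) \<omega>. \<Sum>l<d n. \<phi> n t $$ (l, j) * gam (n, i, l) \<omega>)"

definition jy :: "'a \<Rightarrow> nat \<Rightarrow> (nat \<times> nat \<times> nat) \<times> bool \<Rightarrow> 'w \<Rightarrow> real" where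
  "jy t k = (\<lambda>(b, r) \<omega>. sqrt 2 * (if r then Re (\<i> ^ k * hh t b \<omega>) else Im (\<i> ^ k * hh t b \<omega>)))"

lemma sumE_match:
  fixes f :: "nat \<Rightarrow> complex"
  assumes "n \<in> S" "i < d n"
  shows "(\<Sum>(n', i', l)\<in>E. if n' = n \<and> i' = i then f l else 0) = (\<Sum>l<d n. f l)"
proof -
  have "(\<Sum>(n', i', l)\<in>E. if n' = n \<and> i' = i then f l else 0)
    = (\<Sum>n'\<in>S. if n' = n then (\<Sum>i'<d n. if i' = i then (\<Sum>l<d n. f l) else 0) else 0)"
    unfolding sumE prod.case
  proof (intro sum.cong refl)
    have e: "(\<Sum>l<d n. if Q then f l else 0) = (if Q then \<Sum>l<d n. f l else 0)" for Q by (cases Q) simp_all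
    show "(\<Sum>i'<d n'. \<Sum>l<d n'. if n' = n \<and> i' = i then f l else 0) = (if n' = n then (\<Sum>i'<d n. if i' = i then (\<Sum>l<d n. f l) else 0) else 0)" for n'
      by (cases "n' = n") (simp_all add: e)
  qed
  thus ?thesis using assms by (simp only: sum.delta[OF finS] sum.delta[OF finite_lessThan] lessThan_iff if_True)
qed

text \<open>The columns of \<open>\<phi> n t\<close> are orthonormal and \<open>\<i> ^ k\<close> has
  modulus one, so the entries of the rotated product have the same joint law as those of
  \<open>g\<close>.\<close>

lemma jy_jgauss:
  assumes t: "t \<in> carrier G" shows "Q.jgauss J (jy t k)"
proof -
  define U where "U = (\<lambda>(n::nat, i::nat, j::nat) (n'::nat, i'::nat, l::nat). if n' = n \<and> i' = i then \<i> ^ k * \<phi> n t $$ (l, j) else 0)"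
  have ik: "\<i> ^ k * cnj (\<i> ^ k) = 1" by (simp flip: power_mult_distrib)
  have W: "(\<Sum>a\<in>E. U b a * gam a \<omega>) = \<i> ^ k * hh t b \<omega>" if "b \<in> E" for b \<omega>
  proof -
    obtain n i j where b: "b = (n, i, j)" by (metis prod_cases3)
    have n: "n \<in> S" "i < d n" using that by (auto simp: b E_iff)
    have "(\<Sum>a\<in>E. U b a * gam a \<omega>) = (\<Sum>(n', i', l)\<in>E. if n' = n \<and> i' = i then \<i> ^ k * \<phi> n t $$ (l, j) * gam (n, i, l) \<omega> else 0)"
      by (intro sum.cong refl) (auto simp: U_def b)
    also have "\<dots> = \<i> ^ k * hh t b \<omega>" unfolding sumE_match[OF n] by (simp add: b hh_def sum_distrib_left mult.assoc)
    finally show ?thesis .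
  qed
  have U: "(\<Sum>a\<in>E. U b a * cnj (U b' a)) = (if b = b' then 1 else 0)" if "b \<in> E" "b' \<in> E" for b b'
  proof -
    obtain n i j where b: "b = (n, i, j)" by (metis prod_cases3)
    obtain n0 i0 j0 where b': "b' = (n0, i0, j0)" by (metis prod_cases3)
    have n: "n \<in> S" "i < d n" "j < d n" "j0 < d n0" using that by (auto simp: b b' E_iff)
    have "(\<Sum>a\<in>E. U b a * cnj (U b' a)) = (\<Sum>(n', i', l)\<in>E. if n' = n \<and> i' = i then (if n = n0 \<and> i = i0 then (\<i> ^ k * cnj (\<i> ^ k)) * (cnj (\<phi> n t $$ (l, j0)) * \<phi> n t $$ (l, j)) else 0) else 0)"
      by (intro sum.cong refl) (auto simp: U_def b b' mult_ac)
    also have "\<dots> = (\<Sum>l<d n. if n = n0 \<and> i = i0 then cnj (\<phi> n t $$ (l, j0)) * \<phi> n t $$ (l, j) else 0)"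
      unfolding sumE_match[OF n(1,2)] ik mult_1 ..
    also have "\<dots> = (if b = b' then 1 else 0)"
      using unitaryD(1)[OF rep_unitary[OF rep t], of j0 n j] n by (cases "n = n0 \<and> i = i0") (auto simp: b b')
    finally show ?thesis .
  qed
  have "Q.jgauss (E \<times> UNIV) (\<lambda>(b, r) \<omega>. sqrt 2 * (if r then Re (\<Sum>a\<in>E. U b a * gam a \<omega>) else Im (\<Sum>a\<in>E. U b a * gam a \<omega>)))"
    by (rule Q.unitary_image_jgauss[OF finE E_entries finE]) (rule U)
  thus ?thesis unfolding J_def
  proof (rule Q.jgauss_cong)
    fix a :: "(nat \<times> nat \<times> nat) \<times> bool" and \<omega> assume "a \<in> E \<times> UNIV"
    then obtain b r where a: "a = (b, r)" "b \<in> E" by (cases a) auto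
    show "jy t k a \<omega> = (case a of (b, r) \<Rightarrow> \<lambda>\<omega>. sqrt 2 * (if r then Re (\<Sum>a\<in>E. U b a * gam a \<omega>) else Im (\<Sum>a\<in>E. U b a * gam a \<omega>))) \<omega>"
      unfolding a(1) jy_def prod.case W[OF a(2)] ..
  qed
qed

definition big :: "((nat \<times> nat \<times> nat) \<times> bool) set set" where "big = {A. A \<subseteq> J \<and> 2 \<le> card A}"

text \<open>What is left of \<open>\<Sum>\<^sub>A W\<^sub>A L(X\<^sub>A)\<close> when its constant term and a term linear in \<open>jy\<close> are removed.\<close>

definition Xi :: "'a \<Rightarrow> nat \<Rightarrow> 'w \<Rightarrow> nat \<times> nat \<times> nat \<Rightarrow> complex" where
  "Xi t k \<omega> e = (\<Sum>A\<in>big. L (Inl A, e) * complex_of_real (sinprod \<rho> (jy t k) A \<omega>))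
    + (\<Sum>a\<in>J. L (Inr a, e) * complex_of_real (\<rho> * jy t k a \<omega>))
    + (\<Sum>a\<in>J. L (Inl {a}, e) * complex_of_real (sinrem \<rho> (jy t k) a \<omega>))"

lemma hh_measurable:
  assumes "b \<in> E" shows "(\<lambda>x. hh (fst x) b (snd x)) \<in> borel_measurable (m \<Otimes>\<^sub>M P)"
proof -
  obtain n i j where b: "b = (n, i, j)" by (metis prod_cases3)
  have n: "i < d n" "j < d n" using assms by (auto simp: b E_iff)
  have "(\<lambda>x. \<Sum>l<d n. \<phi> n (fst x) $$ (l, j) * gam (n, i, l) (snd x)) \<in> borel_measurable (m \<Otimes>\<^sub>M P)"
  proof (intro borel_measurable_sum borel_measurable_times)
    fix l assume "l \<in> {..<d n}"
    hence l: "l < d n" by simp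
    show "(\<lambda>x. \<phi> n (fst x) $$ (l, j)) \<in> borel_measurable (m \<Otimes>\<^sub>M P)"
      by (rule measurable_compose[OF measurable_fst rep_measurable[OF rep l n(2)]])
    have "(n, i, l) \<in> entries" using n l by (simp add: entries_def)
    thus "(\<lambda>x. gam (n, i, l) (snd x)) \<in> borel_measurable (m \<Otimes>\<^sub>M P)"
      by (rule measurable_compose[OF measurable_snd Q.gamma_measurable])
  qed
  thus ?thesis by (simp add: b hh_def)
qed

lemma jy_measurable:
  assumes "a \<in> J" shows "(\<lambda>x. jy (fst x) k a (snd x)) \<in> borel_measurable (m \<Otimes>\<^sub>M P)"
proof -
  obtain b r where a: "a = (b, r)" "b \<in> E" using assms by (cases a) (auto simp: J_def)
  note [measurable] = hh_measurable[OF a(2)]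
  show ?thesis by (cases r) (simp_all add: a(1) jy_def)
qed

lemma sinprod_jy_measurable:
  assumes "A \<subseteq> J" shows "(\<lambda>x. sinprod \<rho> (jy (fst x) k) A (snd x)) \<in> borel_measurable (m \<Otimes>\<^sub>M P)"
  unfolding sinprod_def
  by (intro borel_measurable_prod measurable_compose[OF _ borel_measurable_sin] borel_measurable_times borel_measurable_const jy_measurable subsetD[OF assms])

lemma sinrem_jy_measurable:
  assumes "a \<in> J" shows "(\<lambda>x. sinrem \<rho> (jy (fst x) k) a (snd x)) \<in> borel_measurable (m \<Otimes>\<^sub>M P)"
proof -
  note [measurable] = jy_measurable[OF assms]
  show ?thesis unfolding sinrem_def by measurable
qed

lemma Xi_measurable: "(\<lambda>x. Xi (fst x) k (snd x) e) \<in> borel_measurable (m \<Otimes>\<^sub>M P)"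
  unfolding Xi_def
  by (intro borel_measurable_add borel_measurable_sum borel_measurable_times borel_measurable_const measurable_compose[OF _ borel_measurable_of_real]
    sinprod_jy_measurable sinrem_jy_measurable jy_measurable) (simp_all add: big_def)

lemma nrm2_Xi_measurable:
  "(\<lambda>x. nrm2 (d n) (\<lambda>p. \<Sum>q<d n. Xi (fst x) k (snd x) (n, p, q) * v q)) \<in> borel_measurable (m \<Otimes>\<^sub>M P)"
  unfolding nrm2_def
  by (intro borel_measurable_sum borel_measurable_power measurable_compose[OF _ borel_measurable_norm] borel_measurable_times borel_measurable_const Xi_measurable)

lemma sum_times_swap:
  fixes l :: "'k \<Rightarrow> 'q \<Rightarrow> complex"
  shows "(\<Sum>q\<in>Q. (\<Sum>k\<in>K. l k q * c k) * v q) = (\<Sum>k\<in>K. (\<Sum>q\<in>Q. l k q * v q) * c k)"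
  unfolding sum_distrib_right by (subst sum.swap) (simp only: mult_ac)

text \<open>The three pieces have L2 bounds \<open>C * \<rho>^2 * \<rho>^2\<close> for sets with at
  least two keys, \<open>C * \<rho>^2 * \<rho>\<close> for errors in \<open>x\<close> against linear
  \<open>w\<close>, and \<open>C * \<rho> * \<rho>^2\<close> for sines of \<open>x\<close> against
  errors in \<open>w\<close>. Each is at most \<open>C * \<rho>^3\<close>. Squaring a sum of three
  costs a factor \<open>3\<close> and there are three squares, which gives
  \<open>(3 * C * \<rho>^3)^2\<close>.\<close>

lemma Xi_bound:
  assumes t: "t \<in> carrier G" and n: "n \<in> S" and v: "nrm2 (d n) v \<le> 1"
  shows "integrable P (\<lambda>\<omega>. sqrt (nrm2 (d n) (\<lambda>p. \<Sum>q<d n. Xi t k \<omega> (n, p, q) * v q)))" (is "integrable P (\<lambda>\<omega>. sqrt (?N \<omega>))")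
    "(\<integral>\<omega>. sqrt (nrm2 (d n) (\<lambda>p. \<Sum>q<d n. Xi t k \<omega> (n, p, q) * v q)) \<partial>P) \<le> 3 * C * \<rho> ^ 3"
proof -
  define N1 where "N1 \<omega> = nrm2 (d n) (\<lambda>p. \<Sum>A\<in>big. (\<Sum>q<d n. L (Inl A, (n, p, q)) * v q) * complex_of_real (sinprod \<rho> (jy t k) A \<omega>))" for \<omega>
  define N2 where "N2 \<omega> = nrm2 (d n) (\<lambda>p. \<Sum>a\<in>J. (\<Sum>q<d n. L (Inr a, (n, p, q)) * v q) * complex_of_real (\<rho> * jy t k a \<omega>))" for \<omega>
  define N3 where "N3 \<omega> = nrm2 (d n) (\<lambda>p. \<Sum>a\<in>J. (\<Sum>q<d n. L (Inl {a}, (n, p, q)) * v q) * complex_of_real (sinrem \<rho> (jy t k) a \<omega>))" for \<omega>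
  note jy = jy_jgauss[OF t, where k=k]
  have f1: "Q.orthogonal_family big (\<lambda>A. chi (Inl A)) (\<rho>\<^sup>2)"
    unfolding chi_def sum.case by (rule Q.sinprod_family[OF jx_jgauss rho]) (simp add: big_def)
  have f2: "Q.orthogonal_family J (\<lambda>a. chi (Inr a)) (\<rho>\<^sup>2)"
    unfolding chi_def sum.case by (rule Q.sinrem_family[OF jx_jgauss rho(1)])
  have f3: "Q.orthogonal_family J (\<lambda>a. chi (Inl {a})) \<rho>"
  proof -
    have "Q.orthogonal_family ((\<lambda>a. {a}) ` J) (sinprod \<rho> jx) (\<rho> ^ 1)"
      by (rule Q.sinprod_family[OF jx_jgauss rho]) auto
    from Q.orthogonal_family_reindex[OF this] show ?thesis unfolding chi_def sum.case by (simp add: inj_on_def)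
  qed
  have g1: "Q.orthogonal_family big (sinprod \<rho> (jy t k)) (\<rho>\<^sup>2)"
    by (rule Q.sinprod_family[OF jy rho]) (simp add: big_def)
  have B: "Inl ` big \<subseteq> B" "Inr ` J \<subseteq> B" "(\<lambda>a. Inl {a}) ` J \<subseteq> B" by (auto simp: B_def big_def)
  have I: "inj_on Inl big" "inj_on Inr J" "inj_on (\<lambda>a. Inl {a}) J" by (simp_all add: inj_on_def)
  note b1 = piece_bound[OF I(1) B(1) f1 n g1 v, folded N1_def]
  note b2 = piece_bound[OF I(2) B(2) f2 n Q.jgauss_family[OF jy less_imp_le[OF rho(1)]] v, folded N2_def]
  note b3 = piece_bound[OF I(3) B(3) f3 n Q.sinrem_family[OF jy rho(1)] v, folded N3_def]
  have le: "?N \<omega> \<le> 3 * (N1 \<omega> + N2 \<omega> + N3 \<omega>)" for \<omega>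
  proof -
    have "(\<Sum>q<d n. Xi t k \<omega> (n, p, q) * v q)
      = (\<Sum>A\<in>big. (\<Sum>q<d n. L (Inl A, (n, p, q)) * v q) * complex_of_real (sinprod \<rho> (jy t k) A \<omega>))
      + (\<Sum>a\<in>J. (\<Sum>q<d n. L (Inr a, (n, p, q)) * v q) * complex_of_real (\<rho> * jy t k a \<omega>))
      + (\<Sum>a\<in>J. (\<Sum>q<d n. L (Inl {a}, (n, p, q)) * v q) * complex_of_real (sinrem \<rho> (jy t k) a \<omega>))" for p
      unfolding Xi_def distrib_right sum.distrib by (intro arg_cong2[where f="(+)"] sum_times_swap)
    thus ?thesis unfolding N1_def N2_def N3_def by (simp only: nrm2_add3)
  qed
  have i3: "integrable P (\<lambda>\<omega>. 3 * (N1 \<omega> + N2 \<omega> + N3 \<omega>))" using b1(1) b2(1) b3(1) by simp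
  have "t \<in> space m" by (simp add: spacem t)
  hence "(\<lambda>\<omega>. nrm2 (d n) (\<lambda>p. \<Sum>q<d n. Xi (fst (t, \<omega>)) k (snd (t, \<omega>)) (n, p, q) * v q)) \<in> borel_measurable P"
    by (rule measurable_compose[OF measurable_Pair1' nrm2_Xi_measurable])
  hence Nm: "?N \<in> borel_measurable P" by simp
  have Ni: "integrable P ?N"
  proof (rule Bochner_Integration.integrable_bound[OF i3 Nm], rule AE_I2)
    fix \<omega> show "norm (?N \<omega>) \<le> norm (3 * (N1 \<omega> + N2 \<omega> + N3 \<omega>))"
      using le[of \<omega>] nrm2_nonneg[of "d n" "\<lambda>p. \<Sum>q<d n. Xi t k \<omega> (n, p, q) * v q"] by simp
  qed
  have r4: "(C * \<rho>\<^sup>2 * \<rho>\<^sup>2)\<^sup>2 \<le> (C * \<rho> ^ 3)\<^sup>2"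
  proof (rule power_mono)
    have "\<rho> ^ 4 \<le> \<rho> ^ 3" using rho by (intro power_decreasing) auto
    thus "C * \<rho>\<^sup>2 * \<rho>\<^sup>2 \<le> C * \<rho> ^ 3" using C_pos by (simp add: mult.assoc flip: power_add)
  qed (use C_pos rho in simp)
  have r3: "C * \<rho>\<^sup>2 * \<rho> = C * \<rho> ^ 3" "C * \<rho> * \<rho>\<^sup>2 = C * \<rho> ^ 3" by (simp_all add: power2_eq_square power3_eq_cube mult_ac)
  have "(\<integral>\<omega>. ?N \<omega> \<partial>P) \<le> (\<integral>\<omega>. 3 * (N1 \<omega> + N2 \<omega> + N3 \<omega>) \<partial>P)" by (rule integral_mono[OF Ni i3 le])
  also have "\<dots> = 3 * ((\<integral>\<omega>. N1 \<omega> \<partial>P) + (\<integral>\<omega>. N2 \<omega> \<partial>P) + (\<integral>\<omega>. N3 \<omega> \<partial>P))" using b1(1) b2(1) b3(1) by simp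
  also have "\<dots> \<le> 3 * ((C * \<rho> ^ 3)\<^sup>2 + (C * \<rho> ^ 3)\<^sup>2 + (C * \<rho> ^ 3)\<^sup>2)"
    by (intro mult_left_mono add_mono order_trans[OF b1(2) r4]) (use b2(2)[unfolded r3] b3(2)[unfolded r3] in simp_all)
  also have "\<dots> = (3 * C * \<rho> ^ 3)\<^sup>2" by (simp add: power2_eq_square)
  finally have "(\<integral>\<omega>. ?N \<omega> \<partial>P) \<le> (3 * C * \<rho> ^ 3)\<^sup>2" .
  note sq = Q.expectation_sqrt[OF Ni nrm2_nonneg this]
  show "integrable P (\<lambda>\<omega>. sqrt (?N \<omega>))" by (rule sq(1)) (use C_pos rho in simp)
  show "(\<integral>\<omega>. sqrt (?N \<omega>) \<partial>P) \<le> 3 * C * \<rho> ^ 3" by (rule sq(2)) (use C_pos rho in simp)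
qed

end

section \<open>Testing against a Riesz product\<close>

lemma sum_lessThan_4: "(\<Sum>k<4. f k) = f 0 + f 1 + f 2 + f (3::nat)"
  by (simp add: eval_nat_numeral)

text \<open>\<open>Re (\<i> ^ k * h)\<close> is half the sum of a number and its conjugate. After
  multiplication with \<open>\<i> ^ k\<close> the first half alternates in sign and cancels, while
  the conjugate half is independent of \<open>k\<close>. Imaginary parts behave likewise.\<close>

lemma fourth_roots_average:
  "(\<Sum>k<4. \<i> ^ k) = 0"
  "(\<Sum>k<4. \<i> ^ k * complex_of_real (Re (\<i> ^ k * h))) = 2 * cnj h"
  "(\<Sum>k<4. \<i> ^ k * complex_of_real (Im (\<i> ^ k * h))) = 2 * (\<i> * cnj h)"
  by (simp_all add: sum_lessThan_4 complex_eq_iff power3_eq_cube power2_eq_square)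

locale randomly_sidon_test = randomly_sidon_dual G T m d \<phi> P g S C \<rho> z L
  for G :: "'a monoid" (structure) and T :: "'a topology" and m :: "'a measure"
    and d :: "nat \<Rightarrow> nat" and \<phi> :: "nat \<Rightarrow> 'a \<Rightarrow> complex mat"
    and P :: "'w measure" and g :: "nat \<Rightarrow> 'w \<Rightarrow> complex mat"
    and S C \<rho> z L +
  fixes x :: "nat \<Rightarrow> complex mat" and s u v
  assumes sv: "\<And>n. svd (d n) (x n) (s n) (u n) (v n)"
    and z_mult: "\<And>n. n \<in> S \<Longrightarrow> z n * x n = mat_abs (x n)"
begin

lemma x_carrier: "x n \<in> carrier_mat (d n) (d n)" by (rule svdD(1)[OF sv])

definition f :: "'a \<Rightarrow> complex" where "f t = (\<Sum>n\<in>S. of_nat (d n) * mat_trace (x n * \<phi> n t))"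

definition Wt :: "'a \<Rightarrow> nat \<times> nat \<times> nat \<Rightarrow> complex" where
  "Wt r = (\<lambda>(n, p, q). of_nat (d n) * (x n * \<phi> n r) $$ (q, p))"

text \<open>The functional applied to the Riesz product in its first Gaussian variable, times the
  group coefficient \<open>e\<close>; the second Gaussian variable, evaluated at
  \<open>\<omega>\<close>, remains.\<close>

definition D :: "'a \<Rightarrow> nat \<Rightarrow> 'w \<Rightarrow> nat \<times> nat \<times> nat \<Rightarrow> complex" where
  "D t k \<omega> e = (\<Sum>A\<in>Pow J. L (Inl A, e) * complex_of_real (sinprod \<rho> (jy t k) A \<omega>))"

lemma f_bdd: "bdd_above ((\<lambda>t. cmod (f t)) ` carrier G)"
  unfolding f_def by (rule bdd_continuous[OF trace_continuous[OF finS x_carrier]])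

lemma Wt_fe:
  assumes r: "r \<in> carrier G" and t: "t \<in> carrier G"
  shows "(\<Sum>e\<in>E. Wt r e * fe e t) = f (r \<otimes> t)"
  unfolding sumE f_def
proof (intro sum.cong refl)
  fix n
  note c = x_carrier[of n] rep_carrier[OF rep r, of n] rep_carrier[OF rep t, of n]
  have "(\<Sum>p<d n. \<Sum>q<d n. Wt r (n, p, q) * fe (n, p, q) t)
    = (\<Sum>q<d n. \<Sum>p<d n. of_nat (d n) * ((x n * \<phi> n r) $$ (q, p) * \<phi> n t $$ (p, q)))"
    by (subst sum.swap) (simp only: Wt_def fe_def prod.case mult.assoc)
  also have "\<dots> = of_nat (d n) * mat_trace (x n * \<phi> n r * \<phi> n t)"
    unfolding mat_trace_mult[OF mult_carrier_mat[OF c(1,2)] c(3)] sum_distrib_left ..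
  also have "x n * \<phi> n r * \<phi> n t = x n * \<phi> n (r \<otimes> t)"
    unfolding rep_mult[OF rep r t] by (rule assoc_mult_mat[OF c])
  finally show "(\<Sum>p<d n. \<Sum>q<d n. Wt r (n, p, q) * fe (n, p, q) t) = of_nat (d n) * mat_trace (x n * \<phi> n (r \<otimes> t))" .
qed

text \<open>The Riesz product \<open>\<Sum>\<^sub>A X\<^sub>A W\<^sub>A = \<Prod>\<^sub>a (1 + X\<^sub>a W\<^sub>a)\<close> is nonnegative with mean \<open>1\<close>.\<close>

lemma D_bound:
  assumes r: "r \<in> carrier G"
  shows "cmod (\<Sum>e\<in>E. Wt r e * D t k \<omega> e) \<le> C * supnorm f"
proof -
  define W where "W A = sinprod \<rho> (jy t k) A \<omega>" for A
  define c where "c b e = (case b of Inl A \<Rightarrow> complex_of_real (W A) * Wt r e | Inr a \<Rightarrow> 0)"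
    for b :: "((nat \<times> nat \<times> nat) \<times> bool) set + (nat \<times> nat \<times> nat) \<times> bool" and e
  define F where "F \<omega>' = (\<Sum>A\<in>Pow J. W A * sinprod \<rho> jx A \<omega>')" for \<omega>'
  have F0: "0 \<le> F \<omega>'" for \<omega>'
  proof -
    have "F \<omega>' = (\<Prod>a\<in>J. sin (\<rho> * jy t k a \<omega>) * sin (\<rho> * jx a \<omega>') + 1)"
      unfolding prod_add[OF finJ] F_def W_def sinprod_def prod.distrib by simp
    also have "\<dots> \<ge> 0"
    proof (rule prod_nonneg)
      fix a
      have "\<bar>sin (\<rho> * jy t k a \<omega>) * sin (\<rho> * jx a \<omega>')\<bar> \<le> 1 * 1"
        unfolding abs_mult by (intro mult_mono) auto
      thus "0 \<le> sin (\<rho> * jy t k a \<omega>) * sin (\<rho> * jx a \<omega>') + 1" by linarith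
    qed
    finally show ?thesis .
  qed
  have si: "integrable P (sinprod \<rho> jx A)" if "A \<in> Pow J" for A
  proof (rule Q.integrable_const_bound[where B=1])
    show "sinprod \<rho> jx A \<in> borel_measurable P" using Q.sinprod_measurable[OF jx_jgauss] that by simp
    show "AE y in P. norm (sinprod \<rho> jx A y) \<le> 1" by (rule AE_I2) (simp add: Q.sinprod_bounded)
  qed
  have Fi: "integrable P F" unfolding F_def[abs_def]
    by (intro Bochner_Integration.integrable_sum integrable_mult_right si)
  have "(\<integral>\<omega>'. F \<omega>' \<partial>P) = (\<Sum>A\<in>Pow J. \<integral>\<omega>'. W A * sinprod \<rho> jx A \<omega>' \<partial>P)"
    unfolding F_def by (rule Bochner_Integration.integral_sum) (intro integrable_mult_right si)
  \<comment> \<open>The empty sine product is the constant \<open>1\<close>, so a mean is an inner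
    product with it, and orthogonality leaves the empty set.\<close>
  also have "\<dots> = (\<Sum>A\<in>Pow J. if A = {} then W A else 0)"
  proof (intro sum.cong refl)
    fix A assume "A \<in> Pow J"
    hence "(\<integral>\<omega>'. sinprod \<rho> jx A \<omega>' * sinprod \<rho> jx {} \<omega>' \<partial>P) = (if A = {} then sinvar \<rho> ^ card A else 0)"
      by (intro Q.sinprod_orthogonal[OF jx_jgauss rho(1)]) auto
    moreover have "sinprod \<rho> jx {} \<omega>' = 1" for \<omega>' by (simp add: sinprod_def)
    ultimately show "(\<integral>\<omega>'. W A * sinprod \<rho> jx A \<omega>' \<partial>P) = (if A = {} then W A else 0)" by simp
  qed
  also have "\<dots> = 1" by (subst sum.delta) (simp_all add: finJ W_def sinprod_def)
  finally have F1: "(\<integral>\<omega>'. F \<omega>' \<partial>P) = 1" .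
  have cc: "(\<Sum>b\<in>B. \<Sum>e\<in>E. c b e * h b e) = (\<Sum>A\<in>Pow J. complex_of_real (W A) * (\<Sum>e\<in>E. Wt r e * h (Inl A) e))" for h
    unfolding sumB c_def sum.case by (simp add: sum_distrib_left mult.assoc)
  have "(\<Sum>b\<in>B. \<Sum>e\<in>E. L (b, e) * c b e) = (\<Sum>A\<in>Pow J. complex_of_real (W A) * (\<Sum>e\<in>E. Wt r e * L (Inl A, e)))"
    unfolding mult.commute[of "L _"] cc ..
  also have "\<dots> = (\<Sum>e\<in>E. Wt r e * D t k \<omega> e)"
    unfolding D_def W_def[symmetric] sum_distrib_left by (subst sum.swap) (simp only: mult_ac)
  finally have lhs: "(\<Sum>b\<in>B. \<Sum>e\<in>E. L (b, e) * c b e) = (\<Sum>e\<in>E. Wt r e * D t k \<omega> e)" .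
  have sb: "supnorm (\<lambda>t. \<Sum>b\<in>B. \<Sum>e\<in>E. c b e * complex_of_real (chi b \<omega>') * fe e t) \<le> F \<omega>' * supnorm f" for \<omega>'
  proof (rule supnorm_least)
    fix t' assume t': "t' \<in> carrier G"
    have "(\<Sum>b\<in>B. \<Sum>e\<in>E. c b e * complex_of_real (chi b \<omega>') * fe e t')
      = (\<Sum>A\<in>Pow J. complex_of_real (W A) * (\<Sum>e\<in>E. Wt r e * (complex_of_real (sinprod \<rho> jx A \<omega>') * fe e t')))"
      unfolding mult.assoc[of "c _ _"] cc chi_def sum.case ..
    also have "\<dots> = (\<Sum>A\<in>Pow J. complex_of_real (W A * sinprod \<rho> jx A \<omega>') * f (r \<otimes> t'))"
      unfolding Wt_fe[OF r t', symmetric] sum_distrib_left of_real_mult by (intro sum.cong refl) (simp only: mult_ac)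
    also have "\<dots> = complex_of_real (F \<omega>') * f (r \<otimes> t')"
      unfolding F_def of_real_sum sum_distrib_right ..
    finally have "cmod (\<Sum>b\<in>B. \<Sum>e\<in>E. c b e * complex_of_real (chi b \<omega>') * fe e t') = F \<omega>' * cmod (f (r \<otimes> t'))"
      using F0 by (simp add: norm_mult)
    also have "\<dots> \<le> F \<omega>' * supnorm f"
      by (intro mult_left_mono F0 supnorm_upper[OF f_bdd] m_closed r t')
    finally show "cmod (\<Sum>b\<in>B. \<Sum>e\<in>E. c b e * complex_of_real (chi b \<omega>') * fe e t') \<le> F \<omega>' * supnorm f" .
  qed
  have "cmod (\<Sum>b\<in>B. \<Sum>e\<in>E. L (b, e) * c b e) \<le> C * (\<integral>\<omega>'. supnorm (\<lambda>t. \<Sum>b\<in>B. \<Sum>e\<in>E. c b e * complex_of_real (chi b \<omega>') * fe e t) \<partial>P)"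
    by (rule L_bound)
  also have "\<dots> \<le> C * (\<integral>\<omega>'. F \<omega>' * supnorm f \<partial>P)"
    using C_pos Fi by (intro mult_left_mono integral_mono L_integrable sb) simp_all
  also have "\<dots> = C * supnorm f" using F1 by simp
  finally show ?thesis unfolding lhs .
qed

lemma sum_Pow_split:
  fixes h :: "((nat \<times> nat \<times> nat) \<times> bool) set \<Rightarrow> complex"
  shows "(\<Sum>A\<in>Pow J. h A) = h {} + (\<Sum>a\<in>J. h {a}) + (\<Sum>A\<in>big. h A)"
proof -
  have fin: "finite A" if "A \<subseteq> J" for A using finJ that by (rule finite_subset[rotated])
  have "Pow J = insert {} ((\<lambda>a. {a}) ` J \<union> big)"
  proof (intro equalityI subsetI)
    fix A assume "A \<in> Pow J"
    hence A: "A \<subseteq> J" by simp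
    consider "card A = 0" | "card A = 1" | "2 \<le> card A" by linarith
    thus "A \<in> insert {} ((\<lambda>a. {a}) ` J \<union> big)"
    proof cases
      case 1 thus ?thesis using fin[OF A] by simp
    next
      case 2
      then obtain a where "A = {a}" by (auto simp: card_1_singleton_iff)
      thus ?thesis using A by blast
    next
      case 3 thus ?thesis using A by (simp add: big_def)
    qed
  qed (auto simp: big_def)
  moreover have "finite big" using finJ by (simp add: big_def)
  moreover have "{} \<notin> (\<lambda>a. {a}) ` J \<union> big" "(\<lambda>a. {a}) ` J \<inter> big = {}" by (auto simp: big_def)
  ultimately show ?thesis
    using finJ by (simp add: sum.union_disjoint sum.reindex inj_on_def add.assoc)
qed

definition del :: "nat \<times> nat \<times> nat \<Rightarrow> nat \<times> nat \<times> nat \<Rightarrow> complex" where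
  "del b e = (L (Inl {(b, True)}, e) - L (Inr (b, True), e)) + \<i> * (L (Inl {(b, False)}, e) - L (Inr (b, False), e))"

text \<open>The conjugate linear part of \<open>D\<close>. The conjugate on \<open>hh\<close> is
  essential: it places conjugated coefficients of \<open>\<phi>\<close> opposite the plain ones in
  \<open>Wt\<close>, as Schur orthogonality demands.\<close>

definition Lin :: "'a \<Rightarrow> 'w \<Rightarrow> nat \<times> nat \<times> nat \<Rightarrow> complex" where
  "Lin t \<omega> e = complex_of_real (\<rho> * sqrt 2 / 2) * (\<Sum>b\<in>E. cnj (hh t b \<omega>) * del b e)"

text \<open>For a singleton, writing each sine as linear part plus error gives the linear variable
  \<open>w\<close> against the functional at \<open>\<rho> x\<close>, the linear variable
  \<open>w\<close> against the error in \<open>x\<close>, and the error in \<open>w\<close> against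
  the sine of \<open>x\<close>. The last two belong to \<open>Xi\<close>.\<close>

lemma D_split:
  "D t k \<omega> e = L (Inl {}, e) + (\<Sum>a\<in>J. complex_of_real (\<rho> * jy t k a \<omega>) * (L (Inl {a}, e) - L (Inr a, e))) + Xi t k \<omega> e"
proof -
  have "(\<Sum>a\<in>J. L (Inl {a}, e) * complex_of_real (sinprod \<rho> (jy t k) {a} \<omega>))
    = (\<Sum>a\<in>J. complex_of_real (\<rho> * jy t k a \<omega>) * (L (Inl {a}, e) - L (Inr a, e)))
    + (\<Sum>a\<in>J. L (Inr a, e) * complex_of_real (\<rho> * jy t k a \<omega>)) + (\<Sum>a\<in>J. L (Inl {a}, e) * complex_of_real (sinrem \<rho> (jy t k) a \<omega>))"
    unfolding sum.distrib[symmetric] by (intro sum.cong refl) (simp add: sinprod_def sinrem_def algebra_simps)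
  moreover have "sinprod \<rho> (jy t k) {} \<omega> = 1" by (simp add: sinprod_def)
  ultimately show ?thesis unfolding D_def sum_Pow_split Xi_def by simp
qed

lemma D_average: "(\<Sum>k<4. \<i> ^ k * D t k \<omega> e) = 4 * Lin t \<omega> e + (\<Sum>k<4. \<i> ^ k * Xi t k \<omega> e)"
proof -
  let ?r2 = "complex_of_real (\<rho> * sqrt 2)"
  have b: "(\<Sum>k<4. \<i> ^ k * complex_of_real (\<rho> * jy t k (b, r) \<omega>)) = ?r2 * (2 * cnj (hh t b \<omega>) * cunit r)" for b r
  proof -
    have eq: "(\<Sum>k<4. \<i> ^ k * complex_of_real (\<rho> * jy t k (b, r) \<omega>))
      = ?r2 * (\<Sum>k<4. \<i> ^ k * complex_of_real (if r then Re (\<i> ^ k * hh t b \<omega>) else Im (\<i> ^ k * hh t b \<omega>)))"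
      unfolding sum_distrib_left jy_def prod.case of_real_mult by (intro sum.cong refl) (simp only: mult_ac)
    show ?thesis unfolding eq cunit_def
      by (cases r) (simp_all only: if_True if_False fourth_roots_average mult_1_right, simp only: mult_ac)
  qed
  have "(\<Sum>k<4. \<i> ^ k * (\<Sum>a\<in>J. complex_of_real (\<rho> * jy t k a \<omega>) * (L (Inl {a}, e) - L (Inr a, e))))
    = (\<Sum>a\<in>J. (\<Sum>k<4. \<i> ^ k * complex_of_real (\<rho> * jy t k a \<omega>)) * (L (Inl {a}, e) - L (Inr a, e)))"
    unfolding sum_distrib_left sum_distrib_right mult.assoc by (rule sum.swap)
  also have "\<dots> = (\<Sum>b\<in>E. ?r2 * 2 * (cnj (hh t b \<omega>) * del b e))"
    unfolding sumJ b by (intro sum.cong refl) (simp add: del_def cunit_def algebra_simps)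
  also have "\<dots> = 4 * Lin t \<omega> e" unfolding Lin_def sum_distrib_left[symmetric] by simp
  finally have "(\<Sum>k<4. \<i> ^ k * D t k \<omega> e) = (\<Sum>k<4. \<i> ^ k) * L (Inl {}, e) + 4 * Lin t \<omega> e + (\<Sum>k<4. \<i> ^ k * Xi t k \<omega> e)"
    unfolding D_split distrib_left sum.distrib sum_distrib_right by simp
  thus ?thesis unfolding fourth_roots_average by simp
qed

definition Rk :: "'a \<Rightarrow> nat \<Rightarrow> 'w \<Rightarrow> real" where
  "Rk t k \<omega> = (\<Sum>n\<in>S. real (d n) * (\<Sum>\<kappa><d n. s n \<kappa> * sqrt (nrm2 (d n) (\<lambda>p. \<Sum>q<d n. Xi t k \<omega> (n, p, q) * u n \<kappa> q))))"

lemma Rk_nonneg: "0 \<le> Rk t k \<omega>"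
  unfolding Rk_def by (intro sum_nonneg mult_nonneg_nonneg) (auto simp: svdD(2)[OF sv])

text \<open>In the singular value expansion of \<open>x n\<close> the matrix
  \<open>\<phi> n r\<close> acts on the vectors formed from \<open>Xi\<close> and \<open>u\<close>,
  whose lengths it preserves. The bound is therefore the same for all \<open>r\<close>, and a
  supremum over the group may precede the expectation.\<close>

lemma Xi_trace:
  assumes r: "r \<in> carrier G"
  shows "cmod (\<Sum>e\<in>E. Wt r e * Xi t k \<omega> e) \<le> Rk t k \<omega>"
proof -
  define Bm where "Bm n b q = (\<Sum>p<d n. \<phi> n r $$ (b, p) * Xi t k \<omega> (n, p, q))" for n b q
  have e: "(\<Sum>p<d n. \<Sum>q<d n. Wt r (n, p, q) * Xi t k \<omega> (n, p, q)) = of_nat (d n) * (\<Sum>q<d n. \<Sum>b<d n. x n $$ (q, b) * Bm n b q)" for n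
  proof -
    have "(\<Sum>p<d n. \<Sum>q<d n. Wt r (n, p, q) * Xi t k \<omega> (n, p, q))
      = (\<Sum>q<d n. \<Sum>p<d n. \<Sum>b<d n. of_nat (d n) * (x n $$ (q, b) * (\<phi> n r $$ (b, p) * Xi t k \<omega> (n, p, q))))"
      by (subst sum.swap, intro sum.cong refl)
        (simp add: Wt_def times_mat_sum[OF x_carrier rep_carrier[OF rep r]] sum_distrib_left sum_distrib_right mult_ac)
    also have "\<dots> = (\<Sum>q<d n. \<Sum>b<d n. \<Sum>p<d n. of_nat (d n) * (x n $$ (q, b) * (\<phi> n r $$ (b, p) * Xi t k \<omega> (n, p, q))))"
      by (intro sum.cong refl sum.swap)
    finally show ?thesis unfolding Bm_def sum_distrib_left .
  qed
  have "cmod (\<Sum>e\<in>E. Wt r e * Xi t k \<omega> e) \<le> (\<Sum>n\<in>S. cmod (of_nat (d n) * (\<Sum>q<d n. \<Sum>b<d n. x n $$ (q, b) * Bm n b q)))"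
    unfolding sumE e by (rule norm_sum)
  also have "\<dots> \<le> Rk t k \<omega>" unfolding Rk_def
  proof (rule sum_mono)
    fix n
    have le: "cmod (\<Sum>q<d n. \<Sum>b<d n. x n $$ (q, b) * Bm n b q) \<le> (\<Sum>\<kappa><d n. s n \<kappa> * sqrt (nrm2 (d n) (\<lambda>b. \<Sum>q<d n. Bm n b q * u n \<kappa> q)))"
      by (rule trace_mult_svd_le[OF sv])
    have "nrm2 (d n) (\<lambda>b. \<Sum>q<d n. Bm n b q * u n \<kappa> q) = nrm2 (d n) (\<lambda>p. \<Sum>q<d n. Xi t k \<omega> (n, p, q) * u n \<kappa> q)" for \<kappa>
    proof -
      have "(\<Sum>q<d n. Bm n b q * u n \<kappa> q) = (\<Sum>p<d n. \<phi> n r $$ (b, p) * (\<Sum>q<d n. Xi t k \<omega> (n, p, q) * u n \<kappa> q))" for b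
        unfolding Bm_def sum_distrib_right sum_distrib_left by (subst sum.swap) (simp only: mult_ac)
      thus ?thesis by (simp only: rep_nrm2[OF rep r])
    qed
    with le have "cmod (\<Sum>q<d n. \<Sum>b<d n. x n $$ (q, b) * Bm n b q) \<le> (\<Sum>\<kappa><d n. s n \<kappa> * sqrt (nrm2 (d n) (\<lambda>p. \<Sum>q<d n. Xi t k \<omega> (n, p, q) * u n \<kappa> q)))"
      by (simp only:)
    thus "cmod (of_nat (d n) * (\<Sum>q<d n. \<Sum>b<d n. x n $$ (q, b) * Bm n b q)) \<le> real (d n) * (\<Sum>\<kappa><d n. s n \<kappa> * sqrt (nrm2 (d n) (\<lambda>p. \<Sum>q<d n. Xi t k \<omega> (n, p, q) * u n \<kappa> q)))"
      unfolding norm_mult norm_of_nat by (rule mult_left_mono) simp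
  qed
  finally show ?thesis .
qed

lemma Lin_bound:
  assumes r: "r \<in> carrier G"
  shows "cmod (\<Sum>e\<in>E. Wt r e * Lin t \<omega> e) \<le> C * supnorm f + (\<Sum>k<4. Rk t k \<omega>) / 4"
proof -
  have sw: "(\<Sum>e\<in>E. Wt r e * (\<Sum>k<4. \<i> ^ k * h k e)) = (\<Sum>k<4. \<i> ^ k * (\<Sum>e\<in>E. Wt r e * h k e))" for h :: "nat \<Rightarrow> _ \<Rightarrow> complex"
    unfolding sum_distrib_left by (subst sum.swap) (simp only: mult_ac)
  have "4 * (\<Sum>e\<in>E. Wt r e * Lin t \<omega> e) = (\<Sum>e\<in>E. Wt r e * ((\<Sum>k<4. \<i> ^ k * D t k \<omega> e) - (\<Sum>k<4. \<i> ^ k * Xi t k \<omega> e)))"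
    unfolding D_average sum_distrib_left by (intro sum.cong refl) simp
  also have "\<dots> = (\<Sum>k<4. \<i> ^ k * (\<Sum>e\<in>E. Wt r e * D t k \<omega> e)) - (\<Sum>k<4. \<i> ^ k * (\<Sum>e\<in>E. Wt r e * Xi t k \<omega> e))"
    unfolding right_diff_distrib sum_subtractf sw ..
  finally have eq: "4 * (\<Sum>e\<in>E. Wt r e * Lin t \<omega> e)
    = (\<Sum>k<4. \<i> ^ k * (\<Sum>e\<in>E. Wt r e * D t k \<omega> e)) - (\<Sum>k<4. \<i> ^ k * (\<Sum>e\<in>E. Wt r e * Xi t k \<omega> e))" .
  have "4 * cmod (\<Sum>e\<in>E. Wt r e * Lin t \<omega> e)
    = cmod ((\<Sum>k<4. \<i> ^ k * (\<Sum>e\<in>E. Wt r e * D t k \<omega> e)) - (\<Sum>k<4. \<i> ^ k * (\<Sum>e\<in>E. Wt r e * Xi t k \<omega> e)))"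
    unfolding eq[symmetric] norm_mult norm_numeral ..
  also have "\<dots> \<le> (\<Sum>k<4. cmod (\<i> ^ k * (\<Sum>e\<in>E. Wt r e * D t k \<omega> e))) + (\<Sum>k<4. cmod (\<i> ^ k * (\<Sum>e\<in>E. Wt r e * Xi t k \<omega> e)))"
    by (intro order_trans[OF norm_triangle_ineq4] add_mono norm_sum)
  also have "\<dots> = (\<Sum>k<4. cmod (\<Sum>e\<in>E. Wt r e * D t k \<omega> e)) + (\<Sum>k<4. cmod (\<Sum>e\<in>E. Wt r e * Xi t k \<omega> e))"
    by (simp add: norm_mult norm_power)
  also have "\<dots> \<le> (\<Sum>k<4::nat. C * supnorm f) + (\<Sum>k<4. Rk t k \<omega>)"
    by (intro add_mono sum_mono D_bound[OF r] Xi_trace[OF r])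
  finally show ?thesis by simp
qed

section \<open>Averaging over the group\<close>

lemma mat_abs_hermitian: "i < d n \<Longrightarrow> j < d n \<Longrightarrow> cnj (mat_abs (x n) $$ (i, j)) = mat_abs (x n) $$ (j, i)"
  unfolding mat_abs_svd[OF sv] by (simp add: abs_of_index mult_ac)

lemma schur:
  assumes "a < d n" "p < d n" "l < d n'" "j < d n'"
  shows "has_bochner_integral m (\<lambda>t. \<phi> n t $$ (a, p) * cnj (\<phi> n' t $$ (l, j))) (if n' = n \<and> l = a \<and> j = p then 1 / of_nat (d n) else 0)"
proof -
  have "(\<integral>t. \<phi> n t $$ (a, p) * cnj (\<phi> n' t $$ (l, j)) \<partial>m) = (if n' = n \<and> l = a \<and> j = p then 1 / of_nat (d n) else 0)"
  proof (cases "n' = n")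
    case True thus ?thesis using schur_orthogonality_eq[OF rep irr, of a n l p j] assms by auto
  next
    case False
    hence "\<not> equivalent_reps G (d n') (\<phi> n') (d n) (\<phi> n)" using irreps by (simp add: distinct_irreps_def)
    from schur_orthogonality_neq[OF rep irr rep irr this assms(1,3,2,4)] show ?thesis using False by simp
  qed
  thus ?thesis by (simp add: has_bochner_integral_iff rep_coeff_integrable[OF rep rep assms])
qed

definition Xs :: "'a \<Rightarrow> nat \<Rightarrow> complex mat" where "Xs r n = x n * \<phi> n r"

text \<open>Schur orthogonality retains only \<open>n' = n\<close>, \<open>l = a\<close>,
  \<open>j = p\<close>, and its factor \<open>1 / d n\<close> cancels the weight in
  \<open>Wt\<close>. The sum over \<open>p\<close> that is left is evaluated by
  \<open>dual_functional\<close> and equals a multiple of \<open>z n\<close>, which combines with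
  \<open>x n\<close> to \<open>|x n|\<close>.\<close>

lemma Lin_has_integral:
  assumes r: "r \<in> carrier G"
  shows "has_bochner_integral m (\<lambda>t. \<Sum>e\<in>E. Wt (r \<otimes> t) e * Lin t \<omega> e)
    (complex_of_real (\<rho>\<^sup>2) * (\<Sum>n\<in>S. of_nat (d n) * (\<Sum>i<d n. \<Sum>a<d n. (mat_abs (x n) * \<phi> n r) $$ (i, a) * cnj (g n \<omega> $$ (i, a)))))"
proof -
  let ?c = "complex_of_real (\<rho> * sqrt 2 / 2)"
  define K where "K n p q a n' i j l = of_nat (d n) * Xs r n $$ (q, a) * (?c * (cnj (gam (n', i, l) \<omega>) * del (n', i, j) (n, p, q)))" for n p q a n' i j l
  have Xc: "Xs r n \<in> carrier_mat (d n) (d n)" for n unfolding Xs_def by (rule mult_carrier_mat[OF x_carrier rep_carrier[OF rep r]])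
  have integrand: "(\<Sum>e\<in>E. Wt (r \<otimes> t) e * Lin t \<omega> e)
    = (\<Sum>n\<in>S. \<Sum>p<d n. \<Sum>q<d n. \<Sum>a<d n. \<Sum>n'\<in>S. \<Sum>i<d n'. \<Sum>j<d n'. \<Sum>l<d n'. K n p q a n' i j l * (\<phi> n t $$ (a, p) * cnj (\<phi> n' t $$ (l, j))))"
    if t: "t \<in> carrier G" for t
    unfolding sumE[of "\<lambda>e. Wt (r \<otimes> t) e * Lin t \<omega> e"]
  proof (intro sum.cong refl)
    fix n p q assume "p \<in> {..<d n}" "q \<in> {..<d n}"
    hence pq: "p < d n" "q < d n" by auto
    have "x n * \<phi> n (r \<otimes> t) = Xs r n * \<phi> n t"
      unfolding Xs_def rep_mult[OF rep r t] by (rule assoc_mult_mat[symmetric, OF x_carrier rep_carrier[OF rep r] rep_carrier[OF rep t]])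
    hence W: "Wt (r \<otimes> t) (n, p, q) = (\<Sum>a<d n. of_nat (d n) * Xs r n $$ (q, a) * \<phi> n t $$ (a, p))"
      unfolding Wt_def prod.case by (simp only: times_mat_sum[OF Xc rep_carrier[OF rep t] pq(2,1)] sum_distrib_left mult.assoc)
    have Ln: "Lin t \<omega> (n, p, q) = (\<Sum>n'\<in>S. \<Sum>i<d n'. \<Sum>j<d n'. \<Sum>l<d n'. ?c * (cnj (gam (n', i, l) \<omega>) * del (n', i, j) (n, p, q)) * cnj (\<phi> n' t $$ (l, j)))"
      unfolding Lin_def sumE hh_def prod.case cnj_sum sum_distrib_left sum_distrib_right complex_cnj_mult
      by (intro sum.cong refl) (simp only: mult_ac)
    show "Wt (r \<otimes> t) (n, p, q) * Lin t \<omega> (n, p, q) = (\<Sum>a<d n. \<Sum>n'\<in>S. \<Sum>i<d n'. \<Sum>j<d n'. \<Sum>l<d n'. K n p q a n' i j l * (\<phi> n t $$ (a, p) * cnj (\<phi> n' t $$ (l, j))))"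
      unfolding W Ln sum_distrib_right unfolding sum_distrib_left K_def
      by (intro sum.cong refl) (simp only: mult_ac)
  qed
  have I: "has_bochner_integral m (\<lambda>t. \<Sum>n\<in>S. \<Sum>p<d n. \<Sum>q<d n. \<Sum>a<d n. \<Sum>n'\<in>S. \<Sum>i<d n'. \<Sum>j<d n'. \<Sum>l<d n'. K n p q a n' i j l * (\<phi> n t $$ (a, p) * cnj (\<phi> n' t $$ (l, j))))
    (\<Sum>n\<in>S. \<Sum>p<d n. \<Sum>q<d n. \<Sum>a<d n. \<Sum>n'\<in>S. \<Sum>i<d n'. \<Sum>j<d n'. \<Sum>l<d n'. K n p q a n' i j l * (if n' = n \<and> l = a \<and> j = p then 1 / of_nat (d n) else 0))"
    by (intro has_bochner_integral_sum has_bochner_integral_mult_right schur) simp_all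
  have inner: "(\<Sum>n'\<in>S. \<Sum>i<d n'. \<Sum>j<d n'. \<Sum>l<d n'. K n p q a n' i j l * (if n' = n \<and> l = a \<and> j = p then 1 / of_nat (d n) else 0))
    = (\<Sum>i<d n. K n p q a n i p a / of_nat (d n))" if n: "n \<in> S" "p < d n" "a < d n" for n p q a
  proof -
    have "(\<Sum>n'\<in>S. \<Sum>i<d n'. \<Sum>j<d n'. \<Sum>l<d n'. K n p q a n' i j l * (if n' = n \<and> l = a \<and> j = p then 1 / of_nat (d n) else 0))
      = (\<Sum>n'\<in>S. if n' = n then (\<Sum>i<d n. K n p q a n i p a / of_nat (d n)) else 0)"
    proof (intro sum.cong refl)
      fix n'
      show "(\<Sum>i<d n'. \<Sum>j<d n'. \<Sum>l<d n'. K n p q a n' i j l * (if n' = n \<and> l = a \<and> j = p then 1 / of_nat (d n) else 0))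
        = (if n' = n then (\<Sum>i<d n. K n p q a n i p a / of_nat (d n)) else 0)"
      proof (cases "n' = n")
        case True
        have "(\<Sum>j<d n. \<Sum>l<d n. K n p q a n i j l * (if n = n \<and> l = a \<and> j = p then 1 / of_nat (d n) else 0)) = K n p q a n i p a / of_nat (d n)" for i
        proof -
          have "(\<Sum>l<d n. K n p q a n i j l * (if n = n \<and> l = a \<and> j = p then 1 / of_nat (d n) else 0)) = (if j = p then K n p q a n i j a / of_nat (d n) else 0)" for j
          proof (cases "j = p")
            case True
            have "(\<Sum>l<d n. K n p q a n i p l * (if l = a then 1 / of_nat (d n) else 0)) = (\<Sum>l<d n. if l = a then K n p q a n i p l / of_nat (d n) else 0)"
              by (intro sum.cong refl) simp
            also have "\<dots> = K n p q a n i p a / of_nat (d n)" using n(3) by (simp only: sum.delta[OF finite_lessThan] lessThan_iff if_True)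
            finally show ?thesis by (simp only: True simp_thms if_True)
          qed simp
          thus ?thesis using n(2) by (simp only: sum.delta[OF finite_lessThan] lessThan_iff if_True)
        qed
        thus ?thesis by (simp only: True if_True simp_thms)
      qed simp
    qed
    also have "\<dots> = (\<Sum>i<d n. K n p q a n i p a / of_nat (d n))" by (simp only: sum.delta[OF finS] n(1) if_True)
    finally show ?thesis .
  qed
  have val: "(\<Sum>p<d n. \<Sum>q<d n. \<Sum>a<d n. \<Sum>i<d n. K n p q a n i p a / of_nat (d n))
    = complex_of_real (\<rho>\<^sup>2) * (of_nat (d n) * (\<Sum>i<d n. \<Sum>a<d n. (mat_abs (x n) * \<phi> n r) $$ (i, a) * cnj (g n \<omega> $$ (i, a))))" if n: "n \<in> S" for n
  proof -
    have zc: "z n \<in> carrier_mat (d n) (d n)" using z_contraction[OF n] by (simp add: contraction_def)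
    have dual: "(\<Sum>p<d n. del (n, i, p) (n, p, q)) = complex_of_real (\<rho> * sqrt (2 * real (d n))) * z n $$ (i, q)" if "i < d n" "q < d n" for i q
      unfolding del_def by (rule L[unfolded dual_functional_def, THEN conjunct2, rule_format, OF n that(2,1)])
    \<comment> \<open>The three constants come from \<open>Lin\<close>, from the dual functional and
      from the normalisation of \<open>g\<close>; together they form \<open>\<rho>^2\<close> times
      the weight \<open>d n\<close>.\<close>
    have c2: "?c * complex_of_real (\<rho> * sqrt (2 * real (d n))) * complex_of_real (sqrt (real (d n))) = complex_of_real (\<rho>\<^sup>2) * of_nat (d n)"
    proof -
      have "\<rho> * sqrt 2 / 2 * (\<rho> * sqrt (2 * real (d n))) * sqrt (real (d n)) = \<rho>\<^sup>2 * real (d n)"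
        by (simp add: real_sqrt_mult power2_eq_square mult_ac)
      hence "complex_of_real (\<rho> * sqrt 2 / 2 * (\<rho> * sqrt (2 * real (d n))) * sqrt (real (d n))) = complex_of_real (\<rho>\<^sup>2 * real (d n))"
        by (simp only:)
      thus ?thesis by (simp only: of_real_mult of_real_of_nat_eq)
    qed
    have "(\<Sum>p<d n. \<Sum>q<d n. \<Sum>a<d n. \<Sum>i<d n. K n p q a n i p a / of_nat (d n))
      = (\<Sum>p<d n. \<Sum>q<d n. \<Sum>a<d n. \<Sum>i<d n. (?c * Xs r n $$ (q, a) * cnj (gam (n, i, a) \<omega>)) * del (n, i, p) (n, p, q))"
      unfolding K_def using d_pos[of n] by (intro sum.cong refl) simp
    also have "\<dots> = (\<Sum>q<d n. \<Sum>p<d n. \<Sum>a<d n. \<Sum>i<d n. (?c * Xs r n $$ (q, a) * cnj (gam (n, i, a) \<omega>)) * del (n, i, p) (n, p, q))"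
      by (rule sum.swap)
    also have "\<dots> = (\<Sum>q<d n. \<Sum>a<d n. \<Sum>p<d n. \<Sum>i<d n. (?c * Xs r n $$ (q, a) * cnj (gam (n, i, a) \<omega>)) * del (n, i, p) (n, p, q))"
      by (intro sum.cong refl sum.swap)
    also have "\<dots> = (\<Sum>q<d n. \<Sum>a<d n. \<Sum>i<d n. \<Sum>p<d n. (?c * Xs r n $$ (q, a) * cnj (gam (n, i, a) \<omega>)) * del (n, i, p) (n, p, q))"
      by (intro sum.cong refl sum.swap)
    also have "\<dots> = (\<Sum>q<d n. \<Sum>a<d n. \<Sum>i<d n. (complex_of_real (\<rho>\<^sup>2) * of_nat (d n)) * (z n $$ (i, q) * Xs r n $$ (q, a) * cnj (g n \<omega> $$ (i, a))))"
    proof (intro sum.cong refl)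
      fix q a i assume "q \<in> {..<d n}" "i \<in> {..<d n}"
      hence qi: "q < d n" "i < d n" by auto
      have "cnj (gam (n, i, a) \<omega>) = complex_of_real (sqrt (real (d n))) * cnj (g n \<omega> $$ (i, a))" by (simp add: gam_def)
      thus "(\<Sum>p<d n. (?c * Xs r n $$ (q, a) * cnj (gam (n, i, a) \<omega>)) * del (n, i, p) (n, p, q))
        = (complex_of_real (\<rho>\<^sup>2) * of_nat (d n)) * (z n $$ (i, q) * Xs r n $$ (q, a) * cnj (g n \<omega> $$ (i, a)))"
        unfolding sum_distrib_left[symmetric] dual[OF qi(2,1)] c2[symmetric] by (simp only: mult_ac)
    qed
    also have "\<dots> = (\<Sum>a<d n. \<Sum>q<d n. \<Sum>i<d n. (complex_of_real (\<rho>\<^sup>2) * of_nat (d n)) * (z n $$ (i, q) * Xs r n $$ (q, a) * cnj (g n \<omega> $$ (i, a))))"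
      by (rule sum.swap)
    also have "\<dots> = (\<Sum>a<d n. \<Sum>i<d n. \<Sum>q<d n. (complex_of_real (\<rho>\<^sup>2) * of_nat (d n)) * (z n $$ (i, q) * Xs r n $$ (q, a) * cnj (g n \<omega> $$ (i, a))))"
      by (intro sum.cong refl sum.swap)
    also have "\<dots> = (\<Sum>i<d n. \<Sum>a<d n. \<Sum>q<d n. (complex_of_real (\<rho>\<^sup>2) * of_nat (d n)) * (z n $$ (i, q) * Xs r n $$ (q, a) * cnj (g n \<omega> $$ (i, a))))"
      by (rule sum.swap)
    also have "\<dots> = (\<Sum>i<d n. \<Sum>a<d n. (complex_of_real (\<rho>\<^sup>2) * of_nat (d n)) * ((mat_abs (x n) * \<phi> n r) $$ (i, a) * cnj (g n \<omega> $$ (i, a))))"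
    proof (intro sum.cong refl)
      fix i a assume "i \<in> {..<d n}" "a \<in> {..<d n}"
      hence ia: "i < d n" "a < d n" by auto
      have "mat_abs (x n) * \<phi> n r = z n * Xs r n"
        unfolding Xs_def z_mult[OF n, symmetric] by (rule assoc_mult_mat[OF zc x_carrier rep_carrier[OF rep r]])
      thus "(\<Sum>q<d n. (complex_of_real (\<rho>\<^sup>2) * of_nat (d n)) * (z n $$ (i, q) * Xs r n $$ (q, a) * cnj (g n \<omega> $$ (i, a))))
        = (complex_of_real (\<rho>\<^sup>2) * of_nat (d n)) * ((mat_abs (x n) * \<phi> n r) $$ (i, a) * cnj (g n \<omega> $$ (i, a)))"
        by (simp only: times_mat_sum[OF zc Xc ia] sum_distrib_left sum_distrib_right)
    qed
    finally show ?thesis by (simp only: sum_distrib_left[symmetric] mult.assoc)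
  qed
  have "(\<Sum>n\<in>S. \<Sum>p<d n. \<Sum>q<d n. \<Sum>a<d n. \<Sum>n'\<in>S. \<Sum>i<d n'. \<Sum>j<d n'. \<Sum>l<d n'. K n p q a n' i j l * (if n' = n \<and> l = a \<and> j = p then 1 / of_nat (d n) else 0))
    = (\<Sum>n\<in>S. \<Sum>p<d n. \<Sum>q<d n. \<Sum>a<d n. \<Sum>i<d n. K n p q a n i p a / of_nat (d n))"
    by (intro sum.cong refl inner) simp_all
  also have "\<dots> = complex_of_real (\<rho>\<^sup>2) * (\<Sum>n\<in>S. of_nat (d n) * (\<Sum>i<d n. \<Sum>a<d n. (mat_abs (x n) * \<phi> n r) $$ (i, a) * cnj (g n \<omega> $$ (i, a))))"
    unfolding sum_distrib_left[of "complex_of_real (\<rho>\<^sup>2)"] by (intro sum.cong refl val)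
  finally have v: "(\<Sum>n\<in>S. \<Sum>p<d n. \<Sum>q<d n. \<Sum>a<d n. \<Sum>n'\<in>S. \<Sum>i<d n'. \<Sum>j<d n'. \<Sum>l<d n'. K n p q a n' i j l * (if n' = n \<and> l = a \<and> j = p then 1 / of_nat (d n) else 0))
    = complex_of_real (\<rho>\<^sup>2) * (\<Sum>n\<in>S. of_nat (d n) * (\<Sum>i<d n. \<Sum>a<d n. (mat_abs (x n) * \<phi> n r) $$ (i, a) * cnj (g n \<omega> $$ (i, a))))" .
  show ?thesis
    by (rule has_bochner_integral_cong[THEN iffD2, OF refl integrand v[symmetric] I]) (simp add: spacem)
qed

text \<open>\<open>|x n|\<close> is hermitian and \<open>\<phi> n\<close> unitary, so conjugation
  removes the conjugate from \<open>g\<close> and replaces \<open>r\<close> by its inverse. A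
  supremum over the group is unaffected by this.\<close>

lemma trace_inv:
  assumes r: "r \<in> carrier G" and w: "\<omega> \<in> space P"
  shows "(\<Sum>n\<in>S. of_nat (d n) * (\<Sum>i<d n. \<Sum>a<d n. (mat_abs (x n) * \<phi> n r) $$ (i, a) * cnj (g n \<omega> $$ (i, a))))
    = cnj (\<Sum>n\<in>S. of_nat (d n) * mat_trace (mat_abs (x n) * g n \<omega> * \<phi> n (inv r)))"
  unfolding cnj_sum
proof (intro sum.cong refl)
  fix n
  have ac: "mat_abs (x n) \<in> carrier_mat (d n) (d n)" by (rule mat_abs_carrier[OF x_carrier])
  have "cnj (mat_trace (mat_abs (x n) * g n \<omega> * \<phi> n (inv r)))
    = (\<Sum>i<d n. \<Sum>l<d n. \<Sum>j<d n. (mat_abs (x n) $$ (l, i) * \<phi> n r $$ (i, j)) * cnj (g n \<omega> $$ (l, j)))"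
    unfolding mat_trace_mult3[OF ac g_carrier[OF w] rep_carrier[OF rep inv_closed[OF r]]] cnj_sum
    by (intro sum.cong refl) (simp add: mat_abs_hermitian rep_inv_index[OF rep r] mult_ac)
  also have "\<dots> = (\<Sum>l<d n. \<Sum>i<d n. \<Sum>j<d n. (mat_abs (x n) $$ (l, i) * \<phi> n r $$ (i, j)) * cnj (g n \<omega> $$ (l, j)))"
    by (rule sum.swap)
  also have "\<dots> = (\<Sum>l<d n. \<Sum>j<d n. \<Sum>i<d n. (mat_abs (x n) $$ (l, i) * \<phi> n r $$ (i, j)) * cnj (g n \<omega> $$ (l, j)))"
    by (intro sum.cong refl sum.swap)
  also have "\<dots> = (\<Sum>l<d n. \<Sum>j<d n. (mat_abs (x n) * \<phi> n r) $$ (l, j) * cnj (g n \<omega> $$ (l, j)))"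
    by (intro sum.cong refl) (simp only: times_mat_sum[OF ac rep_carrier[OF rep r]] lessThan_iff sum_distrib_right)
  finally show "of_nat (d n) * (\<Sum>i<d n. \<Sum>a<d n. (mat_abs (x n) * \<phi> n r) $$ (i, a) * cnj (g n \<omega> $$ (i, a)))
    = cnj (of_nat (d n) * mat_trace (mat_abs (x n) * g n \<omega> * \<phi> n (inv r)))" by simp
qed

definition Rm :: "'a \<Rightarrow> 'w \<Rightarrow> real" where "Rm t \<omega> = (\<Sum>k<4. Rk t k \<omega>) / 4"

lemma Rm_nonneg: "0 \<le> Rm t \<omega>" by (simp add: Rm_def sum_nonneg Rk_nonneg)

lemma Rm_measurable: "(\<lambda>y. Rm (fst y) (snd y)) \<in> borel_measurable (m \<Otimes>\<^sub>M P)"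
  unfolding Rm_def Rk_def
  by (intro borel_measurable_divide borel_measurable_sum borel_measurable_times borel_measurable_const
    measurable_compose[OF _ borel_measurable_sqrt] nrm2_Xi_measurable)

text \<open>Left singular vectors have length at most one, so \<open>Xi_bound\<close> applies to
  each of them, and the weights \<open>s n\<close> add up to the trace norm.\<close>

lemma Rm_expectation:
  assumes t: "t \<in> carrier G"
  shows "integrable P (Rm t)" "(\<integral>\<omega>. Rm t \<omega> \<partial>P) \<le> 3 * C * \<rho> ^ 3 * (\<Sum>n\<in>S. real (d n) * trace_norm (x n))"
proof -
  define q where "q n k \<kappa> \<omega> = sqrt (nrm2 (d n) (\<lambda>p. \<Sum>q<d n. Xi t k \<omega> (n, p, q) * u n \<kappa> q))" for n k \<kappa> \<omega>
  have qi: "integrable P (q n k \<kappa>)" and qe: "(\<integral>\<omega>. q n k \<kappa> \<omega> \<partial>P) \<le> 3 * C * \<rho> ^ 3" if "n \<in> S" "\<kappa> < d n" for n k \<kappa>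
    using Xi_bound[OF t that(1) svd_nrm2_u[OF sv that(2)], of k] unfolding q_def[abs_def] by blast+
  have Ri: "has_bochner_integral P (Rm t) ((\<Sum>k<4. \<Sum>n\<in>S. real (d n) * (\<Sum>\<kappa><d n. s n \<kappa> * (\<integral>\<omega>. q n k \<kappa> \<omega> \<partial>P))) / 4)"
    unfolding Rm_def[abs_def] Rk_def q_def[symmetric]
    by (intro has_bochner_integral_divide has_bochner_integral_sum has_bochner_integral_mult_right has_bochner_integral_integrable qi) simp_all
  show "integrable P (Rm t)" using Ri by (simp add: has_bochner_integral_iff)
  have "(\<Sum>k<4::nat. \<Sum>n\<in>S. real (d n) * (\<Sum>\<kappa><d n. s n \<kappa> * (\<integral>\<omega>. q n k \<kappa> \<omega> \<partial>P)))
    \<le> (\<Sum>k<4::nat. \<Sum>n\<in>S. real (d n) * (\<Sum>\<kappa><d n. s n \<kappa> * (3 * C * \<rho> ^ 3)))"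
    by (intro sum_mono mult_left_mono qe) (simp_all add: svdD(2)[OF sv])
  also have "\<dots> = 4 * (3 * C * \<rho> ^ 3 * (\<Sum>n\<in>S. real (d n) * trace_norm (x n)))"
    unfolding trace_norm_svd[OF sv] sum_distrib_right[symmetric] by (simp add: sum_distrib_left mult_ac)
  finally show "(\<integral>\<omega>. Rm t \<omega> \<partial>P) \<le> 3 * C * \<rho> ^ 3 * (\<Sum>n\<in>S. real (d n) * trace_norm (x n))"
    unfolding has_bochner_integral_integral_eq[OF Ri] by simp
qed

text \<open>Stated in \<open>ennreal\<close> because the integral of the remainder over the group
  may be infinite for an individual \<open>\<omega>\<close>; so far only expectations for fixed
  \<open>t\<close> are under control.\<close>

lemma randnorm_pointwise:
  assumes w: "\<omega> \<in> space P"
  shows "ennreal (\<rho>\<^sup>2 * randnorm S (\<lambda>n. mat_abs (x n)) \<omega>) \<le> ennreal (C * supnorm f) + (\<integral>\<^sup>+t. ennreal (Rm t \<omega>) \<partial>m)"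
proof (cases "(\<integral>\<^sup>+t. ennreal (Rm t \<omega>) \<partial>m) = \<top>")
  case False
  define b where "b = enn2real (\<integral>\<^sup>+t. ennreal (Rm t \<omega>) \<partial>m)"
  have b: "(\<integral>\<^sup>+t. ennreal (Rm t \<omega>) \<partial>m) = ennreal b" "0 \<le> b" using False by (auto simp: b_def top.not_eq_extremum)
  have Cf: "0 \<le> C * supnorm f" using C_pos supnorm_nonneg[OF f_bdd] by simp
  have Rmm: "(\<lambda>t. Rm t \<omega>) \<in> borel_measurable m"
    using measurable_compose[OF measurable_Pair2'[OF w] Rm_measurable] by simp
  have "randnorm S (\<lambda>n. mat_abs (x n)) \<omega> \<le> (C * supnorm f + b) / \<rho>\<^sup>2"
    unfolding randnorm_def
  proof (rule supnorm_least)
    fix t assume t: "t \<in> carrier G"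
    let ?A = "\<Sum>n\<in>S. of_nat (d n) * mat_trace (mat_abs (x n) * g n \<omega> * \<phi> n t)"
    have r: "inv t \<in> carrier G" using t by simp
    note h = Lin_has_integral[OF r, of \<omega>, unfolded trace_inv[OF r w] inv_inv[OF t]]
    have "ennreal (\<rho>\<^sup>2 * cmod ?A) = ennreal (norm (\<integral>t'. (\<Sum>e\<in>E. Wt (inv t \<otimes> t') e * Lin t' \<omega> e) \<partial>m))"
      unfolding has_bochner_integral_integral_eq[OF h] norm_mult complex_mod_cnj by (simp add: norm_power)
    also have "\<dots> \<le> (\<integral>\<^sup>+t'. ennreal (norm (\<Sum>e\<in>E. Wt (inv t \<otimes> t') e * Lin t' \<omega> e)) \<partial>m)"
      using h by (intro integral_norm_bound_ennreal) (simp add: has_bochner_integral_iff)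
    also have "\<dots> \<le> (\<integral>\<^sup>+t'. ennreal (C * supnorm f) + ennreal (Rm t' \<omega>) \<partial>m)"
    proof (rule nn_integral_mono)
      fix t' assume "t' \<in> space m"
      hence "inv t \<otimes> t' \<in> carrier G" using r by (simp add: spacem)
      from Lin_bound[OF this, of t' \<omega>] have "norm (\<Sum>e\<in>E. Wt (inv t \<otimes> t') e * Lin t' \<omega> e) \<le> C * supnorm f + Rm t' \<omega>"
        by (simp only: Rm_def)
      hence "ennreal (norm (\<Sum>e\<in>E. Wt (inv t \<otimes> t') e * Lin t' \<omega> e)) \<le> ennreal (C * supnorm f + Rm t' \<omega>)" by (rule ennreal_leI)
      thus "ennreal (norm (\<Sum>e\<in>E. Wt (inv t \<otimes> t') e * Lin t' \<omega> e)) \<le> ennreal (C * supnorm f) + ennreal (Rm t' \<omega>)"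
        by (simp only: ennreal_plus[OF Cf Rm_nonneg])
    qed
    also have "\<dots> = ennreal (C * supnorm f) + ennreal b"
      using Rmm b(1) by (subst nn_integral_add) (simp_all add: emeasure_space_1)
    also have "\<dots> = ennreal (C * supnorm f + b)" using Cf b(2) by simp
    finally have "\<rho>\<^sup>2 * cmod ?A \<le> C * supnorm f + b" by (simp only: ennreal_le_iff[OF add_nonneg_nonneg[OF Cf b(2)]])
    thus "cmod ?A \<le> (C * supnorm f + b) / \<rho>\<^sup>2" using rho by (simp add: field_simps)
  qed
  hence "\<rho>\<^sup>2 * randnorm S (\<lambda>n. mat_abs (x n)) \<omega> \<le> C * supnorm f + b" using rho by (simp add: field_simps)
  hence "ennreal (\<rho>\<^sup>2 * randnorm S (\<lambda>n. mat_abs (x n)) \<omega>) \<le> ennreal (C * supnorm f + b)" by (rule ennreal_leI)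
  thus ?thesis unfolding b(1) using Cf b(2) by simp
qed simp

text \<open>Exchanging the integrals lets \<open>\<omega>\<close> be integrated first at fixed
  \<open>t\<close>, where the remainder has a bound that is uniform in \<open>t\<close>, and
  \<open>m\<close> has total mass one.\<close>

lemma randnorm_expectation:
  "\<rho>\<^sup>2 * (\<integral>\<omega>. randnorm S (\<lambda>n. mat_abs (x n)) \<omega> \<partial>P) \<le> C * supnorm f + 3 * C * \<rho> ^ 3 * (\<Sum>n\<in>S. real (d n) * trace_norm (x n))"
proof -
  let ?R = "\<lambda>\<omega>. \<rho>\<^sup>2 * randnorm S (\<lambda>n. mat_abs (x n)) \<omega>" and ?M = "3 * C * \<rho> ^ 3 * (\<Sum>n\<in>S. real (d n) * trace_norm (x n))"
  have ac: "mat_abs (x n) \<in> carrier_mat (d n) (d n)" for n by (rule mat_abs_carrier[OF x_carrier])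
  have Cf: "0 \<le> C * supnorm f" using C_pos supnorm_nonneg[OF f_bdd] by simp
  have M0: "0 \<le> ?M" using C_pos rho by (intro mult_nonneg_nonneg sum_nonneg trace_norm_nonneg[OF x_carrier]) simp_all
  have Ri: "integrable P ?R" using randnorm_integrable[OF finS ac] by simp
  have R0: "0 \<le> ?R \<omega>" if w: "\<omega> \<in> space P" for \<omega>
    unfolding randnorm_def
    by (intro mult_nonneg_nonneg supnorm_nonneg[OF bdd_continuous[OF trace_continuous[OF finS, of "\<lambda>n. mat_abs (x n) * g n \<omega>"]]]
      mult_carrier_mat[OF ac g_carrier[OF w]]) simp
  interpret pair_sigma_finite m P ..
  have meas: "case_prod (\<lambda>t \<omega>. ennreal (Rm t \<omega>)) \<in> borel_measurable (m \<Otimes>\<^sub>M P)"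
    using measurable_compose[OF Rm_measurable measurable_ennreal] by (simp add: case_prod_beta')
  have wmeas: "(\<lambda>\<omega>. \<integral>\<^sup>+t. ennreal (Rm t \<omega>) \<partial>m) \<in> borel_measurable P"
    using sigma_finite_measure.borel_measurable_nn_integral_fst[OF prob_space_imp_sigma_finite[OF prob] measurable_compose[OF measurable_pair_swap' meas]] by simp
  have "ennreal (\<integral>\<omega>. ?R \<omega> \<partial>P) = (\<integral>\<^sup>+\<omega>. ennreal (?R \<omega>) \<partial>P)"
    by (rule nn_integral_eq_integral[symmetric, OF Ri]) (rule AE_I2, rule R0)
  also have "\<dots> \<le> (\<integral>\<^sup>+\<omega>. ennreal (C * supnorm f) + (\<integral>\<^sup>+t. ennreal (Rm t \<omega>) \<partial>m) \<partial>P)"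
    by (rule nn_integral_mono) (rule randnorm_pointwise)
  also have "\<dots> = ennreal (C * supnorm f) + (\<integral>\<^sup>+\<omega>. \<integral>\<^sup>+t. ennreal (Rm t \<omega>) \<partial>m \<partial>P)"
    using wmeas by (subst nn_integral_add) (simp_all add: Q.emeasure_space_1)
  also have "(\<integral>\<^sup>+\<omega>. \<integral>\<^sup>+t. ennreal (Rm t \<omega>) \<partial>m \<partial>P) = (\<integral>\<^sup>+t. \<integral>\<^sup>+\<omega>. ennreal (Rm t \<omega>) \<partial>P \<partial>m)"
    by (rule Fubini'[OF meas])
  also have "\<dots> \<le> (\<integral>\<^sup>+t. ennreal ?M \<partial>m)"
  proof (rule nn_integral_mono)
    fix t assume "t \<in> space m"
    hence t: "t \<in> carrier G" by (simp add: spacem)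
    have "(\<integral>\<^sup>+\<omega>. ennreal (Rm t \<omega>) \<partial>P) = ennreal (\<integral>\<omega>. Rm t \<omega> \<partial>P)"
      by (rule nn_integral_eq_integral[OF Rm_expectation(1)[OF t]]) (simp add: Rm_nonneg)
    also have "\<dots> \<le> ennreal ?M" by (rule ennreal_leI[OF Rm_expectation(2)[OF t]])
    finally show "(\<integral>\<^sup>+\<omega>. ennreal (Rm t \<omega>) \<partial>P) \<le> ennreal ?M" .
  qed
  also have "\<dots> = ennreal ?M" by (simp add: emeasure_space_1)
  finally have "ennreal (\<integral>\<omega>. ?R \<omega> \<partial>P) \<le> ennreal (C * supnorm f) + ennreal ?M" by (simp add: add_left_mono)
  hence "ennreal (\<integral>\<omega>. ?R \<omega> \<partial>P) \<le> ennreal (C * supnorm f + ?M)" by (simp only: ennreal_plus[OF Cf M0])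
  thus ?thesis by (simp only: ennreal_le_iff[OF add_nonneg_nonneg[OF Cf M0]] integral_mult_right_zero)
qed

lemma sidon_bound:
  assumes small: "3 * C\<^sup>2 * \<rho> \<le> 1 / 2"
  shows "(\<Sum>n\<in>S. real (d n) * trace_norm (x n)) \<le> 2 * C\<^sup>2 / \<rho>\<^sup>2 * supnorm f"
proof -
  let ?N = "\<Sum>n\<in>S. real (d n) * trace_norm (x n)"
  have N0: "0 \<le> ?N" by (intro sum_nonneg mult_nonneg_nonneg trace_norm_nonneg[OF x_carrier]) simp
  have "?N = (\<Sum>n\<in>S. real (d n) * trace_norm (mat_abs (x n)))" by (simp only: trace_norm_mat_abs[OF x_carrier])
  also have "\<dots> \<le> C * (\<integral>\<omega>. randnorm S (\<lambda>n. mat_abs (x n)) \<omega> \<partial>P)" by (rule random_bound[OF mat_abs_carrier[OF x_carrier]])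
  finally have "\<rho>\<^sup>2 * ?N \<le> \<rho>\<^sup>2 * (C * (\<integral>\<omega>. randnorm S (\<lambda>n. mat_abs (x n)) \<omega> \<partial>P))" by (rule mult_left_mono) simp
  also have "\<dots> = C * (\<rho>\<^sup>2 * (\<integral>\<omega>. randnorm S (\<lambda>n. mat_abs (x n)) \<omega> \<partial>P))" by (simp only: mult_ac)
  also have "\<dots> \<le> C * (C * supnorm f + 3 * C * \<rho> ^ 3 * ?N)"
    using C_pos by (intro mult_left_mono randnorm_expectation) simp
  \<comment> \<open>The remainder carries \<open>\<rho>^3\<close> against \<open>\<rho>^2\<close> on
    the left, so its coefficient relative to the left-hand side is \<open>3 * C^2 * \<rho>\<close>,
    which \<open>small\<close> bounds by one half.\<close>
  also have "\<dots> = C\<^sup>2 * supnorm f + (3 * C\<^sup>2 * \<rho>) * (\<rho>\<^sup>2 * ?N)" by (simp add: power2_eq_square power3_eq_cube algebra_simps)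
  also have "\<dots> \<le> C\<^sup>2 * supnorm f + 1 / 2 * (\<rho>\<^sup>2 * ?N)"
    using N0 by (intro add_left_mono mult_right_mono small) simp
  finally have "\<rho>\<^sup>2 * ?N \<le> 2 * (C\<^sup>2 * supnorm f)" by simp
  thus ?thesis using rho by (simp add: field_simps)
qed

end

theorem (in sidon_setting) randomly_sidon_imp_sidon:
  assumes "randomly_sidon m d \<phi> P g" shows "sidon m d \<phi>"
proof -
  obtain C0 where C0: "\<And>x. fin_supp_family d x \<Longrightarrow> (\<Sum>n\<in>mat_supp d x. real (d n) * trace_norm (x n))
      \<le> C0 * (\<integral>\<omega>. Linfty_norm m (\<lambda>t. \<Sum>n\<in>mat_supp d x. of_nat (d n) * mat_trace (x n * g n \<omega> * \<phi> n t)) \<partial>P)"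
    using assms unfolding randomly_sidon_def by blast
  \<comment> \<open>With \<open>C \<ge> 1\<close> the choice \<open>\<rho> = 1 / (6 * C^2)\<close>
    stays below \<open>1\<close> and gives \<open>3 * C^2 * \<rho>\<close> the value
    \<open>1 / 2\<close>. The resulting Sidon constant is \<open>72 * C^6\<close>.\<close>
  define C where "C = max C0 1"
  define \<rho> where "\<rho> = 1 / (6 * C\<^sup>2)"
  have C: "1 \<le> C" "C0 \<le> C" by (simp_all add: C_def)
  have C2: "1 \<le> C\<^sup>2" using C(1) by simp
  have rho: "0 < \<rho>" "\<rho> \<le> 1" "3 * C\<^sup>2 * \<rho> \<le> 1 / 2"
  proof -
    have p: "0 < 6 * C\<^sup>2" using C2 by linarith
    show "\<rho> \<le> 1" unfolding \<rho>_def divide_le_eq_1_pos[OF p] using C2 by linarith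
  qed (use C(1) in \<open>simp_all add: \<rho>_def\<close>)
  have rb: "(\<Sum>n\<in>S. real (d n) * trace_norm (q n)) \<le> C * (\<integral>\<omega>. randnorm S q \<omega> \<partial>P)"
    if S: "finite S" and q: "\<And>n. q n \<in> carrier_mat (d n) (d n)" for S q
  proof -
    \<comment> \<open>The random Sidon inequality speaks of finitely supported families, so
      \<open>q\<close> is cut off outside \<open>S\<close>.\<close>
    define q' where "q' n = (if n \<in> S then q n else 0\<^sub>m (d n) (d n))" for n
    have qc: "q' n \<in> carrier_mat (d n) (d n)" for n using q by (simp add: q'_def)
    have qS: "mat_supp d q' \<subseteq> S" by (auto simp: mat_supp_def q'_def)
    have qf: "fin_supp_family d q'" unfolding fin_supp_family_def using qc finite_subset[OF qS S] by blast
    have R: "randnorm S q' \<omega> = randnorm S q \<omega>" for \<omega>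
      unfolding randnorm_def by (intro arg_cong[where f=supnorm] ext sum.cong refl) (simp add: q'_def)
    have Lq: "Linfty_norm m (\<lambda>t. \<Sum>n\<in>mat_supp d q'. of_nat (d n) * mat_trace (q' n * g n \<omega> * \<phi> n t)) = randnorm S q \<omega>" if w: "\<omega> \<in> space P" for \<omega>
      unfolding R[symmetric] unfolding randnorm_def
      by (rule Linfty_cong[OF mat_supp_sum(3)[OF qc S qS w] trace_continuous[OF S, of "\<lambda>n. q' n * g n \<omega>"]])
        (assumption, rule mult_carrier_mat[OF qc g_carrier[OF w]])
    have r0: "0 \<le> randnorm S q \<omega>" if w: "\<omega> \<in> space P" for \<omega>
      unfolding randnorm_def
      by (rule supnorm_nonneg[OF bdd_continuous[OF trace_continuous[OF S, of "\<lambda>n. q n * g n \<omega>"]]]) (rule mult_carrier_mat[OF q g_carrier[OF w]])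
    have "(\<Sum>n\<in>S. real (d n) * trace_norm (q n)) = (\<Sum>n\<in>S. real (d n) * trace_norm (q' n))" by (simp add: q'_def)
    also have "\<dots> = (\<Sum>n\<in>mat_supp d q'. real (d n) * trace_norm (q' n))" by (rule mat_supp_sum(1)[OF qc S qS, symmetric])
    also have "\<dots> \<le> C0 * (\<integral>\<omega>. Linfty_norm m (\<lambda>t. \<Sum>n\<in>mat_supp d q'. of_nat (d n) * mat_trace (q' n * g n \<omega> * \<phi> n t)) \<partial>P)" by (rule C0[OF qf])
    also have "\<dots> = C0 * (\<integral>\<omega>. randnorm S q \<omega> \<partial>P)"
      by (intro arg_cong2[where f="(*)"] refl Bochner_Integration.integral_cong Lq)
    also have "\<dots> \<le> C * (\<integral>\<omega>. randnorm S q \<omega> \<partial>P)"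
      by (intro mult_right_mono C(2) Bochner_Integration.integral_nonneg_AE AE_I2 r0)
    finally show ?thesis .
  qed
  show ?thesis unfolding sidon_def
  proof (intro exI[of _ "2 * C\<^sup>2 / \<rho>\<^sup>2"] allI impI)
    fix x assume "fin_supp_family d x"
    hence xc: "\<And>n. x n \<in> carrier_mat (d n) (d n)" and S: "finite (mat_supp d x)" by (auto simp: fin_supp_family_def)
    let ?S = "mat_supp d x"
    have "\<exists>s u v. svd (d n) (x n) s u v" for n by (rule svd_exists[OF xc])
    then obtain s u v where sv: "\<And>n. svd (d n) (x n) (s n) (u n) (v n)" by metis
    define z where "z n = polar (d n) (u n) (v n)" for n
    interpret st: randomly_sidon_step G T m d \<phi> P g ?S C \<rho> z
      using C(1) rho rb[OF S] contraction_polar[OF sv] S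
      by unfold_locales (simp_all add: z_def)
    obtain L where "st.dual_functional L" using st.dual_functional_exists by blast
    then interpret dl: randomly_sidon_dual G T m d \<phi> P g ?S C \<rho> z L by unfold_locales
    interpret te: randomly_sidon_test G T m d \<phi> P g ?S C \<rho> z L x s u v
      by unfold_locales (simp_all add: z_def sv polar_mult[OF sv])
    have "Linfty_norm m (\<lambda>t. \<Sum>n\<in>?S. of_nat (d n) * mat_trace (x n * \<phi> n t)) = supnorm te.f"
      unfolding te.f_def[abs_def] by (rule Linfty_eq_supnorm[OF trace_continuous[OF S xc]])
    with te.sidon_bound[OF rho(3)] show "(\<Sum>n\<in>?S. real (d n) * trace_norm (x n))
      \<le> 2 * C\<^sup>2 / \<rho>\<^sup>2 * Linfty_norm m (\<lambda>t. \<Sum>n\<in>?S. of_nat (d n) * mat_trace (x n * \<phi> n t))" by (simp only:)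
  qed
qed

theorem corollary5p8:
  fixes G :: "'a monoid" and T :: "'a topology" and m :: "'a measure"
    and d :: "nat \<Rightarrow> nat" and \<phi> :: "nat \<Rightarrow> 'a \<Rightarrow> complex mat"
    and P :: "'w measure" and g :: "nat \<Rightarrow> 'w \<Rightarrow> complex mat"
  assumes "compact_group G T"
    and "haar_prob_measure G T m"
    and "distinct_irreps G T d \<phi>"
    and "gaussian_matrices P d g"
  shows "sidon m d \<phi> \<longleftrightarrow> randomly_sidon m d \<phi> P g"
proof -
  interpret sidon_setting G T m d \<phi> P g
    by (intro sidon_setting.intro compact_haar.intro sidon_setting_axioms.intro assms)
  show ?thesis using sidon_imp_randomly_sidon randomly_sidon_imp_sidon by blast
qed

end
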